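(* Let $G(s)$ and $\bar G(s)$ be $m\times m$ transfer function matrices. Suppose that $\bar G(s)$ is strictly negative imaginary (SNI) and that $G(s)$ is strictly proper and negative imaginary (NI) with $G_2=0$ and $G_1\neq0$. Let $F_1$ be the matrix obtained from the singular value decomposition of $G_1$ as described in the context, suppose that $F_1^T\bar G(0)F_1$ is non-singular, and let $N_1=\bar G(0)-\bar G(0)F_1\left(F_1^T\bar G(0)F_1\right)^{-1}F_1^T\bar G(0)$. (a) If $N_1$ is positive semidefinite, then the positive-feedback interconnection $[G(s),\bar G(s)]$ is internally stable if and only if $$F_1^T\bar G(0)F_1<0\quad\text{and}\quad I-N_1^{1/2}G_0N_1^{1/2}>0 .$$ (b) If $N_1$ is negative semidefinite, then, with $\tilde N_1=(-N_1)^{1/2}$, the positive-feedback interconnection $[G(s),\bar G(s)]$ is internally stable if and only if $$F_1^T\bar G(0)F_1<0\quad\text{and}\quad \det(I+\tilde N_1G_0\tilde N_1)\neq0 .$$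
   Context: Conventions. Transfer function matrices are square, real, rational and proper, $G(s)=C(sI-A)^{-1}B+D$ with real $A,B,C,D$; $G$ is strictly proper if $G(\infty)=D=0$. $M^*$ is the conjugate transpose; $>0,\ \ge 0,\ <0$ denote (Hermitian/symmetric) positive definiteness, positive semidefiniteness, negative definiteness; $(\cdot)^{1/2}$ is the positive semidefinite square root of a positive semidefinite matrix. NI. A square $G(s)$ is NI if: (1) $G(s)$ has no pole in $\mathrm{Re}[s]>0$; (2) for all $\omega>0$ such that $j\omega$ is not a pole of $G(s)$, $j(G(j\omega)-G(j\omega)^* )\ge 0$; (3) if $s=j\omega_0$ with $\omega_0>0$ is a pole of $G(s)$, it is a simple pole and $K=\lim_{s\to j\omega_0}(s-j\omega_0)jG(s)$ is Hermitian and positive semidefinite; (4) if $s=0$ is a pole of $G(s)$, then $\lim_{s\to0}s^kG(s)=0$ for all $k\ge 3$ and $\lim_{s\to 0}s^2G(s)$ is Hermitian and positive semidefinite. SNI. A square $\bar G(s)$ is SNI if it has no pole in $\mathrm{Re}[s]\ge 0$ and $j(\bar G(j\omega)-\bar G(j\omega)^* )>0$ for all $\omega>0$. Internal stability. Let $G$ have minimal realization $(A,B,C,D)$ and $\bar G$ minimal realization $(\bar A,\bar B,\bar C,\bar D)$ with $I-D\bar D$ nonsingular. The positive feedback interconnection $[G(s),\bar G(s)]$ is internally stable if $$\breve A=\begin{bmatrix}A+B\bar D(I-D\bar D)^{-1}C & B\bar C+B\bar D(I-D\bar D)^{-1}D\bar C \\ \bar B(I-D\bar D)^{-1}C & \bar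 A+\bar B(I-D\bar D)^{-1}D\bar C\end{bmatrix}$$ is Hurwitz (all eigenvalues in the open left half plane). Matrices attached to an NI $G$: $G_2=\lim_{s\to0}s^2G(s)$, $G_1=\lim_{s\to0}s\left(G(s)-\frac{G_2}{s^2}\right)$, $G_0=\lim_{s\to0}\left(G(s)-\frac{G_2}{s^2}-\frac{G_1}{s}\right)$. Definition of $F_1$: take a singular value decomposition $G_1=\begin{bmatrix}\tilde F_1 & \tilde F_2\end{bmatrix}\begin{bmatrix}S_2 & 0 \\ 0 & 0\end{bmatrix}\begin{bmatrix}V_1^T \\ V_2^T\end{bmatrix}$ with $[\tilde F_1\ \tilde F_2]$ and $[V_1\ V_2]$ orthogonal and $S_2>0$, and set $F_1=\tilde F_1S_2$, so that $G_1=F_1V_1^T$ and $F_1$, $V_1$ each have orthogonal columns. *)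

theory Defs
  imports
    "HOL-Complex_Analysis.Complex_Analysis"
    "Jordan_Normal_Form.Schur_Decomposition"
    "Jordan_Normal_Form.Gauss_Jordan_Elimination"
begin

(* These names clash with the matrices of Jordan_Normal_Form, which are used throughout. *)
hide_const (open) Determinants.det Finite_Cartesian_Product.mat
  Finite_Cartesian_Product.vec Finite_Cartesian_Product.row
  Finite_Cartesian_Product.column

abbreviation cmat :: "real mat \<Rightarrow> complex mat" where
  "cmat \<equiv> map_mat complex_of_real"

abbreviation re_mat :: "complex mat \<Rightarrow> real mat" where
  "re_mat \<equiv> map_mat Re"

(* Meaningful for invertible matrices only. *)
definition minv :: "'a :: field mat \<Rightarrow> 'a mat" where
  "minv M = the (mat_inverse M)"

(* Definiteness includes M being Hermitian (symmetric for real M), hence square. On the complex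
   numbers 0 \<le> z (0 < z) says that z is real and nonnegative (positive). *)
definition pos_semidef :: "'a :: conjugatable_ordered_field mat \<Rightarrow> bool" where
  "pos_semidef M \<longleftrightarrow> mat_adjoint M = M \<and>
     (\<forall>v \<in> carrier_vec (dim_row M). 0 \<le> (M *\<^sub>v v) \<bullet>c v)"

definition pos_def :: "'a :: conjugatable_ordered_field mat \<Rightarrow> bool" where
  "pos_def M \<longleftrightarrow> mat_adjoint M = M \<and>
     (\<forall>v \<in> carrier_vec (dim_row M). v \<noteq> 0\<^sub>v (dim_row M) \<longrightarrow> 0 < (M *\<^sub>v v) \<bullet>c v)"

abbreviation neg_semidef :: "'a :: conjugatable_ordered_field mat \<Rightarrow> bool" where
  "neg_semidef M \<equiv> pos_semidef (- M)"

abbreviation neg_def :: "'a :: conjugatable_ordered_field mat \<Rightarrow> bool" where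
  "neg_def M \<equiv> pos_def (- M)"

definition psd_sqrt :: "real mat \<Rightarrow> real mat" where
  "psd_sqrt M = (THE R. pos_semidef R \<and> R * R = M)"

definition mat_tendsto ::
  "nat \<Rightarrow> ('x \<Rightarrow> complex mat) \<Rightarrow> complex mat \<Rightarrow> 'x filter \<Rightarrow> bool" where
  "mat_tendsto m f L F \<longleftrightarrow> L \<in> carrier_mat m m \<and>
     (\<forall>i<m. \<forall>j<m. ((\<lambda>x. f x $$ (i, j)) \<longlongrightarrow> L $$ (i, j)) F)"

definition mat_Lim :: "nat \<Rightarrow> 'x filter \<Rightarrow> ('x \<Rightarrow> complex mat) \<Rightarrow> complex mat" where
  "mat_Lim m F f = mat m m (\<lambda>(i, j). Lim F (\<lambda>x. f x $$ (i, j)))"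

definition mat_pole :: "nat \<Rightarrow> (complex \<Rightarrow> complex mat) \<Rightarrow> complex \<Rightarrow> bool" where
  "mat_pole m G z \<longleftrightarrow> (\<exists>i<m. \<exists>j<m. is_pole (\<lambda>s. G s $$ (i, j)) z)"

definition simple_mat_pole :: "nat \<Rightarrow> (complex \<Rightarrow> complex mat) \<Rightarrow> complex \<Rightarrow> bool" where
  "simple_mat_pole m G z \<longleftrightarrow> mat_pole m G z \<and>
     (\<forall>i<m. \<forall>j<m. is_pole (\<lambda>s. G s $$ (i, j)) z \<longrightarrow> zorder (\<lambda>s. G s $$ (i, j)) z = -1)"

definition realization :: "nat \<Rightarrow> (complex \<Rightarrow> complex mat) \<Rightarrow> nat \<Rightarrow>
    real mat \<Rightarrow> real mat \<Rightarrow> real mat \<Rightarrow> real mat \<Rightarrow> bool" where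
  "realization m G n A B C D \<longleftrightarrow>
     A \<in> carrier_mat n n \<and> B \<in> carrier_mat n m \<and> C \<in> carrier_mat m n \<and> D \<in> carrier_mat m m \<and>
     (\<forall>s. \<not> eigenvalue (cmat A) s \<longrightarrow>
        G s = cmat C * minv (s \<cdot>\<^sub>m 1\<^sub>m n - cmat A) * cmat B + cmat D)"

(* Continuity off the poles fixes the value of G at an eigenvalue of A that cancels in
   C (sI - A)^{-1} B, so that G s is the value of the rational matrix at each s that is not a pole.
   The value of G at a pole is irrelevant. *)
definition transfer_matrix :: "nat \<Rightarrow> (complex \<Rightarrow> complex mat) \<Rightarrow> bool" where
  "transfer_matrix m G \<longleftrightarrow>
     (\<forall>s. G s \<in> carrier_mat m m) \<and>
     (\<exists>n A B C D. realization m G n A B C D) \<and>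
     (\<forall>z. \<not> mat_pole m G z \<longrightarrow> (\<forall>i<m. \<forall>j<m. isCont (\<lambda>s. G s $$ (i, j)) z))"

definition strictly_proper :: "nat \<Rightarrow> (complex \<Rightarrow> complex mat) \<Rightarrow> bool" where
  "strictly_proper m G \<longleftrightarrow> mat_tendsto m G (0\<^sub>m m m) at_infinity"

definition minimal_realization :: "nat \<Rightarrow> (complex \<Rightarrow> complex mat) \<Rightarrow> nat \<Rightarrow>
    real mat \<Rightarrow> real mat \<Rightarrow> real mat \<Rightarrow> real mat \<Rightarrow> bool" where
  "minimal_realization m G n A B C D \<longleftrightarrow> realization m G n A B C D \<and>
     (\<forall>n' A' B' C' D'. realization m G n' A' B' C' D' \<longrightarrow> n \<le> n')"

definition negative_imaginary :: "nat \<Rightarrow> (complex \<Rightarrow> complex mat) \<Rightarrow> bool" where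
  "negative_imaginary m G \<longleftrightarrow>
     (\<forall>s. Re s > 0 \<longrightarrow> \<not> mat_pole m G s) \<and>
     (\<forall>\<omega>>0. \<not> mat_pole m G (\<i> * complex_of_real \<omega>) \<longrightarrow>
        pos_semidef (\<i> \<cdot>\<^sub>m (G (\<i> * complex_of_real \<omega>) - mat_adjoint (G (\<i> * complex_of_real \<omega>))))) \<and>
     (\<forall>\<omega>>0. mat_pole m G (\<i> * complex_of_real \<omega>) \<longrightarrow>
        simple_mat_pole m G (\<i> * complex_of_real \<omega>) \<and>
        (\<exists>K. mat_tendsto m (\<lambda>s. ((s - \<i> * complex_of_real \<omega>) * \<i>) \<cdot>\<^sub>m G s) K
               (at (\<i> * complex_of_real \<omega>)) \<and> pos_semidef K)) \<and>
     (mat_pole m G 0 \<longrightarrow>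
        (\<forall>k\<ge>3. mat_tendsto m (\<lambda>s. s ^ k \<cdot>\<^sub>m G s) (0\<^sub>m m m) (at 0)) \<and>
        (\<exists>K. mat_tendsto m (\<lambda>s. s\<^sup>2 \<cdot>\<^sub>m G s) K (at 0) \<and> pos_semidef K))"

definition strictly_negative_imaginary :: "nat \<Rightarrow> (complex \<Rightarrow> complex mat) \<Rightarrow> bool" where
  "strictly_negative_imaginary m G \<longleftrightarrow>
     (\<forall>s. Re s \<ge> 0 \<longrightarrow> \<not> mat_pole m G s) \<and>
     (\<forall>\<omega>>0. pos_def (\<i> \<cdot>\<^sub>m (G (\<i> * complex_of_real \<omega>) - mat_adjoint (G (\<i> * complex_of_real \<omega>)))))"

definition laurent2 :: "nat \<Rightarrow> (complex \<Rightarrow> complex mat) \<Rightarrow> complex mat" where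
  "laurent2 m G = mat_Lim m (at 0) (\<lambda>s. s\<^sup>2 \<cdot>\<^sub>m G s)"

definition laurent1 :: "nat \<Rightarrow> (complex \<Rightarrow> complex mat) \<Rightarrow> complex mat" where
  "laurent1 m G = mat_Lim m (at 0) (\<lambda>s. s \<cdot>\<^sub>m (G s - (1 / s\<^sup>2) \<cdot>\<^sub>m laurent2 m G))"

definition laurent0 :: "nat \<Rightarrow> (complex \<Rightarrow> complex mat) \<Rightarrow> complex mat" where
  "laurent0 m G = mat_Lim m (at 0)
     (\<lambda>s. G s - (1 / s\<^sup>2) \<cdot>\<^sub>m laurent2 m G - (1 / s) \<cdot>\<^sub>m laurent1 m G)"

definition hurwitz :: "real mat \<Rightarrow> bool" where
  "hurwitz M \<longleftrightarrow> (\<forall>z. eigenvalue (cmat M) z \<longrightarrow> Re z < 0)"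

definition closed_loop_matrix :: "nat \<Rightarrow> real mat \<Rightarrow> real mat \<Rightarrow> real mat \<Rightarrow> real mat \<Rightarrow>
    real mat \<Rightarrow> real mat \<Rightarrow> real mat \<Rightarrow> real mat \<Rightarrow> real mat" where
  "closed_loop_matrix m A B C D A' B' C' D' =
     (let X = minv (1\<^sub>m m - D * D') in
      four_block_mat
        (A + B * D' * X * C)   (B * C' + B * D' * X * D * C')
        (B' * X * C)           (A' + B' * X * D * C'))"

(* Minimal realizations of a transfer matrix are unique up to similarity, so the choice of the
   realizations does not matter. *)
definition internally_stable ::
  "nat \<Rightarrow> (complex \<Rightarrow> complex mat) \<Rightarrow> (complex \<Rightarrow> complex mat) \<Rightarrow> bool" where
  "internally_stable m G G' \<longleftrightarrow>
     (\<exists>n A B C D n' A' B' C' D'.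
        minimal_realization m G n A B C D \<and> minimal_realization m G' n' A' B' C' D' \<and>
        invertible_mat (1\<^sub>m m - D * D') \<and>
        hurwitz (closed_loop_matrix m A B C D A' B' C' D'))"

definition hcat :: "real mat \<Rightarrow> real mat \<Rightarrow> real mat" where
  "hcat P Q = four_block_mat P Q (0\<^sub>m 0 (dim_col P)) (0\<^sub>m 0 (dim_col Q))"

(* M = [P1 P2] diag(S, 0) [V1 V2]^T is a singular value decomposition and F = P1 S.
   The predicate orthogonal_mat of the library does not normalise the columns. *)
definition svd_factor :: "nat \<Rightarrow> real mat \<Rightarrow> real mat \<Rightarrow> bool" where
  "svd_factor m M F \<longleftrightarrow>
     (\<exists>r P1 P2 S V1 V2. r \<le> m \<and>
        P1 \<in> carrier_mat m r \<and> P2 \<in> carrier_mat m (m - r) \<and>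
        V1 \<in> carrier_mat m r \<and> V2 \<in> carrier_mat m (m - r) \<and>
        S \<in> carrier_mat r r \<and> diagonal_mat S \<and> (\<forall>i<r. S $$ (i, i) > 0) \<and>
        (hcat P1 P2)\<^sup>T * hcat P1 P2 = 1\<^sub>m m \<and>
        (hcat V1 V2)\<^sup>T * hcat V1 V2 = 1\<^sub>m m \<and>
        M = hcat P1 P2 *
            four_block_mat S (0\<^sub>m r (m - r)) (0\<^sub>m (m - r) r) (0\<^sub>m (m - r) (m - r)) *
            (hcat V1 V2)\<^sup>T \<and>
        F = P1 * S)"

end

theory Submission
  imports Defs "Jordan_Normal_Form.Spectral_Radius"
begin

no_notation inner (infix "\<bullet>" 70)
no_notation fps_nth (infixl "$" 75)
no_notation Finite_Cartesian_Product.vec_nth (infixl "$" 90)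

text \<open>Write H for the value of Gbar at 0 and T for the closed-loop map from a disturbance at the input
  of G to its output x. If the loop is stable, then v* (T(0) - T(s)) v / s has nonnegative real part on
  the imaginary axis, hence on the right half plane by the minimum principle, and v* T(0) v \<ge> 0. For u
  in the kernel of G1 and x in G0 u + range G1 one has T(0) (u - H x) = x, so that x . (u - H x) \<ge> 0,
  and u = H x only for x = 0. Choosing u = 0 gives F1* H F1 < 0, and u in the range of the square root
  of N1 or -N1 gives the second condition.

  Conversely, an eigenvector of the closed loop at s with Re s \<ge> 0 has an output y \<noteq> 0 reproduced by
  the loop at s. For Re s > 0 the strict bound Re (y* (H - Gbar(s)) y / s) > 0 and a Schwarz-Pick
  inequality for s G(s) at the nodes s and 0 contradict the conditions; on the imaginary axis away from
  0 strictness of Gbar excludes y; at s = 0 the vector y satisfies w = H y, G1 w = 0 and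
  y \<in> G0 w + range G1, and the conditions force y = 0.\<close>

section \<open>Matrices\<close>

text \<open>The estimates use quadratic forms of single vectors rather than products and inverses of
  rational matrices, because the loop must be examined where G may have a pole. At such a point z,
  in particular at 0, an eigenvector gives (zI - A) x = B w but no value G(z). Minimality, used
  through the eigenvector tests for controllability and observability, supplies inputs w + (s - z)
  Z(s) whose outputs converge to C x, and the behaviour of G near z then decides.

  The asymmetry of the two conditions shows up in the open right half plane. A mode there satisfies
  2 Re y* p - p* G0 p < y* H y for each p in the kernel of G1, and H \<le> N1 once F1* H F1 < 0. If
  N1 \<ge> 0, the choice p = N1 y turns this into |q|^2 < q* K q with q = N1^{1/2} y and K =
  N1^{1/2} G0 N1^{1/2}, which I - K > 0 excludes. If N1 \<le> 0, p = 0 already gives 0 < y* H y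
  \<le> 0, so only a mode at s = 0 is left to exclude, and nonsingularity does that.\<close>

lemma minv_mult:
  fixes A :: "'a :: field mat"
  assumes A: "A \<in> carrier_mat n n" and d: "Determinant.det A \<noteq> 0"
  shows minv_carrier: "minv A \<in> carrier_mat n n"
    and minv_right: "A * minv A = 1\<^sub>m n" and minv_left: "minv A * A = 1\<^sub>m n"
proof -
  have "A \<in> Units (ring_mat TYPE('a) n ())" by (rule det_non_zero_imp_unit[OF A d])
  with mat_inverse(1)[OF A, of "()"] obtain B where "mat_inverse A = Some B"
    by (cases "mat_inverse A") auto
  with mat_inverse(2)[OF A this]
  show "minv A \<in> carrier_mat n n" "A * minv A = 1\<^sub>m n" "minv A * A = 1\<^sub>m n"
    by (auto simp: minv_def)
qed

lemma det_nonzero_iff_inj: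
  fixes A :: "'a :: field mat"
  assumes "A \<in> carrier_mat n n"
  shows "Determinant.det A \<noteq> 0 \<longleftrightarrow> (\<forall>v \<in> carrier_vec n. A *\<^sub>v v = 0\<^sub>v n \<longrightarrow> v = 0\<^sub>v n)"
  using det_0_iff_vec_prod_zero_field[OF assms] by auto

lemma invertible_mat_iff_det:
  fixes A :: "'a :: field mat"
  assumes A: "A \<in> carrier_mat n n"
  shows "invertible_mat A \<longleftrightarrow> Determinant.det A \<noteq> 0"
proof
  assume "invertible_mat A"
  then obtain B where B: "A * B = 1\<^sub>m (dim_row A)" "B * A = 1\<^sub>m (dim_row B)"
    by (auto simp: invertible_mat_def inverts_mat_def)
  have "dim_col (A * B) = n" "dim_col (B * A) = dim_row B" using A B by auto
  hence Bc: "B \<in> carrier_mat n n" using A by auto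
  from det_mult[OF A Bc] B(1) A show "Determinant.det A \<noteq> 0" by auto
next
  assume "Determinant.det A \<noteq> 0"
  from minv_mult[OF A this] A show "invertible_mat A"
    by (auto simp: invertible_mat_def inverts_mat_def intro!: exI[of _ "minv A"])
qed

lemma mult_minv_vec:
  fixes A :: "'a :: field mat"
  assumes "A \<in> carrier_mat n n" "Determinant.det A \<noteq> 0" "v \<in> carrier_vec n"
  shows "A *\<^sub>v (minv A *\<^sub>v v) = v" "minv A *\<^sub>v (A *\<^sub>v v) = v"
proof -
  note inv = minv_mult[OF assms(1,2)]
  have "A *\<^sub>v (minv A *\<^sub>v v) = (A * minv A) *\<^sub>v v"
    by (rule assoc_mult_mat_vec[OF assms(1) inv(1) assms(3), symmetric])
  then show "A *\<^sub>v (minv A *\<^sub>v v) = v" using inv assms(3) by simp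
  have "minv A *\<^sub>v (A *\<^sub>v v) = (minv A * A) *\<^sub>v v"
    by (rule assoc_mult_mat_vec[OF inv(1) assms(1,3), symmetric])
  then show "minv A *\<^sub>v (A *\<^sub>v v) = v" using inv assms(3) by simp
qed

lemma mult_mat_zero_vec [simp]:
  "A \<in> carrier_mat n k \<Longrightarrow> A *\<^sub>v 0\<^sub>v k = (0\<^sub>v n :: 'a :: semiring_0 vec)"
  by (intro eq_vecI) auto

lemma smult_zero_vec [simp]: "c \<cdot>\<^sub>v 0\<^sub>v n = (0\<^sub>v n :: 'a :: mult_zero vec)"
  by (intro eq_vecI) auto

section \<open>Adjoints, definiteness and quadratic forms\<close>

lemma mat_adjoint_dims [simp]:
  "dim_row (mat_adjoint A) = dim_col A" "dim_col (mat_adjoint A) = dim_row A"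
  by (auto simp: mat_adjoint_def)

lemma mat_adjoint_index [simp]:
  "i < dim_col A \<Longrightarrow> j < dim_row A \<Longrightarrow> mat_adjoint A $$ (i, j) = conjugate (A $$ (j, i))"
  by (auto simp: mat_adjoint_def mat_of_rows_index)

lemma mat_adjoint_carrier [simp]: "mat_adjoint A \<in> carrier_mat n m \<longleftrightarrow> A \<in> carrier_mat m n"
  by (metis carrier_matD carrier_matI mat_adjoint_dims)

lemma mat_adjoint_real: "mat_adjoint (A :: real mat) = A\<^sup>T"
  by (intro eq_matI) auto

lemma mat_adjoint_cmat: "mat_adjoint (cmat A) = cmat (A\<^sup>T)"
  by (intro eq_matI) auto

lemma cscalar_prod_adjoint:
  fixes A :: "complex mat"
  assumes A: "A \<in> carrier_mat n m" and x: "x \<in> carrier_vec m" and y: "y \<in> carrier_vec n"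
  shows "(A *\<^sub>v x) \<bullet>c y = x \<bullet>c (mat_adjoint A *\<^sub>v y)"
proof -
  have "conjugate (mat_adjoint A *\<^sub>v y) = A\<^sup>T *\<^sub>v conjugate y"
  proof (rule eq_vecI)
    fix i assume "i < dim_vec (A\<^sup>T *\<^sub>v conjugate y)"
    with A y show "conjugate (mat_adjoint A *\<^sub>v y) $ i = (A\<^sup>T *\<^sub>v conjugate y) $ i"
      by (auto simp: scalar_prod_def mat_adjoint_def mat_of_rows_index)
  qed (use A in auto)
  moreover have "x \<bullet> (A\<^sup>T *\<^sub>v conjugate y) = (A *\<^sub>v x) \<bullet>c y"
    using transpose_vec_mult_scalar[OF A x, of "conjugate y"] A x y
    by (simp add: comm_scalar_prod[of _ m] comm_scalar_prod[of _ n])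
  ultimately show ?thesis by simp
qed

lemma cscalar_prod_cnj:
  "x \<in> carrier_vec n \<Longrightarrow> y \<in> carrier_vec n \<Longrightarrow> cnj (x \<bullet>c y) = y \<bullet>c (x :: complex vec)"
  by (simp add: scalar_prod_def mult.commute)

lemma cscalar_prod_self_Re: "0 \<le> Re (x \<bullet>c (x :: complex vec))" "Im (x \<bullet>c (x :: complex vec)) = 0"
  using conjugate_square_ge_0_vec[of x] by (auto simp: less_eq_complex_def)

lemma cscalar_prod_self_pos: "x \<in> carrier_vec n \<Longrightarrow> x \<noteq> 0\<^sub>v n \<Longrightarrow> 0 < Re (x \<bullet>c (x :: complex vec))"
  using conjugate_square_greater_0_vec[of x n] by (auto simp: less_complex_def)

lemma scalar_prod_self_real:
  fixes x :: "real vec"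
  shows "0 \<le> x \<bullet> x" "x \<in> carrier_vec n \<Longrightarrow> x \<bullet> x = 0 \<longleftrightarrow> x = 0\<^sub>v n"
  using conjugate_square_ge_0_vec[of x] conjugate_square_eq_0_vec[of x n] by auto

lemma pos_semidef_real:
  fixes M :: "real mat"
  assumes "M \<in> carrier_mat n n"
  shows "pos_semidef M \<longleftrightarrow> M\<^sup>T = M \<and> (\<forall>v \<in> carrier_vec n. 0 \<le> v \<bullet> (M *\<^sub>v v))"
  using assms by (auto simp: pos_semidef_def mat_adjoint_real comm_scalar_prod[of _ n])

lemma pos_def_real:
  fixes M :: "real mat"
  assumes "M \<in> carrier_mat n n"
  shows "pos_def M \<longleftrightarrow> M\<^sup>T = M \<and> (\<forall>v \<in> carrier_vec n. v \<noteq> 0\<^sub>v n \<longrightarrow> 0 < v \<bullet> (M *\<^sub>v v))"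
  using assms by (auto simp: pos_def_def mat_adjoint_real comm_scalar_prod[of _ n])

lemma symmetric_scalar_prod:
  fixes M :: "'a :: comm_semiring_0 mat"
  assumes "M \<in> carrier_mat n n" "M\<^sup>T = M" "x \<in> carrier_vec n" "y \<in> carrier_vec n"
  shows "(M *\<^sub>v x) \<bullet> y = x \<bullet> (M *\<^sub>v y)"
  using transpose_vec_mult_scalar[OF assms(1,4,3)] assms(2) by simp

text \<open>A nonnegative quadratic form vanishes only on the kernel: test it on x + t M x.\<close>

lemma pos_semidef_null:
  fixes M :: "real mat"
  assumes M: "M \<in> carrier_mat n n" and psd: "pos_semidef M"
    and x: "x \<in> carrier_vec n" and 0: "x \<bullet> (M *\<^sub>v x) = 0"
  shows "M *\<^sub>v x = 0\<^sub>v n"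
proof -
  define y where "y = M *\<^sub>v x"
  have y: "y \<in> carrier_vec n" using M x by (simp add: y_def)
  have sym: "M\<^sup>T = M" and nn: "\<And>v. v \<in> carrier_vec n \<Longrightarrow> 0 \<le> v \<bullet> (M *\<^sub>v v)"
    using psd pos_semidef_real[OF M] by auto
  have "0 \<le> 2 * t * (y \<bullet> y) + t\<^sup>2 * (y \<bullet> (M *\<^sub>v y))" for t
  proof -
    have "0 \<le> (x + t \<cdot>\<^sub>v y) \<bullet> (M *\<^sub>v (x + t \<cdot>\<^sub>v y))" using nn x y by auto
    also have "\<dots> = x \<bullet> y + t * (x \<bullet> (M *\<^sub>v y)) + t * (y \<bullet> y) + t * t * (y \<bullet> (M *\<^sub>v y))"
      using x y M by (simp add: mult_add_distrib_mat_vec[of _ n n] mult_mat_vec[of _ n n]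
        add_scalar_prod_distrib[of _ n] scalar_prod_add_distrib[of _ n] algebra_simps flip: y_def)
    also have "x \<bullet> (M *\<^sub>v y) = y \<bullet> y"
      using symmetric_scalar_prod[OF M sym x y] by (simp add: y_def)
    finally show ?thesis using 0 by (simp add: y_def power2_eq_square)
  qed
  note * = this
  have "y \<bullet> y = 0"
  proof (rule ccontr)
    assume "y \<bullet> y \<noteq> 0"
    with scalar_prod_self_real(1)[of y] have p: "y \<bullet> y > 0" by simp
    define c where "c = y \<bullet> (M *\<^sub>v y)"
    have c: "c \<ge> 0" using nn[OF y] by (simp add: c_def)
    \<comment> \<open>A small negative t is wanted: dividing by \<open>c + 1\<close> keeps t * c
      above - (y . y) and also covers c = 0.\<close>
    define t where "t = - (y \<bullet> y) / (c + 1)"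
    have "t * (2 * (y \<bullet> y) + t * c) < 0"
    proof (rule mult_neg_pos)
      show "t < 0" using p c by (simp add: t_def)
      have "t * c \<ge> - (y \<bullet> y)" using p c by (simp add: t_def field_simps)
      with p show "0 < 2 * (y \<bullet> y) + t * c" by simp
    qed
    with *[of t] show False by (simp add: c_def power2_eq_square algebra_simps)
  qed
  with scalar_prod_self_real(2)[OF y] show ?thesis by (simp add: y_def)
qed

section \<open>Real and imaginary parts of complex vectors\<close>

abbreviation cvec :: "real vec \<Rightarrow> complex vec" where "cvec \<equiv> map_vec complex_of_real"
abbreviation re_vec :: "complex vec \<Rightarrow> real vec" where "re_vec \<equiv> map_vec Re"
abbreviation im_vec :: "complex vec \<Rightarrow> real vec" where "im_vec \<equiv> map_vec Im"

lemma re_vec_cmat_mult: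
  assumes "A \<in> carrier_mat n m" "v \<in> carrier_vec m"
  shows "re_vec (cmat A *\<^sub>v v) = A *\<^sub>v re_vec v" "im_vec (cmat A *\<^sub>v v) = A *\<^sub>v im_vec v"
  using assms by (auto simp: scalar_prod_def)

lemma complex_vec_eq_iff:
  "x \<in> carrier_vec n \<Longrightarrow> y \<in> carrier_vec n \<Longrightarrow>
    x = y \<longleftrightarrow> re_vec x = re_vec y \<and> im_vec x = im_vec y"
  by (auto simp: vec_eq_iff complex_eq_iff)

lemma cmat_mult: "A \<in> carrier_mat n m \<Longrightarrow> B \<in> carrier_mat m k \<Longrightarrow> cmat (A * B) = cmat A * cmat B"
  by (rule of_real_hom.mat_hom_mult)

lemma cmat_mult_cvec:
  "A \<in> carrier_mat n m \<Longrightarrow> v \<in> carrier_vec m \<Longrightarrow> cmat A *\<^sub>v cvec v = cvec (A *\<^sub>v v)"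
  by (rule of_real_hom.mult_mat_vec_hom[symmetric])

lemma cmat_one [simp]: "cmat (1\<^sub>m n) = 1\<^sub>m n"
  by (rule of_real_hom.mat_hom_one)

lemma cmat_minus: "A \<in> carrier_mat n m \<Longrightarrow> B \<in> carrier_mat n m \<Longrightarrow> cmat (A - B) = cmat A - cmat B"
  by auto

lemma cscalar_prod_Re_Im:
  assumes "x \<in> carrier_vec n" "y \<in> carrier_vec n"
  shows "Re (x \<bullet>c y) = re_vec x \<bullet> re_vec y + im_vec x \<bullet> im_vec y"
    "Im (x \<bullet>c y) = im_vec x \<bullet> re_vec y - re_vec x \<bullet> im_vec y"
  using assms by (auto simp: scalar_prod_def sum.distrib sum_subtractf)

text \<open>With x = a + i b, the mixed terms a . M b and b . M a agree by symmetry, so the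
  imaginary part cancels and the two real forms remain.\<close>

lemma symmetric_quadratic_form:
  fixes M :: "real mat" and x :: "complex vec"
  assumes M: "M \<in> carrier_mat n n" "M\<^sup>T = M" and x: "x \<in> carrier_vec n"
  shows "Re ((cmat M *\<^sub>v x) \<bullet>c x) = re_vec x \<bullet> (M *\<^sub>v re_vec x) + im_vec x \<bullet> (M *\<^sub>v im_vec x)"
    "Im ((cmat M *\<^sub>v x) \<bullet>c x) = 0"
proof -
  have "(M *\<^sub>v re_vec x) \<bullet> im_vec x = re_vec x \<bullet> (M *\<^sub>v im_vec x)"
    "(M *\<^sub>v re_vec x) \<bullet> re_vec x = re_vec x \<bullet> (M *\<^sub>v re_vec x)"
    "(M *\<^sub>v im_vec x) \<bullet> im_vec x = im_vec x \<bullet> (M *\<^sub>v im_vec x)"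
    "(M *\<^sub>v im_vec x) \<bullet> re_vec x = im_vec x \<bullet> (M *\<^sub>v re_vec x)"
    "re_vec x \<bullet> (M *\<^sub>v im_vec x) = im_vec x \<bullet> (M *\<^sub>v re_vec x)"
    using symmetric_scalar_prod[OF M, of "re_vec x" "im_vec x"]
      symmetric_scalar_prod[OF M, of "re_vec x" "re_vec x"]
      symmetric_scalar_prod[OF M, of "im_vec x" "im_vec x"]
      symmetric_scalar_prod[OF M, of "im_vec x" "re_vec x"]
      comm_scalar_prod[of "im_vec x" n "M *\<^sub>v re_vec x"] M x by auto
  then show "Re ((cmat M *\<^sub>v x) \<bullet>c x) = re_vec x \<bullet> (M *\<^sub>v re_vec x) + im_vec x \<bullet> (M *\<^sub>v im_vec x)"
    "Im ((cmat M *\<^sub>v x) \<bullet>c x) = 0"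
    using M x cscalar_prod_Re_Im[of "cmat M *\<^sub>v x" n x] re_vec_cmat_mult[OF M(1) x] by auto
qed

lemma pos_semidef_complex_form:
  fixes M :: "real mat" and x :: "complex vec"
  assumes M: "M \<in> carrier_mat n n" and psd: "pos_semidef M" and x: "x \<in> carrier_vec n"
  shows "0 \<le> Re ((cmat M *\<^sub>v x) \<bullet>c x)"
proof -
  have "M\<^sup>T = M" and "\<And>v. v \<in> carrier_vec n \<Longrightarrow> 0 \<le> v \<bullet> (M *\<^sub>v v)"
    using psd pos_semidef_real[OF M] by auto
  with symmetric_quadratic_form(1)[OF M _ x] x show ?thesis by simp
qed

lemma pos_def_imp_semidef:
  fixes M :: "real mat"
  assumes M: "M \<in> carrier_mat n n" and pd: "pos_def M"
  shows "pos_semidef M"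
  unfolding pos_semidef_real[OF M]
proof (intro conjI ballI)
  show "M\<^sup>T = M" using pd pos_def_real[OF M] by auto
  fix v :: "real vec" assume "v \<in> carrier_vec n"
  then show "0 \<le> v \<bullet> (M *\<^sub>v v)"
    using pd M unfolding pos_def_real[OF M] by (cases "v = 0\<^sub>v n") auto
qed

lemma pos_def_det:
  fixes M :: "real mat"
  assumes M: "M \<in> carrier_mat n n" and pd: "pos_def M"
  shows "Determinant.det M \<noteq> 0"
  unfolding det_nonzero_iff_inj[OF M] using pd unfolding pos_def_real[OF M] by fastforce

subsection \<open>Rank factorisations\<close>

text \<open>Completing c to an orthogonal basis W of the middle space gives Y L = (Y W) (W^{-1} L).
  The first column of Y W is Y c = 0, so it can be deleted together with the first row of W^{-1}
  L.\<close>

lemma drop_kernel_vector: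
  fixes Y L :: "real mat"
  assumes Y: "Y \<in> carrier_mat p k" and L: "L \<in> carrier_mat k q"
    and c: "c \<in> carrier_vec k" "c \<noteq> 0\<^sub>v k" "Y *\<^sub>v c = 0\<^sub>v p"
  shows "\<exists>Y' L'. Y' \<in> carrier_mat p (k - 1) \<and> L' \<in> carrier_mat (k - 1) q \<and> Y * L = Y' * L' \<and> 0 < k"
proof -
  interpret cof_vec_space k "TYPE(real)" .
  define b where "b = basis_completion c"
  define ws where "ws = gram_schmidt k b"
  define W where "W = mat_of_cols k ws"
  from basis_completion[OF c(1,2), folded b_def]
  have dist_b: "distinct b" and indep: "\<not> lin_dep (set b)" and b: "set b \<subseteq> carrier_vec k"
    and hdb: "hd b = c" and len_b: "length b = k" by auto
  have k: "k > 0" using c by (cases k) auto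
  from hdb len_b k obtain vs where bv: "b = c # vs" by (cases b) auto
  from gram_schmidt_result[OF b dist_b indep refl, folded ws_def]
  have ws: "set ws \<subseteq> carrier_vec k" "corthogonal ws" "length ws = k" by (auto simp: len_b)
  \<comment> \<open>Gram-Schmidt leaves the head of the list unchanged, so c itself is the first
    column of \<open>W\<close>.\<close>
  from gram_schmidt_hd[OF c(1), of vs, folded bv] have hdws: "hd ws = c" unfolding ws_def .
  have orth_W: "corthogonal_mat W" using orthogonal_mat_of_cols ws unfolding W_def .
  have W: "W \<in> carrier_mat k k"
    using ws unfolding W_def using mat_of_cols_carrier(1)[of k ws] by auto
  have col0: "col W 0 = c" using hdws ws k by (cases ws) (auto simp: W_def)
  define V where "V = corthogonal_inv W"
  have V: "V \<in> carrier_mat k k" unfolding V_def corthogonal_inv_def using W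
    by (auto simp: mat_of_rows_def)
  have VW: "V * W = 1\<^sub>m k" using corthogonal_inv_result[OF orth_W] V
    by (auto simp: inverts_mat_def V_def)
  have WV: "W * V = 1\<^sub>m k" by (rule mat_mult_left_right_inverse[OF V W VW])
  define P where "P = Y * W"
  define Q where "Q = V * L"
  have P: "P \<in> carrier_mat p k" and Q: "Q \<in> carrier_mat k q" using Y W V L by (auto simp: P_def Q_def)
  have "P * Q = Y * (W * (V * L))"
    using Y W V L by (simp add: P_def Q_def assoc_mult_mat[of Y p k W k "V * L" q])
  also have "W * (V * L) = L" using W V L WV assoc_mult_mat[of W k k V k L q] by auto
  finally have PQ: "P * Q = Y * L" .
  have "col P 0 = 0\<^sub>v p" unfolding P_def using col_mult2[OF Y W k] col0 c by simp
  hence P0: "P $$ (i, 0) = 0" if "i < p" for i using that P k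
    by (metis carrier_matD index_col index_zero_vec(1))
  define Y' where "Y' = mat p (k - 1) (\<lambda>(i, j). P $$ (i, Suc j))"
  define L' where "L' = mat (k - 1) q (\<lambda>(i, j). Q $$ (Suc i, j))"
  have "Y * L = Y' * L'" unfolding PQ[symmetric]
  proof (rule eq_matI)
    fix i j assume "i < dim_row (Y' * L')" "j < dim_col (Y' * L')"
    hence ij: "i < p" "j < q" by (auto simp: Y'_def L'_def)
    from k obtain k' where k': "k = Suc k'" by (cases k) auto
    have "(P * Q) $$ (i, j) = (\<Sum>l = 0..<Suc k'. P $$ (i, l) * Q $$ (l, j))"
      using P Q ij k' by (simp add: scalar_prod_def del: sum.op_ivl_Suc)
    also have "\<dots> = (\<Sum>l = 0..<k'. P $$ (i, Suc l) * Q $$ (Suc l, j))"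
      by (subst sum.atLeast0_lessThan_Suc_shift) (simp add: P0 ij)
    also have "\<dots> = (Y' * L') $$ (i, j)"
      using ij k' by (simp add: Y'_def L'_def scalar_prod_def)
    finally show "(P * Q) $$ (i, j) = (Y' * L') $$ (i, j)" .
  qed (use P Q in \<open>auto simp: Y'_def L'_def\<close>)
  moreover have "Y' \<in> carrier_mat p (k - 1)" "L' \<in> carrier_mat (k - 1) q"
    by (auto simp: Y'_def L'_def)
  ultimately show ?thesis using k by blast
qed

text \<open>A factorisation through a middle space of least dimension k is taken: a kernel vector of
  Y, or of L^T after transposing the product, could be dropped and would contradict minimality. The
  trivial factorisation M = M I gives k \<le> q.\<close>

lemma rank_factorisation:
  fixes M :: "real mat"
  assumes M: "M \<in> carrier_mat p q"
  shows "\<exists>k Y L. Y \<in> carrier_mat p k \<and> L \<in> carrier_mat k q \<and> M = Y * L \<and> k \<le> q \<and>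
    (\<forall>c \<in> carrier_vec k. Y *\<^sub>v c = 0\<^sub>v p \<longrightarrow> c = 0\<^sub>v k) \<and>
    (\<forall>c \<in> carrier_vec k. L\<^sup>T *\<^sub>v c = 0\<^sub>v q \<longrightarrow> c = 0\<^sub>v k)"
proof -
  let ?P = "\<lambda>k. \<exists>Y L. Y \<in> carrier_mat p k \<and> L \<in> carrier_mat k q \<and> M = Y * L"
  define k where "k = (LEAST k. ?P k)"
  have q: "?P q" using M by (intro exI[of _ M] exI[of _ "1\<^sub>m q"]) auto
  from LeastI[of ?P, OF q] obtain Y L where
    YL: "Y \<in> carrier_mat p k" "L \<in> carrier_mat k q" "M = Y * L" by (auto simp: k_def)
  have min: "k \<le> j" if "?P j" for j unfolding k_def by (rule Least_le[of ?P, OF that])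
  have 1: "c = 0\<^sub>v k" if c: "c \<in> carrier_vec k" "Y *\<^sub>v c = 0\<^sub>v p" for c
    proof (rule ccontr)
      assume "c \<noteq> 0\<^sub>v k"
      from drop_kernel_vector[OF YL(1,2) c(1) this c(2)] have "?P (k - 1)" "0 < k" using YL(3) by auto
      from min[OF this(1)] this(2) show False by auto
    qed
  have 2: "c = 0\<^sub>v k" if c: "c \<in> carrier_vec k" "L\<^sup>T *\<^sub>v c = 0\<^sub>v q" for c
    proof (rule ccontr)
      assume "c \<noteq> 0\<^sub>v k"
      from drop_kernel_vector[OF _ _ c(1) this c(2), of "Y\<^sup>T" p] YL
      obtain Y' L' where *: "Y' \<in> carrier_mat q (k - 1)" "L' \<in> carrier_mat (k - 1) p"
        "L\<^sup>T * Y\<^sup>T = Y' * L'" "0 < k" by auto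
      have "M = (L\<^sup>T * Y\<^sup>T)\<^sup>T" using YL by (simp flip: transpose_mult)
      also have "\<dots> = L'\<^sup>T * Y'\<^sup>T" unfolding *(3) using *(1,2) by (rule transpose_mult)
      finally have "?P (k - 1)" using * by (intro exI[of _ "L'\<^sup>T"] exI[of _ "Y'\<^sup>T"]) auto
      from min[OF this] *(4) show False by auto
    qed
  from YL min[OF q] 1 2 show ?thesis by blast
qed

text \<open>If L L^T c = 0, then |L^T c|^2 = c . L L^T c = 0.\<close>

lemma gram_det_nonzero:
  fixes L :: "real mat"
  assumes L: "L \<in> carrier_mat k q"
    and inj: "\<And>c. c \<in> carrier_vec k \<Longrightarrow> L\<^sup>T *\<^sub>v c = 0\<^sub>v q \<Longrightarrow> c = 0\<^sub>v k"
  shows "Determinant.det (L * L\<^sup>T) \<noteq> 0"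
proof -
  have LL: "L * L\<^sup>T \<in> carrier_mat k k" using L by simp
  show ?thesis unfolding det_nonzero_iff_inj[OF LL]
  proof (intro ballI impI)
    fix c assume c: "c \<in> carrier_vec k" "L * L\<^sup>T *\<^sub>v c = 0\<^sub>v k"
    have "(L\<^sup>T *\<^sub>v c) \<bullet> (L\<^sup>T *\<^sub>v c) = c \<bullet> (L *\<^sub>v (L\<^sup>T *\<^sub>v c))"
      using L c(1) by (intro transpose_vec_mult_scalar[OF L]) simp_all
    also have "L *\<^sub>v (L\<^sup>T *\<^sub>v c) = 0\<^sub>v k" using L c by simp
    finally have "L\<^sup>T *\<^sub>v c = 0\<^sub>v q"
      using scalar_prod_self_real(2)[of "L\<^sup>T *\<^sub>v c" q] L c by auto
    then show "c = 0\<^sub>v k" by (rule inj[OF c(1)])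
  qed
qed

text \<open>\<open>L\<close> is the right factor of a rank factorisation of M, so both have the same
  kernel, and \<open>R\<close> = L^T (L L^T)^{-1} is a right inverse of it. The pair serves as
  coordinates on the quotient by the kernel of M; the nonzero kernel vector v makes this quotient
  strictly smaller.\<close>

lemma kernel_quotient:
  fixes M :: "real mat"
  assumes M: "M \<in> carrier_mat p q" and v: "v \<in> carrier_vec q" "v \<noteq> 0\<^sub>v q" "M *\<^sub>v v = 0\<^sub>v p"
  obtains k L R where "k < q" "L \<in> carrier_mat k q" "R \<in> carrier_mat q k" "L * R = 1\<^sub>m k"
    "\<And>x. x \<in> carrier_vec q \<Longrightarrow> L *\<^sub>v x = 0\<^sub>v k \<Longrightarrow> M *\<^sub>v x = 0\<^sub>v p"
    "\<And>x. x \<in> carrier_vec q \<Longrightarrow> M *\<^sub>v x = 0\<^sub>v p \<Longrightarrow> L *\<^sub>v x = 0\<^sub>v k"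
proof -
  from rank_factorisation[OF M] obtain k Y L where Y: "Y \<in> carrier_mat p k"
    and L: "L \<in> carrier_mat k q" and YL: "M = Y * L" and kq: "k \<le> q"
    and Yinj: "\<And>c. c \<in> carrier_vec k \<Longrightarrow> Y *\<^sub>v c = 0\<^sub>v p \<Longrightarrow> c = 0\<^sub>v k"
    and Linj: "\<And>c. c \<in> carrier_vec k \<Longrightarrow> L\<^sup>T *\<^sub>v c = 0\<^sub>v q \<Longrightarrow> c = 0\<^sub>v k"
    by auto
  have ker: "L *\<^sub>v x = 0\<^sub>v k" if "x \<in> carrier_vec q" "M *\<^sub>v x = 0\<^sub>v p" for x
    using that Yinj[of "L *\<^sub>v x"] Y L YL by simp
  have "k \<noteq> q"
  proof
    assume "k = q"
    with L Linj have L: "L \<in> carrier_mat q q"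
      and Linj: "\<And>c. c \<in> carrier_vec q \<Longrightarrow> L\<^sup>T *\<^sub>v c = 0\<^sub>v q \<Longrightarrow> c = 0\<^sub>v q" by auto
    have "L\<^sup>T \<in> carrier_mat q q" using L by simp
    from det_nonzero_iff_inj[OF this] Linj have "Determinant.det (L\<^sup>T) \<noteq> 0" by blast
    hence "Determinant.det L \<noteq> 0" using det_transpose[OF L] by simp
    moreover have "L *\<^sub>v v = 0\<^sub>v q" using ker[OF v(1,3)] \<open>k = q\<close> by simp
    ultimately show False using det_nonzero_iff_inj[OF L] v(1,2) by blast
  qed
  with kq have "k < q" by simp
  define R where "R = L\<^sup>T * minv (L * L\<^sup>T)"
  have LL: "L * L\<^sup>T \<in> carrier_mat k k" using L by simp
  note inv = minv_mult[OF LL gram_det_nonzero[OF L Linj]]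
  have R: "R \<in> carrier_mat q k" using L inv by (auto simp: R_def)
  have LR: "L * R = 1\<^sub>m k" unfolding R_def
    using L inv assoc_mult_mat[of L k q "L\<^sup>T" k "minv (L * L\<^sup>T)" k] by auto
  have LM: "M *\<^sub>v x = 0\<^sub>v p" if "x \<in> carrier_vec q" "L *\<^sub>v x = 0\<^sub>v k" for x
    using that Y L by (auto simp: YL)
  show thesis by (rule that[OF \<open>k < q\<close> L R LR LM ker])
qed

subsection \<open>Square roots of positive semidefinite matrices\<close>

lemma mat_eqI_vec:
  fixes A B :: "'a :: semiring_1 mat"
  assumes A: "A \<in> carrier_mat n m" and B: "B \<in> carrier_mat n m"
    and eq: "\<And>x. x \<in> carrier_vec m \<Longrightarrow> A *\<^sub>v x = B *\<^sub>v x"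
  shows "A = B"
proof (rule eq_matI)
  fix i j assume ij: "i < dim_row B" "j < dim_col B"
  have "(A *\<^sub>v unit_vec m j) $ i = (B *\<^sub>v unit_vec m j) $ i" using eq[of "unit_vec m j"] by simp
  then show "A $$ (i, j) = B $$ (i, j)" using A B ij by simp
qed (use A B in auto)

text \<open>Padding the vectors with zeros to length l > n gives a square matrix with a zero row,
  hence a linear relation among them; pairing the relation with \<open>ws ! k\<close> isolates its
  k-th coefficient. The bound ends the recursion that splits off eigenvectors.\<close>

lemma orthogonal_list_length:
  fixes ws :: "real vec list"
  assumes ws: "set ws \<subseteq> carrier_vec n" and orth: "corthogonal ws"
  shows "length ws \<le> n"
proof (rule ccontr)
  define l where "l = length ws"
  assume "\<not> length ws \<le> n"
  then have l: "n < l" by (simp add: l_def)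
  define W where "W = mat l l (\<lambda>(i, j). if i < n then (ws ! j) $ i else 0)"
  have W: "W \<in> carrier_mat l l" by (simp add: W_def)
  have "W\<^sup>T *\<^sub>v unit_vec l (l - 1) = 0\<^sub>v l"
    using l by (intro eq_vecI) (auto simp: W_def)
  moreover have "unit_vec l (l - 1) \<noteq> (0\<^sub>v l :: real vec)" using l by simp
  ultimately have "Determinant.det (W\<^sup>T) = 0"
    using det_nonzero_iff_inj[of "W\<^sup>T" l] W by (metis transpose_carrier_mat unit_vec_carrier)
  then have "Determinant.det W = 0" using det_transpose[OF W] by simp
  then obtain c where c: "c \<in> carrier_vec l" "W *\<^sub>v c = 0\<^sub>v l" "c \<noteq> 0\<^sub>v l"
    using det_nonzero_iff_inj[OF W] by blast
  obtain k where k: "k < l" "c $ k \<noteq> 0" using c(1,3) by (auto simp: vec_eq_iff)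
  have wsc: "ws ! j \<in> carrier_vec n" if "j < l" for j using ws that by (auto simp: l_def)
  have row: "(\<Sum>j = 0..<l. (ws ! j) $ i * c $ j) = 0" if "i < n" for i
  proof -
    have "(W *\<^sub>v c) $ i = (\<Sum>j = 0..<l. (ws ! j) $ i * c $ j)"
      using that l c(1) by (simp add: W_def scalar_prod_def)
    then show ?thesis using c(2) that l by simp
  qed
  have "0 = (\<Sum>i = 0..<n. (ws ! k) $ i * (\<Sum>j = 0..<l. (ws ! j) $ i * c $ j))"
    by (simp add: row)
  also have "\<dots> = (\<Sum>j = 0..<l. c $ j * (\<Sum>i = 0..<n. (ws ! k) $ i * (ws ! j) $ i))"
    unfolding sum_distrib_left by (subst sum.swap) (simp add: ac_simps)
  also have "\<dots> = (\<Sum>j = 0..<l. c $ j * ((ws ! k) \<bullet> (ws ! j)))"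
    using wsc carrier_vecD by (intro sum.cong refl) (auto simp: scalar_prod_def)
  also have "\<dots> = (\<Sum>j = 0..<l. if j = k then c $ k * ((ws ! k) \<bullet> (ws ! k)) else 0)"
    using corthogonalD[OF orth, of k] k(1) by (intro sum.cong refl) (auto simp: l_def)
  also have "\<dots> = c $ k * ((ws ! k) \<bullet> (ws ! k))" using k(1) by simp
  finally show False using k corthogonalD[OF orth, of k k] by (simp add: l_def)
qed

text \<open>The eigenvalue 0 has to be avoided, so the spectrum is taken of L Y instead of N = Y L,
  where Y and L^T are injective. Symmetry of N makes L Y injective, hence its complex eigenvalues
  are nonzero, and Y carries an eigenvector to one of N with the same eigenvalue. Symmetry once more
  makes the eigenvalue real, and a nonzero real or imaginary part is the required vector.\<close>

lemma symmetric_nonzero_eigenvector: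
  fixes N :: "real mat"
  assumes N: "N \<in> carrier_mat n n" and sym: "N\<^sup>T = N" and N0: "N \<noteq> 0\<^sub>m n n"
  shows "\<exists>\<alpha> v. \<alpha> \<noteq> 0 \<and> v \<in> carrier_vec n \<and> v \<noteq> 0\<^sub>v n \<and> N *\<^sub>v v = \<alpha> \<cdot>\<^sub>v v"
proof -
  from rank_factorisation[OF N] obtain k Y L where Y: "Y \<in> carrier_mat n k"
    and L: "L \<in> carrier_mat k n" and YL: "N = Y * L"
    and Yinj: "\<And>c. c \<in> carrier_vec k \<Longrightarrow> Y *\<^sub>v c = 0\<^sub>v n \<Longrightarrow> c = 0\<^sub>v k"
    and Linj: "\<And>c. c \<in> carrier_vec k \<Longrightarrow> L\<^sup>T *\<^sub>v c = 0\<^sub>v n \<Longrightarrow> c = 0\<^sub>v k"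
    by auto
  have k: "k > 0"
  proof (rule ccontr)
    assume "\<not> k > 0"
    then have "N = 0\<^sub>m n n" unfolding YL using Y L by (intro eq_matI) (auto simp: scalar_prod_def)
    with N0 show False by simp
  qed
  have LL: "L * L\<^sup>T \<in> carrier_mat k k" using L by simp
  have inj: "c = 0\<^sub>v k" if c: "c \<in> carrier_vec k" and 0: "L *\<^sub>v (Y *\<^sub>v c) = 0\<^sub>v k" for c
  proof -
    \<comment> \<open>A preimage of c under \<open>L\<close>, so that N z = Y c. Then |Y c|^2 = (N
      (Y c)) . z, which vanishes because L Y c = 0.\<close>
    define z where "z = L\<^sup>T *\<^sub>v (minv (L * L\<^sup>T) *\<^sub>v c)"
    note inv = minv_carrier[OF LL gram_det_nonzero[OF L Linj]]
    have z: "z \<in> carrier_vec n" using L inv c by (simp add: z_def)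
    have mc: "minv (L * L\<^sup>T) *\<^sub>v c \<in> carrier_vec k" using inv c by simp
    have "L *\<^sub>v z = (L * L\<^sup>T) *\<^sub>v (minv (L * L\<^sup>T) *\<^sub>v c)" unfolding z_def
      by (rule assoc_mult_mat_vec[symmetric, of _ k n _ k]) (use L mc in simp_all)
    also have "\<dots> = c" by (rule mult_minv_vec[OF LL gram_det_nonzero[OF L Linj] c])
    finally have Lz: "L *\<^sub>v z = c" .
    have Nz: "N *\<^sub>v z = Y *\<^sub>v c" unfolding YL using Y L z Lz by simp
    have Yc: "Y *\<^sub>v c \<in> carrier_vec n" using Y c by simp
    have NYc: "N *\<^sub>v (Y *\<^sub>v c) = 0\<^sub>v n" unfolding YL using Y L Yc 0 by simp
    have "(Y *\<^sub>v c) \<bullet> (Y *\<^sub>v c) = (N *\<^sub>v (Y *\<^sub>v c)) \<bullet> z"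
      using symmetric_scalar_prod[OF N sym Yc z] by (simp add: Nz)
    also have "\<dots> = 0" using NYc z by simp
    finally have "Y *\<^sub>v c = 0\<^sub>v n" using scalar_prod_self_real(2)[OF Yc] by simp
    then show ?thesis by (rule Yinj[OF c])
  qed
  have M: "cmat (L * Y) \<in> carrier_mat k k" using L Y by simp
  from spectrum_non_empty[OF M k] obtain \<mu> where "eigenvalue (cmat (L * Y)) \<mu>"
    by (auto simp: spectrum_def)
  then obtain c where c: "c \<in> carrier_vec k" "c \<noteq> 0\<^sub>v k" "cmat (L * Y) *\<^sub>v c = \<mu> \<cdot>\<^sub>v c"
    using M by (auto simp: eigenvalue_def eigenvector_def)
  define v where "v = cmat Y *\<^sub>v c"
  have v: "v \<in> carrier_vec n" using Y c by (simp add: v_def)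
  have Lv: "cmat L *\<^sub>v v = \<mu> \<cdot>\<^sub>v c" unfolding v_def c(3)[symmetric] cmat_mult[OF L Y]
    by (rule assoc_mult_mat_vec[symmetric, of _ k n _ k]) (use L Y c in simp_all)
  have Nv: "cmat N *\<^sub>v v = \<mu> \<cdot>\<^sub>v v"
  proof -
    have "cmat N *\<^sub>v v = cmat Y *\<^sub>v (cmat L *\<^sub>v v)" unfolding YL cmat_mult[OF Y L]
      by (rule assoc_mult_mat_vec[of _ n k _ n]) (use L Y v in simp_all)
    also have "\<dots> = \<mu> \<cdot>\<^sub>v v" unfolding Lv using mult_mat_vec[of "cmat Y" n k c \<mu>] Y c(1) by (simp add: v_def)
    finally show ?thesis .
  qed
  have \<mu>0: "\<mu> \<noteq> 0"
  proof
    assume "\<mu> = 0"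
    then have "cmat L *\<^sub>v (cmat Y *\<^sub>v c) = 0\<^sub>v k" using Lv c(1) by (auto simp: v_def)
    then have "re_vec (cmat L *\<^sub>v (cmat Y *\<^sub>v c)) = 0\<^sub>v k" "im_vec (cmat L *\<^sub>v (cmat Y *\<^sub>v c)) = 0\<^sub>v k"
      by auto
    then have "L *\<^sub>v (Y *\<^sub>v re_vec c) = 0\<^sub>v k" "L *\<^sub>v (Y *\<^sub>v im_vec c) = 0\<^sub>v k"
      using re_vec_cmat_mult[OF L, of "cmat Y *\<^sub>v c"] re_vec_cmat_mult[OF Y c(1)] Y c(1) by simp_all
    with inj[of "re_vec c"] inj[of "im_vec c"] c(1) have "re_vec c = 0\<^sub>v k" "im_vec c = 0\<^sub>v k" by auto
    then have "c = 0\<^sub>v k" using c(1) complex_vec_eq_iff[of c k "0\<^sub>v k"] by (auto simp: vec_eq_iff)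
    with c(2) show False by simp
  qed
  have v0: "v \<noteq> 0\<^sub>v n"
  proof
    assume "v = 0\<^sub>v n"
    then have "\<mu> \<cdot>\<^sub>v c = 0\<^sub>v k" using Lv L mult_mat_zero_vec[of "cmat L" k n] by simp
    with \<mu>0 c(1) have "c = 0\<^sub>v k" by (auto simp: vec_eq_iff)
    with c(2) show False by simp
  qed
  have "Im \<mu> * Re (v \<bullet>c v) = 0"
    using symmetric_quadratic_form(2)[OF N sym v] v cscalar_prod_self_Re(2)[of v] by (simp add: Nv)
  with cscalar_prod_self_pos[OF v v0] have "Im \<mu> = 0" by simp
  then have \<mu>: "\<mu> = complex_of_real (Re \<mu>)" by (simp add: complex_eq_iff)
  have "re_vec (cmat N *\<^sub>v v) = Re \<mu> \<cdot>\<^sub>v re_vec v" "im_vec (cmat N *\<^sub>v v) = Re \<mu> \<cdot>\<^sub>v im_vec v"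
    unfolding Nv using \<open>Im \<mu> = 0\<close> by auto
  then have eig: "N *\<^sub>v re_vec v = Re \<mu> \<cdot>\<^sub>v re_vec v" "N *\<^sub>v im_vec v = Re \<mu> \<cdot>\<^sub>v im_vec v"
    using re_vec_cmat_mult[OF N v] by auto
  have "Re \<mu> \<noteq> 0" using \<mu>0 \<mu> by (metis of_real_0)
  have "re_vec v \<noteq> 0\<^sub>v n \<or> im_vec v \<noteq> 0\<^sub>v n"
    using v0 v complex_vec_eq_iff[of v n "0\<^sub>v n"] by (auto simp: vec_eq_iff)
  then show ?thesis
  proof
    assume "re_vec v \<noteq> 0\<^sub>v n"
    with eig(1) v \<open>Re \<mu> \<noteq> 0\<close> show ?thesis by (intro exI[of _ "Re \<mu>"] exI[of _ "re_vec v"]) auto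
  next
    assume "im_vec v \<noteq> 0\<^sub>v n"
    with eig(2) v \<open>Re \<mu> \<noteq> 0\<close> show ?thesis by (intro exI[of _ "Re \<mu>"] exI[of _ "im_vec v"]) auto
  qed
qed

text \<open>An eigenvector v of R - S with eigenvalue \<alpha> \<noteq> 0 satisfies |R v|^2 = |S
  v|^2 because the squares agree. Expanding with R v = S v + \<alpha> v gives v . S v + v . R v = 0,
  so both nonnegative terms vanish. Hence R v = S v = 0, and \<alpha> v = 0.\<close>

lemma psd_sqrt_unique:
  fixes R S :: "real mat"
  assumes R: "R \<in> carrier_mat n n" "pos_semidef R" and S: "S \<in> carrier_mat n n" "pos_semidef S"
    and RS: "R * R = S * S"
  shows "R = S"
proof (rule ccontr)
  assume "R \<noteq> S"
  define D where "D = R - S"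
  have D: "D \<in> carrier_mat n n" using R S by (auto simp: D_def)
  have Rs: "R\<^sup>T = R" and Ss: "S\<^sup>T = S" using R S pos_semidef_real by auto
  have Ds: "D\<^sup>T = D" using transpose_minus[OF R(1) S(1)] Rs Ss by (simp add: D_def)
  have "D \<noteq> 0\<^sub>m n n"
  proof
    assume "D = 0\<^sub>m n n"
    then have "R $$ (i, j) = S $$ (i, j)" if "i < n" "j < n" for i j
      using that R S by (metis D_def carrier_matD eq_iff_diff_eq_0 index_minus_mat(1) index_zero_mat(1))
    with R S \<open>R \<noteq> S\<close> show False by (metis carrier_matD eq_matI)
  qed
  from symmetric_nonzero_eigenvector[OF D Ds this] obtain \<alpha> v
    where l: "\<alpha> \<noteq> 0" and v: "v \<in> carrier_vec n" "v \<noteq> 0\<^sub>v n" and Dv: "D *\<^sub>v v = \<alpha> \<cdot>\<^sub>v v" by blast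
  have Rv: "R *\<^sub>v v \<in> carrier_vec n" and Sv: "S *\<^sub>v v \<in> carrier_vec n" using R S v by auto
  have eq: "R *\<^sub>v v = S *\<^sub>v v + \<alpha> \<cdot>\<^sub>v v"
  proof -
    have "D *\<^sub>v v = R *\<^sub>v v - S *\<^sub>v v" unfolding D_def by (rule minus_mult_distrib_mat_vec[OF R(1) S(1) v(1)])
    with Dv have "R *\<^sub>v v - S *\<^sub>v v = \<alpha> \<cdot>\<^sub>v v" by simp
    then have "(R *\<^sub>v v - S *\<^sub>v v) $ i = (\<alpha> \<cdot>\<^sub>v v) $ i" for i by simp
    note * = this
    show ?thesis
    proof (rule eq_vecI)
      fix i assume "i < dim_vec (S *\<^sub>v v + \<alpha> \<cdot>\<^sub>v v)"
      with v have i: "i < n" by simp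
      have "(R *\<^sub>v v - S *\<^sub>v v) $ i = (R *\<^sub>v v) $ i - (S *\<^sub>v v) $ i" using i S(1) by simp
      with *[of i] i v(1) S(1) show "(R *\<^sub>v v) $ i = (S *\<^sub>v v + \<alpha> \<cdot>\<^sub>v v) $ i"
        by (simp del: index_mult_mat_vec)
    qed (use R(1) v(1) in simp)
  qed
  have "(R *\<^sub>v v) \<bullet> (R *\<^sub>v v) = (S *\<^sub>v v) \<bullet> (S *\<^sub>v v)"
  proof -
    have "(R *\<^sub>v v) \<bullet> (R *\<^sub>v v) = v \<bullet> ((R * R) *\<^sub>v v)"
      using symmetric_scalar_prod[OF R(1) Rs v(1) Rv] R v by simp
    also have "\<dots> = v \<bullet> (S *\<^sub>v (S *\<^sub>v v))" unfolding RS using S v by simp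
    also have "\<dots> = (S *\<^sub>v v) \<bullet> (S *\<^sub>v v)"
      using symmetric_scalar_prod[OF S(1) Ss v(1) Sv] by simp
    finally show ?thesis .
  qed
  moreover have "(R *\<^sub>v v) \<bullet> (R *\<^sub>v v) =
      (S *\<^sub>v v) \<bullet> (S *\<^sub>v v) + \<alpha> * (v \<bullet> (S *\<^sub>v v)) + \<alpha> * (v \<bullet> (R *\<^sub>v v))"
    using comm_scalar_prod[OF v(1) Sv] Sv v(1) Rv
    by (subst (1 2) eq, subst eq) (simp add: add_scalar_prod_distrib[of _ n] scalar_prod_add_distrib[of _ n]
      algebra_simps)
  ultimately have "\<alpha> * (v \<bullet> (S *\<^sub>v v) + v \<bullet> (R *\<^sub>v v)) = 0" by (simp add: algebra_simps)
  with l have "v \<bullet> (S *\<^sub>v v) + v \<bullet> (R *\<^sub>v v) = 0" by simp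
  moreover have "0 \<le> v \<bullet> (S *\<^sub>v v)" "0 \<le> v \<bullet> (R *\<^sub>v v)"
    using R S v pos_semidef_real by auto
  ultimately have "v \<bullet> (S *\<^sub>v v) = 0" "v \<bullet> (R *\<^sub>v v) = 0" by linarith+
  then have "R *\<^sub>v v = 0\<^sub>v n" "S *\<^sub>v v = 0\<^sub>v n"
    using pos_semidef_null[OF R v(1)] pos_semidef_null[OF S v(1)] by auto
  with eq v(1) have "\<alpha> \<cdot>\<^sub>v v = 0\<^sub>v n" by simp
  with l v show False by (auto simp: vec_eq_iff)
qed

text \<open>The rank-one matrix c v v^T; the factor c spares a normalisation of v.\<close>

definition outer :: "real \<Rightarrow> real vec \<Rightarrow> real mat" where
  "outer c v = mat (dim_vec v) (dim_vec v) (\<lambda>(i, j). c * v $ i * v $ j)"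

lemma outer_mult:
  assumes "v \<in> carrier_vec n" "x \<in> carrier_vec n"
  shows "outer c v \<in> carrier_mat n n" "(outer c v)\<^sup>T = outer c v"
    "outer c v *\<^sub>v x = (c * (v \<bullet> x)) \<cdot>\<^sub>v v"
  using assms by (auto simp: outer_def scalar_prod_def sum_distrib_left ac_simps intro!: eq_vecI)

text \<open>Spectral deflation: v is an eigenvector of N with eigenvalue \<alpha>, q = |v|^2 and N'
  = N - (\<alpha>/q) v v^T. A root of N' annihilates v, so adding a multiple of v v^T to it produces
  no mixed terms in the square. The conclusion about kernel vectors of N lets orthogonal kernel
  directions accumulate under repetition.\<close>

lemma psd_deflation:
  fixes N :: "real mat"
  assumes N: "N \<in> carrier_mat n n" "pos_semidef N" and N0: "N \<noteq> 0\<^sub>m n n"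
  obtains v N' where "v \<in> carrier_vec n" "v \<noteq> 0\<^sub>v n" "N' \<in> carrier_mat n n" "pos_semidef N'"
    "N' *\<^sub>v v = 0\<^sub>v n"
    "\<And>w. w \<in> carrier_vec n \<Longrightarrow> N *\<^sub>v w = 0\<^sub>v n \<Longrightarrow> v \<bullet> w = 0 \<and> N' *\<^sub>v w = 0\<^sub>v n"
    "\<And>R. R \<in> carrier_mat n n \<Longrightarrow> pos_semidef R \<Longrightarrow> R * R = N' \<Longrightarrow>
       \<exists>R. R \<in> carrier_mat n n \<and> pos_semidef R \<and> R * R = N"
proof -
  have sym: "N\<^sup>T = N" and nn: "\<And>x. x \<in> carrier_vec n \<Longrightarrow> 0 \<le> x \<bullet> (N *\<^sub>v x)"
    using N(2) pos_semidef_real[OF N(1)] by auto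
  from symmetric_nonzero_eigenvector[OF N(1) sym N0] obtain \<alpha> v
    where l: "\<alpha> \<noteq> 0" and v: "v \<in> carrier_vec n" "v \<noteq> 0\<^sub>v n" and Nv: "N *\<^sub>v v = \<alpha> \<cdot>\<^sub>v v" by blast
  define q where "q = v \<bullet> v"
  have q: "q > 0" using scalar_prod_self_real[of v] v unfolding q_def by fastforce
  have "0 \<le> \<alpha> * q" using nn[OF v(1)] v by (simp add: Nv q_def)
  with l q have l0: "\<alpha> > 0" by (simp add: zero_le_mult_iff)
  have vN: "v \<bullet> (N *\<^sub>v x) = \<alpha> * (v \<bullet> x)" if x: "x \<in> carrier_vec n" for x
    using symmetric_scalar_prod[OF N(1) sym v(1) x] v x by (simp add: Nv)
  define N' where "N' = N + outer (- \<alpha> / q) v"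
  note out = outer_mult[OF v(1)]
  have N': "N' \<in> carrier_mat n n" using N out(1)[OF v(1)] by (simp add: N'_def)
  have N'x: "N' *\<^sub>v x = N *\<^sub>v x + (- \<alpha> / q * (v \<bullet> x)) \<cdot>\<^sub>v v" if x: "x \<in> carrier_vec n" for x
    unfolding N'_def using add_mult_distrib_mat_vec[OF N(1) out(1)[OF v(1)] x] out(3)[OF x] by simp
  have N'psd: "pos_semidef N'" unfolding pos_semidef_real[OF N']
  proof (intro conjI ballI)
    show "N'\<^sup>T = N'" unfolding N'_def using transpose_add[OF N(1) out(1)[OF v(1)]] sym out(2)[OF v(1)] by simp
    fix x :: "real vec" assume x: "x \<in> carrier_vec n"
    \<comment> \<open>The coefficient of the projection of x on v. The form of N' at x is the form
      of N at x - t v, hence nonnegative.\<close>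
    define t where "t = (v \<bullet> x) / q"
    have xv: "x \<bullet> v = v \<bullet> x" by (rule comm_scalar_prod[OF x v(1)])
    have Nx: "N *\<^sub>v x \<in> carrier_vec n" using N x by simp
    have "0 \<le> (x + (- t) \<cdot>\<^sub>v v) \<bullet> (N *\<^sub>v (x + (- t) \<cdot>\<^sub>v v))" using nn x v by auto
    also have "N *\<^sub>v (x + (- t) \<cdot>\<^sub>v v) = N *\<^sub>v x + (- t * \<alpha>) \<cdot>\<^sub>v v"
      using mult_add_distrib_mat_vec[OF N(1) x, of "(- t) \<cdot>\<^sub>v v"] mult_mat_vec[OF N(1) v(1), of "- t"] v
      by (simp add: Nv smult_smult_assoc)
    also have "(x + (- t) \<cdot>\<^sub>v v) \<bullet> \<dots> = x \<bullet> (N *\<^sub>v x) - 2 * t * \<alpha> * (v \<bullet> x) + t * t * \<alpha> * q"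
      using x v Nx vN[OF x] xv by (simp add: add_scalar_prod_distrib[of _ n] scalar_prod_add_distrib[of _ n]
        q_def algebra_simps)
    also have "\<dots> = x \<bullet> (N *\<^sub>v x) - \<alpha> / q * (v \<bullet> x) * (v \<bullet> x)"
      using q by (simp add: t_def field_simps)
    also have "\<dots> = x \<bullet> (N' *\<^sub>v x)" unfolding N'x[OF x]
      using x v Nx xv by (simp add: scalar_prod_add_distrib[of _ n])
    finally show "0 \<le> x \<bullet> (N' *\<^sub>v x)" .
  qed
  have N'v: "N' *\<^sub>v v = 0\<^sub>v n" unfolding N'x[OF v(1)] Nv
    using q v by (auto simp flip: q_def)
  have ker: "v \<bullet> w = 0 \<and> N' *\<^sub>v w = 0\<^sub>v n" if w: "w \<in> carrier_vec n" "N *\<^sub>v w = 0\<^sub>v n" for w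
  proof -
    have "v \<bullet> w = 0" using vN[OF w(1)] w v l by simp
    then show ?thesis unfolding N'x[OF w(1)] using w v by auto
  qed
  have sqrt: "\<exists>R. R \<in> carrier_mat n n \<and> pos_semidef R \<and> R * R = N"
    if R: "R \<in> carrier_mat n n" "pos_semidef R" and RR: "R * R = N'" for R
  proof -
    have Rs: "R\<^sup>T = R" and Rn: "\<And>x. x \<in> carrier_vec n \<Longrightarrow> 0 \<le> x \<bullet> (R *\<^sub>v x)"
      using R(2) pos_semidef_real[OF R(1)] by auto
    have Rvc: "R *\<^sub>v v \<in> carrier_vec n" using R v by simp
    have "(R *\<^sub>v v) \<bullet> (R *\<^sub>v v) = v \<bullet> ((R * R) *\<^sub>v v)"
      using symmetric_scalar_prod[OF R(1) Rs v(1) Rvc] R v by simp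
    also have "\<dots> = 0" unfolding RR N'v using v by simp
    finally have Rv: "R *\<^sub>v v = 0\<^sub>v n" using scalar_prod_self_real(2)[OF Rvc] by simp
    \<comment> \<open>This equals sqrt(\<alpha>) / q, the value for which d v v^T squares to
      (\<alpha>/q) v v^T, the term removed from N.\<close>
    define d where "d = sqrt \<alpha> / (sqrt q * q) * sqrt q"
    have d: "d \<ge> 0" "d * d * q = \<alpha> / q"
      using l0 q by (auto simp: d_def field_simps simp flip: real_sqrt_mult)
    define S where "S = R + outer d v"
    have S: "S \<in> carrier_mat n n" using R out(1)[OF v(1)] by (simp add: S_def)
    have Sx: "S *\<^sub>v x = R *\<^sub>v x + (d * (v \<bullet> x)) \<cdot>\<^sub>v v" if x: "x \<in> carrier_vec n" for x
      unfolding S_def using add_mult_distrib_mat_vec[OF R(1) out(1)[OF v(1)] x] out(3)[OF x] by simp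
    have "pos_semidef S" unfolding pos_semidef_real[OF S]
    proof (intro conjI ballI)
      show "S\<^sup>T = S" unfolding S_def using transpose_add[OF R(1) out(1)[OF v(1)]] Rs out(2)[OF v(1)] by simp
      fix x :: "real vec" assume x: "x \<in> carrier_vec n"
      have "x \<bullet> (S *\<^sub>v x) = x \<bullet> (R *\<^sub>v x) + d * (v \<bullet> x)\<^sup>2" unfolding Sx[OF x]
        using x v R comm_scalar_prod[OF x v(1)]
        by (simp add: scalar_prod_add_distrib[of _ n] power2_eq_square)
      with Rn[OF x] d(1) show "0 \<le> x \<bullet> (S *\<^sub>v x)" by simp
    qed
    moreover have "S * S = N"
    proof (rule mat_eqI_vec)
      fix x :: "real vec" assume x: "x \<in> carrier_vec n"
      have Rx: "R *\<^sub>v x \<in> carrier_vec n" using R x by simp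
      have vRx: "v \<bullet> (R *\<^sub>v x) = 0" using symmetric_scalar_prod[OF R(1) Rs v(1) x] Rv x by simp
      have Sxc: "S *\<^sub>v x \<in> carrier_vec n" using S x by simp
      have "(S * S) *\<^sub>v x = S *\<^sub>v (S *\<^sub>v x)" using S x by simp
      also have "\<dots> = R *\<^sub>v (S *\<^sub>v x) + (d * (v \<bullet> (S *\<^sub>v x))) \<cdot>\<^sub>v v" by (rule Sx[OF Sxc])
      also have "R *\<^sub>v (S *\<^sub>v x) = (R * R) *\<^sub>v x" unfolding Sx[OF x]
        using mult_add_distrib_mat_vec[OF R(1) Rx, of "(d * (v \<bullet> x)) \<cdot>\<^sub>v v"]
          mult_mat_vec[OF R(1) v(1)] R x v Rx
          mult_carrier_mat[OF R(1) R(1)] by (simp add: Rv)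
      also have "v \<bullet> (S *\<^sub>v x) = d * (v \<bullet> x) * q" unfolding Sx[OF x]
        using v Rx vRx by (simp add: scalar_prod_add_distrib[of _ n] q_def)
      also have "d * (d * (v \<bullet> x) * q) = (d * d * q) * (v \<bullet> x)" by simp
      also have "(R * R) *\<^sub>v x + (d * d * q * (v \<bullet> x)) \<cdot>\<^sub>v v = N *\<^sub>v x"
        unfolding RR N'x[OF x] d(2) using N x v by (intro eq_vecI) auto
      finally show "(S * S) *\<^sub>v x = N *\<^sub>v x" .
    qed (use S N in auto)
    ultimately show ?thesis using S by blast
  qed
  show thesis by (rule that[OF v N' N'psd N'v ker sqrt])
qed

text \<open>\<open>ws\<close> collects orthogonal kernel vectors of N, and j bounds how many are
  still missing. Each deflation moves an eigenvector into the kernel and lengthens the list by one;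
  as at most n nonzero orthogonal vectors exist, N must be 0 once j is exhausted.\<close>

lemma psd_sqrt_exists_aux:
  fixes N :: "real mat"
  assumes "N \<in> carrier_mat n n" "pos_semidef N"
    and "set ws \<subseteq> carrier_vec n" "corthogonal ws" "\<And>w. w \<in> set ws \<Longrightarrow> N *\<^sub>v w = 0\<^sub>v n"
    and "n \<le> length ws + j"
  shows "\<exists>R. R \<in> carrier_mat n n \<and> pos_semidef R \<and> R * R = N"
  using assms
proof (induction j arbitrary: N ws rule: less_induct)
  case (less j N ws)
  show ?case
  proof (cases "N = 0\<^sub>m n n")
    case True
    then show ?thesis using less.prems(2) by (intro exI[of _ N]) auto
  next
    case False
    obtain v N' where
      v: "v \<in> carrier_vec n" "v \<noteq> 0\<^sub>v n" and N': "N' \<in> carrier_mat n n" "pos_semidef N'" "N' *\<^sub>v v = 0\<^sub>v n"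
      and ker: "\<And>w. w \<in> carrier_vec n \<Longrightarrow> N *\<^sub>v w = 0\<^sub>v n \<Longrightarrow> v \<bullet> w = 0 \<and> N' *\<^sub>v w = 0\<^sub>v n"
      and sqrt: "\<And>R. R \<in> carrier_mat n n \<Longrightarrow> pos_semidef R \<Longrightarrow> R * R = N' \<Longrightarrow>
        \<exists>R. R \<in> carrier_mat n n \<and> pos_semidef R \<and> R * R = N"
      by (rule psd_deflation[OF less.prems(1,2) False]) (rule that)
    have ws: "w \<in> carrier_vec n" "v \<bullet> w = 0" "w \<bullet> v = 0" "N' *\<^sub>v w = 0\<^sub>v n" if "w \<in> set ws" for w
      using ker[OF _ less.prems(5)[OF that]] less.prems(3) that comm_scalar_prod[of w n v] v by auto
    have orth: "corthogonal (v # ws)"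
    proof (rule corthogonalI)
      fix i k assume ik: "i < length (v # ws)" "k < length (v # ws)"
      have "v \<bullet> v \<noteq> 0" using scalar_prod_self_real(2)[OF v(1)] v(2) by simp
      with ik ws(2,3) corthogonalD[OF less.prems(4)]
      show "((v # ws) ! i \<bullet>c (v # ws) ! k = 0) = (i \<noteq> k)"
        by (cases i; cases k) auto
    qed
    have sub: "set (v # ws) \<subseteq> carrier_vec n" using v ws(1) by auto
    have j: "j \<noteq> 0" using orthogonal_list_length[OF sub orth] less.prems(6) by auto
    have "\<exists>R. R \<in> carrier_mat n n \<and> pos_semidef R \<and> R * R = N'"
      by (rule less.IH[of "j - 1" N' "v # ws"]) (use j N' sub orth ws(4) less.prems(6) in auto)
    with sqrt show ?thesis by blast
  qed
qed

lemma psd_sqrt: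
  assumes N: "N \<in> carrier_mat n n" "pos_semidef N"
  shows "psd_sqrt N \<in> carrier_mat n n" "pos_semidef (psd_sqrt N)" "psd_sqrt N * psd_sqrt N = N"
proof -
  obtain R where R: "R \<in> carrier_mat n n" "pos_semidef R" "R * R = N"
    using psd_sqrt_exists_aux[OF N, of "[]" n] by (auto simp: corthogonal_def)
  have "psd_sqrt N = R" unfolding psd_sqrt_def
  proof (rule the_equality)
    fix S assume S: "pos_semidef S \<and> S * S = N"
    \<comment> \<open>The definite description ranges over matrices of every size. The product fixes
      the number of rows and self-adjointness makes S square, so uniqueness among n x n matrices
      applies.\<close>
    then have "dim_row S = dim_row N" "dim_row S = dim_col S"
      by (metis index_mult_mat(2), metis mat_adjoint_dims(1) pos_semidef_def)
    with N have "S \<in> carrier_mat n n" by auto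
    then show "S = R" using psd_sqrt_unique[of S n R] S R by simp
  qed (use R in auto)
  with R show "psd_sqrt N \<in> carrier_mat n n" "pos_semidef (psd_sqrt N)" "psd_sqrt N * psd_sqrt N = N"
    by auto
qed

section \<open>A minimum principle on the right half plane\<close>

text \<open>Riemann's removability theorem at one point after another: f is extended across z, and
  the extension agrees with f near every other point of the set, so the limit condition passes to
  it.\<close>

lemma holomorphic_extend_finite:
  fixes f :: "complex \<Rightarrow> complex"
  assumes "finite E" "open U" "E \<subseteq> U" "f holomorphic_on U - E"
    and "\<And>z. z \<in> E \<Longrightarrow> ((\<lambda>s. (s - z) * f s) \<longlongrightarrow> 0) (at z)"
  shows "\<exists>g. g holomorphic_on U \<and> (\<forall>s \<in> U - E. g s = f s)"
  using assms
proof (induction E arbitrary: f rule: finite_induct)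
  case empty
  then show ?case by auto
next
  case (insert z E)
  define V where "V = U - E"
  have V: "open V" "z \<in> V"
    using insert.hyps insert.prems(1,2) by (simp_all add: V_def open_Diff finite_imp_closed)
  have "f holomorphic_on V - {z}" using insert.prems(3) by (simp add: V_def Diff_insert[symmetric])
  moreover have "z \<in> interior V" using V by (simp add: interior_open)
  ultimately obtain g where g: "g holomorphic_on V" "\<And>s. s \<in> V - {z} \<Longrightarrow> g s = f s"
    using holomorphic_on_extend_lim[of f V z] insert.prems(4)[of z] by blast
  have "\<exists>h. h holomorphic_on U \<and> (\<forall>s \<in> U - E. h s = g s)"
  proof (rule insert.IH)
    fix w assume w: "w \<in> E"
    have "eventually (\<lambda>s. s \<notin> insert z E) (at w)"
      using islimpt_finite[of "insert z E" w] insert.hyps by (auto simp: islimpt_iff_eventually)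
    moreover have "eventually (\<lambda>s. s \<in> U) (at w)"
      using insert.prems(1,2) w by (intro eventually_at_in_open') auto
    ultimately have "eventually (\<lambda>s. (s - w) * f s = (s - w) * g s) (at w)"
      by eventually_elim (auto simp: g(2) V_def)
    with insert.prems(4)[of w] w show "((\<lambda>s. (s - w) * g s) \<longlongrightarrow> 0) (at w)"
      by (simp add: Lim_transform_eventually)
  qed (use insert.prems(1,2) g(1) in \<open>auto simp: V_def\<close>)
  then obtain h where "h holomorphic_on U" "\<forall>s \<in> U - E. h s = g s" by blast
  with g(2) show ?case by (intro exI[of _ h]) (auto simp: V_def)
qed

lemma eventually_line_notin_finite:
  assumes "finite E" "d \<noteq> 0"
  shows "eventually (\<lambda>t. z + d * complex_of_real t \<notin> E) (at 0)"
proof -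
  have "finite ((\<lambda>t. z + d * complex_of_real t) -` E)"
    by (rule finite_vimageI) (use assms in \<open>auto intro: injI\<close>)
  from islimpt_finite[OF this, of 0] show ?thesis by (simp add: islimpt_iff_eventually)
qed

lemma tendsto_line:
  assumes "isCont g z"
  shows "((\<lambda>t. g (z + d * complex_of_real t)) \<longlongrightarrow> g z) (at 0)"
proof -
  have "isCont (\<lambda>t. g (z + d * complex_of_real t)) 0"
    by (rule isCont_o2) (use assms in \<open>auto intro!: continuous_intros\<close>)
  then show ?thesis by (simp add: isCont_def)
qed

text \<open>Poles on the boundary prevent a direct use of the minimum principle. The principal parts
  r / (s - z) with r \<ge> 0 and Re z = 0 are imaginary on the axis and have nonnegative real part
  to its right. Subtracting them keeps the real part on the axis, can only lower it inside, and
  leaves a function holomorphic on a neighbourhood of the closed half plane. The arc at infinity is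
  controlled by the limit l, whose real part is nonnegative because it is also reached along the
  axis.\<close>

lemma half_plane_minimum:
  fixes f :: "complex \<Rightarrow> complex"
  assumes E: "finite E" "\<And>z. z \<in> E \<Longrightarrow> Re z \<le> 0" and hol: "f holomorphic_on - E"
    and res: "\<And>z. z \<in> E \<Longrightarrow> Re z = 0 \<Longrightarrow>
      \<exists>r\<ge>0. ((\<lambda>s. (s - z) * f s) \<longlongrightarrow> complex_of_real r) (at z)"
    and axis: "\<And>s. Re s = 0 \<Longrightarrow> s \<notin> E \<Longrightarrow> 0 \<le> Re (f s)"
    and lim: "(f \<longlongrightarrow> l) at_infinity"
    and s0: "0 < Re s0"
  shows half_plane_minimum_weak: "0 \<le> Re (f s0)"
    and half_plane_minimum_strict:
      "Re s1 = 0 \<Longrightarrow> s1 \<notin> E \<Longrightarrow> 0 < Re (f s1) \<Longrightarrow> 0 < Re (f s0)"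
proof -
  define E0 where "E0 = {z \<in> E. Re z = 0}"
  define U where "U = - (E - E0)"
  have E0: "finite E0" "E0 \<subseteq> E" using E by (auto simp: E0_def)
  have U: "open U" unfolding U_def by (intro open_Compl finite_imp_closed finite_Diff E(1))
  have HU: "s \<in> U" if "0 \<le> Re s" for s using that E(2)[of s] by (auto simp: U_def E0_def)
  have UE: "U - E0 = - E" using E0 by (auto simp: U_def)
  have "\<forall>z \<in> E0. \<exists>r\<ge>0. ((\<lambda>s. (s - z) * f s) \<longlongrightarrow> complex_of_real r) (at z)"
    using res by (auto simp: E0_def)
  then obtain r where r: "\<And>z. z \<in> E0 \<Longrightarrow> r z \<ge> 0"
    "\<And>z. z \<in> E0 \<Longrightarrow> ((\<lambda>s. (s - z) * f s) \<longlongrightarrow> complex_of_real (r z)) (at z)" by metis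
  define p where "p = (\<lambda>s. \<Sum>z\<in>E0. complex_of_real (r z) / (s - z))"
  have p_Re: "0 \<le> Re (p s)" if "Re s \<ge> 0" for s
    unfolding p_def Re_sum
  proof (rule sum_nonneg)
    fix z assume z: "z \<in> E0"
    then have "Re (complex_of_real (r z) / (s - z)) = r z * Re s / (cmod (s - z))\<^sup>2"
      by (simp add: E0_def Re_divide cmod_power2)
    with r(1)[OF z] that show "0 \<le> Re (complex_of_real (r z) / (s - z))" by simp
  qed
  have p_axis: "Re (p s) = 0" if "Re s = 0" for s
    unfolding p_def Re_sum using that by (intro sum.neutral) (auto simp: E0_def Re_divide)
  define g0 where "g0 = (\<lambda>s. f s - p s)"
  have "\<exists>g. g holomorphic_on U \<and> (\<forall>s \<in> U - E0. g s = g0 s)"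
  proof (rule holomorphic_extend_finite[OF E0(1) U])
    show "E0 \<subseteq> U" by (auto simp: U_def)
    show "g0 holomorphic_on U - E0" unfolding UE g0_def p_def using E0
      by (intro holomorphic_intros hol) auto
    fix z assume z: "z \<in> E0"
    have "((\<lambda>s. \<Sum>w\<in>E0 - {z}. complex_of_real (r w) / (s - w)) \<longlongrightarrow>
        (\<Sum>w\<in>E0 - {z}. complex_of_real (r w) / (z - w))) (at z)"
      by (intro tendsto_intros) auto
    from tendsto_mult[OF tendsto_diff[OF tendsto_ident_at tendsto_const[of z]] this]
    have "((\<lambda>s. (s - z) * (\<Sum>w\<in>E0 - {z}. complex_of_real (r w) / (s - w))) \<longlongrightarrow>
        (z - z) * (\<Sum>w\<in>E0 - {z}. complex_of_real (r w) / (z - w))) (at z)" .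
    from tendsto_diff[OF tendsto_diff[OF r(2)[OF z] tendsto_const[of "complex_of_real (r z)"]] this]
    have "((\<lambda>s. (s - z) * f s - complex_of_real (r z)
        - (s - z) * (\<Sum>w\<in>E0 - {z}. complex_of_real (r w) / (s - w))) \<longlongrightarrow> 0) (at z)" by simp
    moreover have "eventually (\<lambda>s. (s - z) * f s - complex_of_real (r z)
        - (s - z) * (\<Sum>w\<in>E0 - {z}. complex_of_real (r w) / (s - w)) = (s - z) * g0 s) (at z)"
      using eventually_neq_at_within[of z z UNIV]
    proof eventually_elim
      case (elim s)
      have "p s = complex_of_real (r z) / (s - z) + (\<Sum>w\<in>E0 - {z}. complex_of_real (r w) / (s - w))"
        unfolding p_def by (rule sum.remove[OF E0(1) z])
      with elim show ?case by (simp add: g0_def right_diff_distrib distrib_left)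
    qed
    ultimately show "((\<lambda>s. (s - z) * g0 s) \<longlongrightarrow> 0) (at z)"
      by (rule Lim_transform_eventually)
  qed
  then obtain g where g: "g holomorphic_on U" and gf: "\<And>s. s \<notin> E \<Longrightarrow> g s = f s - p s"
    using UE by (auto simp: g0_def)
  have contg: "isCont g s" if "0 \<le> Re s" for s
    using g U HU[OF that] holomorphic_on_imp_continuous_on continuous_on_eq_continuous_at by blast
  have g_axis: "0 \<le> Re (g z)" if z: "Re z = 0" for z
  proof -
    have "((\<lambda>t. Re (g (z + \<i> * complex_of_real t))) \<longlongrightarrow> Re (g z)) (at 0)"
      by (intro tendsto_Re tendsto_line contg) (use z in auto)
    moreover have "eventually (\<lambda>t. 0 \<le> Re (g (z + \<i> * complex_of_real t))) (at 0)"
      using eventually_line_notin_finite[OF E(1), of \<i> z]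
      by (rule eventually_mono) (use axis p_axis z in \<open>auto simp: gf\<close>)
    ultimately show ?thesis by (intro tendsto_lowerbound) auto
  qed
  have "(p \<longlongrightarrow> (\<Sum>z\<in>E0. 0)) at_infinity" unfolding p_def
  proof (intro tendsto_sum tendsto_divide_0[OF tendsto_const])
    fix z
    show "filterlim (\<lambda>s. s - z) at_infinity at_infinity"
      using tendsto_add_filterlim_at_infinity'[OF filterlim_ident tendsto_const[of "- z"]] by simp
  qed
  then have "((\<lambda>s. f s - p s) \<longlongrightarrow> l) at_infinity" using tendsto_diff[OF lim] by fastforce
  moreover have "eventually (\<lambda>s. f s - p s = g s) at_infinity"
  proof -
    obtain B where "\<And>z. z \<in> E \<Longrightarrow> norm z \<le> B"
      using finite_imp_bounded[OF E(1)] by (auto simp: bounded_iff)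
    then show ?thesis
      unfolding eventually_at_infinity by (intro exI[of _ "B + 1"] allI impI gf[symmetric]) force
  qed
  ultimately have glim: "(g \<longlongrightarrow> l) at_infinity" by (rule Lim_transform_eventually)
  have l: "0 \<le> Re l"
  proof (rule tendsto_lowerbound)
    have "filterlim (\<lambda>t. \<i> * complex_of_real t) at_infinity at_top"
      by (rule filterlim_norm_at_top_imp_at_infinity)
        (auto simp: norm_mult intro: filterlim_abs_real)
    then show "((\<lambda>t. Re (g (\<i> * complex_of_real t))) \<longlongrightarrow> Re l) at_top"
      by (intro tendsto_Re filterlim_compose[OF glim])
  qed (use g_axis in auto)
  have gmin: "0 \<le> Re (g s)" if s: "0 < Re s" for s
  proof (rule ccontr)
    assume "\<not> 0 \<le> Re (g s)"
    \<comment> \<open>Half the supposed deficit: Re g is at least -\<delta> on the axis and, for a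
      radius beyond \<open>R\<close>, on the arc. The maximum principle for -g on a half disc then
      contradicts Re g(s) = -2 \<delta>.\<close>
    define \<delta> where "\<delta> = - Re (g s) / 2"
    have \<delta>: "\<delta> > 0" "Re (g s) < - \<delta>" using \<open>\<not> 0 \<le> Re (g s)\<close> by (auto simp: \<delta>_def)
    from tendstoD[OF glim \<delta>(1)] obtain R where R: "\<And>w. norm w \<ge> R \<Longrightarrow> dist (g w) l < \<delta>"
      by (auto simp: eventually_at_infinity)
    define R' where "R' = max R (norm s) + 1"
    define S where "S = {w. 0 < Re w} \<inter> ball 0 R'"
    have S: "open S" "bounded S" "s \<in> S"
      using s by (auto simp: S_def R'_def open_halfspace_Re_gt)
    have "S \<subseteq> {w. 0 \<le> Re w} \<inter> cball 0 R'" by (auto simp: S_def)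
    then have clS: "closure S \<subseteq> {w. 0 \<le> Re w} \<inter> cball 0 R'"
      by (intro closure_minimal closed_Int) (auto simp: closed_halfspace_Re_ge)
    have "Re (- g s) \<le> \<delta>"
    proof (rule maximum_real_frontier[of "\<lambda>s. - g s" S])
      show "(\<lambda>s. - g s) holomorphic_on interior S"
        unfolding interior_open[OF S(1)]
        by (intro holomorphic_intros holomorphic_on_subset[OF g]) (auto simp: S_def HU)
      show "continuous_on (closure S) (\<lambda>s. - g s)"
        using clS HU
        by (intro continuous_intros continuous_on_subset[OF holomorphic_on_imp_continuous_on[OF g]]) auto
      fix w assume "w \<in> frontier S"
      then have w: "w \<in> closure S" "w \<notin> S" using S(1) by (auto simp: frontier_def interior_open)
      with clS have "0 \<le> Re w" "norm w \<le> R'" by auto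
      with w(2) consider "Re w = 0" | "norm w = R'" by (force simp: S_def)
      then show "Re (- g w) \<le> \<delta>"
      proof cases
        case 1
        with g_axis[OF this] \<delta> show ?thesis by simp
      next
        case 2
        then have "dist (g w) l < \<delta>" by (intro R) (simp add: R'_def)
        then have "\<bar>Re (g w - l)\<bar> < \<delta>"
          using abs_Re_le_cmod[of "g w - l"] by (simp add: dist_norm)
        with l show ?thesis by simp
      qed
    qed (use S in auto)
    with \<delta> show False by simp
  qed
  have s0E: "s0 \<notin> E" using E(2)[of s0] s0 by auto
  show weak: "0 \<le> Re (f s0)" using gmin[OF s0] gf[OF s0E] p_Re[of s0] s0 by simp
  assume s1: "Re s1 = 0" "s1 \<notin> E" "0 < Re (f s1)"
  show "0 < Re (f s0)"
  proof (rule ccontr)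
    assume "\<not> 0 < Re (f s0)"
    then have g0: "Re (g s0) = 0" using gmin[OF s0] gf[OF s0E] p_Re[of s0] s0 by simp
    define H where "H = {s. 0 < Re s}"
    have H: "open H" "connected H"
      by (auto simp: H_def open_halfspace_Re_gt intro!: convex_connected convex_halfspace_Re_gt)
    \<comment> \<open>A zero of Re g inside is a maximum of |exp(-g)| = exp(-Re g), so this function
      is constant and Re g = 0 throughout the half plane. Continuity carries this to
      \<open>s1\<close>, where Re g = Re f > 0.\<close>
    have "(\<lambda>s. exp (- g s)) constant_on H"
      by (rule maximum_modulus_principle[OF _ H, of _ H s0])
        (use H HU s0 g0 gmin in \<open>auto simp: H_def intro!: holomorphic_intros holomorphic_on_subset[OF g]\<close>)
    then obtain c where c: "\<And>s. s \<in> H \<Longrightarrow> exp (- g s) = c" by (auto simp: constant_on_def)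
    have gH: "Re (g s) = 0" if "0 < Re s" for s
    proof -
      have "exp (- g s) = exp (- g s0)" using c s0 that by (simp add: H_def)
      then have "norm (exp (- g s)) = norm (exp (- g s0))" by simp
      then show ?thesis using g0 by simp
    qed
    have "((\<lambda>t. Re (g (s1 + 1 * complex_of_real t))) \<longlongrightarrow> Re (g s1)) (at 0)"
      by (intro tendsto_Re tendsto_line contg) (use s1 in auto)
    then have "((\<lambda>t. Re (g (s1 + 1 * complex_of_real t))) \<longlongrightarrow> Re (g s1)) (at_right 0)"
      by (rule tendsto_mono[rotated]) (auto intro: at_le)
    moreover have "eventually (\<lambda>t. Re (g (s1 + 1 * complex_of_real t)) = 0) (at_right 0)"
      using gH s1 by (auto simp: eventually_at_filter)
    then have "((\<lambda>t. Re (g (s1 + 1 * complex_of_real t))) \<longlongrightarrow> 0) (at_right 0)"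
      by (rule tendsto_eventually)
    ultimately have "Re (g s1) = 0" by (intro tendsto_unique[OF trivial_limit_at_right_real])
    with s1 gf[OF s1(2)] p_axis[OF s1(1)] show False by simp
  qed
qed

section \<open>Resolvents and transfer functions\<close>

lemma vec_minus_eq_iff:
  fixes x a b :: "'a :: ab_group_add vec"
  assumes "x \<in> carrier_vec n" "a \<in> carrier_vec n" "b \<in> carrier_vec n"
  shows "x - a = b \<longleftrightarrow> x = a + b"
  using assms by (auto simp: vec_eq_iff algebra_simps)

lemma cmat_zero [simp]: "cmat (0\<^sub>m p m) = 0\<^sub>m p m"
  by auto

lemma zero_mat_mult_vec [simp]: "y \<in> carrier_vec m \<Longrightarrow> 0\<^sub>m p m *\<^sub>v y = (0\<^sub>v p :: 'a :: semiring_0 vec)"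
  by (intro eq_vecI) auto

section \<open>The resolvent: adjugate formula, pole order and decay at infinity\<close>

definition pencil :: "real mat \<Rightarrow> complex \<Rightarrow> complex mat" where
  "pencil A s = s \<cdot>\<^sub>m 1\<^sub>m (dim_row A) - cmat A"

lemma pencil_carrier [simp]: "A \<in> carrier_mat n n \<Longrightarrow> pencil A s \<in> carrier_mat n n"
  by (auto simp: pencil_def intro!: minus_carrier_mat)

lemma pencil_dim [simp]: "dim_row (pencil A s) = dim_row A" "dim_col (pencil A s) = dim_col A"
  by (simp_all add: pencil_def)

lemma pencil_index:
  "A \<in> carrier_mat n n \<Longrightarrow> i < n \<Longrightarrow> j < n \<Longrightarrow>
    pencil A s $$ (i, j) = (if i = j then s else 0) - complex_of_real (A $$ (i, j))"
  by (simp add: pencil_def)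

lemma pencil_index_holomorphic:
  "A \<in> carrier_mat n n \<Longrightarrow> i < n \<Longrightarrow> j < n \<Longrightarrow> (\<lambda>s. pencil A s $$ (i, j)) holomorphic_on S"
  by (cases "i = j") (auto simp: pencil_index intro!: holomorphic_intros)

lemma pencil_mult:
  assumes A: "A \<in> carrier_mat n n" and x: "x \<in> carrier_vec n"
  shows "pencil A s *\<^sub>v x = s \<cdot>\<^sub>v x - cmat A *\<^sub>v x"
proof -
  have "(s \<cdot>\<^sub>m 1\<^sub>m n) *\<^sub>v x = s \<cdot>\<^sub>v x" using x by (intro eq_vecI) auto
  then show ?thesis
    unfolding pencil_def using A x minus_mult_distrib_mat_vec[of "s \<cdot>\<^sub>m 1\<^sub>m n" n n "cmat A" x] by simp
qed

lemma det_pencil: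
  assumes A: "A \<in> carrier_mat n n"
  shows "Determinant.det (pencil A s) = poly (char_poly (cmat A)) s"
proof -
  have "pencil A s = - char_matrix (cmat A) s"
    using A by (intro eq_matI) (auto simp: pencil_index char_matrix_def)
  then show ?thesis using char_poly_matrix[of "cmat A" n s] A by simp
qed

lemma eigenvalue_iff_det:
  assumes A: "A \<in> carrier_mat n n"
  shows "eigenvalue (cmat A) s \<longleftrightarrow> Determinant.det (pencil A s) = 0"
  using eigenvalue_root_char_poly[of "cmat A" n s] A by (simp add: det_pencil)

lemma finite_eigenvalues:
  assumes A: "A \<in> carrier_mat n n"
  shows "finite {s. eigenvalue (cmat A) s}"
  using card_finite_spectrum(1)[of "cmat A" n] A by (simp add: spectrum_def)

lemma det_holomorphic:
  fixes M :: "complex \<Rightarrow> complex mat"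
  assumes M: "\<And>s. M s \<in> carrier_mat n n"
    and hol: "\<And>i j. i < n \<Longrightarrow> j < n \<Longrightarrow> (\<lambda>s. M s $$ (i, j)) holomorphic_on S"
  shows "(\<lambda>s. Determinant.det (M s)) holomorphic_on S"
  unfolding det_def'[OF M]
  by (intro holomorphic_intros hol) (auto simp: permutes_in_image[of _ "{0..<n}"])

text \<open>Cramer's rule; applied to the pencil it writes each resolvent entry as a quotient of
  entire functions of s.\<close>

lemma minv_adj:
  fixes M :: "complex mat"
  assumes M: "M \<in> carrier_mat n n" and d: "Determinant.det M \<noteq> 0" and ij: "i < n" "j < n"
  shows "minv M $$ (i, j) = adj_mat M $$ (i, j) / Determinant.det M"
proof -
  note inv = minv_mult[OF M d] and adj = adj_mat[OF M]
  have "adj_mat M = (minv M * M) * adj_mat M" using inv adj by simp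
  also have "\<dots> = minv M * (M * adj_mat M)" by (rule assoc_mult_mat[OF inv(1) M adj(1)])
  also have "\<dots> = Determinant.det M \<cdot>\<^sub>m minv M"
    unfolding adj(2) using inv(1) mult_smult_distrib[OF inv(1) one_carrier_mat] by simp
  finally have "adj_mat M $$ (i, j) = Determinant.det M * minv M $$ (i, j)"
    using ij inv(1) by simp
  with d show ?thesis by simp
qed

lemma adj_pencil_holomorphic:
  assumes A: "A \<in> carrier_mat n n" and ij: "i < n" "j < n"
  shows "(\<lambda>s. adj_mat (pencil A s) $$ (i, j)) holomorphic_on S"
proof -
  have "(\<lambda>s. (-1) ^ (j + i) * Determinant.det (mat_delete (pencil A s) j i)) holomorphic_on S"
  proof (intro holomorphic_intros det_holomorphic)
    show "mat_delete (pencil A s) j i \<in> carrier_mat (n - 1) (n - 1)" for s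
      by (rule mat_delete_carrier) (use A in simp)
    fix k l assume kl: "k < n - 1" "l < n - 1"
    have "mat_delete (pencil A s) j i $$ (k, l) =
        pencil A s $$ (if k < j then k else Suc k, if l < i then l else Suc l)" for s
      using A kl by (simp add: mat_delete_def)
    then show "(\<lambda>s. mat_delete (pencil A s) j i $$ (k, l)) holomorphic_on S"
      using A kl by (auto intro!: pencil_index_holomorphic[OF A])
  qed
  then show ?thesis using A ij by (simp add: adj_mat_def cofactor_def)
qed

lemma det_pencil_holomorphic:
  "A \<in> carrier_mat n n \<Longrightarrow> (\<lambda>s. Determinant.det (pencil A s)) holomorphic_on S"
  by (rule det_holomorphic[of _ n]) (auto intro!: pencil_index_holomorphic)

lemma resolvent_holomorphic:
  assumes A: "A \<in> carrier_mat n n" and ij: "i < n" "j < n"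
  shows "(\<lambda>s. minv (pencil A s) $$ (i, j)) holomorphic_on - {s. eigenvalue (cmat A) s}"
proof -
  have "(\<lambda>s. adj_mat (pencil A s) $$ (i, j) / Determinant.det (pencil A s)) holomorphic_on
      - {s. eigenvalue (cmat A) s}"
    by (intro holomorphic_on_divide adj_pencil_holomorphic[OF A] det_pencil_holomorphic[OF A] ij)
      (auto simp: eigenvalue_iff_det[OF A])
  then show ?thesis
    by (rule holomorphic_transform) (use minv_adj[OF pencil_carrier[OF A] _ ij] in \<open>auto simp: eigenvalue_iff_det[OF A]\<close>)
qed

text \<open>The multiplicity k of z as a root of the characteristic polynomial is at most n, so (s -
  z)^(n+1) cancels the zero of the denominator in the adjugate formula and leaves at least one spare
  factor.\<close>

lemma resolvent_pole_order:
  assumes A: "A \<in> carrier_mat n n" and ij: "i < n" "j < n"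
  shows "((\<lambda>s. (s - z) ^ Suc n * minv (pencil A s) $$ (i, j)) \<longlongrightarrow> 0) (at z)"
proof -
  let ?p = "char_poly (cmat A)"
  have deg: "degree ?p = n" and p0: "?p \<noteq> 0"
    using degree_monic_char_poly[of "cmat A" n] A by auto
  define k where "k = Polynomial.order z ?p"
  have k: "k \<le> n" unfolding k_def using order_degree[OF p0, of z] deg by simp
  from order_decomp[OF p0, of z] obtain q where
    q: "?p = [:- z, 1:] ^ k * q" "\<not> [:- z, 1:] dvd q" by (auto simp: k_def)
  have qz: "poly q z \<noteq> 0" using q(2) by (simp add: poly_eq_0_iff_dvd)
  have "isCont (\<lambda>s. adj_mat (pencil A s) $$ (i, j)) z"
    using adj_pencil_holomorphic[OF A ij, of UNIV] holomorphic_on_imp_continuous_on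
      continuous_on_eq_continuous_at by blast
  then have "isCont (\<lambda>s. (s - z) ^ (Suc n - k) * (adj_mat (pencil A s) $$ (i, j) / poly q s)) z"
    using qz by (intro continuous_intros) auto
  then have "((\<lambda>s. (s - z) ^ (Suc n - k) * (adj_mat (pencil A s) $$ (i, j) / poly q s)) \<longlongrightarrow> 0) (at z)"
    using k by (simp add: isCont_def Suc_diff_le)
  moreover have "eventually (\<lambda>s. (s - z) ^ (Suc n - k) * (adj_mat (pencil A s) $$ (i, j) / poly q s) =
      (s - z) ^ Suc n * minv (pencil A s) $$ (i, j)) (at z)"
  proof -
    have "eventually (\<lambda>s. poly q s \<noteq> 0) (at z)"
      by (rule tendsto_imp_eventually_ne[of _ "poly q z"]) (use qz in \<open>auto intro!: tendsto_intros\<close>)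
    moreover have "eventually (\<lambda>s. s \<noteq> z) (at z)" by (rule eventually_neq_at_within)
    ultimately show ?thesis
    proof eventually_elim
      case (elim s)
      have d: "Determinant.det (pencil A s) = (s - z) ^ k * poly q s"
        by (simp add: det_pencil[OF A] q(1))
      have "(s - z) ^ Suc n = (s - z) ^ (Suc n - k) * (s - z) ^ k"
        using k by (simp flip: power_add)
      with d elim show ?case using minv_adj[of "pencil A s" n i j] A ij by simp
    qed
  qed
  ultimately show ?thesis by (rule Lim_transform_eventually)
qed

lemma eventually_not_in_finite_infinity: "finite E \<Longrightarrow> eventually (\<lambda>s::complex. s \<notin> E) at_infinity"
proof -
  assume "finite E"
  from finite_imp_bounded[OF this] obtain B where "\<And>z. z \<in> E \<Longrightarrow> norm z \<le> B"
    by (auto simp: bounded_iff)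
  then show ?thesis unfolding eventually_at_infinity by (intro exI[of _ "B + 1"]) force
qed

lemma eventually_not_in_finite_at: "finite E \<Longrightarrow> eventually (\<lambda>s::complex. s \<notin> E) (at z)"
  using islimpt_finite[of E z] by (simp add: islimpt_iff_eventually)

text \<open>A column x of the resolvent satisfies s x = e_j + A x. In the sum norm this gives |s| N
  \<le> 1 + c N, where c is the sum of the absolute values of all entries of A, hence N \<le> 1 /
  (|s| - c) once |s| > c.\<close>

lemma resolvent_at_infinity:
  assumes A: "A \<in> carrier_mat n n" and ij: "i < n" "j < n"
  shows "((\<lambda>s. minv (pencil A s) $$ (i, j)) \<longlongrightarrow> 0) at_infinity"
proof -
  define c where "c = (\<Sum>k<n. \<Sum>l<n. \<bar>A $$ (k, l)\<bar>)"
  have bound: "cmod (minv (pencil A s) $$ (i, j)) \<le> 1 / (cmod s - c)"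
    if d: "Determinant.det (pencil A s) \<noteq> 0" and s: "cmod s > c" for s
  proof -
    have P: "pencil A s \<in> carrier_mat n n" using A by simp
    note inv = minv_mult[OF P d]
    define x where "x = minv (pencil A s) *\<^sub>v unit_vec n j"
    have x: "x \<in> carrier_vec n" using inv by (simp add: x_def)
    have xi: "x $ k = minv (pencil A s) $$ (k, j)" if "k < n" for k
      using that inv(1) ij by (simp add: x_def)
    have "pencil A s *\<^sub>v x = unit_vec n j" unfolding x_def by (rule mult_minv_vec[OF P d]) simp
    then have eq: "s \<cdot>\<^sub>v x - cmat A *\<^sub>v x = unit_vec n j" by (simp add: pencil_mult[OF A x])
    have comp: "s * x $ k = (if k = j then 1 else 0) + (\<Sum>l<n. complex_of_real (A $$ (k, l)) * x $ l)"
      if k: "k < n" for k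
    proof -
      have "(s \<cdot>\<^sub>v x - cmat A *\<^sub>v x) $ k = s * x $ k - (\<Sum>l<n. complex_of_real (A $$ (k, l)) * x $ l)"
        using k A x by (simp add: scalar_prod_def lessThan_atLeast0)
      with eq k ij show ?thesis by (simp add: algebra_simps)
    qed
    define N where "N = (\<Sum>k<n. cmod (x $ k))"
    have "cmod s * N = (\<Sum>k<n. cmod (s * x $ k))" by (simp add: N_def sum_distrib_left norm_mult)
    also have "\<dots> \<le> (\<Sum>k<n. (if k = j then 1 else 0) + (\<Sum>l<n. \<bar>A $$ (k, l)\<bar> * N))"
    proof (rule sum_mono)
      fix k assume "k \<in> {..<n}"
      then have k: "k < n" by simp
      have "cmod (s * x $ k) \<le> cmod (if k = j then 1 else 0)
          + cmod (\<Sum>l<n. complex_of_real (A $$ (k, l)) * x $ l)"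
        unfolding comp[OF k] by (rule norm_triangle_ineq)
      also have "cmod (\<Sum>l<n. complex_of_real (A $$ (k, l)) * x $ l) \<le> (\<Sum>l<n. \<bar>A $$ (k, l)\<bar> * N)"
      proof (rule sum_norm_le)
        fix l assume l: "l \<in> {..<n}"
        have "cmod (x $ l) \<le> N" unfolding N_def by (rule member_le_sum) (use l in auto)
        then show "cmod (complex_of_real (A $$ (k, l)) * x $ l) \<le> \<bar>A $$ (k, l)\<bar> * N"
          by (simp add: norm_mult mult_left_mono)
      qed
      finally show "cmod (s * x $ k) \<le> (if k = j then 1 else 0) + (\<Sum>l<n. \<bar>A $$ (k, l)\<bar> * N)"
        by (simp split: if_splits)
    qed
    also have "\<dots> = 1 + c * N"
      using ij by (simp add: sum.distrib c_def sum_distrib_right)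
    finally have "(cmod s - c) * N \<le> 1" by (simp add: algebra_simps)
    then have "N \<le> 1 / (cmod s - c)" using s by (simp add: field_simps)
    moreover have "cmod (x $ i) \<le> N" unfolding N_def by (rule member_le_sum) (use ij in auto)
    ultimately show ?thesis using xi[OF ij(1)] by simp
  qed
  show ?thesis
  proof (rule Lim_null_comparison)
    show "eventually (\<lambda>s. cmod (minv (pencil A s) $$ (i, j)) \<le> 1 / (cmod s - c)) at_infinity"
    proof -
      have "eventually (\<lambda>s. cmod s > c) at_infinity"
        unfolding eventually_at_infinity by (intro exI[of _ "c + 1"]) auto
      moreover have "eventually (\<lambda>s. s \<notin> {s. eigenvalue (cmat A) s}) at_infinity"
        by (rule eventually_not_in_finite_infinity[OF finite_eigenvalues[OF A]])
      ultimately show ?thesis by eventually_elim (auto intro!: bound simp: eigenvalue_iff_det[OF A])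
    qed
    have "filterlim (\<lambda>s. - c + cmod s) at_top (at_infinity :: complex filter)"
      by (rule filterlim_tendsto_add_at_top[OF tendsto_const filterlim_norm_at_top])
    then have "filterlim (\<lambda>s. cmod s - c) at_infinity (at_infinity :: complex filter)"
      by (intro filterlim_at_top_imp_at_infinity) simp
    then show "((\<lambda>s. 1 / (cmod s - c)) \<longlongrightarrow> 0) (at_infinity :: complex filter)"
      by (rule tendsto_divide_0[OF tendsto_const])
  qed
qed

section \<open>Transfer functions of state-space models\<close>

definition tf :: "real mat \<Rightarrow> real mat \<Rightarrow> real mat \<Rightarrow> real mat \<Rightarrow> complex \<Rightarrow> complex mat" where
  "tf A B C D s = cmat C * minv (pencil A s) * cmat B + cmat D"

lemma realization_tf:
  assumes "realization m G n A B C D" "\<not> eigenvalue (cmat A) s"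
  shows "G s = tf A B C D s"
  using assms by (auto simp: realization_def tf_def pencil_def)

lemma realizationD:
  assumes "realization m G n A B C D"
  shows "A \<in> carrier_mat n n" "B \<in> carrier_mat n m" "C \<in> carrier_mat m n" "D \<in> carrier_mat m m"
  using assms by (auto simp: realization_def)

locale state_space =
  fixes n m p :: nat and A B C D :: "real mat"
  assumes A: "A \<in> carrier_mat n n" and B: "B \<in> carrier_mat n m"
    and C: "C \<in> carrier_mat p n" and D: "D \<in> carrier_mat p m"
begin

lemma tf_carrier:
  assumes "\<not> eigenvalue (cmat A) s"
  shows "tf A B C D s \<in> carrier_mat p m"
  using minv_carrier[of "pencil A s" n] assms A B C D by (auto simp: tf_def eigenvalue_iff_det)

text \<open>Any state solving the resolvent equation determines the output, so later arguments can
  follow states instead of manipulating the inverse.\<close>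

lemma tf_mult:
  assumes s: "\<not> eigenvalue (cmat A) s" and x: "x \<in> carrier_vec n" and y: "y \<in> carrier_vec m"
    and eq: "pencil A s *\<^sub>v x = cmat B *\<^sub>v y"
  shows "tf A B C D s *\<^sub>v y = cmat C *\<^sub>v x + cmat D *\<^sub>v y"
proof -
  have P: "pencil A s \<in> carrier_mat n n" and d: "Determinant.det (pencil A s) \<noteq> 0"
    using A s by (auto simp: eigenvalue_iff_det)
  note inv = minv_carrier[OF P d]
  have cB: "cmat B \<in> carrier_mat n m" and cC: "cmat C \<in> carrier_mat p n"
    and cD: "cmat D \<in> carrier_mat p m" using B C D by auto
  have By: "cmat B *\<^sub>v y \<in> carrier_vec n" using cB y by simp
  have "tf A B C D s *\<^sub>v y = (cmat C * minv (pencil A s) * cmat B) *\<^sub>v y + cmat D *\<^sub>v y"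
    unfolding tf_def by (rule add_mult_distrib_mat_vec[of _ p m]) (use cB cC cD inv y in auto)
  also have "(cmat C * minv (pencil A s) * cmat B) *\<^sub>v y = (cmat C * minv (pencil A s)) *\<^sub>v (cmat B *\<^sub>v y)"
    by (rule assoc_mult_mat_vec[of _ p n _ m]) (use cB cC inv y in auto)
  also have "\<dots> = cmat C *\<^sub>v (minv (pencil A s) *\<^sub>v (cmat B *\<^sub>v y))"
    by (rule assoc_mult_mat_vec[OF cC inv By])
  also have "minv (pencil A s) *\<^sub>v (cmat B *\<^sub>v y) = x"
    unfolding eq[symmetric] by (rule mult_minv_vec[OF P d x])
  finally show ?thesis .
qed

lemma state_exists:
  assumes s: "\<not> eigenvalue (cmat A) s" and b: "b \<in> carrier_vec n"
  shows "\<exists>x \<in> carrier_vec n. pencil A s *\<^sub>v x = b"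
proof -
  have P: "pencil A s \<in> carrier_mat n n" and d: "Determinant.det (pencil A s) \<noteq> 0"
    using A s by (auto simp: eigenvalue_iff_det)
  show ?thesis
    by (rule bexI[of _ "minv (pencil A s) *\<^sub>v b"])
      (use mult_minv_vec[OF P d b] minv_carrier[OF P d] b in auto)
qed

lemma tf_index:
  assumes s: "\<not> eigenvalue (cmat A) s" and ij: "i < p" "j < m"
  shows "tf A B C D s $$ (i, j) = (\<Sum>l<n. \<Sum>k<n. complex_of_real (C $$ (i, k)) *
    minv (pencil A s) $$ (k, l) * complex_of_real (B $$ (l, j))) + complex_of_real (D $$ (i, j))"
proof -
  have inv: "minv (pencil A s) \<in> carrier_mat n n"
    using minv_carrier[of "pencil A s" n] s A by (auto simp: eigenvalue_iff_det)
  show ?thesis using ij A B C D inv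
    by (simp add: tf_def scalar_prod_def sum_distrib_left mult.assoc lessThan_atLeast0) (rule sum.swap)
qed

lemma tf_holomorphic:
  assumes ij: "i < p" "j < m"
  shows "(\<lambda>s. tf A B C D s $$ (i, j)) holomorphic_on - {s. eigenvalue (cmat A) s}"
proof -
  have "(\<lambda>s. (\<Sum>l<n. \<Sum>k<n. complex_of_real (C $$ (i, k)) *
      minv (pencil A s) $$ (k, l) * complex_of_real (B $$ (l, j))) + complex_of_real (D $$ (i, j)))
      holomorphic_on - {s. eigenvalue (cmat A) s}"
    by (intro holomorphic_intros resolvent_holomorphic[OF A]) auto
  then show ?thesis by (rule holomorphic_transform) (use ij in \<open>simp add: tf_index\<close>)
qed

lemma tf_at_infinity:
  assumes ij: "i < p" "j < m"
  shows "((\<lambda>s. tf A B C D s $$ (i, j)) \<longlongrightarrow> complex_of_real (D $$ (i, j))) at_infinity"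
proof -
  have "((\<lambda>s. (\<Sum>l<n. \<Sum>k<n. complex_of_real (C $$ (i, k)) *
      minv (pencil A s) $$ (k, l) * complex_of_real (B $$ (l, j))) + complex_of_real (D $$ (i, j))) \<longlongrightarrow>
      (\<Sum>l<n. \<Sum>k<n. complex_of_real (C $$ (i, k)) * 0 * complex_of_real (B $$ (l, j)))
        + complex_of_real (D $$ (i, j))) at_infinity"
    by (intro tendsto_intros resolvent_at_infinity[OF A]) auto
  moreover have "eventually (\<lambda>s. (\<Sum>l<n. \<Sum>k<n. complex_of_real (C $$ (i, k)) *
      minv (pencil A s) $$ (k, l) * complex_of_real (B $$ (l, j))) + complex_of_real (D $$ (i, j)) =
      tf A B C D s $$ (i, j)) at_infinity"
    using eventually_not_in_finite_infinity[OF finite_eigenvalues[OF A]]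
    by eventually_elim (use ij in \<open>simp add: tf_index\<close>)
  ultimately show ?thesis using Lim_transform_eventually by fastforce
qed

end

lemma cmat_mult_vec:
  assumes "A \<in> carrier_mat n m" "B \<in> carrier_mat m k" "x \<in> carrier_vec k"
  shows "cmat (A * B) *\<^sub>v x = cmat A *\<^sub>v (cmat B *\<^sub>v x)"
  unfolding cmat_mult[OF assms(1,2)] by (rule assoc_mult_mat_vec[of _ n m _ k]) (use assms in auto)

text \<open>From s x = A x + B y the factor s can be moved into C, so s G(s) is again a proper
  transfer function. Its feedthrough C B is the limit of s G(s) at infinity, which the minimum
  principle requires for test functions built from s G(s).\<close>

lemma (in state_space) tf_smult:
  assumes s: "\<not> eigenvalue (cmat A) s"
  shows "s \<cdot>\<^sub>m tf A B C (0\<^sub>m p m) s = tf A B (C * A) (C * B) s"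
proof (rule mat_eqI_vec)
  interpret S0: state_space n m p A B C "0\<^sub>m p m" by unfold_locales (use A B C in auto)
  interpret S1: state_space n m p A B "C * A" "C * B" by unfold_locales (use A B C in auto)
  show "s \<cdot>\<^sub>m tf A B C (0\<^sub>m p m) s \<in> carrier_mat p m" using S0.tf_carrier[OF s] by simp
  show "tf A B (C * A) (C * B) s \<in> carrier_mat p m" by (rule S1.tf_carrier[OF s])
  fix y :: "complex vec" assume y: "y \<in> carrier_vec m"
  have By: "cmat B *\<^sub>v y \<in> carrier_vec n" using B y by simp
  from state_exists[OF s By] obtain x where x: "x \<in> carrier_vec n" "pencil A s *\<^sub>v x = cmat B *\<^sub>v y" by blast
  have Ax: "cmat A *\<^sub>v x \<in> carrier_vec n" using A x by simp
  have cC: "cmat C \<in> carrier_mat p n" using C by simp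
  have sx: "s \<cdot>\<^sub>v x = cmat A *\<^sub>v x + cmat B *\<^sub>v y"
    using x(2) vec_minus_eq_iff[OF _ Ax By, of "s \<cdot>\<^sub>v x"] x(1) unfolding pencil_mult[OF A x(1)] by simp
  have "(s \<cdot>\<^sub>m tf A B C (0\<^sub>m p m) s) *\<^sub>v y = s \<cdot>\<^sub>v (tf A B C (0\<^sub>m p m) s *\<^sub>v y)"
    using S0.tf_carrier[OF s] y by (intro eq_vecI) auto
  also have "tf A B C (0\<^sub>m p m) s *\<^sub>v y = cmat C *\<^sub>v x"
    unfolding S0.tf_mult[OF s x(1) y x(2)] using cC x(1) y by simp
  also have "s \<cdot>\<^sub>v (cmat C *\<^sub>v x) = cmat C *\<^sub>v (s \<cdot>\<^sub>v x)" by (rule mult_mat_vec[OF cC x(1), symmetric])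
  also have "\<dots> = cmat C *\<^sub>v (cmat A *\<^sub>v x) + cmat C *\<^sub>v (cmat B *\<^sub>v y)"
    unfolding sx by (rule mult_add_distrib_mat_vec[OF cC Ax By])
  also have "\<dots> = tf A B (C * A) (C * B) s *\<^sub>v y"
    unfolding S1.tf_mult[OF s x(1) y x(2)] using cmat_mult_vec[OF C A x(1)] cmat_mult_vec[OF C B y] by simp
  finally show "(s \<cdot>\<^sub>m tf A B C (0\<^sub>m p m) s) *\<^sub>v y = tf A B (C * A) (C * B) s *\<^sub>v y" .
qed

lemma conjugate_cmat_mult:
  assumes "A \<in> carrier_mat n m" "x \<in> carrier_vec m"
  shows "conjugate (cmat A *\<^sub>v x) = cmat A *\<^sub>v conjugate x"
  using assms by (intro eq_vecI) (auto simp: scalar_prod_def)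

lemma pencil_cnj:
  assumes A: "A \<in> carrier_mat n n" and x: "x \<in> carrier_vec n"
  shows "pencil A (cnj s) *\<^sub>v conjugate x = conjugate (pencil A s *\<^sub>v x)"
  using A x by (intro eq_vecI) (auto simp: scalar_prod_def pencil_index intro!: sum.cong)

lemma eigenvalue_iff_pencil:
  assumes A: "A \<in> carrier_mat n n"
  shows "eigenvalue (cmat A) s \<longleftrightarrow> (\<exists>v \<in> carrier_vec n. v \<noteq> 0\<^sub>v n \<and> pencil A s *\<^sub>v v = 0\<^sub>v n)"
  using det_nonzero_iff_inj[OF pencil_carrier[OF A]] by (auto simp: eigenvalue_iff_det[OF A])

lemma eigenvalue_cnj:
  assumes A: "A \<in> carrier_mat n n"
  shows "eigenvalue (cmat A) (cnj s) \<longleftrightarrow> eigenvalue (cmat A) s"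
proof -
  have *: "eigenvalue (cmat A) (cnj s)" if "eigenvalue (cmat A) s" for s
  proof -
    from that obtain v where "v \<in> carrier_vec n" "v \<noteq> 0\<^sub>v n" "pencil A s *\<^sub>v v = 0\<^sub>v n"
      by (auto simp: eigenvalue_iff_pencil[OF A])
    then show ?thesis unfolding eigenvalue_iff_pencil[OF A]
      by (intro bexI[of _ "conjugate v"]) (auto simp: pencil_cnj[OF A])
  qed
  from *[of s] *[of "cnj s"] show ?thesis by auto
qed

lemma (in state_space) tf_cnj:
  assumes s: "\<not> eigenvalue (cmat A) s" and y: "y \<in> carrier_vec m"
  shows "tf A B C D (cnj s) *\<^sub>v conjugate y = conjugate (tf A B C D s *\<^sub>v y)"
proof -
  have s': "\<not> eigenvalue (cmat A) (cnj s)" using s eigenvalue_cnj[OF A] by simp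
  have By: "cmat B *\<^sub>v y \<in> carrier_vec n" using B y by simp
  from state_exists[OF s By] obtain x where x: "x \<in> carrier_vec n" "pencil A s *\<^sub>v x = cmat B *\<^sub>v y" by blast
  have "pencil A (cnj s) *\<^sub>v conjugate x = cmat B *\<^sub>v conjugate y"
    unfolding pencil_cnj[OF A x(1)] x(2) by (rule conjugate_cmat_mult[OF B y])
  from tf_mult[OF s' _ _ this] x(1) y
  have "tf A B C D (cnj s) *\<^sub>v conjugate y = cmat C *\<^sub>v conjugate x + cmat D *\<^sub>v conjugate y" by simp
  also have "\<dots> = conjugate (cmat C *\<^sub>v x + cmat D *\<^sub>v y)"
    using conjugate_add_vec[of "cmat C *\<^sub>v x" p "cmat D *\<^sub>v y"] C D x(1) y
    by (simp add: conjugate_cmat_mult[OF C] conjugate_cmat_mult[OF D])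
  also have "cmat C *\<^sub>v x + cmat D *\<^sub>v y = tf A B C D s *\<^sub>v y" by (rule tf_mult[OF s x(1) y x(2), symmetric])
  finally show ?thesis .
qed

section \<open>Minimal realizations\<close>

lemma realization_state_space:
  assumes "realization m G n A B C D"
  shows "state_space n m m A B C D"
  using realizationD[OF assms] by unfold_locales

lemma tf_isCont:
  assumes "state_space n m p A B C D" "\<not> eigenvalue (cmat A) s" "i < p" "j < m"
  shows "isCont (\<lambda>s. tf A B C D s $$ (i, j)) s"
proof -
  interpret state_space n m p A B C D by fact
  have "open (- {s. eigenvalue (cmat A) s})"
    using finite_eigenvalues[OF A] by (intro open_Compl finite_imp_closed)
  with tf_holomorphic[OF assms(3,4)] assms(2) show ?thesis
    using holomorphic_on_imp_continuous_on continuous_on_eq_continuous_at by blast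
qed

text \<open>Cancelled eigenvalues are recovered by continuity of G off its poles.\<close>

lemma realization_transfer:
  assumes G: "transfer_matrix m G" and R: "realization m G n A B C D"
    and S: "state_space k m m A' B' C' D"
    and eq: "\<And>s. \<not> eigenvalue (cmat A) s \<Longrightarrow> \<not> eigenvalue (cmat A') s \<Longrightarrow>
      tf A' B' C' D s = tf A B C D s"
  shows "realization m G k A' B' C' D"
proof -
  interpret S: state_space k m m A' B' C' D by fact
  note RD = realizationD[OF R]
  have "G s = tf A' B' C' D s" if s: "\<not> eigenvalue (cmat A') s" for s
  proof -
    have ev: "eventually (\<lambda>z. z \<notin> {s. eigenvalue (cmat A) s} \<union> {s. eigenvalue (cmat A') s}) (at s)"
      by (rule eventually_not_in_finite_at) (use finite_eigenvalues[OF RD(1)] finite_eigenvalues[OF S.A] in auto)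
    have lim: "((\<lambda>z. G z $$ (i, j)) \<longlongrightarrow> tf A' B' C' D s $$ (i, j)) (at s)" if ij: "i < m" "j < m" for i j
    proof (rule Lim_transform_eventually)
      show "((\<lambda>z. tf A' B' C' D z $$ (i, j)) \<longlongrightarrow> tf A' B' C' D s $$ (i, j)) (at s)"
        using tf_isCont[OF S s ij] by (simp add: isCont_def)
      show "eventually (\<lambda>z. tf A' B' C' D z $$ (i, j) = G z $$ (i, j)) (at s)"
        using ev by eventually_elim (simp add: eq realization_tf[OF R])
    qed
    have "\<not> mat_pole m G s"
    proof
      assume "mat_pole m G s"
      then obtain i j where ij: "i < m" "j < m" "is_pole (\<lambda>s. G s $$ (i, j)) s" by (auto simp: mat_pole_def)
      with lim[OF ij(1,2)] show False
        using not_tendsto_and_filterlim_at_infinity[of "at s"] by (auto simp: is_pole_def)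
    qed
    then have cont: "isCont (\<lambda>s. G s $$ (i, j)) s" if "i < m" "j < m" for i j
      using G that by (auto simp: transfer_matrix_def)
    show ?thesis
    proof (rule eq_matI)
      fix i j assume "i < dim_row (tf A' B' C' D s)" "j < dim_col (tf A' B' C' D s)"
      with S.tf_carrier[OF s] have ij: "i < m" "j < m" by auto
      show "G s $$ (i, j) = tf A' B' C' D s $$ (i, j)"
        using tendsto_unique[OF _ lim[OF ij], of "G s $$ (i, j)"] cont[OF ij] by (auto simp: isCont_def)
    qed (use S.tf_carrier[OF s] G in \<open>auto simp: transfer_matrix_def\<close>)
  qed
  then show ?thesis using S.A S.B S.C S.D by (auto simp: realization_def tf_def pencil_def)
qed

text \<open>The subspace divided out is the joint kernel of C, C A and (A - s I)(A - cnj s I):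
  it is real, invariant under A, and contains the real and imaginary part of v.\<close>

lemma unobservable_quotient:
  assumes A: "A \<in> carrier_mat n n" and C: "C \<in> carrier_mat p n"
    and v: "v \<in> carrier_vec n" "v \<noteq> 0\<^sub>v n" and Av: "pencil A s *\<^sub>v v = 0\<^sub>v n" and Cv: "cmat C *\<^sub>v v = 0\<^sub>v p"
  shows "\<exists>k L A' C'. k < n \<and> L \<in> carrier_mat k n \<and> A' \<in> carrier_mat k k \<and> C' \<in> carrier_mat p k \<and>
    L * A = A' * L \<and> C = C' * L"
proof -
  \<comment> \<open>The coefficients of (X - s) (X - cnj s) = X^2 + a X + b, which are real.\<close>
  define a b where "a = - 2 * Re s" and "b = (cmod s)\<^sup>2"
  define Q where "Q = A * A + a \<cdot>\<^sub>m A + b \<cdot>\<^sub>m 1\<^sub>m n"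
  have Q: "Q \<in> carrier_mat n n" using A by (simp add: Q_def)
  have Qx: "Q *\<^sub>v x = A *\<^sub>v (A *\<^sub>v x) + a \<cdot>\<^sub>v (A *\<^sub>v x) + b \<cdot>\<^sub>v x" if x: "x \<in> carrier_vec n" for x
  proof -
    have "Q *\<^sub>v x = (A * A + a \<cdot>\<^sub>m A) *\<^sub>v x + (b \<cdot>\<^sub>m 1\<^sub>m n) *\<^sub>v x"
      unfolding Q_def by (rule add_mult_distrib_mat_vec[of _ n n]) (use A x in auto)
    also have "(A * A + a \<cdot>\<^sub>m A) *\<^sub>v x = (A * A) *\<^sub>v x + (a \<cdot>\<^sub>m A) *\<^sub>v x"
      by (rule add_mult_distrib_mat_vec[of _ n n]) (use A x in auto)
    also have "(A * A) *\<^sub>v x = A *\<^sub>v (A *\<^sub>v x)" using A x by simp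
    also have "(a \<cdot>\<^sub>m A) *\<^sub>v x = a \<cdot>\<^sub>v (A *\<^sub>v x)" using A x by (intro eq_vecI) auto
    also have "(b \<cdot>\<^sub>m 1\<^sub>m n) *\<^sub>v x = b \<cdot>\<^sub>v x" using x by (intro eq_vecI) auto
    finally show ?thesis .
  qed
  define M where "M = Q @\<^sub>r (C @\<^sub>r (C * A))"
  have CA: "C * A \<in> carrier_mat p n" using A C by simp
  have M: "M \<in> carrier_mat (n + (p + p)) n" unfolding M_def using Q C CA by (intro carrier_append_rows)
  have z: "0\<^sub>v (n + (p + p)) = 0\<^sub>v n @\<^sub>v (0\<^sub>v p @\<^sub>v 0\<^sub>v p)" by (intro eq_vecI) auto
  have kerM: "M *\<^sub>v x = 0\<^sub>v (n + (p + p)) \<longleftrightarrow> Q *\<^sub>v x = 0\<^sub>v n \<and> C *\<^sub>v x = 0\<^sub>v p \<and> C *\<^sub>v (A *\<^sub>v x) = 0\<^sub>v p"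
    if x: "x \<in> carrier_vec n" for x
  proof -
    have "M *\<^sub>v x = Q *\<^sub>v x @\<^sub>v (C *\<^sub>v x @\<^sub>v C *\<^sub>v (A *\<^sub>v x))"
      unfolding M_def using mat_mult_append[OF Q _ x, of "C @\<^sub>r (C * A)" "p + p"]
        mat_mult_append[OF C CA x] C CA A x by (simp add: carrier_append_rows)
    then show ?thesis unfolding z using append_vec_eq[of "Q *\<^sub>v x" n "0\<^sub>v n"]
        append_vec_eq[of "C *\<^sub>v x" p "0\<^sub>v p"] Q C x by simp
  qed
  have inv: "M *\<^sub>v (A *\<^sub>v x) = 0\<^sub>v (n + (p + p))" if x: "x \<in> carrier_vec n" "M *\<^sub>v x = 0\<^sub>v (n + (p + p))" for x
  proof -
    from x kerM have k: "Q *\<^sub>v x = 0\<^sub>v n" "C *\<^sub>v x = 0\<^sub>v p" "C *\<^sub>v (A *\<^sub>v x) = 0\<^sub>v p" by auto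
    have Ax: "A *\<^sub>v x \<in> carrier_vec n" and AAx: "A *\<^sub>v (A *\<^sub>v x) \<in> carrier_vec n" using A x by auto
    have dist: "B *\<^sub>v (u + a \<cdot>\<^sub>v y + b \<cdot>\<^sub>v x) = B *\<^sub>v u + a \<cdot>\<^sub>v (B *\<^sub>v y) + b \<cdot>\<^sub>v (B *\<^sub>v x)"
      if "B \<in> carrier_mat q n" "u \<in> carrier_vec n" "y \<in> carrier_vec n" for B :: "real mat" and q u y
    proof -
      have "B *\<^sub>v (u + a \<cdot>\<^sub>v y + b \<cdot>\<^sub>v x) = B *\<^sub>v (u + a \<cdot>\<^sub>v y) + B *\<^sub>v (b \<cdot>\<^sub>v x)"
        by (rule mult_add_distrib_mat_vec[OF that(1)]) (use that x in auto)
      also have "B *\<^sub>v (u + a \<cdot>\<^sub>v y) = B *\<^sub>v u + B *\<^sub>v (a \<cdot>\<^sub>v y)"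
        by (rule mult_add_distrib_mat_vec[OF that(1)]) (use that x in auto)
      finally show ?thesis using mult_mat_vec[OF that(1)] that x by simp
    qed
    have "Q *\<^sub>v (A *\<^sub>v x) = A *\<^sub>v (Q *\<^sub>v x)"
      unfolding Qx[OF x(1)] Qx[OF Ax] using dist[OF A AAx Ax] by simp
    also have "\<dots> = 0\<^sub>v n" using k A by simp
    finally have 1: "Q *\<^sub>v (A *\<^sub>v x) = 0\<^sub>v n" .
    \<comment> \<open>Q x = 0 expresses A^2 x through A x and x, so C A^2 x = 0 follows from C x = C
      A x = 0. This is why no higher power of A has to be stacked in \<open>M\<close>.\<close>
    have "C *\<^sub>v (Q *\<^sub>v x) = C *\<^sub>v (A *\<^sub>v (A *\<^sub>v x)) + a \<cdot>\<^sub>v (C *\<^sub>v (A *\<^sub>v x)) + b \<cdot>\<^sub>v (C *\<^sub>v x)"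
      unfolding Qx[OF x(1)] by (rule dist[OF C AAx Ax])
    then have "C *\<^sub>v (A *\<^sub>v (A *\<^sub>v x)) = 0\<^sub>v p" using k C AAx by simp
    with 1 k(3) show ?thesis by (simp add: kerM[OF Ax])
  qed
  have ker: "M *\<^sub>v re_vec v = 0\<^sub>v (n + (p + p))" "M *\<^sub>v im_vec v = 0\<^sub>v (n + (p + p))"
  proof -
    have cA: "cmat A \<in> carrier_mat n n" using A by simp
    have Asv: "cmat A *\<^sub>v v = s \<cdot>\<^sub>v v"
      using Av v(1) A unfolding pencil_mult[OF A v(1)] by (auto simp: vec_eq_iff)
    have "cmat Q *\<^sub>v v = cmat A *\<^sub>v (cmat A *\<^sub>v v) + complex_of_real a \<cdot>\<^sub>v (cmat A *\<^sub>v v) + complex_of_real b \<cdot>\<^sub>v v"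
    proof (rule iffD2[OF complex_vec_eq_iff[of _ n]])
      show "re_vec (cmat Q *\<^sub>v v) = re_vec (cmat A *\<^sub>v (cmat A *\<^sub>v v) + complex_of_real a \<cdot>\<^sub>v (cmat A *\<^sub>v v) + complex_of_real b \<cdot>\<^sub>v v)
        \<and> im_vec (cmat Q *\<^sub>v v) = im_vec (cmat A *\<^sub>v (cmat A *\<^sub>v v) + complex_of_real a \<cdot>\<^sub>v (cmat A *\<^sub>v v) + complex_of_real b \<cdot>\<^sub>v v)"
      proof -
        have "re_vec (x + complex_of_real a \<cdot>\<^sub>v y + complex_of_real b \<cdot>\<^sub>v v) = re_vec x + a \<cdot>\<^sub>v re_vec y + b \<cdot>\<^sub>v re_vec v"
          "im_vec (x + complex_of_real a \<cdot>\<^sub>v y + complex_of_real b \<cdot>\<^sub>v v) = im_vec x + a \<cdot>\<^sub>v im_vec y + b \<cdot>\<^sub>v im_vec v"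
          if "x \<in> carrier_vec n" "y \<in> carrier_vec n" for x y :: "complex vec"
          using that v(1) by (auto simp: vec_eq_iff)
        note * = this[of "cmat A *\<^sub>v (cmat A *\<^sub>v v)" "cmat A *\<^sub>v v"]
        have cAv: "cmat A *\<^sub>v v \<in> carrier_vec n" using cA v by simp
        show ?thesis using *[OF _ cAv] cA cAv re_vec_cmat_mult[OF Q v(1)] re_vec_cmat_mult[OF A v(1)]
            re_vec_cmat_mult[OF A cAv] Qx[of "re_vec v"] Qx[of "im_vec v"] v(1)
          by (simp del: assoc_add_vec)
      qed
    qed (use Q A v in auto)
    also have "\<dots> = (s * s + complex_of_real a * s + complex_of_real b) \<cdot>\<^sub>v v"
      unfolding Asv using mult_mat_vec[OF cA v(1), of s] v(1)
      by (auto simp: Asv vec_eq_iff algebra_simps)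
    also have "s * s + complex_of_real a * s + complex_of_real b = 0"
      by (simp add: a_def b_def complex_eq_iff cmod_power2) (simp add: power2_eq_square)
    finally have "cmat Q *\<^sub>v v = 0\<^sub>v n" using v(1) by auto
    then have "re_vec (cmat Q *\<^sub>v v) = 0\<^sub>v n" "im_vec (cmat Q *\<^sub>v v) = 0\<^sub>v n" by auto
    then have 1: "Q *\<^sub>v re_vec v = 0\<^sub>v n" "Q *\<^sub>v im_vec v = 0\<^sub>v n" using re_vec_cmat_mult[OF Q v(1)] by auto
    have "re_vec (cmat C *\<^sub>v v) = 0\<^sub>v p" "im_vec (cmat C *\<^sub>v v) = 0\<^sub>v p" unfolding Cv by auto
    then have 2: "C *\<^sub>v re_vec v = 0\<^sub>v p" "C *\<^sub>v im_vec v = 0\<^sub>v p" using re_vec_cmat_mult[OF C v(1)] by auto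
    have "cmat (C * A) *\<^sub>v v = 0\<^sub>v p"
      unfolding cmat_mult_vec[OF C A v(1)] Asv using mult_mat_vec[of "cmat C" p n v s] C v(1) by (simp add: Cv)
    then have "re_vec (cmat (C * A) *\<^sub>v v) = 0\<^sub>v p" "im_vec (cmat (C * A) *\<^sub>v v) = 0\<^sub>v p" by auto
    then have 3: "C *\<^sub>v (A *\<^sub>v re_vec v) = 0\<^sub>v p" "C *\<^sub>v (A *\<^sub>v im_vec v) = 0\<^sub>v p"
      using re_vec_cmat_mult[OF CA v(1)] C A v(1) by auto
    from 1 2 3 v(1) show "M *\<^sub>v re_vec v = 0\<^sub>v (n + (p + p))" "M *\<^sub>v im_vec v = 0\<^sub>v (n + (p + p))"
      by (simp_all add: kerM)
  qed
  have "re_vec v \<noteq> 0\<^sub>v n \<or> im_vec v \<noteq> 0\<^sub>v n"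
    using v complex_vec_eq_iff[of v n "0\<^sub>v n"] by (auto simp: vec_eq_iff)
  then obtain w where w: "w \<in> carrier_vec n" "w \<noteq> 0\<^sub>v n" "M *\<^sub>v w = 0\<^sub>v (n + (p + p))"
    using ker v(1) by (metis map_carrier_vec)
  obtain k L R where k: "k < n" and L: "L \<in> carrier_mat k n" and R: "R \<in> carrier_mat n k" and LR: "L * R = 1\<^sub>m k"
    and LM: "\<And>x. x \<in> carrier_vec n \<Longrightarrow> L *\<^sub>v x = 0\<^sub>v k \<Longrightarrow> M *\<^sub>v x = 0\<^sub>v (n + (p + p))"
    and kerL: "\<And>x. x \<in> carrier_vec n \<Longrightarrow> M *\<^sub>v x = 0\<^sub>v (n + (p + p)) \<Longrightarrow> L *\<^sub>v x = 0\<^sub>v k"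
    by (rule kernel_quotient[OF M w]) (rule that)
  have proj: "M *\<^sub>v (x - R *\<^sub>v (L *\<^sub>v x)) = 0\<^sub>v (n + (p + p))" if x: "x \<in> carrier_vec n" for x
  proof (rule LM)
    have Lx: "L *\<^sub>v x \<in> carrier_vec k" using L x by simp
    have RLx: "R *\<^sub>v (L *\<^sub>v x) \<in> carrier_vec n" using R Lx by simp
    show "x - R *\<^sub>v (L *\<^sub>v x) \<in> carrier_vec n" using x RLx by simp
    have "L *\<^sub>v (R *\<^sub>v (L *\<^sub>v x)) = (L * R) *\<^sub>v (L *\<^sub>v x)"
      by (rule assoc_mult_mat_vec[OF L R Lx, symmetric])
    then have "L *\<^sub>v (R *\<^sub>v (L *\<^sub>v x)) = L *\<^sub>v x" using LR Lx by simp
    then show "L *\<^sub>v (x - R *\<^sub>v (L *\<^sub>v x)) = 0\<^sub>v k"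
      unfolding mult_minus_distrib_mat_vec[OF L x RLx] using Lx by simp
  qed
  \<comment> \<open>x and R L x differ by an element of the kernel of \<open>M\<close>, which A
    preserves and L annihilates; so A descends to the quotient as L A R.\<close>
  have "L * A = (L * A * R) * L"
  proof (rule mat_eqI_vec)
    fix x :: "real vec" assume x: "x \<in> carrier_vec n"
    define y where "y = R *\<^sub>v (L *\<^sub>v x)"
    have y: "y \<in> carrier_vec n" using R L x by (simp add: y_def)
    have "L *\<^sub>v (A *\<^sub>v (x - y)) = 0\<^sub>v k"
      using A x y proj[OF x] by (intro kerL inv) (auto simp: y_def)
    then have "L *\<^sub>v (A *\<^sub>v x) - L *\<^sub>v (A *\<^sub>v y) = 0\<^sub>v k"
      using mult_minus_distrib_mat_vec[OF A x y] mult_minus_distrib_mat_vec[OF L, of "A *\<^sub>v x" "A *\<^sub>v y"] A x y by simp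
    then have "L *\<^sub>v (A *\<^sub>v x) = L *\<^sub>v (A *\<^sub>v y)"
      using vec_minus_eq_iff[of "L *\<^sub>v (A *\<^sub>v x)" k "L *\<^sub>v (A *\<^sub>v y)" "0\<^sub>v k"] L A x y by simp
    moreover have "(L * A) *\<^sub>v x = L *\<^sub>v (A *\<^sub>v x)" using L A x by simp
    moreover have "(L * A * R * L) *\<^sub>v x = (L * A * R) *\<^sub>v (L *\<^sub>v x)"
      by (rule assoc_mult_mat_vec[of _ k k _ n]) (use L A R x in auto)
    moreover have "(L * A * R) *\<^sub>v (L *\<^sub>v x) = (L * A) *\<^sub>v y" unfolding y_def
      by (rule assoc_mult_mat_vec[of _ k n _ k]) (use L A R x in auto)
    moreover have "(L * A) *\<^sub>v y = L *\<^sub>v (A *\<^sub>v y)" using L A y by simp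
    ultimately show "(L * A) *\<^sub>v x = (L * A * R * L) *\<^sub>v x" by simp
  qed (use L A R in auto)
  moreover have "C = (C * R) * L"
  proof (rule mat_eqI_vec)
    fix x :: "real vec" assume x: "x \<in> carrier_vec n"
    define y where "y = R *\<^sub>v (L *\<^sub>v x)"
    have Lx: "L *\<^sub>v x \<in> carrier_vec k" using L x by simp
    have y: "y \<in> carrier_vec n" using R Lx by (simp add: y_def)
    have "C *\<^sub>v (x - y) = 0\<^sub>v p" using proj[OF x] kerM[of "x - y"] x y by (simp add: y_def)
    then have "C *\<^sub>v x = C *\<^sub>v y"
      using mult_minus_distrib_mat_vec[OF C x y] vec_minus_eq_iff[of "C *\<^sub>v x" p "C *\<^sub>v y" "0\<^sub>v p"] C x y by simp
    moreover have "(C * R * L) *\<^sub>v x = (C * R) *\<^sub>v (L *\<^sub>v x)"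
      by (rule assoc_mult_mat_vec[of _ p k _ n]) (use L C R x in auto)
    moreover have "(C * R) *\<^sub>v (L *\<^sub>v x) = C *\<^sub>v y" unfolding y_def by (rule assoc_mult_mat_vec[OF C R Lx])
    ultimately show "C *\<^sub>v x = (C * R * L) *\<^sub>v x" by simp
  qed (use L C R in auto)
  moreover have "L * A * R \<in> carrier_mat k k" "C * R \<in> carrier_mat p k" using L A R C by auto
  ultimately show ?thesis using k L by blast
qed

text \<open>An eigenvector of A invisible to C could be divided out: the map \<open>L\<close> on
  states intertwines the two systems, so the quotient realizes the same G with fewer states.\<close>

lemma minimal_observable:
  assumes G: "transfer_matrix m G" and min: "minimal_realization m G n A B C D"
    and v: "v \<in> carrier_vec n" and Av: "pencil A s *\<^sub>v v = 0\<^sub>v n" and Cv: "cmat C *\<^sub>v v = 0\<^sub>v m"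
  shows "v = 0\<^sub>v n"
proof (rule ccontr)
  assume v0: "v \<noteq> 0\<^sub>v n"
  have R: "realization m G n A B C D" using min by (simp add: minimal_realization_def)
  note RD = realizationD[OF R]
  interpret S: state_space n m m A B C D by (rule realization_state_space[OF R])
  from unobservable_quotient[OF RD(1,3) v v0 Av Cv] obtain k L A' C' where
    k: "k < n" and L: "L \<in> carrier_mat k n" and A': "A' \<in> carrier_mat k k" and C': "C' \<in> carrier_mat m k"
    and LA: "L * A = A' * L" and CL: "C = C' * L" by blast
  have S': "state_space k m m A' (L * B) C' D" using L A' C' RD by unfold_locales auto
  then interpret S': state_space k m m A' "L * B" C' D .
  have "realization m G k A' (L * B) C' D"
  proof (rule realization_transfer[OF G R S'], rule mat_eqI_vec)
    fix s assume s: "\<not> eigenvalue (cmat A) s" "\<not> eigenvalue (cmat A') s"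
    show "tf A' (L * B) C' D s \<in> carrier_mat m m" "tf A B C D s \<in> carrier_mat m m"
      using S'.tf_carrier[OF s(2)] S.tf_carrier[OF s(1)] by auto
    fix y :: "complex vec" assume y: "y \<in> carrier_vec m"
    have By: "cmat B *\<^sub>v y \<in> carrier_vec n" using RD y by simp
    from S.state_exists[OF s(1) By] obtain x where x: "x \<in> carrier_vec n" "pencil A s *\<^sub>v x = cmat B *\<^sub>v y" by blast
    have cL: "cmat L \<in> carrier_mat k n" using L by simp
    have Lx: "cmat L *\<^sub>v x \<in> carrier_vec k" and Ax: "cmat A *\<^sub>v x \<in> carrier_vec n" using cL x RD by auto
    have "pencil A' s *\<^sub>v (cmat L *\<^sub>v x) = s \<cdot>\<^sub>v (cmat L *\<^sub>v x) - cmat L *\<^sub>v (cmat A *\<^sub>v x)"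
      unfolding pencil_mult[OF A' Lx] using cmat_mult_vec[OF A' L x(1)] cmat_mult_vec[OF L RD(1) x(1)] LA by simp
    also have "\<dots> = cmat L *\<^sub>v (pencil A s *\<^sub>v x)"
      unfolding pencil_mult[OF RD(1) x(1)] using mult_minus_distrib_mat_vec[OF cL _ Ax, of "s \<cdot>\<^sub>v x"]
        mult_mat_vec[OF cL x(1), of s] x(1) by simp
    also have "\<dots> = cmat (L * B) *\<^sub>v y" unfolding x(2) by (rule cmat_mult_vec[OF L RD(2) y, symmetric])
    finally have "pencil A' s *\<^sub>v (cmat L *\<^sub>v x) = cmat (L * B) *\<^sub>v y" .
    from S'.tf_mult[OF s(2) Lx y this] S.tf_mult[OF s(1) x(1) y x(2)]
    show "tf A' (L * B) C' D s *\<^sub>v y = tf A B C D s *\<^sub>v y"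
      using cmat_mult_vec[OF C' L x(1)] CL by simp
  qed
  with min have "n \<le> k" unfolding minimal_realization_def by blast
  with k show False by simp
qed

text \<open>Dual to observability: the quotient of the pair (A^T, B^T) transposes to an A-invariant
  subspace, the range of T = L^T, that contains the range of B. Restricting to it realizes G with
  fewer states; here states are lifted by T instead of projected by L.\<close>

lemma minimal_controllable:
  assumes G: "transfer_matrix m G" and min: "minimal_realization m G n A B C D"
    and v: "v \<in> carrier_vec n" and Av: "pencil (A\<^sup>T) s *\<^sub>v v = 0\<^sub>v n" and Bv: "cmat (B\<^sup>T) *\<^sub>v v = 0\<^sub>v m"
  shows "v = 0\<^sub>v n"
proof (rule ccontr)
  assume v0: "v \<noteq> 0\<^sub>v n"
  have R: "realization m G n A B C D" using min by (simp add: minimal_realization_def)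
  note RD = realizationD[OF R]
  interpret S: state_space n m m A B C D by (rule realization_state_space[OF R])
  have AT: "A\<^sup>T \<in> carrier_mat n n" "B\<^sup>T \<in> carrier_mat m n" using RD by auto
  from unobservable_quotient[OF AT v v0 Av Bv] obtain k L A' C' where
    k: "k < n" and L: "L \<in> carrier_mat k n" and A': "A' \<in> carrier_mat k k" and C': "C' \<in> carrier_mat m k"
    and LA: "L * A\<^sup>T = A' * L" and CL: "B\<^sup>T = C' * L" by blast
  define T A1 B1 where "T = L\<^sup>T" and "A1 = A'\<^sup>T" and "B1 = C'\<^sup>T"
  have T: "T \<in> carrier_mat n k" and A1: "A1 \<in> carrier_mat k k" and B1: "B1 \<in> carrier_mat k m"
    using L A' C' by (auto simp: T_def A1_def B1_def)
  have AT: "A * T = T * A1"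
    using arg_cong[OF LA, of transpose_mat] transpose_mult[OF L AT(1)] transpose_mult[OF A' L]
    by (simp add: T_def A1_def)
  have BT: "B = T * B1"
    using arg_cong[OF CL, of transpose_mat] transpose_mult[OF C' L] by (simp add: T_def B1_def)
  have S': "state_space k m m A1 B1 (C * T) D" using T A1 B1 RD by unfold_locales auto
  then interpret S': state_space k m m A1 B1 "C * T" D .
  have "realization m G k A1 B1 (C * T) D"
  proof (rule realization_transfer[OF G R S'], rule mat_eqI_vec)
    fix s assume s: "\<not> eigenvalue (cmat A) s" "\<not> eigenvalue (cmat A1) s"
    show "tf A1 B1 (C * T) D s \<in> carrier_mat m m" "tf A B C D s \<in> carrier_mat m m"
      using S'.tf_carrier[OF s(2)] S.tf_carrier[OF s(1)] by auto
    fix y :: "complex vec" assume y: "y \<in> carrier_vec m"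
    have By: "cmat B1 *\<^sub>v y \<in> carrier_vec k" using B1 y by simp
    from S'.state_exists[OF s(2) By] obtain x where x: "x \<in> carrier_vec k" "pencil A1 s *\<^sub>v x = cmat B1 *\<^sub>v y" by blast
    have cT: "cmat T \<in> carrier_mat n k" using T by simp
    have Tx: "cmat T *\<^sub>v x \<in> carrier_vec n" and Ax: "cmat A1 *\<^sub>v x \<in> carrier_vec k" using cT x A1 by auto
    have "pencil A s *\<^sub>v (cmat T *\<^sub>v x) = s \<cdot>\<^sub>v (cmat T *\<^sub>v x) - cmat T *\<^sub>v (cmat A1 *\<^sub>v x)"
      unfolding pencil_mult[OF RD(1) Tx] using cmat_mult_vec[OF RD(1) T x(1)] cmat_mult_vec[OF T A1 x(1)] AT by simp
    also have "\<dots> = cmat T *\<^sub>v (pencil A1 s *\<^sub>v x)"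
      unfolding pencil_mult[OF A1 x(1)] using mult_minus_distrib_mat_vec[OF cT _ Ax, of "s \<cdot>\<^sub>v x"]
        mult_mat_vec[OF cT x(1), of s] x(1) by simp
    also have "\<dots> = cmat B *\<^sub>v y" unfolding x(2) using cmat_mult_vec[OF T B1 y] BT by simp
    finally have "pencil A s *\<^sub>v (cmat T *\<^sub>v x) = cmat B *\<^sub>v y" .
    from S.tf_mult[OF s(1) Tx y this] S'.tf_mult[OF s(2) x(1) y x(2)]
    show "tf A1 B1 (C * T) D s *\<^sub>v y = tf A B C D s *\<^sub>v y"
      using cmat_mult_vec[OF RD(3) T x(1)] by simp
  qed
  with min have "n \<le> k" unfolding minimal_realization_def by blast
  with k show False by simp
qed

lemma minimal_realization_exists:
  assumes "transfer_matrix m G"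
  shows "\<exists>n A B C D. minimal_realization m G n A B C D"
proof -
  let ?P = "\<lambda>n. \<exists>A B C D. realization m G n A B C D"
  have ex: "\<exists>n. ?P n" using assms by (auto simp: transfer_matrix_def)
  have "?P (LEAST n. ?P n)" using LeastI_ex[OF ex] .
  then obtain A B C D where "realization m G (LEAST n. ?P n) A B C D" by blast
  moreover have "(LEAST n. ?P n) \<le> n'" if "realization m G n' A' B' C' D'" for n' A' B' C' D'
    by (rule Least_le) (use that in blast)
  ultimately show ?thesis unfolding minimal_realization_def by blast
qed

section \<open>Approximating a steady state by inputs off the spectrum\<close>

lemma pencil_shift:
  assumes A: "A \<in> carrier_mat n n" and x: "x \<in> carrier_vec n"
  shows "pencil A s *\<^sub>v x = (s - z) \<cdot>\<^sub>v x + pencil A z *\<^sub>v x"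
  using A x by (auto simp: pencil_mult[OF A x] vec_eq_iff algebra_simps)

lemma mat_adjoint_pencil:
  assumes A: "A \<in> carrier_mat n n"
  shows "mat_adjoint (pencil A s) = pencil (A\<^sup>T) (cnj s)"
  using A by (intro eq_matI) (auto simp: pencil_index pencil_index[of "A\<^sup>T" n])

text \<open>Phrased as the left-eigenvector test, because this is what minimality yields and what
  makes [sI - A, B] surjective at each single s.\<close>

definition controllable :: "real mat \<Rightarrow> real mat \<Rightarrow> bool" where
  "controllable A B \<longleftrightarrow> (\<forall>s. \<forall>w \<in> carrier_vec (dim_row A). pencil (A\<^sup>T) s *\<^sub>v w = 0\<^sub>v (dim_row A) \<longrightarrow>
     cmat (B\<^sup>T) *\<^sub>v w = 0\<^sub>v (dim_col B) \<longrightarrow> w = 0\<^sub>v (dim_row A))"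

lemma vec_add_diff_cancel:
  "a \<in> carrier_vec n \<Longrightarrow> b \<in> carrier_vec n \<Longrightarrow> a + b - b = (a :: 'a :: ab_group_add vec)"
  by (auto simp: vec_eq_iff)

text \<open>The Popov-Belevitch-Hautus condition says that P P* + B B* is invertible.\<close>

lemma controllable_surj:
  assumes A: "A \<in> carrier_mat n n" and B: "B \<in> carrier_mat n m"
    and ctrl: "controllable A B"
    and x: "x \<in> carrier_vec n"
  shows "\<exists>h \<in> carrier_vec n. \<exists>a \<in> carrier_vec m. x = pencil A s *\<^sub>v h + cmat B *\<^sub>v a"
proof -
  let ?P = "pencil A s" and ?B = "cmat B"
  define Ps Bs where "Ps = mat_adjoint ?P" and "Bs = mat_adjoint ?B"
  have P: "?P \<in> carrier_mat n n" and cB: "?B \<in> carrier_mat n m" using A B by auto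
  have Ps: "Ps \<in> carrier_mat n n" and Bs: "Bs \<in> carrier_mat m n" using P cB by (auto simp: Ps_def Bs_def)
  define M where "M = ?P * Ps + ?B * Bs"
  have PP: "?P * Ps \<in> carrier_mat n n" and BB: "?B * Bs \<in> carrier_mat n n" using P cB Ps Bs by auto
  have M: "M \<in> carrier_mat n n" unfolding M_def using PP BB by simp
  have Mw: "M *\<^sub>v w = ?P *\<^sub>v (Ps *\<^sub>v w) + ?B *\<^sub>v (Bs *\<^sub>v w)" if w: "w \<in> carrier_vec n" for w
    unfolding M_def add_mult_distrib_mat_vec[OF PP BB w]
      assoc_mult_mat_vec[OF P Ps w] assoc_mult_mat_vec[OF cB Bs w] ..
  have "Determinant.det M \<noteq> 0" unfolding det_nonzero_iff_inj[OF M]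
  proof (intro ballI impI)
    fix w assume w: "w \<in> carrier_vec n" "M *\<^sub>v w = 0\<^sub>v n"
    have Pw: "Ps *\<^sub>v w \<in> carrier_vec n" and Bw: "Bs *\<^sub>v w \<in> carrier_vec m" using Ps Bs w by auto
    have PPw: "?P *\<^sub>v (Ps *\<^sub>v w) \<in> carrier_vec n" and BBw: "?B *\<^sub>v (Bs *\<^sub>v w) \<in> carrier_vec n"
      using P cB Pw Bw by auto
    have "0 = (M *\<^sub>v w) \<bullet>c w" using w by simp
    also have "\<dots> = (?P *\<^sub>v (Ps *\<^sub>v w)) \<bullet>c w + (?B *\<^sub>v (Bs *\<^sub>v w)) \<bullet>c w"
      unfolding Mw[OF w(1)] by (rule add_scalar_prod_distrib[OF PPw BBw]) (use w in simp)
    also have "\<dots> = (Ps *\<^sub>v w) \<bullet>c (Ps *\<^sub>v w) + (Bs *\<^sub>v w) \<bullet>c (Bs *\<^sub>v w)"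
      using cscalar_prod_adjoint[OF P Pw w(1)] cscalar_prod_adjoint[OF cB Bw w(1)] by (simp add: Ps_def Bs_def)
    finally have "Re ((Ps *\<^sub>v w) \<bullet>c (Ps *\<^sub>v w)) + Re ((Bs *\<^sub>v w) \<bullet>c (Bs *\<^sub>v w)) = 0" by (metis plus_complex.sel(1) zero_complex.sel(1))
    then have "Ps *\<^sub>v w = 0\<^sub>v n" "Bs *\<^sub>v w = 0\<^sub>v m"
      using cscalar_prod_self_pos[OF Pw] cscalar_prod_self_pos[OF Bw]
        cscalar_prod_self_Re(1)[of "Ps *\<^sub>v w"] cscalar_prod_self_Re(1)[of "Bs *\<^sub>v w"] by force+
    then show "w = 0\<^sub>v n" using ctrl w(1) A B
      by (simp add: Ps_def Bs_def mat_adjoint_pencil[OF A] mat_adjoint_cmat controllable_def)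
  qed
  from mult_minv_vec(1)[OF M this x] minv_carrier[OF M this] x
  have z: "minv M *\<^sub>v x \<in> carrier_vec n" "M *\<^sub>v (minv M *\<^sub>v x) = x" by auto
  show ?thesis
    by (rule bexI[of _ "Ps *\<^sub>v (minv M *\<^sub>v x)"], rule bexI[of _ "Bs *\<^sub>v (minv M *\<^sub>v x)"])
      (use z Mw[OF z(1)] Ps Bs in auto)
qed

context state_space
begin

text \<open>At an eigenvalue z of A the equation (zI - A) x = B y need not come from a value G(z) y,
  so the pair (x, y) is continued to nearby s with an error of any prescribed order. Keeping x and y
  constant leaves the error (s - z) x. Controllability writes an error vector as (zI - A) h + B a;
  the first part is absorbed by the state and the second by the input, and the remainder gains one
  order.\<close>

lemma steady_state_expansion:
  assumes ctrl: "controllable A B"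
    and x: "x \<in> carrier_vec n" and y: "y \<in> carrier_vec m" and eq: "pencil A z *\<^sub>v x = cmat B *\<^sub>v y"
  shows "\<exists>S Z r. r \<in> carrier_vec n \<and> (\<forall>s. S s \<in> carrier_vec n) \<and> (\<forall>s. Z s \<in> carrier_vec m) \<and>
    (\<forall>s. pencil A s *\<^sub>v S s = cmat B *\<^sub>v (y + (s - z) \<cdot>\<^sub>v Z s) + (s - z) ^ Suc N \<cdot>\<^sub>v r) \<and>
    S z = x \<and> (\<forall>i<n. isCont (\<lambda>s. S s $ i) z) \<and> (\<forall>i<m. isCont (\<lambda>s. Z s $ i) z)"
proof (induction N)
  case 0
  have By: "cmat B *\<^sub>v y \<in> carrier_vec n" using B y by simp
  show ?case
  proof (rule exI[of _ "\<lambda>_. x"], rule exI[of _ "\<lambda>_. 0\<^sub>v m"], rule exI[of _ x], intro conjI allI impI)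
    show "pencil A s *\<^sub>v x = cmat B *\<^sub>v (y + (s - z) \<cdot>\<^sub>v 0\<^sub>v m) + (s - z) ^ Suc 0 \<cdot>\<^sub>v x" for s
      using comm_add_vec[of "(s - z) \<cdot>\<^sub>v x" n "cmat B *\<^sub>v y"] By x y
      unfolding pencil_shift[OF A x, of s z] eq by simp
  qed (use x in auto)
next
  case (Suc N)
  then obtain S Z r where r: "r \<in> carrier_vec n" and S: "\<And>s. S s \<in> carrier_vec n"
    and Z: "\<And>s. Z s \<in> carrier_vec m"
    and SZ: "\<And>s. pencil A s *\<^sub>v S s = cmat B *\<^sub>v (y + (s - z) \<cdot>\<^sub>v Z s) + (s - z) ^ Suc N \<cdot>\<^sub>v r"
    and Sz: "S z = x" and cont: "\<And>i. i < n \<Longrightarrow> isCont (\<lambda>s. S s $ i) z" "\<And>i. i < m \<Longrightarrow> isCont (\<lambda>s. Z s $ i) z"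
    by blast
  have "\<exists>h \<in> carrier_vec n. \<exists>a \<in> carrier_vec m. r = pencil A z *\<^sub>v h + cmat B *\<^sub>v a"
    by (rule controllable_surj[OF A B ctrl r])
  then obtain h a where h: "h \<in> carrier_vec n" and a: "a \<in> carrier_vec m"
    and ra: "r = pencil A z *\<^sub>v h + cmat B *\<^sub>v a" by blast
  define S' where "S' = (\<lambda>s. S s - (s - z) ^ Suc N \<cdot>\<^sub>v h)"
  define Z' where "Z' = (\<lambda>s. Z s + (s - z) ^ N \<cdot>\<^sub>v a)"
  have S': "S' s \<in> carrier_vec n" for s using S h by (simp add: S'_def)
  have Z': "Z' s \<in> carrier_vec m" for s using Z a by (simp add: Z'_def)
  have cB: "cmat B \<in> carrier_mat n m" using B by simp
  have eqn: "pencil A s *\<^sub>v S' s = cmat B *\<^sub>v (y + (s - z) \<cdot>\<^sub>v Z' s) + (s - z) ^ Suc (Suc N) \<cdot>\<^sub>v (- h)" for s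
  proof -
    define t where "t = s - z"
    have P: "pencil A s \<in> carrier_mat n n" using A by simp
    have ph: "pencil A z *\<^sub>v h \<in> carrier_vec n" and Ba: "cmat B *\<^sub>v a \<in> carrier_vec n"
      and BZ: "cmat B *\<^sub>v (y + t \<cdot>\<^sub>v Z s) \<in> carrier_vec n" using pencil_carrier[OF A, of z] h cB a y Z by auto
    have "pencil A s *\<^sub>v S' s = pencil A s *\<^sub>v S s - t ^ Suc N \<cdot>\<^sub>v (pencil A s *\<^sub>v h)"
      unfolding S'_def t_def[symmetric] using mult_minus_distrib_mat_vec[OF P S, of "t ^ Suc N \<cdot>\<^sub>v h"]
        mult_mat_vec[OF P h] h by simp
    \<comment> \<open>Having the pencil at s instead of z costs the extra term t h, which becomes
      the remainder - h of the next order.\<close>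
    also have "pencil A s *\<^sub>v h = t \<cdot>\<^sub>v h + pencil A z *\<^sub>v h" unfolding t_def by (rule pencil_shift[OF A h])
    also have "pencil A s *\<^sub>v S s - t ^ Suc N \<cdot>\<^sub>v (t \<cdot>\<^sub>v h + pencil A z *\<^sub>v h) =
      cmat B *\<^sub>v (y + t \<cdot>\<^sub>v Z s) + t ^ Suc N \<cdot>\<^sub>v (cmat B *\<^sub>v a) + t ^ Suc (Suc N) \<cdot>\<^sub>v (- h)"
      unfolding SZ[of s, folded t_def] ra
    proof (rule eq_vecI)
      fix i assume "i < dim_vec (cmat B *\<^sub>v (y + t \<cdot>\<^sub>v Z s) + t ^ Suc N \<cdot>\<^sub>v (cmat B *\<^sub>v a) + t ^ Suc (Suc N) \<cdot>\<^sub>v (- h))"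
      then have "i < n" using h by simp
      then show "(cmat B *\<^sub>v (y + t \<cdot>\<^sub>v Z s) + t ^ Suc N \<cdot>\<^sub>v (pencil A z *\<^sub>v h + cmat B *\<^sub>v a) -
          t ^ Suc N \<cdot>\<^sub>v (t \<cdot>\<^sub>v h + pencil A z *\<^sub>v h)) $ i =
        (cmat B *\<^sub>v (y + t \<cdot>\<^sub>v Z s) + t ^ Suc N \<cdot>\<^sub>v (cmat B *\<^sub>v a) + t ^ Suc (Suc N) \<cdot>\<^sub>v (- h)) $ i"
        using h ph Ba BZ A B by (simp add: algebra_simps del: index_mult_mat_vec)
    qed (use h ph Ba BZ A B in simp)
    also have "cmat B *\<^sub>v (y + t \<cdot>\<^sub>v Z s) + t ^ Suc N \<cdot>\<^sub>v (cmat B *\<^sub>v a) = cmat B *\<^sub>v (y + t \<cdot>\<^sub>v Z' s)"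
    proof -
      have "y + t \<cdot>\<^sub>v Z' s = (y + t \<cdot>\<^sub>v Z s) + t ^ Suc N \<cdot>\<^sub>v a"
        using y Z[of s] a by (auto simp: Z'_def t_def vec_eq_iff algebra_simps)
      moreover have "cmat B *\<^sub>v ((y + t \<cdot>\<^sub>v Z s) + t ^ Suc N \<cdot>\<^sub>v a) =
          cmat B *\<^sub>v (y + t \<cdot>\<^sub>v Z s) + cmat B *\<^sub>v (t ^ Suc N \<cdot>\<^sub>v a)"
        by (rule mult_add_distrib_mat_vec[OF cB]) (use y Z a in auto)
      moreover have "cmat B *\<^sub>v (t ^ Suc N \<cdot>\<^sub>v a) = t ^ Suc N \<cdot>\<^sub>v (cmat B *\<^sub>v a)" by (rule mult_mat_vec[OF cB a])
      ultimately show ?thesis by simp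
    qed
    finally show ?thesis by (simp add: t_def)
  qed
  show ?case
  proof (intro exI conjI allI impI)
    show "- h \<in> carrier_vec n" using h by simp
    show "S' s \<in> carrier_vec n" "Z' s \<in> carrier_vec m" for s by (fact S' Z')+
    show "pencil A s *\<^sub>v S' s = cmat B *\<^sub>v (y + (s - z) \<cdot>\<^sub>v Z' s) + (s - z) ^ Suc (Suc N) \<cdot>\<^sub>v (- h)" for s
      by (rule eqn)
    show "S' z = x" using Sz x h by (auto simp: S'_def)
    fix i
    { assume i: "i < n"
      have "(\<lambda>s. S' s $ i) = (\<lambda>s. S s $ i - (s - z) ^ Suc N * h $ i)" using i h by (auto simp: S'_def)
      then show "isCont (\<lambda>s. S' s $ i) z" using cont(1)[OF i] by (auto intro!: continuous_intros) }
    { assume i: "i < m"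
      have "(\<lambda>s. Z' s $ i) = (\<lambda>s. Z s $ i + (s - z) ^ N * a $ i)" using i a by (auto simp: Z'_def)
      then show "isCont (\<lambda>s. Z' s $ i) z" using cont(2)[OF i] by (auto intro!: continuous_intros) }
  qed
qed

text \<open>The resolvent has a pole of order at most n, so it sends an error of order n + 1 to 0.
  Hence the true response to y + (s - z) Z(s) tends to the steady-state output C x + D y, although
  the transfer function itself may have a pole at z.\<close>

lemma steady_state_limit:
  assumes ctrl: "controllable A B"
    and x: "x \<in> carrier_vec n" and y: "y \<in> carrier_vec m" and eq: "pencil A z *\<^sub>v x = cmat B *\<^sub>v y"
  obtains Z where "\<And>s. Z s \<in> carrier_vec m" "\<And>i. i < m \<Longrightarrow> isCont (\<lambda>s. Z s $ i) z"
    "\<And>i. i < p \<Longrightarrow> ((\<lambda>s. (tf A B C D s *\<^sub>v (y + (s - z) \<cdot>\<^sub>v Z s)) $ i) \<longlongrightarrow>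
       (cmat C *\<^sub>v x + cmat D *\<^sub>v y) $ i) (at z)"
proof -
  from steady_state_expansion[OF assms, where N = n] obtain S Z r where r: "r \<in> carrier_vec n"
    and S: "\<And>s. S s \<in> carrier_vec n" and Z: "\<And>s. Z s \<in> carrier_vec m"
    and SZ: "\<And>s. pencil A s *\<^sub>v S s = cmat B *\<^sub>v (y + (s - z) \<cdot>\<^sub>v Z s) + (s - z) ^ Suc n \<cdot>\<^sub>v r"
    and Sz: "S z = x" and cont: "\<And>i. i < n \<Longrightarrow> isCont (\<lambda>s. S s $ i) z" "\<And>i. i < m \<Longrightarrow> isCont (\<lambda>s. Z s $ i) z"
    by blast
  define R where "R = (\<lambda>s i. \<Sum>k<n. (s - z) ^ Suc n * minv (pencil A s) $$ (i, k) * r $ k)"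
  define Y where "Y = (\<lambda>s. y + (s - z) \<cdot>\<^sub>v Z s)"
  have Y: "Y s \<in> carrier_vec m" for s using y Z by (simp add: Y_def)
  have Rlim: "((\<lambda>s. R s i) \<longlongrightarrow> 0) (at z)" if "i < n" for i
  proof -
    have "((\<lambda>s. R s i) \<longlongrightarrow> (\<Sum>k<n. 0 * r $ k)) (at z)" unfolding R_def
      by (intro tendsto_intros resolvent_pole_order[OF A that]) auto
    then show ?thesis by simp
  qed
  have "((\<lambda>s. (tf A B C D s *\<^sub>v Y s) $ i) \<longlongrightarrow> (cmat C *\<^sub>v x + cmat D *\<^sub>v y) $ i) (at z)" if i: "i < p" for i
  proof -
    have "((\<lambda>s. (\<Sum>k<n. complex_of_real (C $$ (i, k)) * (S s $ k - R s k)) +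
        (\<Sum>k<m. complex_of_real (D $$ (i, k)) * (y $ k + (s - z) * Z s $ k))) \<longlongrightarrow>
        (\<Sum>k<n. complex_of_real (C $$ (i, k)) * (S z $ k - 0)) +
        (\<Sum>k<m. complex_of_real (D $$ (i, k)) * (y $ k + (z - z) * Z z $ k))) (at z)"
      using cont by (intro tendsto_intros Rlim) (auto simp: isCont_def)
    also have "(\<Sum>k<n. complex_of_real (C $$ (i, k)) * (S z $ k - 0)) +
        (\<Sum>k<m. complex_of_real (D $$ (i, k)) * (y $ k + (z - z) * Z z $ k)) = (cmat C *\<^sub>v x + cmat D *\<^sub>v y) $ i"
      using i C D x y Sz by (simp add: scalar_prod_def lessThan_atLeast0)
    finally show ?thesis
    proof (rule Lim_transform_eventually)
      show "eventually (\<lambda>s. (\<Sum>k<n. complex_of_real (C $$ (i, k)) * (S s $ k - R s k)) +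
          (\<Sum>k<m. complex_of_real (D $$ (i, k)) * (y $ k + (s - z) * Z s $ k)) = (tf A B C D s *\<^sub>v Y s) $ i) (at z)"
        using eventually_not_in_finite_at[OF finite_eigenvalues[OF A], of z]
      proof eventually_elim
        case (elim s)
        then have s: "\<not> eigenvalue (cmat A) s" by simp
        have P: "pencil A s \<in> carrier_mat n n" and d: "Determinant.det (pencil A s) \<noteq> 0"
          using A s by (auto simp: eigenvalue_iff_det[OF A])
        note inv = minv_carrier[OF P d]
        define w where "w = (s - z) ^ Suc n \<cdot>\<^sub>v (minv (pencil A s) *\<^sub>v r)"
        have w: "w \<in> carrier_vec n" using inv r by (simp add: w_def)
        have mr: "minv (pencil A s) *\<^sub>v r \<in> carrier_vec n" using inv r by simp
        have wi: "w $ k = R s k" if "k < n" for k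
          using that inv r by (simp add: w_def R_def scalar_prod_def sum_distrib_left lessThan_atLeast0 ac_simps)
        have BY: "cmat B *\<^sub>v Y s \<in> carrier_vec n" using B Y by simp
        have "pencil A s *\<^sub>v w = (s - z) ^ Suc n \<cdot>\<^sub>v r"
          unfolding w_def mult_mat_vec[OF P mr] mult_minv_vec(1)[OF P d r] ..
        moreover have "pencil A s *\<^sub>v S s = cmat B *\<^sub>v Y s + (s - z) ^ Suc n \<cdot>\<^sub>v r"
          unfolding Y_def by (rule SZ)
        ultimately have "pencil A s *\<^sub>v (S s - w) = cmat B *\<^sub>v Y s"
          unfolding mult_minus_distrib_mat_vec[OF P S w]
          using vec_add_diff_cancel[OF BY, of "(s - z) ^ Suc n \<cdot>\<^sub>v r"] r by simp
        from tf_mult[OF s _ Y this] S w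
        have "tf A B C D s *\<^sub>v Y s = cmat C *\<^sub>v (S s - w) + cmat D *\<^sub>v Y s" by simp
        then show ?case
          using i C D S[of s] w Y[of s] y Z[of s] by (simp add: scalar_prod_def lessThan_atLeast0 wi Y_def)
      qed
    qed
  qed
  then show thesis by (intro that[of Z] Z cont(2)) (simp_all add: Y_def)
qed

end

section \<open>Frequency domain properties\<close>

lemma cscalar_form_sum:
  fixes M :: "complex mat"
  assumes "M \<in> carrier_mat m m" "v \<in> carrier_vec m" "u \<in> carrier_vec m"
  shows "(M *\<^sub>v v) \<bullet>c u = (\<Sum>i<m. \<Sum>j<m. M $$ (i, j) * (v $ j * cnj (u $ i)))"
  using assms by (simp add: scalar_prod_def sum_distrib_right lessThan_atLeast0 mult.assoc)

lemma cscalar_form_tendsto: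
  fixes f :: "'x \<Rightarrow> complex mat"
  assumes f: "\<And>x. f x \<in> carrier_mat m m" and L: "L \<in> carrier_mat m m"
    and lim: "\<And>i j. i < m \<Longrightarrow> j < m \<Longrightarrow> ((\<lambda>x. c x * f x $$ (i, j)) \<longlongrightarrow> L $$ (i, j)) F"
    and v: "v \<in> carrier_vec m" and u: "u \<in> carrier_vec m"
  shows "((\<lambda>x. c x * ((f x *\<^sub>v v) \<bullet>c u)) \<longlongrightarrow> (L *\<^sub>v v) \<bullet>c u) F"
proof -
  have "((\<lambda>x. \<Sum>i<m. \<Sum>j<m. c x * f x $$ (i, j) * (v $ j * cnj (u $ i))) \<longlongrightarrow>
      (\<Sum>i<m. \<Sum>j<m. L $$ (i, j) * (v $ j * cnj (u $ i)))) F"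
    by (intro tendsto_sum tendsto_mult_right lim) auto
  then show ?thesis
    unfolding cscalar_form_sum[OF L v u] cscalar_form_sum[OF f v u]
    by (simp add: sum_distrib_left mult.assoc)
qed

text \<open>Turns the matrix inequalities that define NI and SNI into signs of Im x* K x, the form
  in which they enter the estimates.\<close>

lemma skew_form:
  fixes K :: "complex mat"
  assumes K: "K \<in> carrier_mat m m" and x: "x \<in> carrier_vec m"
  shows "((\<i> \<cdot>\<^sub>m (K - mat_adjoint K)) *\<^sub>v x) \<bullet>c x = complex_of_real (- 2 * Im ((K *\<^sub>v x) \<bullet>c x))"
proof -
  have K': "mat_adjoint K \<in> carrier_mat m m" using K by simp
  have Kx: "K *\<^sub>v x \<in> carrier_vec m" and K'x: "mat_adjoint K *\<^sub>v x \<in> carrier_vec m" using K K' x by auto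
  have "(\<i> \<cdot>\<^sub>m (K - mat_adjoint K)) *\<^sub>v x = \<i> \<cdot>\<^sub>v ((K - mat_adjoint K) *\<^sub>v x)"
    using K x by (intro eq_vecI) auto
  also have "(K - mat_adjoint K) *\<^sub>v x = K *\<^sub>v x - mat_adjoint K *\<^sub>v x"
    by (rule minus_mult_distrib_mat_vec[OF K K' x])
  also have "(\<i> \<cdot>\<^sub>v (K *\<^sub>v x - mat_adjoint K *\<^sub>v x)) \<bullet>c x = \<i> * ((K *\<^sub>v x) \<bullet>c x - (mat_adjoint K *\<^sub>v x) \<bullet>c x)"
    using Kx K'x x minus_scalar_prod_distrib[OF Kx K'x, of "conjugate x"]
      smult_scalar_prod_distrib[of "K *\<^sub>v x - mat_adjoint K *\<^sub>v x" m "conjugate x" \<i>] by simp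
  also have "(mat_adjoint K *\<^sub>v x) \<bullet>c x = cnj ((K *\<^sub>v x) \<bullet>c x)"
    unfolding cscalar_prod_adjoint[OF K x x] using cscalar_prod_cnj[OF x K'x] by simp
  finally show ?thesis by (simp add: complex_eq_iff)
qed

lemma pos_semidef_complexD:
  fixes K :: "complex mat"
  assumes "pos_semidef K" "K \<in> carrier_mat m m" "x \<in> carrier_vec m"
  shows "0 \<le> Re ((K *\<^sub>v x) \<bullet>c x)" "Im ((K *\<^sub>v x) \<bullet>c x) = 0"
  using assms by (auto simp: pos_semidef_def less_eq_complex_def)

lemma pos_def_complexD:
  fixes K :: "complex mat"
  assumes "pos_def K" "K \<in> carrier_mat m m" "x \<in> carrier_vec m" "x \<noteq> 0\<^sub>v m"
  shows "0 < Re ((K *\<^sub>v x) \<bullet>c x)"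
  using assms by (auto simp: pos_def_def less_complex_def)

lemma cscalar_prod_conjugate:
  assumes "x \<in> carrier_vec n" "y \<in> carrier_vec n"
  shows "conjugate x \<bullet>c conjugate y = cnj (x \<bullet>c (y :: complex vec))"
  using assms by (simp add: scalar_prod_def)

lemma cmat_form_conjugate:
  assumes "M \<in> carrier_mat m m" "x \<in> carrier_vec m" "y \<in> carrier_vec m"
  shows "(cmat M *\<^sub>v conjugate x) \<bullet>c conjugate y = cnj ((cmat M *\<^sub>v x) \<bullet>c y)"
  using assms cscalar_prod_conjugate[of "cmat M *\<^sub>v x" m y]
  by (simp add: conjugate_cmat_mult[of M m m, symmetric])

text \<open>Polarisation: the form at x + i y has imaginary part (M y) . x - (M x) . y, and its
  vanishing makes M agree with its transpose.\<close>

lemma symmetric_if_form_real: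
  assumes M: "M \<in> carrier_mat m m"
    and im: "\<And>x. x \<in> carrier_vec m \<Longrightarrow> Im ((cmat M *\<^sub>v x) \<bullet>c x) = 0"
  shows "M\<^sup>T = M"
proof (rule mat_eqI_vec)
  fix x :: "real vec" assume x: "x \<in> carrier_vec m"
  have sym: "(M *\<^sub>v y) \<bullet> x = (M *\<^sub>v x) \<bullet> y" if y: "y \<in> carrier_vec m" for y
  proof -
    define z where "z = vec m (\<lambda>i. Complex (x $ i) (y $ i))"
    have z: "z \<in> carrier_vec m" "re_vec z = x" "im_vec z = y" using x y by (auto simp: z_def)
    have Mz: "cmat M *\<^sub>v z \<in> carrier_vec m" using M z by simp
    from im[OF z(1)] show ?thesis
      unfolding cscalar_prod_Re_Im(2)[OF Mz z(1)] re_vec_cmat_mult[OF M z(1)] z by simp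
  qed
  have "(M\<^sup>T *\<^sub>v x - M *\<^sub>v x) \<bullet> y = 0" if y: "y \<in> carrier_vec m" for y
  proof -
    have "(M\<^sup>T *\<^sub>v x) \<bullet> y = x \<bullet> (M *\<^sub>v y)" by (rule transpose_vec_mult_scalar[OF M y x])
    also have "\<dots> = (M *\<^sub>v x) \<bullet> y" using sym[OF y] comm_scalar_prod[of x m "M *\<^sub>v y"] M x y by simp
    finally show ?thesis using minus_scalar_prod_distrib[of "M\<^sup>T *\<^sub>v x" m "M *\<^sub>v x" y] M x y by simp
  qed
  from this[of "M\<^sup>T *\<^sub>v x - M *\<^sub>v x"] have "M\<^sup>T *\<^sub>v x - M *\<^sub>v x = 0\<^sub>v m"
    using scalar_prod_self_real(2)[of "M\<^sup>T *\<^sub>v x - M *\<^sub>v x" m] M x by simp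
  then show "M\<^sup>T *\<^sub>v x = M *\<^sub>v x"
    using vec_minus_eq_iff[of "M\<^sup>T *\<^sub>v x" m "M *\<^sub>v x" "0\<^sub>v m"] M x by simp
qed (use M in auto)

text \<open>The frequency approaches w from above, so that for w = 0 only positive frequencies are
  met, where the NI and SNI conditions are stated.\<close>

lemma tendsto_at_imag_axis:
  assumes "(f \<longlongrightarrow> l) (at (\<i> * complex_of_real w))"
  shows "((\<lambda>t. f (\<i> * complex_of_real t)) \<longlongrightarrow> l) (at_right w)"
proof (rule filterlim_compose[OF assms])
  have "((\<lambda>t. \<i> * complex_of_real t) \<longlongrightarrow> \<i> * complex_of_real w) (at_right w)" by (intro tendsto_intros)
  moreover have "eventually (\<lambda>t. \<i> * complex_of_real t \<noteq> \<i> * complex_of_real w) (at_right w)"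
    by (auto simp: eventually_at_filter)
  ultimately show "filterlim (\<lambda>t. \<i> * complex_of_real t) (at (\<i> * complex_of_real w)) (at_right w)"
    by (simp add: filterlim_at)
qed

lemma eventually_imag_axis_notin_finite:
  assumes "finite E"
  shows "eventually (\<lambda>t. \<i> * complex_of_real t \<notin> E) (at_right w)"
proof -
  have "finite ((\<lambda>t. \<i> * complex_of_real t) -` E)"
    by (rule finite_vimageI) (use assms in \<open>auto intro: injI\<close>)
  from islimpt_finite[OF this, of w] have "eventually (\<lambda>t. \<i> * complex_of_real t \<notin> E) (at w)"
    by (simp add: islimpt_iff_eventually)
  then show ?thesis by (auto simp: eventually_at_filter elim: eventually_mono)
qed

section \<open>A transfer matrix together with one of its realizations\<close>

locale transfer =
  fixes m n :: nat and G :: "complex \<Rightarrow> complex mat" and A B C D :: "real mat"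
  assumes G: "transfer_matrix m G" and R: "realization m G n A B C D"
begin

lemmas RD = realizationD[OF R]

sublocale state_space n m m A B C D
  by (rule realization_state_space[OF R])

text \<open>Contains all poles of G and possibly eigenvalues that cancel; off this finite set G is
  given by the state-space formula.\<close>

definition spec :: "complex set" where "spec = {s. eigenvalue (cmat A) s}"

lemma finite_spec: "finite spec"
  unfolding spec_def by (rule finite_eigenvalues[OF A])

lemma G_carrier [simp]: "G s \<in> carrier_mat m m"
  using G by (simp add: transfer_matrix_def)

lemma G_vec [simp]: "v \<in> carrier_vec m \<Longrightarrow> G s *\<^sub>v v \<in> carrier_vec m"
  using mult_mat_vec_carrier[OF G_carrier] .

lemma G_tf: "s \<notin> spec \<Longrightarrow> G s = tf A B C D s"
  using realization_tf[OF R] by (simp add: spec_def)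

lemma spec_cnj: "cnj s \<in> spec \<longleftrightarrow> s \<in> spec"
  by (simp add: spec_def eigenvalue_cnj[OF A])

lemma G_holomorphic_spec:
  assumes "i < m" "j < m"
  shows "(\<lambda>s. G s $$ (i, j)) holomorphic_on - spec"
  by (rule holomorphic_transform[OF tf_holomorphic[OF assms, folded spec_def]]) (auto simp: G_tf)

lemma G_isCont: "\<not> mat_pole m G s \<Longrightarrow> i < m \<Longrightarrow> j < m \<Longrightarrow> isCont (\<lambda>s. G s $$ (i, j)) s"
  using G by (auto simp: transfer_matrix_def)

lemma not_pole_spec: "s \<notin> spec \<Longrightarrow> \<not> mat_pole m G s"
proof
  assume s: "s \<notin> spec" and "mat_pole m G s"
  then obtain i j where ij: "i < m" "j < m" "is_pole (\<lambda>s. G s $$ (i, j)) s" by (auto simp: mat_pole_def)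
  have "open (- spec)" using finite_spec by (intro open_Compl finite_imp_closed)
  with G_holomorphic_spec[OF ij(1,2)] s have "isCont (\<lambda>s. G s $$ (i, j)) s"
    using holomorphic_on_imp_continuous_on continuous_on_eq_continuous_at by blast
  with ij(3) show False
    using not_tendsto_and_filterlim_at_infinity[of "at s"] by (auto simp: is_pole_def isCont_def)
qed

lemma G_cnj:
  assumes s: "s \<notin> spec" and u: "u \<in> carrier_vec m" and v: "v \<in> carrier_vec m"
  shows "(G (cnj s) *\<^sub>v conjugate v) \<bullet>c conjugate u = cnj ((G s *\<^sub>v v) \<bullet>c u)"
proof -
  have "G (cnj s) *\<^sub>v conjugate v = conjugate (G s *\<^sub>v v)"
    using tf_cnj[OF _ v, of s] s by (simp add: G_tf spec_cnj) (simp add: spec_def)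
  then show ?thesis using cscalar_prod_conjugate[of "G s *\<^sub>v v" m u] u v by simp
qed

lemma G_real:
  assumes t: "complex_of_real t \<notin> spec" and ij: "i < m" "j < m"
  shows "Im (G (complex_of_real t) $$ (i, j)) = 0"
proof -
  have c: "conjugate (unit_vec m k) = (unit_vec m k :: complex vec)" for k
    by (intro eq_vecI) (auto simp: unit_vec_def)
  have "(G (complex_of_real t) *\<^sub>v unit_vec m j) \<bullet>c unit_vec m i = G (complex_of_real t) $$ (i, j)"
    using ij carrier_matD[OF G_carrier, of "complex_of_real t"] by (simp add: c)
  with G_cnj[OF t, of "unit_vec m i" "unit_vec m j"] show ?thesis by (simp add: c complex_eq_iff)
qed

text \<open>The limit can be taken along the real axis, where G is real. Hence the value at 0 of a
  pole-free G and the Laurent coefficients at 0 are real, and \<open>re_mat\<close> loses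
  nothing.\<close>

lemma limit_real:
  assumes ij: "i < m" "j < m"
    and lim: "((\<lambda>s. c s * G s $$ (i, j) - d s) \<longlongrightarrow> l) (at 0)"
    and cd: "\<And>t. Im (c (complex_of_real t)) = 0" "\<And>t. Im (d (complex_of_real t)) = 0"
  shows "Im l = 0"
proof -
  have "filterlim (\<lambda>t. complex_of_real t) (at 0) (at (0::real))"
    using tendsto_of_real[of "\<lambda>x. x" "0::real" "at 0", where ?'a = complex]
    by (auto simp: filterlim_at eventually_at_filter)
  from filterlim_compose[OF lim this]
  have "((\<lambda>t. Im (c (complex_of_real t) * G (complex_of_real t) $$ (i, j) - d (complex_of_real t))) \<longlongrightarrow> Im l) (at 0)"
    by (rule tendsto_Im)
  moreover have "eventually (\<lambda>t. Im (c (complex_of_real t) * G (complex_of_real t) $$ (i, j) - d (complex_of_real t)) = 0) (at 0)"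
    using eventually_line_notin_finite[OF finite_spec, of 1 0]
    by (rule eventually_mono) (use cd ij in \<open>auto simp: G_real\<close>)
  from this have "((\<lambda>t. Im (c (complex_of_real t) * G (complex_of_real t) $$ (i, j) - d (complex_of_real t))) \<longlongrightarrow> 0) (at 0)"
    by (rule tendsto_eventually)
  ultimately show ?thesis by (intro tendsto_unique[OF at_neq_bot])
qed

lemma G_tendsto_D:
  assumes "i < m" "j < m"
  shows "((\<lambda>s. G s $$ (i, j)) \<longlongrightarrow> complex_of_real (D $$ (i, j))) at_infinity"
  by (rule Lim_transform_eventually[OF tf_at_infinity[OF assms]])
    (use eventually_not_in_finite_infinity[OF finite_spec] in \<open>auto elim!: eventually_mono simp: G_tf\<close>)

lemma sG_tendsto:
  assumes D0: "D = 0\<^sub>m m m" and ij: "i < m" "j < m"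
  shows "((\<lambda>s. s * G s $$ (i, j)) \<longlongrightarrow> cmat (C * B) $$ (i, j)) at_infinity"
proof -
  interpret S1: state_space n m m A B "C * A" "C * B" by unfold_locales (use A B C in auto)
  have "((\<lambda>s. tf A B (C * A) (C * B) s $$ (i, j)) \<longlongrightarrow> complex_of_real ((C * B) $$ (i, j))) at_infinity"
    by (rule S1.tf_at_infinity[OF ij])
  moreover have "eventually (\<lambda>s. tf A B (C * A) (C * B) s $$ (i, j) = s * G s $$ (i, j)) at_infinity"
    using eventually_not_in_finite_infinity[OF finite_spec]
  proof eventually_elim
    case (elim s)
    then have "\<not> eigenvalue (cmat A) s" by (simp add: spec_def)
    from tf_smult[OF this] G_tf[OF elim] D0 ij carrier_matD[OF G_carrier[of s]]
    show ?case by (metis index_smult_mat(1))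
  qed
  ultimately show ?thesis using ij B C by (auto intro: Lim_transform_eventually)
qed

lemma eventually_axis_spec: "eventually (\<lambda>t. \<i> * complex_of_real t \<notin> spec) (at_right w)"
  by (rule eventually_imag_axis_notin_finite[OF finite_spec])

text \<open>The part of the spectrum that can carry singularities when G has no pole in the open
  right half plane.\<close>

definition lspec :: "complex set" where "lspec = {s \<in> spec. Re s \<le> 0}"

lemma finite_lspec: "finite lspec"
  using finite_spec by (simp add: lspec_def)

text \<open>At an eigenvalue in the open right half plane there is no pole, hence G is continuous
  there, and the isolated singularity is removable with the value of G itself.\<close>

lemma G_holomorphic:
  assumes np: "\<And>s. Re s > 0 \<Longrightarrow> \<not> mat_pole m G s" and ij: "i < m" "j < m"
  shows "(\<lambda>s. G s $$ (i, j)) holomorphic_on - lspec"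
proof (rule no_isolated_singularity'[where K = "spec - lspec"])
  fix z assume "z \<in> spec - lspec"
  then have "Re z > 0" by (auto simp: lspec_def)
  from G_isCont[OF np[OF this] ij] show "((\<lambda>s. G s $$ (i, j)) \<longlongrightarrow> G z $$ (i, j)) (at z within - lspec)"
    by (auto simp: isCont_def intro: tendsto_within_subset)
next
  have "- lspec - (spec - lspec) = - spec" by (auto simp: lspec_def)
  then show "(\<lambda>s. G s $$ (i, j)) holomorphic_on - lspec - (spec - lspec)" using G_holomorphic_spec[OF ij] by simp
qed (use finite_spec finite_lspec in \<open>auto intro!: open_Compl finite_imp_closed\<close>)

lemma form_holomorphic:
  assumes np: "\<And>s. Re s > 0 \<Longrightarrow> \<not> mat_pole m G s" and v: "v \<in> carrier_vec m" and u: "u \<in> carrier_vec m"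
  shows "(\<lambda>s. (G s *\<^sub>v v) \<bullet>c u) holomorphic_on - lspec"
  unfolding cscalar_form_sum[OF G_carrier v u] by (intro holomorphic_intros G_holomorphic[OF np]) auto

lemma form_isCont:
  assumes np: "\<not> mat_pole m G z" and v: "v \<in> carrier_vec m" and u: "u \<in> carrier_vec m"
  shows "isCont (\<lambda>s. (G s *\<^sub>v v) \<bullet>c u) z"
  unfolding cscalar_form_sum[OF G_carrier v u] by (intro continuous_intros G_isCont[OF np]) auto

end

lemma Re_i_mult: "Re (\<i> * complex_of_real w * z) = - w * Im z"
  by simp

lemma Re_real_minus_divide_i:
  assumes "w \<noteq> 0" "Im h = 0"
  shows "Re ((h - g) / (\<i> * complex_of_real w)) = - Im g / w"
  using assms by (simp add: Re_divide power2_eq_square)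

lemma imag_axis_form: "Re s = 0 \<Longrightarrow> s = \<i> * complex_of_real (Im s)"
  by (simp add: complex_eq_iff)

context transfer
begin

lemma G_cnj_index:
  assumes s: "s \<notin> spec" and ij: "i < m" "j < m"
  shows "G (cnj s) $$ (i, j) = cnj (G s $$ (i, j))"
proof -
  have c: "conjugate (unit_vec m k) = (unit_vec m k :: complex vec)" for k
    by (intro eq_vecI) (auto simp: unit_vec_def)
  have "(G z *\<^sub>v unit_vec m j) \<bullet>c unit_vec m i = G z $$ (i, j)" for z
    using ij carrier_matD[OF G_carrier, of z] by (simp add: c)
  with G_cnj[OF s, of "unit_vec m i" "unit_vec m j"] show ?thesis by (simp add: c)
qed

text \<open>The expression is Re (s x* G(s) x) at s = i w. Conjugate symmetry of G transports the
  sign from positive to negative frequencies, since the minimum principle needs the entire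
  axis.\<close>

lemma axis_form_sign:
  assumes neg: "\<And>w x. 0 < w \<Longrightarrow> \<i> * complex_of_real w \<notin> spec \<Longrightarrow> x \<in> carrier_vec m \<Longrightarrow>
      Im ((G (\<i> * complex_of_real w) *\<^sub>v x) \<bullet>c x) \<le> 0"
    and w: "w \<noteq> 0" "\<i> * complex_of_real w \<notin> spec" and x: "x \<in> carrier_vec m"
  shows "0 \<le> - w * Im ((G (\<i> * complex_of_real w) *\<^sub>v x) \<bullet>c x)"
proof (cases "w > 0")
  case True
  with neg[OF True w(2) x] show ?thesis by (simp add: mult_nonneg_nonpos)
next
  case False
  then have w': "- w > 0" using w by simp
  have ns: "\<i> * complex_of_real (- w) \<notin> spec" using w(2) spec_cnj[of "\<i> * complex_of_real w"] by simp
  have "(G (\<i> * complex_of_real w) *\<^sub>v x) \<bullet>c x =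
      cnj ((G (\<i> * complex_of_real (- w)) *\<^sub>v conjugate x) \<bullet>c conjugate x)"
    using G_cnj[OF ns, of "conjugate x" "conjugate x"] x by simp
  with neg[OF w' ns, of "conjugate x"] x have "0 \<le> Im ((G (\<i> * complex_of_real w) *\<^sub>v x) \<bullet>c x)" by simp
  with w' show ?thesis by (simp add: mult_nonpos_nonneg)
qed

end

section \<open>Strictly negative imaginary systems\<close>

locale sni_system = transfer +
  assumes sni: "strictly_negative_imaginary m G"
begin

lemma no_pole: "0 \<le> Re s \<Longrightarrow> \<not> mat_pole m G s"
  using sni by (simp add: strictly_negative_imaginary_def)

lemma axis_neg:
  assumes "0 < w" "x \<in> carrier_vec m" "x \<noteq> 0\<^sub>v m"
  shows "Im ((G (\<i> * complex_of_real w) *\<^sub>v x) \<bullet>c x) < 0"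
proof -
  let ?K = "G (\<i> * complex_of_real w)"
  have "pos_def (\<i> \<cdot>\<^sub>m (?K - mat_adjoint ?K))"
    using sni assms(1) by (auto simp: strictly_negative_imaginary_def)
  then have "0 < Re (((\<i> \<cdot>\<^sub>m (?K - mat_adjoint ?K)) *\<^sub>v x) \<bullet>c x)"
    by (rule pos_def_complexD[OF _ _ assms(2,3)]) (use minus_carrier_mat[of "mat_adjoint ?K" m m ?K] in simp)
  then show ?thesis by (simp add: skew_form[OF G_carrier assms(2)])
qed

lemma axis_nonpos:
  assumes "0 < w" "x \<in> carrier_vec m"
  shows "Im ((G (\<i> * complex_of_real w) *\<^sub>v x) \<bullet>c x) \<le> 0"
proof (cases "x = 0\<^sub>v m")
  case True
  then show ?thesis by simp
next
  case False
  from axis_neg[OF assms False] show ?thesis by simp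
qed

definition dc :: "real mat" where "dc = re_mat (G 0)"

lemma dc_carrier [simp]: "dc \<in> carrier_mat m m"
  by (simp add: dc_def)

lemma G_dc: "G 0 = cmat dc"
proof (rule eq_matI)
  fix i j assume "i < dim_row (cmat dc)" "j < dim_col (cmat dc)"
  then have ij: "i < m" "j < m" using carrier_matD[OF dc_carrier] by auto
  have "Im (G 0 $$ (i, j)) = 0"
    by (rule limit_real[OF ij, of "\<lambda>_. 1" "\<lambda>_. 0"])
      (use G_isCont[OF no_pole, of 0] ij in \<open>auto simp: isCont_def\<close>)
  with ij carrier_matD[OF G_carrier[of 0]] show "G 0 $$ (i, j) = cmat dc $$ (i, j)"
    by (simp add: dc_def complex_eq_iff)
qed (use carrier_matD[OF G_carrier[of 0]] carrier_matD[OF dc_carrier] in auto)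

text \<open>The SNI sign survives as Im \<le> 0 when the frequency decreases to 0. The same holds
  for the conjugate vector, at which the real matrix takes the conjugate value, and this forces
  equality.\<close>

lemma dc_form_real:
  assumes x: "x \<in> carrier_vec m"
  shows "Im ((cmat dc *\<^sub>v x) \<bullet>c x) = 0"
proof -
  have le: "Im ((cmat dc *\<^sub>v x) \<bullet>c x) \<le> 0" if x: "x \<in> carrier_vec m" for x
  proof (rule tendsto_upperbound)
    have "((\<lambda>s. (G s *\<^sub>v x) \<bullet>c x) \<longlongrightarrow> (cmat dc *\<^sub>v x) \<bullet>c x) (at (\<i> * complex_of_real 0))"
      using form_isCont[OF no_pole x x, of 0] by (simp add: isCont_def G_dc)
    from tendsto_Im[OF tendsto_at_imag_axis[OF this]]
    show "((\<lambda>t. Im ((G (\<i> * complex_of_real t) *\<^sub>v x) \<bullet>c x)) \<longlongrightarrow> Im ((cmat dc *\<^sub>v x) \<bullet>c x)) (at_right 0)" .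
    show "eventually (\<lambda>t. Im ((G (\<i> * complex_of_real t) *\<^sub>v x) \<bullet>c x) \<le> 0) (at_right 0)"
      using eventually_at_right_less[of 0] by eventually_elim (rule axis_nonpos[OF _ x])
  qed simp
  from le[OF x] le[of "conjugate x"] x cmat_form_conjugate[OF dc_carrier x x] show ?thesis by simp
qed

lemma dc_symmetric: "dc\<^sup>T = dc"
  by (rule symmetric_if_form_real[OF dc_carrier dc_form_real])

text \<open>The minimum principle is applied to (h - g(s)) / s with g(s) = x* G(s) x and h = g(0).
  On the axis its real part is - Im g / w, which SNI makes nonnegative, and one frequency with
  strict sign makes the real part strictly positive inside.\<close>

lemma dc_dominates:
  assumes s0: "0 < Re s0" and x: "x \<in> carrier_vec m" "x \<noteq> 0\<^sub>v m"
  shows "0 < Re (((cmat dc *\<^sub>v x) \<bullet>c x - (G s0 *\<^sub>v x) \<bullet>c x) / s0)"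
proof -
  define g where "g = (\<lambda>s. (G s *\<^sub>v x) \<bullet>c x)"
  define h where "h = (cmat dc *\<^sub>v x) \<bullet>c x"
  have h: "Im h = 0" unfolding h_def by (rule dc_form_real[OF x(1)])
  have g0: "g 0 = h" by (simp add: g_def h_def G_dc)
  have gcont: "isCont g z" if "0 \<le> Re z" for z
    unfolding g_def by (rule form_isCont[OF no_pole[OF that] x(1) x(1)])
  define f where "f = (\<lambda>s. (h - g s) / s)"
  have glim: "(g \<longlongrightarrow> (cmat D *\<^sub>v x) \<bullet>c x) at_infinity"
    using cscalar_form_tendsto[of G m "cmat D" "\<lambda>_. 1" at_infinity x x] G_tendsto_D D x
    by (simp add: g_def)
  obtain w where w: "w > 0" "\<i> * complex_of_real w \<notin> spec"
  proof -
    have "eventually (\<lambda>t::real. t > 0 \<and> \<i> * complex_of_real t \<notin> spec) (at_right 0)"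
      using eventually_at_right_less[of 0] eventually_axis_spec[of 0] by eventually_elim auto
    from eventually_happens'[OF _ this] that show thesis by auto
  qed
  have "0 < Re (f s0)"
  proof (rule half_plane_minimum_strict[where f = f and ?s0.0 = s0 and E = "insert 0 lspec" and ?s1.0 = "\<i> * complex_of_real w"])
    show "finite (insert 0 lspec)" using finite_lspec by simp
    show "Re z \<le> 0" if "z \<in> insert 0 lspec" for z using that by (auto simp: lspec_def)
    show "f holomorphic_on - insert 0 lspec" unfolding f_def g_def
      by (intro holomorphic_intros holomorphic_on_subset[OF form_holomorphic[OF _ x(1) x(1)]])
        (auto simp: no_pole)
    \<comment> \<open>The origin contributes no residue because g(0) = h, and spectral points on the
      axis contribute none because G has no pole there; so r = 0 in every case.\<close>
    show "\<exists>r\<ge>0. ((\<lambda>s. (s - z) * f s) \<longlongrightarrow> complex_of_real r) (at z)" if z: "z \<in> insert 0 lspec" "Re z = 0" for z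
    proof (intro exI conjI)
      have "isCont g z" using gcont z(2) by simp
      then have gz: "(g \<longlongrightarrow> g z) (at z)" by (simp add: isCont_def)
      show "((\<lambda>s. (s - z) * f s) \<longlongrightarrow> complex_of_real 0) (at z)"
      proof (cases "z = 0")
        case True
        have "((\<lambda>s. h - g s) \<longlongrightarrow> 0) (at z)" using tendsto_diff[OF tendsto_const gz, of h] g0 True by simp
        moreover have "eventually (\<lambda>s. h - g s = (s - z) * f s) (at z)"
          using eventually_neq_at_within[of z z UNIV] by eventually_elim (simp add: f_def True)
        ultimately show ?thesis by (auto intro: Lim_transform_eventually)
      next
        case False
        have "((\<lambda>s. (s - z) * f s) \<longlongrightarrow> (z - z) * ((h - g z) / z)) (at z)" unfolding f_def
          by (intro tendsto_intros gz False)
        then show ?thesis by simp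
      qed
    qed simp
    show "0 \<le> Re (f s)" if s: "Re s = 0" "s \<notin> insert 0 lspec" for s
    proof -
      define v where "v = Im s"
      have sv: "s = \<i> * complex_of_real v" using imag_axis_form[OF s(1)] by (simp add: v_def)
      have v0: "v \<noteq> 0" using s(2) sv by auto
      have ns: "\<i> * complex_of_real v \<notin> spec" using s sv by (auto simp: lspec_def)
      have "0 \<le> - v * Im (g s)" unfolding sv g_def
        by (rule axis_form_sign[OF _ v0 ns x(1)]) (auto intro: axis_nonpos)
      then have "0 \<le> (- v * Im (g s)) / v\<^sup>2" by (intro divide_nonneg_nonneg) auto
      also have "\<dots> = - Im (g s) / v" using v0 by (simp add: power2_eq_square)
      finally have "0 \<le> - Im (g s) / v" .
      then show ?thesis unfolding f_def using Re_real_minus_divide_i[OF v0 h] sv by simp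
    qed
    show "(f \<longlongrightarrow> 0) at_infinity" unfolding f_def
    proof -
      have "((\<lambda>s. (h - g s) * inverse s) \<longlongrightarrow> (h - (cmat D *\<^sub>v x) \<bullet>c x) * 0) at_infinity"
        by (intro tendsto_intros glim tendsto_inverse_0)
      then show "((\<lambda>s. (h - g s) / s) \<longlongrightarrow> 0) at_infinity" by (simp add: divide_inverse)
    qed
    show "0 < Re (f (\<i> * complex_of_real w))"
      unfolding f_def Re_real_minus_divide_i[OF less_imp_neq[OF w(1), symmetric] h]
      using axis_neg[OF w(1) x] w(1) by (simp add: g_def divide_neg_pos)
    show "\<i> * complex_of_real w \<notin> insert 0 lspec" using w by (auto simp: lspec_def)
  qed (use s0 in auto)
  then show ?thesis by (simp add: f_def g_def h_def)
qed

end

lemma cmat_kernel_iff: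
  assumes M: "M \<in> carrier_mat n k" and x: "x \<in> carrier_vec k"
  shows "cmat M *\<^sub>v x = 0\<^sub>v n \<longleftrightarrow> M *\<^sub>v re_vec x = 0\<^sub>v n \<and> M *\<^sub>v im_vec x = 0\<^sub>v n"
proof -
  have Mx: "cmat M *\<^sub>v x \<in> carrier_vec n" using M x by simp
  have "re_vec (0\<^sub>v n) = 0\<^sub>v n" "im_vec (0\<^sub>v n) = 0\<^sub>v n" by auto
  then show ?thesis unfolding complex_vec_eq_iff[OF Mx zero_carrier_vec] re_vec_cmat_mult[OF M x] by simp
qed

section \<open>Negative imaginary systems without a double pole at 0\<close>

locale ni_system = transfer +
  assumes ni: "negative_imaginary m G" and sp: "strictly_proper m G"
    and g2: "laurent2 m G = 0\<^sub>m m m"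
begin

lemma no_pole: "0 < Re s \<Longrightarrow> \<not> mat_pole m G s"
  using ni by (simp add: negative_imaginary_def)

lemma D_zero: "D = 0\<^sub>m m m"
proof (rule eq_matI)
  fix i j assume "i < dim_row (0\<^sub>m m m :: real mat)" "j < dim_col (0\<^sub>m m m :: real mat)"
  then have ij: "i < m" "j < m" by auto
  have "((\<lambda>s. G s $$ (i, j)) \<longlongrightarrow> 0) at_infinity"
    using sp ij by (simp add: strictly_proper_def mat_tendsto_def)
  from tendsto_unique[OF trivial_limit_at_infinity G_tendsto_D[OF ij] this]
  show "D $$ (i, j) = 0\<^sub>m m m $$ (i, j)" using ij by simp
qed (use D in auto)

lemma axis_nonpos:
  assumes "0 < w" "\<i> * complex_of_real w \<notin> spec" "x \<in> carrier_vec m"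
  shows "Im ((G (\<i> * complex_of_real w) *\<^sub>v x) \<bullet>c x) \<le> 0"
proof -
  let ?K = "G (\<i> * complex_of_real w)"
  have "pos_semidef (\<i> \<cdot>\<^sub>m (?K - mat_adjoint ?K))"
    using ni assms(1) not_pole_spec[OF assms(2)] by (auto simp: negative_imaginary_def)
  then have "0 \<le> Re (((\<i> \<cdot>\<^sub>m (?K - mat_adjoint ?K)) *\<^sub>v x) \<bullet>c x)"
    by (rule pos_semidef_complexD[OF _ _ assms(3)]) (use minus_carrier_mat[of "mat_adjoint ?K" m m ?K] in simp)
  then show ?thesis by (simp add: skew_form[OF G_carrier assms(3)])
qed

text \<open>\<open>laurent2\<close> is defined by \<open>Lim\<close>, whose value is informative
  only if the limit exists. Existence comes from the NI condition when 0 is a pole, and from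
  continuity when it is not.\<close>

lemma s2G_tendsto:
  assumes ij: "i < m" "j < m"
  shows "((\<lambda>s. s\<^sup>2 * G s $$ (i, j)) \<longlongrightarrow> 0) (at 0)"
proof (cases "mat_pole m G 0")
  case True
  then obtain K where K: "mat_tendsto m (\<lambda>s. s\<^sup>2 \<cdot>\<^sub>m G s) K (at 0)"
    using ni by (auto simp: negative_imaginary_def)
  have "((\<lambda>s. (s\<^sup>2 \<cdot>\<^sub>m G s) $$ (i, j)) \<longlongrightarrow> K $$ (i, j)) (at 0)"
    using K ij by (simp add: mat_tendsto_def)
  then have lim: "((\<lambda>s. s\<^sup>2 * G s $$ (i, j)) \<longlongrightarrow> K $$ (i, j)) (at 0)"
    using ij carrier_matD[OF G_carrier] by simp
  have "laurent2 m G $$ (i, j) = Lim (at 0) (\<lambda>s. s\<^sup>2 * G s $$ (i, j))"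
    using ij carrier_matD[OF G_carrier] by (simp add: laurent2_def mat_Lim_def)
  also have "\<dots> = K $$ (i, j)" by (rule tendsto_Lim[OF _ lim]) simp
  finally have "K $$ (i, j) = 0" using g2 ij by simp
  with lim show ?thesis by simp
next
  case False
  from G_isCont[OF this ij] have "((\<lambda>s. s\<^sup>2 * G s $$ (i, j)) \<longlongrightarrow> 0\<^sup>2 * G 0 $$ (i, j)) (at 0)"
    by (intro tendsto_intros) (simp add: isCont_def)
  then show ?thesis by simp
qed

text \<open>Since s^2 G(s) tends to 0, each entry of s G(s) extends holomorphically across 0 to a
  function h, and the two coefficients are h(0) and h'(0).\<close>

lemma laurent_entries:
  assumes ij: "i < m" "j < m"
  obtains l1 l0 where "((\<lambda>s. s * G s $$ (i, j)) \<longlongrightarrow> l1) (at 0)"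
    "((\<lambda>s. G s $$ (i, j) - 1 / s * l1) \<longlongrightarrow> l0) (at 0)"
proof -
  define U where "U = - (spec - {0})"
  have U: "open U" "0 \<in> U"
    unfolding U_def by (intro open_Compl finite_imp_closed finite_Diff finite_spec) simp
  let ?f = "\<lambda>s. s * G s $$ (i, j)"
  have "?f holomorphic_on U - {0}"
    by (intro holomorphic_intros holomorphic_on_subset[OF G_holomorphic_spec[OF ij]]) (auto simp: U_def)
  moreover have "((\<lambda>s. (s - 0) * ?f s) \<longlongrightarrow> 0) (at 0)"
    using s2G_tendsto[OF ij] by (simp add: power2_eq_square mult.assoc)
  moreover have "0 \<in> interior U" using U by (simp add: interior_open)
  ultimately obtain h where h: "h holomorphic_on U" "\<And>s. s \<in> U - {0} \<Longrightarrow> h s = ?f s"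
    using holomorphic_on_extend_lim[of ?f U 0] by blast
  have ev: "eventually (\<lambda>s. s \<in> U - {0}) (at 0)"
    using eventually_at_in_open[OF U] by simp
  have d: "(h has_field_derivative deriv h 0) (at 0)"
    using h(1) U by (intro holomorphic_derivI[of _ U])
  have "(h \<longlongrightarrow> h 0) (at 0)" using DERIV_isCont[OF d] by (simp add: isCont_def)
  then have l1: "(?f \<longlongrightarrow> h 0) (at 0)"
    by (rule Lim_transform_eventually) (use ev h(2) in \<open>auto elim!: eventually_mono\<close>)
  have "((\<lambda>s. (h s - h 0) / s) \<longlongrightarrow> deriv h 0) (at 0)" using d by (simp add: has_field_derivative_iff)
  then have "((\<lambda>s. G s $$ (i, j) - 1 / s * h 0) \<longlongrightarrow> deriv h 0) (at 0)"
    by (rule Lim_transform_eventually) (use ev in \<open>eventually_elim, auto simp: h(2) field_simps\<close>)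
  with l1 show thesis by (rule that)
qed

definition G1 :: "real mat" where "G1 = re_mat (laurent1 m G)"
definition G0 :: "real mat" where "G0 = re_mat (laurent0 m G)"

lemma laurent_carrier: "laurent1 m G \<in> carrier_mat m m" "laurent0 m G \<in> carrier_mat m m"
  by (auto simp: laurent1_def laurent0_def mat_Lim_def)

lemma G1_carrier [simp]: "G1 \<in> carrier_mat m m" and G0_carrier [simp]: "G0 \<in> carrier_mat m m"
  using laurent_carrier by (auto simp: G1_def G0_def)

lemma laurent_real:
  assumes ij: "i < m" "j < m"
  shows G1_entry: "((\<lambda>s. s * G s $$ (i, j)) \<longlongrightarrow> cmat G1 $$ (i, j)) (at 0)"
    and G0_entry: "((\<lambda>s. G s $$ (i, j) - 1 / s * cmat G1 $$ (i, j)) \<longlongrightarrow> cmat G0 $$ (i, j)) (at 0)"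
proof -
  note cG = carrier_matD[OF G_carrier]
  from laurent_entries[OF ij] obtain l1 l0 where
    l1: "((\<lambda>s. s * G s $$ (i, j)) \<longlongrightarrow> l1) (at 0)" and
    l0: "((\<lambda>s. G s $$ (i, j) - 1 / s * l1) \<longlongrightarrow> l0) (at 0)" .
  have "laurent1 m G $$ (i, j) = Lim (at 0) (\<lambda>s. s * G s $$ (i, j))"
    using ij cG by (simp add: laurent1_def mat_Lim_def g2)
  also have "\<dots> = l1" by (rule tendsto_Lim[OF _ l1]) simp
  finally have e1: "laurent1 m G $$ (i, j) = l1" .
  have "laurent0 m G $$ (i, j) = Lim (at 0) (\<lambda>s. G s $$ (i, j) - 1 / s * l1)"
    using ij cG carrier_matD[OF laurent_carrier(1)] by (simp add: laurent0_def mat_Lim_def g2 e1)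
  also have "\<dots> = l0" by (rule tendsto_Lim[OF _ l0]) simp
  finally have e0: "laurent0 m G $$ (i, j) = l0" .
  have "Im l1 = 0" by (rule limit_real[OF ij, of "\<lambda>s. s" "\<lambda>_. 0"]) (use l1 in auto)
  then have G1: "cmat G1 $$ (i, j) = l1"
    using ij e1 carrier_matD[OF laurent_carrier(1)] by (simp add: G1_def complex_eq_iff)
  have "Im l0 = 0"
    by (rule limit_real[OF ij, of "\<lambda>_. 1" "\<lambda>s. 1 / s * l1"]) (use l0 \<open>Im l1 = 0\<close> in \<open>auto simp: Im_divide\<close>)
  then have G0: "cmat G0 $$ (i, j) = l0"
    using ij e0 carrier_matD[OF laurent_carrier(2)] by (simp add: G0_def complex_eq_iff)
  show "((\<lambda>s. s * G s $$ (i, j)) \<longlongrightarrow> cmat G1 $$ (i, j)) (at 0)"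
    "((\<lambda>s. G s $$ (i, j) - 1 / s * cmat G1 $$ (i, j)) \<longlongrightarrow> cmat G0 $$ (i, j)) (at 0)"
    unfolding G1 G0 by (fact l1 l0)+
qed

lemma G1_form:
  assumes "v \<in> carrier_vec m" "u \<in> carrier_vec m"
  shows "((\<lambda>s. s * ((G s *\<^sub>v v) \<bullet>c u)) \<longlongrightarrow> (cmat G1 *\<^sub>v v) \<bullet>c u) (at 0)"
  by (rule cscalar_form_tendsto[of G m "cmat G1" "\<lambda>s. s"]) (use assms G1_entry in auto)

text \<open>The term G1 / s vanishes on v, so the difference that defines \<open>G0\<close> acts on
  v as G(s) itself.\<close>

lemma G0_entries_vec:
  assumes v: "v \<in> carrier_vec m" and 0: "cmat G1 *\<^sub>v v = 0\<^sub>v m" and u: "u \<in> carrier_vec m"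
  shows "((\<lambda>s. (G s *\<^sub>v v) \<bullet>c u) \<longlongrightarrow> (cmat G0 *\<^sub>v v) \<bullet>c u) (at 0)"
proof -
  have cG1: "cmat G1 \<in> carrier_mat m m" by simp
  have sG1: "(1 / s) \<cdot>\<^sub>m cmat G1 \<in> carrier_mat m m" for s by simp
  have "((\<lambda>s. 1 * (((G s - (1 / s) \<cdot>\<^sub>m cmat G1) *\<^sub>v v) \<bullet>c u)) \<longlongrightarrow> (cmat G0 *\<^sub>v v) \<bullet>c u) (at 0)"
  proof (rule cscalar_form_tendsto[of _ m "cmat G0"])
    fix i j assume ij: "i < m" "j < m"
    show "((\<lambda>s. 1 * (G s - (1 / s) \<cdot>\<^sub>m cmat G1) $$ (i, j)) \<longlongrightarrow> cmat G0 $$ (i, j)) (at 0)"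
      using G0_entry[OF ij] ij carrier_matD[OF G1_carrier] by simp
  qed (use u v sG1 in \<open>auto intro!: minus_carrier_mat\<close>)
  moreover have "(G s - (1 / s) \<cdot>\<^sub>m cmat G1) *\<^sub>v v = G s *\<^sub>v v" for s
  proof -
    have "((1 / s) \<cdot>\<^sub>m cmat G1) *\<^sub>v v = (1 / s) \<cdot>\<^sub>v (cmat G1 *\<^sub>v v)"
      using v carrier_matD[OF G1_carrier] by (intro eq_vecI) auto
    then show ?thesis using minus_mult_distrib_mat_vec[OF G_carrier sG1 v] v by (simp add: 0)
  qed
  ultimately show ?thesis by simp
qed

text \<open>This is the limit of Re (s x* G(s) x) along s = i w as w decreases to 0, and NI makes
  these numbers nonnegative.\<close>

lemma G1_form_nonneg:
  assumes x: "x \<in> carrier_vec m"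
  shows "0 \<le> Re ((cmat G1 *\<^sub>v x) \<bullet>c x)"
proof (rule tendsto_lowerbound)
  have "((\<lambda>s. s * ((G s *\<^sub>v x) \<bullet>c x)) \<longlongrightarrow> (cmat G1 *\<^sub>v x) \<bullet>c x) (at (\<i> * complex_of_real 0))"
    using G1_form[OF x x] by simp
  from tendsto_Re[OF tendsto_at_imag_axis[OF this]]
  show "((\<lambda>t. Re (\<i> * complex_of_real t * ((G (\<i> * complex_of_real t) *\<^sub>v x) \<bullet>c x))) \<longlongrightarrow>
    Re ((cmat G1 *\<^sub>v x) \<bullet>c x)) (at_right 0)" .
  show "eventually (\<lambda>t. 0 \<le> Re (\<i> * complex_of_real t * ((G (\<i> * complex_of_real t) *\<^sub>v x) \<bullet>c x))) (at_right 0)"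
    using eventually_at_right_less[of 0] eventually_axis_spec[of 0]
    by eventually_elim (use axis_nonpos[OF _ _ x] in \<open>simp only: Re_i_mult, simp add: mult_nonneg_nonpos\<close>)
qed simp

text \<open>The two-sided sign argument used for the value at 0 of a pole-free system works on the
  kernel of \<open>G1\<close>, where G(s) p has a limit. The kernel is closed under conjugation
  because \<open>G1\<close> is real.\<close>

lemma G0_form_real:
  assumes p: "p \<in> carrier_vec m" and 0: "cmat G1 *\<^sub>v p = 0\<^sub>v m"
  shows "Im ((cmat G0 *\<^sub>v p) \<bullet>c p) = 0"
proof -
  have le: "Im ((cmat G0 *\<^sub>v p) \<bullet>c p) \<le> 0" if p: "p \<in> carrier_vec m" and 0: "cmat G1 *\<^sub>v p = 0\<^sub>v m" for p
  proof (rule tendsto_upperbound)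
    have "((\<lambda>s. (G s *\<^sub>v p) \<bullet>c p) \<longlongrightarrow> (cmat G0 *\<^sub>v p) \<bullet>c p) (at (\<i> * complex_of_real 0))"
      using G0_entries_vec[OF p 0 p] by simp
    from tendsto_Im[OF tendsto_at_imag_axis[OF this]]
    show "((\<lambda>t. Im ((G (\<i> * complex_of_real t) *\<^sub>v p) \<bullet>c p)) \<longlongrightarrow> Im ((cmat G0 *\<^sub>v p) \<bullet>c p)) (at_right 0)" .
    show "eventually (\<lambda>t. Im ((G (\<i> * complex_of_real t) *\<^sub>v p) \<bullet>c p) \<le> 0) (at_right 0)"
      using eventually_at_right_less[of 0] eventually_axis_spec[of 0]
      by eventually_elim (use axis_nonpos[OF _ _ p] in simp)
  qed simp
  have "cmat G1 *\<^sub>v conjugate p = 0\<^sub>v m"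
    using conjugate_cmat_mult[OF G1_carrier p] 0 by simp
  from le[OF p 0] le[OF _ this] p cmat_form_conjugate[OF G0_carrier p p] show ?thesis by simp
qed

text \<open>The sign condition makes G1 + G1^T positive semidefinite. If \<open>G1\<close> or its
  transpose kills x, then x . (G1 + G1^T) x = 0, hence (G1 + G1^T) x = 0, and the other one kills x
  as well.\<close>

lemma kernel_real:
  assumes x: "x \<in> carrier_vec m"
  shows "G1 *\<^sub>v x = 0\<^sub>v m \<longleftrightarrow> G1\<^sup>T *\<^sub>v x = 0\<^sub>v m"
proof -
  define M where "M = G1 + G1\<^sup>T"
  have M: "M \<in> carrier_mat m m" by (simp add: M_def)
  have G1T: "G1\<^sup>T \<in> carrier_mat m m" by simp
  have Mx: "M *\<^sub>v x = G1 *\<^sub>v x + G1\<^sup>T *\<^sub>v x" if "x \<in> carrier_vec m" for x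
    unfolding M_def by (rule add_mult_distrib_mat_vec[OF G1_carrier G1T that])
  have G1v: "G1 *\<^sub>v x \<in> carrier_vec m" "G1\<^sup>T *\<^sub>v x \<in> carrier_vec m" if "x \<in> carrier_vec m" for x
    using mult_mat_vec_carrier[OF G1_carrier that] mult_mat_vec_carrier[OF G1T that] by auto
  have tr: "x \<bullet> (G1\<^sup>T *\<^sub>v x) = x \<bullet> (G1 *\<^sub>v x)" if x: "x \<in> carrier_vec m" for x
    using transpose_vec_mult_scalar[OF G1_carrier x x] comm_scalar_prod[OF x G1v(2)[OF x]] by simp
  have form: "x \<bullet> (M *\<^sub>v x) = 2 * (x \<bullet> (G1 *\<^sub>v x))" if x: "x \<in> carrier_vec m" for x
    unfolding Mx[OF x] using scalar_prod_add_distrib[OF x G1v[OF x]] tr[OF x] by simp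
  have "pos_semidef M" unfolding pos_semidef_real[OF M]
  proof (intro conjI ballI)
    show "M\<^sup>T = M" unfolding M_def using transpose_add[OF G1_carrier G1T] comm_add_mat[OF G1_carrier G1T] by simp
    fix y :: "real vec" assume y: "y \<in> carrier_vec m"
    have "0 \<le> Re ((cmat G1 *\<^sub>v cvec y) \<bullet>c cvec y)" by (rule G1_form_nonneg) (use y in simp)
    also have "Re ((cmat G1 *\<^sub>v cvec y) \<bullet>c cvec y) = (G1 *\<^sub>v y) \<bullet> y"
    proof -
      have "re_vec (cvec y) = y" "im_vec (cvec y) = 0\<^sub>v m" using y by auto
      then show ?thesis using cscalar_prod_Re_Im(1)[of "cmat G1 *\<^sub>v cvec y" m "cvec y"] y
          re_vec_cmat_mult[OF G1_carrier, of "cvec y"] G1v(1)[OF y]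
          mult_mat_vec_carrier[of "cmat G1" m m "cvec y"] mult_mat_zero_vec[OF G1_carrier] by simp
    qed
    also have "\<dots> = y \<bullet> (G1 *\<^sub>v y)" by (rule comm_scalar_prod[OF G1v(1)[OF y] y])
    finally show "0 \<le> y \<bullet> (M *\<^sub>v y)" using form[OF y] by simp
  qed
  note null = pos_semidef_null[OF M this x]
  show ?thesis
  proof
    assume "G1 *\<^sub>v x = 0\<^sub>v m"
    with null form[OF x] Mx[OF x] G1v[OF x] x show "G1\<^sup>T *\<^sub>v x = 0\<^sub>v m" by simp
  next
    assume "G1\<^sup>T *\<^sub>v x = 0\<^sub>v m"
    with null form[OF x] Mx[OF x] G1v[OF x] x tr[OF x] show "G1 *\<^sub>v x = 0\<^sub>v m" by simp
  qed
qed

lemma kernel_complex: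
  assumes x: "x \<in> carrier_vec m"
  shows "cmat G1 *\<^sub>v x = 0\<^sub>v m \<longleftrightarrow> cmat (G1\<^sup>T) *\<^sub>v x = 0\<^sub>v m"
proof -
  have G1T: "G1\<^sup>T \<in> carrier_mat m m" by simp
  show ?thesis unfolding cmat_kernel_iff[OF G1_carrier x] cmat_kernel_iff[OF G1T x]
    using kernel_real[of "re_vec x"] kernel_real[of "im_vec x"] x by simp
qed

text \<open>The kernel of \<open>G1\<close> is also its left kernel. This removes a mixed residue at
  0 of the test function in the Schwarz-Pick argument.\<close>

lemma G1_form_left_kernel:
  assumes p: "p \<in> carrier_vec m" "cmat G1 *\<^sub>v p = 0\<^sub>v m" and u: "u \<in> carrier_vec m"
  shows "(cmat G1 *\<^sub>v u) \<bullet>c p = 0"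
proof -
  have "cmat (G1\<^sup>T) *\<^sub>v p = 0\<^sub>v m" using p kernel_complex by simp
  then show ?thesis
    using cscalar_prod_adjoint[of "cmat G1" m m u p] p(1) u by (simp add: mat_adjoint_cmat)
qed

text \<open>The number z x* K x is the residue at z of s x* G(s) x, which the minimum principle
  wants real and nonnegative. For z = i w with w > 0 the NI limit matrix is i times the residue, so
  this number is w times a nonnegative form. Negative frequencies follow by conjugation, and a point
  that is no pole has residue 0.\<close>

lemma axis_residue:
  assumes z: "Re z = 0" "z \<noteq> 0"
  shows "\<exists>K \<in> carrier_mat m m. (\<forall>i<m. \<forall>j<m. ((\<lambda>s. (s - z) * G s $$ (i, j)) \<longlongrightarrow> K $$ (i, j)) (at z)) \<and>
    (\<forall>x \<in> carrier_vec m. 0 \<le> Re (z * ((K *\<^sub>v x) \<bullet>c x)) \<and> Im (z * ((K *\<^sub>v x) \<bullet>c x)) = 0)"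
proof -
  note cG = carrier_matD[OF G_carrier]
  have pos: "\<exists>K \<in> carrier_mat m m. (\<forall>i<m. \<forall>j<m. ((\<lambda>s. (s - z) * G s $$ (i, j)) \<longlongrightarrow> K $$ (i, j)) (at z)) \<and>
    (\<forall>x \<in> carrier_vec m. 0 \<le> Re (z * ((K *\<^sub>v x) \<bullet>c x)) \<and> Im (z * ((K *\<^sub>v x) \<bullet>c x)) = 0)"
    if w: "w > 0" and z: "z = \<i> * complex_of_real w" for w z
  proof (cases "mat_pole m G z")
    case True
    then obtain K where K: "mat_tendsto m (\<lambda>s. ((s - z) * \<i>) \<cdot>\<^sub>m G s) K (at z)" "pos_semidef K"
      using ni w unfolding negative_imaginary_def z by blast
    have Kc: "K \<in> carrier_mat m m" using K(1) by (simp add: mat_tendsto_def)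
    show ?thesis
    proof (intro bexI[of _ "(- \<i>) \<cdot>\<^sub>m K"] conjI allI impI ballI)
      fix i j assume ij: "i < m" "j < m"
      have "((\<lambda>s. (((s - z) * \<i>) \<cdot>\<^sub>m G s) $$ (i, j)) \<longlongrightarrow> K $$ (i, j)) (at z)"
        using K(1) ij by (simp add: mat_tendsto_def)
      then have "((\<lambda>s. - \<i> * ((s - z) * \<i> * G s $$ (i, j))) \<longlongrightarrow> - \<i> * K $$ (i, j)) (at z)"
        using ij cG by (intro tendsto_mult_left) simp
      then show "((\<lambda>s. (s - z) * G s $$ (i, j)) \<longlongrightarrow> ((- \<i>) \<cdot>\<^sub>m K) $$ (i, j)) (at z)"
        using ij Kc by (simp add: algebra_simps)
    next
      fix x :: "complex vec" assume x: "x \<in> carrier_vec m"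
      have "((- \<i>) \<cdot>\<^sub>m K) *\<^sub>v x = (- \<i>) \<cdot>\<^sub>v (K *\<^sub>v x)" using x Kc by (intro eq_vecI) auto
      then have "z * ((((- \<i>) \<cdot>\<^sub>m K) *\<^sub>v x) \<bullet>c x) = complex_of_real w * ((K *\<^sub>v x) \<bullet>c x)"
        using x Kc smult_scalar_prod_distrib[of "K *\<^sub>v x" m "conjugate x" "- \<i>"]
        by (simp add: z) (simp add: complex_eq_iff)
      with pos_semidef_complexD[OF K(2) Kc x] w
      show "0 \<le> Re (z * ((((- \<i>) \<cdot>\<^sub>m K) *\<^sub>v x) \<bullet>c x))" "Im (z * ((((- \<i>) \<cdot>\<^sub>m K) *\<^sub>v x) \<bullet>c x)) = 0"
        by simp_all
    qed (use Kc in simp)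
  next
    case False
    show ?thesis
    proof (intro bexI[of _ "0\<^sub>m m m"] conjI allI impI ballI)
      fix i j assume ij: "i < m" "j < m"
      have "((\<lambda>s. (s - z) * G s $$ (i, j)) \<longlongrightarrow> (z - z) * G z $$ (i, j)) (at z)"
        using G_isCont[OF False ij] by (intro tendsto_intros) (simp add: isCont_def)
      then show "((\<lambda>s. (s - z) * G s $$ (i, j)) \<longlongrightarrow> 0\<^sub>m m m $$ (i, j)) (at z)" using ij by simp
    qed auto
  qed
  show ?thesis
  proof (cases "Im z > 0")
    case True
    then show ?thesis using pos[of "Im z" z] imag_axis_form[OF z(1)] by simp
  next
    case False
    then have w: "- Im z > 0" using z by (metis complex_eq_iff linorder_cases neg_0_less_iff_less zero_complex.sel)
    have cz: "cnj z = \<i> * complex_of_real (- Im z)" using z(1) by (simp add: complex_eq_iff)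
    from pos[OF w cz] obtain K where K: "K \<in> carrier_mat m m"
      and lim: "\<And>i j. i < m \<Longrightarrow> j < m \<Longrightarrow> ((\<lambda>s. (s - cnj z) * G s $$ (i, j)) \<longlongrightarrow> K $$ (i, j)) (at (cnj z))"
      and psd: "\<And>x. x \<in> carrier_vec m \<Longrightarrow> 0 \<le> Re (cnj z * ((K *\<^sub>v x) \<bullet>c x)) \<and> Im (cnj z * ((K *\<^sub>v x) \<bullet>c x)) = 0"
      by blast
    have cnj_lim: "filterlim cnj (at (cnj z)) (at z)"
      by (auto simp: filterlim_at eventually_at_filter intro!: tendsto_intros)
    show ?thesis
    proof (intro bexI[of _ "map_mat cnj K"] conjI allI impI ballI)
      fix i j assume ij: "i < m" "j < m"
      from tendsto_cnj[OF filterlim_compose[OF lim[OF ij] cnj_lim]]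
      have "((\<lambda>s. cnj ((cnj s - cnj z) * G (cnj s) $$ (i, j))) \<longlongrightarrow> cnj (K $$ (i, j))) (at z)" .
      moreover have "eventually (\<lambda>s. cnj ((cnj s - cnj z) * G (cnj s) $$ (i, j)) = (s - z) * G s $$ (i, j)) (at z)"
        using eventually_not_in_finite_at[OF finite_spec, of z]
        by eventually_elim (simp add: G_cnj_index[OF _ ij])
      ultimately have "((\<lambda>s. (s - z) * G s $$ (i, j)) \<longlongrightarrow> cnj (K $$ (i, j))) (at z)"
        by (rule Lim_transform_eventually)
      then show "((\<lambda>s. (s - z) * G s $$ (i, j)) \<longlongrightarrow> map_mat cnj K $$ (i, j)) (at z)" using ij K by simp
    next
      fix x :: "complex vec" assume x: "x \<in> carrier_vec m"
      have "map_mat cnj K *\<^sub>v x = conjugate (K *\<^sub>v conjugate x)"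
        using K x by (intro eq_vecI) (auto simp: scalar_prod_def)
      then have "(map_mat cnj K *\<^sub>v x) \<bullet>c x = cnj ((K *\<^sub>v conjugate x) \<bullet>c conjugate x)"
        using cscalar_prod_conjugate[of "K *\<^sub>v conjugate x" m "conjugate x"] K x by simp
      then have "z * ((map_mat cnj K *\<^sub>v x) \<bullet>c x) = cnj (cnj z * ((K *\<^sub>v conjugate x) \<bullet>c conjugate x))" by simp
      moreover have "0 \<le> Re (cnj (cnj z * ((K *\<^sub>v conjugate x) \<bullet>c conjugate x)))"
        "Im (cnj (cnj z * ((K *\<^sub>v conjugate x) \<bullet>c conjugate x))) = 0"
        using psd[of "conjugate x"] x by (simp_all only: cnj.sel carrier_vec_conjugate neg_equal_0_iff_equal)
      ultimately show "0 \<le> Re (z * ((map_mat cnj K *\<^sub>v x) \<bullet>c x))" "Im (z * ((map_mat cnj K *\<^sub>v x) \<bullet>c x)) = 0" by (simp_all only:)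
    qed (use K in simp)
  qed
qed

end

context ni_system
begin

text \<open>A Schwarz-Pick inequality for the positive real function s G(s) at the nodes s0 and 0. The test
  function is (u + b~ p)* (s G(s)) (u + b p) with b(s) = (s0 - s) / s, where b~ is analytic and
  agrees with the conjugate of b on the imaginary axis; the last term cancels the pole at 0.\<close>

lemma pick_inequality:
  assumes s0: "0 < Re s0" and u: "u \<in> carrier_vec m"
    and p: "p \<in> carrier_vec m" "cmat G1 *\<^sub>v p = 0\<^sub>v m"
  shows "Re s0 * (2 * Re ((G s0 *\<^sub>v u) \<bullet>c p) - Re ((cmat G0 *\<^sub>v p) \<bullet>c p)) \<le> Re (s0 * ((G s0 *\<^sub>v u) \<bullet>c u))"
proof -
  define g where "g = (\<lambda>v w s. (G s *\<^sub>v v) \<bullet>c w)"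
  define c where "c = (cmat G0 *\<^sub>v p) \<bullet>c p"
  define N where "N = complex_of_real ((cmod s0)\<^sup>2)"
  have c: "Im c = 0" unfolding c_def by (rule G0_form_real[OF p])
  \<comment> \<open>b vanishes at \<open>s0\<close>, so that the terms carrying it drop out there,
    and has a pole at 0, so that p is tested against \<open>G0\<close>.\<close>
  define b where "b = (\<lambda>s. (s0 - s) / s)"
  define b' where "b' = (\<lambda>s. - (cnj s0 + s) / s)"
  \<comment> \<open>Near 0 the product s b(s) b'(s) behaves like -|s0|^2 / s, which fixes
    \<open>N\<close> = |s0|^2. As N c is real, the correction N c / s is imaginary on the axis and
    does not disturb the sign there.\<close>
  define Q where "Q = (\<lambda>s. s * (g u u s + b s * g p u s + b' s * g u p s + b s * b' s * g p p s) + N * c / s)"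
  define E where "E = insert 0 lspec"
  have gform: "(G s *\<^sub>v (u + a \<cdot>\<^sub>v p)) \<bullet>c (u + a \<cdot>\<^sub>v p) =
      g u u s + a * g p u s + cnj a * g u p s + a * cnj a * g p p s" for s a
  proof -
    have ap: "a \<cdot>\<^sub>v p \<in> carrier_vec m" using p by simp
    have Gu: "G s *\<^sub>v u \<in> carrier_vec m" and Gp: "G s *\<^sub>v p \<in> carrier_vec m" using u p by auto
    have "G s *\<^sub>v (u + a \<cdot>\<^sub>v p) = G s *\<^sub>v u + a \<cdot>\<^sub>v (G s *\<^sub>v p)"
      using mult_add_distrib_mat_vec[OF G_carrier u ap] mult_mat_vec[OF G_carrier p(1)] by simp
    moreover have "conjugate (u + a \<cdot>\<^sub>v p) = conjugate u + cnj a \<cdot>\<^sub>v conjugate p"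
      using conjugate_add_vec[OF u ap] by (simp add: conjugate_smult_vec)
    moreover have "(x + a \<cdot>\<^sub>v y) \<bullet> (v + d \<cdot>\<^sub>v w) = x \<bullet> v + a * (y \<bullet> v) + d * (x \<bullet> w) + a * d * (y \<bullet> w)"
      if "x \<in> carrier_vec m" "y \<in> carrier_vec m" "v \<in> carrier_vec m" "w \<in> carrier_vec m"
      for x y v w :: "complex vec" and d
      using that by (simp add: add_scalar_prod_distrib[of _ m] scalar_prod_add_distrib[of _ m] algebra_simps)
    ultimately show ?thesis
      using Gu Gp u p by (simp add: g_def)
  qed
  have Qaxis: "Re (Q s) = Re (s * ((G s *\<^sub>v (u + b s \<cdot>\<^sub>v p)) \<bullet>c (u + b s \<cdot>\<^sub>v p)))"
    if s: "Re s = 0" "s \<noteq> 0" for s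
  proof -
    have cs: "cnj s = - s" using s by (simp add: complex_eq_iff)
    have "b' s = cnj (b s)" using s(2) by (simp add: b_def b'_def cs field_simps)
    moreover have "Re (N * c / s) = 0" using s c by (simp add: N_def Re_divide)
    ultimately show ?thesis unfolding Q_def gform by simp
  qed
  have hol: "Q holomorphic_on - E" unfolding Q_def g_def b_def b'_def
    by (intro holomorphic_intros holomorphic_on_subset[OF form_holomorphic[OF no_pole]])
      (use u p in \<open>auto simp: E_def\<close>)
  have res: "\<exists>r\<ge>0. ((\<lambda>s. (s - z) * Q s) \<longlongrightarrow> complex_of_real r) (at z)" if z: "z \<in> E" "Re z = 0" for z
  proof (cases "z = 0")
    case True
    have "((\<lambda>s. s * (s * g u u s) + (s0 - s) * (s * g p u s) + - (cnj s0 + s) * (s * g u p s)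
        + (s0 - s) * (- (cnj s0 + s)) * g p p s + N * c) \<longlongrightarrow>
        0 * ((cmat G1 *\<^sub>v u) \<bullet>c u) + (s0 - 0) * ((cmat G1 *\<^sub>v p) \<bullet>c u)
        + - (cnj s0 + 0) * ((cmat G1 *\<^sub>v u) \<bullet>c p)
        + (s0 - 0) * (- (cnj s0 + 0)) * c + N * c) (at 0)"
      unfolding g_def c_def by (intro tendsto_intros G1_form u p G0_entries_vec)
    \<comment> \<open>The mixed terms vanish because p lies in the kernel of \<open>G1\<close> on
      either side, and the remaining - s0 cnj(s0) c is cancelled by N c.\<close>
    moreover have "0 * ((cmat G1 *\<^sub>v u) \<bullet>c u) + (s0 - 0) * ((cmat G1 *\<^sub>v p) \<bullet>c u)
        + - (cnj s0 + 0) * ((cmat G1 *\<^sub>v u) \<bullet>c p) + (s0 - 0) * (- (cnj s0 + 0)) * c + N * c = 0"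
      using G1_form_left_kernel[OF p u] p(2) u complex_norm_square[of s0] by (simp add: N_def)
    moreover have "eventually (\<lambda>s. s * (s * g u u s) + (s0 - s) * (s * g p u s) + - (cnj s0 + s) * (s * g u p s)
        + (s0 - s) * (- (cnj s0 + s)) * g p p s + N * c = (s - z) * Q s) (at z)"
      using eventually_neq_at_within[of z z UNIV]
      by eventually_elim (simp add: True Q_def b_def b'_def field_simps)
    ultimately have "((\<lambda>s. (s - z) * Q s) \<longlongrightarrow> complex_of_real 0) (at z)"
      using True by (auto intro: Lim_transform_eventually)
    then show ?thesis by blast
  next
    case False
    from axis_residue[OF z(2) False] obtain K where K: "K \<in> carrier_mat m m"
      and lim: "\<And>i j. i < m \<Longrightarrow> j < m \<Longrightarrow> ((\<lambda>s. (s - z) * G s $$ (i, j)) \<longlongrightarrow> K $$ (i, j)) (at z)"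
      and psd: "\<And>x. x \<in> carrier_vec m \<Longrightarrow> 0 \<le> Re (z * ((K *\<^sub>v x) \<bullet>c x)) \<and> Im (z * ((K *\<^sub>v x) \<bullet>c x)) = 0"
      by blast
    have klim: "((\<lambda>s. (s - z) * g v w s) \<longlongrightarrow> (K *\<^sub>v v) \<bullet>c w) (at z)"
      if "v \<in> carrier_vec m" "w \<in> carrier_vec m" for v w
      unfolding g_def by (rule cscalar_form_tendsto) (use K lim that in auto)
    have bz: "b' z = cnj (b z)"
    proof -
      have "cnj z = - z" using z by (simp add: complex_eq_iff)
      then show ?thesis using False by (simp add: b_def b'_def field_simps)
    qed
    have blim: "(b \<longlongrightarrow> b z) (at z)" "(b' \<longlongrightarrow> b' z) (at z)"
      unfolding b_def b'_def using False by (auto intro!: tendsto_intros)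
    define x where "x = u + b z \<cdot>\<^sub>v p"
    have x: "x \<in> carrier_vec m" using u p by (simp add: x_def)
    have "((\<lambda>s. s * ((s - z) * g u u s + b s * ((s - z) * g p u s) + b' s * ((s - z) * g u p s)
        + b s * b' s * ((s - z) * g p p s)) + (s - z) * (N * c / s)) \<longlongrightarrow>
        z * ((K *\<^sub>v u) \<bullet>c u + b z * ((K *\<^sub>v p) \<bullet>c u) + b' z * ((K *\<^sub>v u) \<bullet>c p)
        + b z * b' z * ((K *\<^sub>v p) \<bullet>c p)) + (z - z) * (N * c / z)) (at z)"
      by (intro tendsto_intros klim blim u p False)
    moreover have "(\<lambda>s. s * ((s - z) * g u u s + b s * ((s - z) * g p u s) + b' s * ((s - z) * g u p s)
        + b s * b' s * ((s - z) * g p p s)) + (s - z) * (N * c / s)) = (\<lambda>s. (s - z) * Q s)"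
      by (auto simp: Q_def algebra_simps)
    moreover have "(K *\<^sub>v u) \<bullet>c u + b z * ((K *\<^sub>v p) \<bullet>c u) + b' z * ((K *\<^sub>v u) \<bullet>c p)
        + b z * b' z * ((K *\<^sub>v p) \<bullet>c p) = (K *\<^sub>v x) \<bullet>c x"
    proof -
      have ap: "b z \<cdot>\<^sub>v p \<in> carrier_vec m" using p by simp
      have Ku: "K *\<^sub>v u \<in> carrier_vec m" and Kp: "K *\<^sub>v p \<in> carrier_vec m" using u p K by auto
      have "K *\<^sub>v x = K *\<^sub>v u + b z \<cdot>\<^sub>v (K *\<^sub>v p)" unfolding x_def
        using mult_add_distrib_mat_vec[OF K u ap] mult_mat_vec[OF K p(1)] by simp
      moreover have "conjugate x = conjugate u + b' z \<cdot>\<^sub>v conjugate p" unfolding x_def bz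
        using conjugate_add_vec[OF u ap] by (simp add: conjugate_smult_vec)
      ultimately show ?thesis using Ku Kp u p
        by (simp add: add_scalar_prod_distrib[of _ m] scalar_prod_add_distrib[of _ m] algebra_simps)
    qed
    ultimately have "((\<lambda>s. (s - z) * Q s) \<longlongrightarrow> z * ((K *\<^sub>v x) \<bullet>c x)) (at z)" by simp
    moreover have "z * ((K *\<^sub>v x) \<bullet>c x) = complex_of_real (Re (z * ((K *\<^sub>v x) \<bullet>c x)))"
      using psd[OF x] by (simp add: complex_eq_iff)
    ultimately show ?thesis using psd[OF x] by metis
  qed
  have axis: "0 \<le> Re (Q s)" if s: "Re s = 0" "s \<notin> E" for s
  proof -
    define v where "v = Im s"
    have sv: "s = \<i> * complex_of_real v" using imag_axis_form[OF s(1)] by (simp add: v_def)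
    have s00: "s \<noteq> 0" using s(2) by (auto simp: E_def)
    then have v0: "v \<noteq> 0" using sv by auto
    have ns: "\<i> * complex_of_real v \<notin> spec" using s sv by (auto simp: lspec_def E_def)
    have "0 \<le> - v * Im ((G (\<i> * complex_of_real v) *\<^sub>v (u + b s \<cdot>\<^sub>v p)) \<bullet>c (u + b s \<cdot>\<^sub>v p))"
      by (rule axis_form_sign[OF axis_nonpos v0 ns]) (use u p in auto)
    moreover have "Re (s * w) = - v * Im w" for w using s(1) by (simp add: v_def)
    ultimately show ?thesis unfolding Qaxis[OF s(1) s00] by (simp add: sv[symmetric])
  qed
  have lim: "\<exists>l. (Q \<longlongrightarrow> l) at_infinity"
  proof -
    have clim: "((\<lambda>s. s * g v w s) \<longlongrightarrow> (cmat (C * B) *\<^sub>v v) \<bullet>c w) at_infinity"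
      if "v \<in> carrier_vec m" "w \<in> carrier_vec m" for v w
      unfolding g_def by (rule cscalar_form_tendsto) (use B C sG_tendsto[OF D_zero] that in auto)
    have inv: "((\<lambda>s. inverse s) \<longlongrightarrow> (0::complex)) at_infinity" by (rule tendsto_inverse_0)
    have ne: "eventually (\<lambda>s::complex. s \<noteq> 0) at_infinity"
      using eventually_not_in_finite_infinity[of "{0}"] by simp
    have "((\<lambda>s. s0 * inverse s - 1) \<longlongrightarrow> s0 * 0 - 1) at_infinity" by (intro tendsto_intros inv)
    then have bl: "(b \<longlongrightarrow> s0 * 0 - 1) at_infinity"
      by (rule Lim_transform_eventually) (use ne in \<open>eventually_elim, simp add: b_def field_simps\<close>)
    have "((\<lambda>s. - (cnj s0 * inverse s + 1)) \<longlongrightarrow> - (cnj s0 * 0 + 1)) at_infinity" by (intro tendsto_intros inv)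
    then have bl': "(b' \<longlongrightarrow> - (cnj s0 * 0 + 1)) at_infinity"
      by (rule Lim_transform_eventually) (use ne in \<open>eventually_elim, simp add: b'_def field_simps\<close>)
    have "Q = (\<lambda>s. s * g u u s + b s * (s * g p u s) + b' s * (s * g u p s) + b s * b' s * (s * g p p s)
        + N * c * inverse s)"
      by (auto simp: Q_def algebra_simps divide_inverse)
    then show ?thesis
      using tendsto_add[OF tendsto_add[OF tendsto_add[OF tendsto_add[OF clim[OF u u]
        tendsto_mult[OF bl clim[OF p(1) u]]] tendsto_mult[OF bl' clim[OF u p(1)]]]
        tendsto_mult[OF tendsto_mult[OF bl bl'] clim[OF p(1) p(1)]]] tendsto_mult[OF tendsto_const inv]] by auto
  qed
  then obtain l where l: "(Q \<longlongrightarrow> l) at_infinity" by blast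
  have "0 \<le> Re (Q s0)"
    by (rule half_plane_minimum_weak[OF _ _ hol res axis l s0])
      (use finite_lspec in \<open>auto simp: E_def lspec_def\<close>)
  have s00: "s0 \<noteq> 0" using s0 by auto
  \<comment> \<open>Here s0 b'(s0) = -2 Re s0 and N c / s0 = cnj(s0) c; nonnegativity of the real
    part of this value is the claimed inequality.\<close>
  have "Q s0 = s0 * g u u s0 - complex_of_real (2 * Re s0) * g u p s0 + cnj s0 * c"
  proof -
    have "b s0 = 0" by (simp add: b_def)
    moreover have "s0 * b' s0 = - complex_of_real (2 * Re s0)" using s00
      by (simp add: b'_def) (simp add: complex_eq_iff)
    moreover have "N * c / s0 = cnj s0 * c" using s00 complex_norm_square[of s0] by (simp add: N_def)
    ultimately show ?thesis by (simp add: Q_def distrib_left flip: mult.assoc)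
  qed
  then have "Re (Q s0) = Re (s0 * g u u s0) - 2 * Re s0 * Re (g u p s0) + Re s0 * Re c" using c by simp
  with \<open>0 \<le> Re (Q s0)\<close> show ?thesis by (simp add: g_def c_def algebra_simps)
qed

end

section \<open>The feedback loop\<close>

lemma cmat_add: "A \<in> carrier_mat n k \<Longrightarrow> B \<in> carrier_mat n k \<Longrightarrow> cmat (A + B) = cmat A + cmat B"
  by auto

lemma append_vec_smult: "s \<cdot>\<^sub>v (a @\<^sub>v b) = (s \<cdot>\<^sub>v a) @\<^sub>v (s \<cdot>\<^sub>v b)"
  by (intro eq_vecI) auto

lemma append_vec_minus:
  assumes "a \<in> carrier_vec n" "b \<in> carrier_vec k" "c \<in> carrier_vec n" "d \<in> carrier_vec k"
  shows "(a @\<^sub>v b) - (c @\<^sub>v d) = (a - c) @\<^sub>v (b - (d :: 'a :: ring vec))"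
  using assms by (intro eq_vecI) auto

lemma zero_append_vec: "0\<^sub>v n @\<^sub>v 0\<^sub>v k = 0\<^sub>v (n + k)"
  by (intro eq_vecI) auto

lemma minv_one: "minv (1\<^sub>m n :: 'a :: field mat) = 1\<^sub>m n"
  using minv_mult[of "1\<^sub>m n :: 'a mat" n] by simp

lemma cvec_conjugate [simp]: "conjugate (cvec x) = cvec x"
  by (intro eq_vecI) auto

section \<open>The closed-loop matrix, its eigenvectors and the disturbance response\<close>

locale feedback = N: ni_system m n G A B C D + S: sni_system m n' Gb A' B' C' D'
  for m n n' G Gb A B C D A' B' C' D'
begin

definition Acl :: "real mat" where
  "Acl = four_block_mat (A + B * D' * C) (B * C') (B' * C) A'"

lemma blocks:
  "A + B * D' * C \<in> carrier_mat n n" "B * C' \<in> carrier_mat n n'" "B' * C \<in> carrier_mat n' n" "A' \<in> carrier_mat n' n'"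
  using N.A N.B N.C S.A S.B S.C S.D by auto

lemma Acl_carrier [simp]: "Acl \<in> carrier_mat (n + n') (n + n')"
  unfolding Acl_def by (rule four_block_carrier_mat[OF blocks(1,4)])

lemma closed_loop: "closed_loop_matrix m A B C D A' B' C' D' = Acl"
proof -
  have 1: "1\<^sub>m m - D * D' = 1\<^sub>m m" using N.D_zero S.D by auto
  have "A + B * D' * 1\<^sub>m m * C = A + B * D' * C" using N.B S.D by simp
  moreover have "B * C' + B * D' * 1\<^sub>m m * D * C' = B * C'"
    using N.B S.D S.C blocks(2) by (simp add: N.D_zero)
  moreover have "B' * 1\<^sub>m m * C = B' * C" using S.B by simp
  moreover have "A' + B' * 1\<^sub>m m * D * C' = A'" using S.A S.B S.C by (simp add: N.D_zero)
  ultimately show ?thesis by (simp add: closed_loop_matrix_def Acl_def 1 minv_one)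
qed

lemma well_posed: "invertible_mat (1\<^sub>m m - D * D')"
proof -
  have "1\<^sub>m m - D * D' = 1\<^sub>m m" using N.D_zero S.D by auto
  then show ?thesis using invertible_mat_iff_det[of "1\<^sub>m m :: real mat" m] by simp
qed

text \<open>Splits the closed-loop pencil into the two open-loop state equations, each driven by the
  output of the other system.\<close>

lemma pencil_Acl:
  assumes x: "x \<in> carrier_vec n" and x': "x' \<in> carrier_vec n'"
  defines "y \<equiv> cmat C *\<^sub>v x"
  shows "pencil Acl s *\<^sub>v (x @\<^sub>v x') =
    (pencil A s *\<^sub>v x - cmat B *\<^sub>v (cmat C' *\<^sub>v x' + cmat D' *\<^sub>v y)) @\<^sub>v (pencil A' s *\<^sub>v x' - cmat B' *\<^sub>v y)"
proof -
  have y: "y \<in> carrier_vec m" using N.C x by (simp add: y_def)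
  have cC'x: "cmat C' *\<^sub>v x' \<in> carrier_vec m" and cD'y: "cmat D' *\<^sub>v y \<in> carrier_vec m"
    and Ax: "cmat A *\<^sub>v x \<in> carrier_vec n" and A'x: "cmat A' *\<^sub>v x' \<in> carrier_vec n'"
    and B'y: "cmat B' *\<^sub>v y \<in> carrier_vec n'"
    using N.A S.A S.B S.C S.D x x' y by auto
  have cB: "cmat B \<in> carrier_mat n m" using N.B by simp
  have BC: "cmat B *\<^sub>v (cmat C' *\<^sub>v x') \<in> carrier_vec n" and BD: "cmat B *\<^sub>v (cmat D' *\<^sub>v y) \<in> carrier_vec n"
    using cB cC'x cD'y by auto
  have xx: "x @\<^sub>v x' \<in> carrier_vec (n + n')" using x x' by simp
  have BDC: "B * D' * C \<in> carrier_mat n n" and BD': "B * D' \<in> carrier_mat n m" using N.B N.C S.D by auto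
  have cA: "cmat A \<in> carrier_mat n n" and cBDC: "cmat (B * D' * C) \<in> carrier_mat n n" using N.A BDC by auto
  have "cmat (A + B * D' * C) = cmat A + cmat (B * D' * C)" by (rule cmat_add[OF N.A BDC])
  then have 1: "cmat (A + B * D' * C) *\<^sub>v x = cmat A *\<^sub>v x + cmat B *\<^sub>v (cmat D' *\<^sub>v y)"
    using add_mult_distrib_mat_vec[OF cA cBDC x] cmat_mult_vec[OF BD' N.C x] cmat_mult_vec[OF N.B S.D y]
    by (simp add: y_def)
  have 2: "cmat (B * C') *\<^sub>v x' = cmat B *\<^sub>v (cmat C' *\<^sub>v x')" by (rule cmat_mult_vec[OF N.B S.C x'])
  have 3: "cmat (B' * C) *\<^sub>v x = cmat B' *\<^sub>v y" unfolding y_def by (rule cmat_mult_vec[OF S.B N.C x])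
  have "cmat Acl = four_block_mat (cmat (A + B * D' * C)) (cmat (B * C')) (cmat (B' * C)) (cmat A')"
    unfolding Acl_def by (rule map_four_block_mat[OF blocks])
  then have "cmat Acl *\<^sub>v (x @\<^sub>v x') =
    (cmat (A + B * D' * C) *\<^sub>v x + cmat (B * C') *\<^sub>v x') @\<^sub>v (cmat (B' * C) *\<^sub>v x + cmat A' *\<^sub>v x')"
    using four_block_mat_mult_vec[of "cmat (A + B * D' * C)" n n "cmat (B * C')" n' "cmat (B' * C)" n' "cmat A'" x x']
      blocks x x' by simp
  also have "\<dots> = (cmat A *\<^sub>v x + cmat B *\<^sub>v (cmat D' *\<^sub>v y) + cmat B *\<^sub>v (cmat C' *\<^sub>v x')) @\<^sub>v
      (cmat B' *\<^sub>v y + cmat A' *\<^sub>v x')" unfolding 1 2 3 ..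
  finally have "pencil Acl s *\<^sub>v (x @\<^sub>v x') =
    (s \<cdot>\<^sub>v x - (cmat A *\<^sub>v x + cmat B *\<^sub>v (cmat D' *\<^sub>v y) + cmat B *\<^sub>v (cmat C' *\<^sub>v x'))) @\<^sub>v
    (s \<cdot>\<^sub>v x' - (cmat B' *\<^sub>v y + cmat A' *\<^sub>v x'))"
    unfolding pencil_mult[OF Acl_carrier xx] append_vec_smult
    using x x' Ax A'x BC BD B'y by (simp add: append_vec_minus[of _ n _ n'])
  moreover have "s \<cdot>\<^sub>v x - (cmat A *\<^sub>v x + cmat B *\<^sub>v (cmat D' *\<^sub>v y) + cmat B *\<^sub>v (cmat C' *\<^sub>v x')) =
      pencil A s *\<^sub>v x - cmat B *\<^sub>v (cmat C' *\<^sub>v x' + cmat D' *\<^sub>v y)"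
    unfolding pencil_mult[OF N.A x] mult_add_distrib_mat_vec[OF cB cC'x cD'y]
    using x Ax BC BD carrier_vecD[OF BC] carrier_vecD[OF BD] carrier_vecD[OF Ax]
    by (intro eq_vecI) (simp_all add: algebra_simps del: index_mult_mat_vec dim_mult_mat_vec)
  moreover have "s \<cdot>\<^sub>v x' - (cmat B' *\<^sub>v y + cmat A' *\<^sub>v x') = pencil A' s *\<^sub>v x' - cmat B' *\<^sub>v y"
    unfolding pencil_mult[OF S.A x'] using x' A'x B'y carrier_vecD[OF B'y] carrier_vecD[OF A'x]
    by (intro eq_vecI) (simp_all add: algebra_simps del: index_mult_mat_vec dim_mult_mat_vec)
  ultimately show ?thesis by simp
qed

lemma eigenvector_Acl:
  assumes "eigenvalue (cmat Acl) s"
  obtains x x' where "x \<in> carrier_vec n" "x' \<in> carrier_vec n'" "x \<noteq> 0\<^sub>v n \<or> x' \<noteq> 0\<^sub>v n'"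
    "pencil A s *\<^sub>v x = cmat B *\<^sub>v (cmat C' *\<^sub>v x' + cmat D' *\<^sub>v (cmat C *\<^sub>v x))"
    "pencil A' s *\<^sub>v x' = cmat B' *\<^sub>v (cmat C *\<^sub>v x)"
proof -
  from assms obtain v where v: "v \<in> carrier_vec (n + n')" "v \<noteq> 0\<^sub>v (n + n')" "pencil Acl s *\<^sub>v v = 0\<^sub>v (n + n')"
    by (auto simp: eigenvalue_iff_pencil[OF Acl_carrier])
  define x x' where "x = vec_first v n" and "x' = vec_last v n'"
  have x: "x \<in> carrier_vec n" and x': "x' \<in> carrier_vec n'" by (auto simp: x_def x'_def)
  have vx: "v = x @\<^sub>v x'" unfolding x_def x'_def by (rule vec_first_last_append[OF v(1), symmetric])
  let ?y = "cmat C *\<^sub>v x" and ?u = "cmat C' *\<^sub>v x' + cmat D' *\<^sub>v (cmat C *\<^sub>v x)"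
  have y: "?y \<in> carrier_vec m" using N.C x by simp
  have u: "?u \<in> carrier_vec m" using S.C S.D x' y by simp
  have Bu: "cmat B *\<^sub>v ?u \<in> carrier_vec n" and B'y: "cmat B' *\<^sub>v ?y \<in> carrier_vec n'"
    using N.B S.B u y by auto
  have px: "pencil A s *\<^sub>v x \<in> carrier_vec n" and px': "pencil A' s *\<^sub>v x' \<in> carrier_vec n'"
    using mult_mat_vec_carrier[OF pencil_carrier[OF N.A] x] mult_mat_vec_carrier[OF pencil_carrier[OF S.A] x'] by auto
  have "(pencil A s *\<^sub>v x - cmat B *\<^sub>v ?u) @\<^sub>v (pencil A' s *\<^sub>v x' - cmat B' *\<^sub>v ?y) = 0\<^sub>v n @\<^sub>v 0\<^sub>v n'"
    using v(3) unfolding vx pencil_Acl[OF x x'] zero_append_vec .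
  then have "pencil A s *\<^sub>v x - cmat B *\<^sub>v ?u = 0\<^sub>v n" "pencil A' s *\<^sub>v x' - cmat B' *\<^sub>v ?y = 0\<^sub>v n'"
    using append_vec_eq[of "pencil A s *\<^sub>v x - cmat B *\<^sub>v ?u" n "0\<^sub>v n"] px Bu by auto
  then have eqs: "pencil A s *\<^sub>v x = cmat B *\<^sub>v ?u" "pencil A' s *\<^sub>v x' = cmat B' *\<^sub>v ?y"
    using vec_minus_eq_iff[OF px Bu, of "0\<^sub>v n"] vec_minus_eq_iff[OF px' B'y, of "0\<^sub>v n'"] Bu B'y by auto
  have "x \<noteq> 0\<^sub>v n \<or> x' \<noteq> 0\<^sub>v n'" using v(2) vx zero_append_vec by auto
  with that[OF x x' _ eqs] show thesis by blast
qed

text \<open>The closed-loop map from a disturbance at the input of G to the output of G.\<close>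

definition Bcl :: "real mat" where "Bcl = B @\<^sub>r 0\<^sub>m n' m"
definition Ccl :: "real mat" where "Ccl = (C\<^sup>T @\<^sub>r 0\<^sub>m n' m)\<^sup>T"

abbreviation T :: "complex \<Rightarrow> complex mat" where "T \<equiv> tf Acl Bcl Ccl (0\<^sub>m m m)"

lemma state_space_cl: "state_space (n + n') m m Acl Bcl Ccl (0\<^sub>m m m)"
  by unfold_locales (use N.B N.C in \<open>auto simp: Bcl_def Ccl_def\<close>)

lemma Bcl_mult: "v \<in> carrier_vec m \<Longrightarrow> cmat Bcl *\<^sub>v v = (cmat B *\<^sub>v v) @\<^sub>v 0\<^sub>v n'"
proof -
  assume v: "v \<in> carrier_vec m"
  have "cmat Bcl = cmat B @\<^sub>r 0\<^sub>m n' m"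
    unfolding Bcl_def append_rows_def using N.B by (intro eq_matI) (auto simp: less_Suc_eq)
  then show ?thesis using mat_mult_append[of "cmat B" n m "0\<^sub>m n' m" n' v] N.B v by simp
qed

lemma Ccl_mult:
  assumes x: "x \<in> carrier_vec n" "x' \<in> carrier_vec n'"
  shows "cmat Ccl *\<^sub>v (x @\<^sub>v x') = cmat C *\<^sub>v x"
proof -
  have "cmat Ccl = four_block_mat (cmat C) (0\<^sub>m m n') (0\<^sub>m 0 n) (0\<^sub>m 0 n')"
    unfolding Ccl_def append_rows_def using N.C by (intro eq_matI) auto
  then have "cmat Ccl *\<^sub>v (x @\<^sub>v x') = (cmat C *\<^sub>v x + 0\<^sub>m m n' *\<^sub>v x') @\<^sub>v (0\<^sub>m 0 n *\<^sub>v x + 0\<^sub>m 0 n' *\<^sub>v x')"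
    using four_block_mat_mult_vec[of "cmat C" m n "0\<^sub>m m n'" n' "0\<^sub>m 0 n" 0 "0\<^sub>m 0 n'" x x'] N.C x by simp
  also have "\<dots> = cmat C *\<^sub>v x" using N.C x by (intro eq_vecI) auto
  finally show ?thesis .
qed

text \<open>This expresses T = G (I - Gbar G)^{-1} at generic s without an inverse: u - Gbar y is
  the disturbance that must be added to the output of Gbar in order to drive G with u.\<close>

lemma T_mult:
  assumes s: "s \<notin> N.spec" "s \<notin> S.spec" "\<not> eigenvalue (cmat Acl) s"
    and u: "u \<in> carrier_vec m"
  defines "y \<equiv> G s *\<^sub>v u"
  shows "T s *\<^sub>v (u - Gb s *\<^sub>v y) = y"
proof -
  interpret cl: state_space "n + n'" m m Acl Bcl Ccl "0\<^sub>m m m" by (rule state_space_cl)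
  have sA: "\<not> eigenvalue (cmat A) s" and sA': "\<not> eigenvalue (cmat A') s" using s by (auto simp: N.spec_def S.spec_def)
  have y: "y \<in> carrier_vec m" using u by (simp add: y_def)
  have Bu: "cmat B *\<^sub>v u \<in> carrier_vec n" and B'y: "cmat B' *\<^sub>v y \<in> carrier_vec n'" using N.B S.B u y by auto
  from N.state_exists[OF sA Bu] obtain x where x: "x \<in> carrier_vec n" "pencil A s *\<^sub>v x = cmat B *\<^sub>v u" by blast
  from S.state_exists[OF sA' B'y] obtain x' where x': "x' \<in> carrier_vec n'" "pencil A' s *\<^sub>v x' = cmat B' *\<^sub>v y" by blast
  have Cx: "cmat C *\<^sub>v x \<in> carrier_vec m" using N.C x by simp
  have yx: "y = cmat C *\<^sub>v x"
    using N.tf_mult[OF sA x(1) u x(2)] N.G_tf[OF s(1)] Cx u by (simp add: y_def N.D_zero)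
  have Gby: "Gb s *\<^sub>v y = cmat C' *\<^sub>v x' + cmat D' *\<^sub>v y"
    using S.tf_mult[OF sA' x'(1) y x'(2)] S.G_tf[OF s(2)] by simp
  have Gbyc: "Gb s *\<^sub>v y \<in> carrier_vec m" using y by simp
  define v where "v = u - Gb s *\<^sub>v y"
  have v: "v \<in> carrier_vec m" using u Gbyc by (simp add: v_def)
  have cB: "cmat B \<in> carrier_mat n m" using N.B by simp
  have "pencil Acl s *\<^sub>v (x @\<^sub>v x') = (cmat B *\<^sub>v u - cmat B *\<^sub>v (Gb s *\<^sub>v y)) @\<^sub>v (cmat B' *\<^sub>v y - cmat B' *\<^sub>v y)"
    unfolding pencil_Acl[OF x(1) x'(1)] yx[symmetric] Gby[symmetric] x(2) x'(2) ..
  also have "\<dots> = cmat Bcl *\<^sub>v v"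
    unfolding Bcl_mult[OF v] using mult_minus_distrib_mat_vec[OF cB u Gbyc] B'y by (simp add: v_def)
  finally have "pencil Acl s *\<^sub>v (x @\<^sub>v x') = cmat Bcl *\<^sub>v v" .
  from cl.tf_mult[OF s(3) _ v this] x x'
  have "T s *\<^sub>v v = cmat Ccl *\<^sub>v (x @\<^sub>v x') + 0\<^sub>m m m *\<^sub>v v" by simp
  also have "\<dots> = y" using Ccl_mult[OF x(1) x'(1)] Cx v yx by simp
  finally show ?thesis by (simp add: v_def)
qed

text \<open>Every disturbance v arises in this way, the input of G being the output w of Gbar plus
  v.\<close>

lemma T_surj:
  assumes s: "s \<notin> N.spec" "s \<notin> S.spec" "\<not> eigenvalue (cmat Acl) s"
    and v: "v \<in> carrier_vec m"
  shows "\<exists>u \<in> carrier_vec m. T s *\<^sub>v v = G s *\<^sub>v u \<and> v = u - Gb s *\<^sub>v (G s *\<^sub>v u)"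
proof -
  interpret cl: state_space "n + n'" m m Acl Bcl Ccl "0\<^sub>m m m" by (rule state_space_cl)
  have sA: "\<not> eigenvalue (cmat A) s" and sA': "\<not> eigenvalue (cmat A') s" using s by (auto simp: N.spec_def S.spec_def)
  have "cmat Bcl *\<^sub>v v \<in> carrier_vec (n + n')" using cl.B v by simp
  from cl.state_exists[OF s(3) this] obtain z where
    z: "z \<in> carrier_vec (n + n')" "pencil Acl s *\<^sub>v z = cmat Bcl *\<^sub>v v" by blast
  define x x' where "x = vec_first z n" and "x' = vec_last z n'"
  have x: "x \<in> carrier_vec n" and x': "x' \<in> carrier_vec n'" by (auto simp: x_def x'_def)
  have zx: "z = x @\<^sub>v x'" unfolding x_def x'_def by (rule vec_first_last_append[OF z(1), symmetric])
  define y where "y = cmat C *\<^sub>v x"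
  define w where "w = cmat C' *\<^sub>v x' + cmat D' *\<^sub>v y"
  have y: "y \<in> carrier_vec m" using N.C x by (simp add: y_def)
  have w: "w \<in> carrier_vec m" using S.C S.D x' y by (simp add: w_def)
  have cB: "cmat B \<in> carrier_mat n m" using N.B by simp
  have Bw: "cmat B *\<^sub>v w \<in> carrier_vec n" and Bv: "cmat B *\<^sub>v v \<in> carrier_vec n" and B'y: "cmat B' *\<^sub>v y \<in> carrier_vec n'"
    using N.B S.B w v y by auto
  have px: "pencil A s *\<^sub>v x \<in> carrier_vec n" and px': "pencil A' s *\<^sub>v x' \<in> carrier_vec n'"
    using mult_mat_vec_carrier[OF pencil_carrier[OF N.A] x] mult_mat_vec_carrier[OF pencil_carrier[OF S.A] x'] by auto
  have "(pencil A s *\<^sub>v x - cmat B *\<^sub>v w) @\<^sub>v (pencil A' s *\<^sub>v x' - cmat B' *\<^sub>v y) = (cmat B *\<^sub>v v) @\<^sub>v 0\<^sub>v n'"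
    using z(2) unfolding zx pencil_Acl[OF x x'] Bcl_mult[OF v] y_def w_def .
  then have "pencil A s *\<^sub>v x - cmat B *\<^sub>v w = cmat B *\<^sub>v v" "pencil A' s *\<^sub>v x' - cmat B' *\<^sub>v y = 0\<^sub>v n'"
    using append_vec_eq[of "pencil A s *\<^sub>v x - cmat B *\<^sub>v w" n "cmat B *\<^sub>v v"] px Bw Bv by auto
  then have eqs: "pencil A s *\<^sub>v x = cmat B *\<^sub>v w + cmat B *\<^sub>v v" "pencil A' s *\<^sub>v x' = cmat B' *\<^sub>v y"
    using vec_minus_eq_iff[OF px Bw Bv] vec_minus_eq_iff[OF px' B'y, of "0\<^sub>v n'"] B'y by auto
  have wv: "w + v \<in> carrier_vec m" using w v by simp
  have eq1: "pencil A s *\<^sub>v x = cmat B *\<^sub>v (w + v)"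
    unfolding eqs(1) by (rule mult_add_distrib_mat_vec[OF cB w v, symmetric])
  have Gu: "G s *\<^sub>v (w + v) = y"
    using N.tf_mult[OF sA x wv eq1] N.G_tf[OF s(1)] y wv by (simp add: y_def[symmetric] N.D_zero)
  have Gby: "Gb s *\<^sub>v y = w"
    using S.tf_mult[OF sA' x' y eqs(2)] S.G_tf[OF s(2)] by (simp add: w_def)
  have "T s *\<^sub>v v = cmat Ccl *\<^sub>v (x @\<^sub>v x') + cmat (0\<^sub>m m m) *\<^sub>v v"
    using cl.tf_mult[OF s(3) z(1) v z(2)] zx by simp
  also have "\<dots> = y" using Ccl_mult[OF x x'] y v by (simp add: y_def)
  finally have "T s *\<^sub>v v = y" .
  moreover have "v = (w + v) - w" using w v by (auto simp: vec_eq_iff)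
  ultimately show ?thesis using Gu Gby wv by (intro bexI[of _ "w + v"]) simp_all
qed

end

lemma conjugate_minus_vec:
  "a \<in> carrier_vec n \<Longrightarrow> b \<in> carrier_vec n \<Longrightarrow>
    conjugate (a - b) = conjugate a - conjugate (b :: complex vec)"
  by (intro eq_vecI) auto

lemma cvec_add: "a \<in> carrier_vec n \<Longrightarrow> b \<in> carrier_vec n \<Longrightarrow> cvec (a + b) = cvec a + cvec b"
  by (intro eq_vecI) auto

lemma cvec_minus: "a \<in> carrier_vec n \<Longrightarrow> b \<in> carrier_vec n \<Longrightarrow> cvec (a - b) = cvec a - cvec b"
  by (intro eq_vecI) auto

lemma mat_vec_tendsto:
  fixes M :: "'x \<Rightarrow> complex mat"
  assumes M: "\<And>s. M s \<in> carrier_mat k m" and L: "L \<in> carrier_mat k m"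
    and w: "\<And>s. w s \<in> carrier_vec m" and w0: "w0 \<in> carrier_vec m"
    and limM: "\<And>i j. i < k \<Longrightarrow> j < m \<Longrightarrow> ((\<lambda>s. M s $$ (i, j)) \<longlongrightarrow> L $$ (i, j)) F"
    and limw: "\<And>j. j < m \<Longrightarrow> ((\<lambda>s. w s $ j) \<longlongrightarrow> w0 $ j) F"
    and i: "i < k"
  shows "((\<lambda>s. (M s *\<^sub>v w s) $ i) \<longlongrightarrow> (L *\<^sub>v w0) $ i) F"
proof -
  have e: "(N *\<^sub>v v) $ i = (\<Sum>j<m. N $$ (i, j) * v $ j)"
    if "N \<in> carrier_mat k m" "v \<in> carrier_vec m" for N :: "complex mat" and v
    using that i by (simp add: scalar_prod_def lessThan_atLeast0)
  show ?thesis unfolding e[OF M w] e[OF L w0] by (intro tendsto_intros limM limw i) auto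
qed

lemma cscalar_prod_tendsto:
  assumes x: "\<And>s. x s \<in> carrier_vec m" "x0 \<in> carrier_vec m"
    and y: "\<And>s. y s \<in> carrier_vec m" "y0 \<in> carrier_vec m"
    and lim: "\<And>i. i < m \<Longrightarrow> ((\<lambda>s. x s $ i) \<longlongrightarrow> x0 $ i) F" "\<And>i. i < m \<Longrightarrow> ((\<lambda>s. y s $ i) \<longlongrightarrow> y0 $ i) F"
  shows "((\<lambda>s. x s \<bullet>c y s) \<longlongrightarrow> x0 \<bullet>c (y0 :: complex vec)) F"
proof -
  have e: "v \<bullet>c w = (\<Sum>i<m. v $ i * cnj (w $ i))"
    if "v \<in> carrier_vec m" "w \<in> carrier_vec m" for v w :: "complex vec"
    using that by (simp add: scalar_prod_def lessThan_atLeast0)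
  show ?thesis unfolding e[OF x(1) y(1)] e[OF x(2) y(2)] by (intro tendsto_intros lim) auto
qed

lemma cscalar_prod_unit: "z \<in> carrier_vec m \<Longrightarrow> i < m \<Longrightarrow> z \<bullet>c unit_vec m i = (z $ i :: complex)"
proof -
  assume "z \<in> carrier_vec m" "i < m"
  moreover have "conjugate (unit_vec m i) = (unit_vec m i :: complex vec)"
    by (intro eq_vecI) (auto simp: unit_vec_def)
  ultimately show ?thesis by simp
qed

lemma (in state_space) tf_carrier_all [simp]: "tf A B C D s \<in> carrier_mat p m"
  using D by (auto simp: tf_def)

context ni_system
begin

lemma G1_vec_tendsto:
  assumes "\<And>s. w s \<in> carrier_vec m" "w0 \<in> carrier_vec m"
    "\<And>j. j < m \<Longrightarrow> ((\<lambda>s. w s $ j) \<longlongrightarrow> w0 $ j) (at 0)" "i < m"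
  shows "((\<lambda>s. s * (G s *\<^sub>v w s) $ i) \<longlongrightarrow> (cmat G1 *\<^sub>v w0) $ i) (at 0)"
proof -
  have "((\<lambda>s. ((s \<cdot>\<^sub>m G s) *\<^sub>v w s) $ i) \<longlongrightarrow> (cmat G1 *\<^sub>v w0) $ i) (at 0)"
    by (rule mat_vec_tendsto[of _ m m]) (use assms G1_entry carrier_matD[OF G_carrier] in auto)
  moreover have "((s \<cdot>\<^sub>m G s) *\<^sub>v w s) $ i = s * (G s *\<^sub>v w s) $ i" for s
    using assms(4) assms(1)[of s] carrier_matD[OF G_carrier[of s]] by simp
  ultimately show ?thesis by simp
qed

lemma G0_vec_tendsto:
  assumes v: "v \<in> carrier_vec m" "cmat G1 *\<^sub>v v = 0\<^sub>v m" and i: "i < m"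
  shows "((\<lambda>s. (G s *\<^sub>v v) $ i) \<longlongrightarrow> (cmat G0 *\<^sub>v v) $ i) (at 0)"
proof -
  have G0v: "cmat G0 *\<^sub>v v \<in> carrier_vec m" using mult_mat_vec_carrier[of "cmat G0" m m v] v by simp
  from G0_entries_vec[OF v, of "unit_vec m i"] show ?thesis
    unfolding cscalar_prod_unit[OF G0v i] cscalar_prod_unit[OF G_vec[OF v(1)] i] by simp
qed

end

section \<open>Consequences of closed-loop stability at zero frequency\<close>

context feedback
begin

lemma finite_spec_cl: "finite {s. eigenvalue (cmat Acl) s}"
  by (rule finite_eigenvalues[OF Acl_carrier])

text \<open>Positive feedback preserves the sign: with y = G u and x = u - Gbar y one has x* T x =
  u* y - (Gbar y)* y, whose imaginary part is the sum of those of u* G u and y* Gbar y.\<close>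

lemma T_form_axis:
  assumes v: "v \<noteq> 0" and s: "s = \<i> * complex_of_real v" "s \<notin> N.spec" "s \<notin> S.spec" "\<not> eigenvalue (cmat Acl) s"
    and x: "x \<in> carrier_vec m"
  shows "0 \<le> - v * Im ((T s *\<^sub>v x) \<bullet>c x)"
proof -
  from T_surj[OF s(2-4) x] obtain u where u: "u \<in> carrier_vec m" and Tx: "T s *\<^sub>v x = G s *\<^sub>v u"
    and xu: "x = u - Gb s *\<^sub>v (G s *\<^sub>v u)" by blast
  define y where "y = G s *\<^sub>v u"
  have y: "y \<in> carrier_vec m" and Gby: "Gb s *\<^sub>v y \<in> carrier_vec m" using u by (simp_all add: y_def)
  have "conjugate x = conjugate u - conjugate (Gb s *\<^sub>v y)"
    unfolding xu y_def[symmetric] by (rule conjugate_minus_vec[OF u Gby])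
  then have "(T s *\<^sub>v x) \<bullet>c x = y \<bullet>c u - y \<bullet>c (Gb s *\<^sub>v y)"
    unfolding Tx y_def[symmetric] using scalar_prod_minus_distrib[of y m "conjugate u" "conjugate (Gb s *\<^sub>v y)"] y u Gby by simp
  also have "y \<bullet>c (Gb s *\<^sub>v y) = cnj ((Gb s *\<^sub>v y) \<bullet>c y)" by (rule cscalar_prod_cnj[OF Gby y, symmetric])
  finally have "Im ((T s *\<^sub>v x) \<bullet>c x) = Im ((G s *\<^sub>v u) \<bullet>c u) + Im ((Gb s *\<^sub>v y) \<bullet>c y)" by (simp add: y_def)
  moreover have "0 \<le> - v * Im ((G s *\<^sub>v u) \<bullet>c u)" unfolding s(1)
    by (rule N.axis_form_sign[OF N.axis_nonpos v s(2)[unfolded s(1)] u])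
  moreover have "0 \<le> - v * Im ((Gb s *\<^sub>v y) \<bullet>c y)" unfolding s(1)
    by (rule S.axis_form_sign[OF _ v s(3)[unfolded s(1)] y]) (auto intro: S.axis_nonpos)
  ultimately show ?thesis by (simp add: algebra_simps)
qed

text \<open>With f(s) = v* T(s) v, the minimum principle for (f(0) - f(s)) / s gives Re f(t) \<le>
  f(0) for real t > 0. Since T is strictly proper, f(t) tends to 0 as t grows, and f(0) \<ge> 0
  remains.\<close>

lemma stable_dc_nonneg:
  assumes hw: "hurwitz Acl" and v: "v \<in> carrier_vec m"
  shows "0 \<le> Re ((T 0 *\<^sub>v cvec v) \<bullet>c cvec v)"
proof -
  interpret cl: state_space "n + n'" m m Acl Bcl Ccl "0\<^sub>m m m" by (rule state_space_cl)
  let ?S = "{s. eigenvalue (cmat Acl) s}"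
  have hS: "Re s < 0" if "s \<in> ?S" for s using hw that by (simp add: hurwitz_def)
  have ns: "\<not> eigenvalue (cmat Acl) s" if "0 \<le> Re s" for s using hS[of s] that by auto
  have cv: "cvec v \<in> carrier_vec m" using v by simp
  define f where "f = (\<lambda>s. (T s *\<^sub>v cvec v) \<bullet>c cvec v)"
  have fsum: "f = (\<lambda>s. \<Sum>i<m. \<Sum>j<m. T s $$ (i, j) * (cvec v $ j * cnj (cvec v $ i)))"
    unfolding f_def using cscalar_form_sum[OF cl.tf_carrier_all cv cv] by simp
  have hol: "f holomorphic_on - ?S" unfolding fsum by (intro holomorphic_intros cl.tf_holomorphic) auto
  have "open (- ?S)" using finite_spec_cl by (intro open_Compl finite_imp_closed)
  then have cont: "isCont f z" if "0 \<le> Re z" for z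
    using hol ns[OF that] holomorphic_on_imp_continuous_on continuous_on_eq_continuous_at by blast
  have flim: "(f \<longlongrightarrow> 0) at_infinity"
  proof -
    have "(f \<longlongrightarrow> (\<Sum>i<m. \<Sum>j<m. 0 * (cvec v $ j * cnj (cvec v $ i)))) at_infinity" unfolding fsum
    proof (intro tendsto_sum tendsto_mult_right)
      fix i j assume "i \<in> {..<m}" "j \<in> {..<m}"
      then show "((\<lambda>s. T s $$ (i, j)) \<longlongrightarrow> 0) at_infinity" using cl.tf_at_infinity[of i j] by simp
    qed
    then show ?thesis by simp
  qed
  have f0: "Im (f 0) = 0"
  proof -
    have T0: "T 0 *\<^sub>v cvec v \<in> carrier_vec m" using mult_mat_vec_carrier[OF cl.tf_carrier_all cv] .
    have "T 0 *\<^sub>v cvec v = conjugate (T 0 *\<^sub>v cvec v)" using cl.tf_cnj[OF ns cv, of 0] by simp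
    then have "f 0 = conjugate (T 0 *\<^sub>v cvec v) \<bullet>c conjugate (cvec v)" by (simp add: f_def)
    also have "\<dots> = cnj (f 0)" unfolding f_def by (rule cscalar_prod_conjugate[OF T0 cv])
    finally show ?thesis by (simp add: complex_eq_iff)
  qed
  define F where "F = (\<lambda>s. (f 0 - f s) / s)"
  \<comment> \<open>Axis points of the two open-loop spectra are set apart because the sign of the
    form is known only off them; f is holomorphic there, so they enter with residue 0.\<close>
  define E where "E = ?S \<union> {s \<in> insert 0 (N.spec \<union> S.spec). Re s = 0}"
  have FRe: "0 \<le> Re (F s)" if s: "0 < Re s" for s
  proof (rule half_plane_minimum_weak[where f = F and ?s0.0 = s and E = E])
    show "finite E" using finite_spec_cl N.finite_spec S.finite_spec by (simp add: E_def)
    show "Re z \<le> 0" if "z \<in> E" for z using that hS[of z] by (auto simp: E_def)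
    show "F holomorphic_on - E" unfolding F_def
      by (intro holomorphic_intros holomorphic_on_subset[OF hol]) (auto simp: E_def)
    show "\<exists>r\<ge>0. ((\<lambda>s. (s - z) * F s) \<longlongrightarrow> complex_of_real r) (at z)" if z: "z \<in> E" "Re z = 0" for z
    proof (intro exI conjI)
      have "isCont f z" using cont z(2) by simp
      then have fz: "(f \<longlongrightarrow> f z) (at z)" by (simp add: isCont_def)
      show "((\<lambda>s. (s - z) * F s) \<longlongrightarrow> complex_of_real 0) (at z)"
      proof (cases "z = 0")
        case True
        have "((\<lambda>s. f 0 - f s) \<longlongrightarrow> 0) (at z)" using tendsto_diff[OF tendsto_const fz, of "f 0"] True by simp
        moreover have "eventually (\<lambda>s. f 0 - f s = (s - z) * F s) (at z)"
          using eventually_neq_at_within[of z z UNIV] by eventually_elim (simp add: F_def True)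
        ultimately show ?thesis by (auto intro: Lim_transform_eventually)
      next
        case False
        have "((\<lambda>s. (s - z) * F s) \<longlongrightarrow> (z - z) * ((f 0 - f z) / z)) (at z)" unfolding F_def
          by (intro tendsto_intros fz False)
        then show ?thesis by simp
      qed
    qed simp
    show "0 \<le> Re (F s)" if s: "Re s = 0" "s \<notin> E" for s
    proof -
      define w where "w = Im s"
      have sw: "s = \<i> * complex_of_real w" using imag_axis_form[OF s(1)] by (simp add: w_def)
      have w0: "w \<noteq> 0" and sp: "s \<notin> N.spec" "s \<notin> S.spec" "\<not> eigenvalue (cmat Acl) s"
        using s sw by (auto simp: E_def)
      have "0 \<le> (- w * Im (f s)) / w\<^sup>2"
        using T_form_axis[OF w0 sw sp cv] by (intro divide_nonneg_nonneg) (auto simp: f_def)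
      also have "\<dots> = - Im (f s) / w" using w0 by (simp add: power2_eq_square)
      finally show ?thesis unfolding F_def using Re_real_minus_divide_i[OF w0 f0] sw by simp
    qed
    have "((\<lambda>s. (f 0 - f s) * inverse s) \<longlongrightarrow> (f 0 - 0) * 0) at_infinity"
      by (intro tendsto_intros flim tendsto_inverse_0)
    then show "(F \<longlongrightarrow> 0) at_infinity" by (simp add: F_def divide_inverse)
  qed (rule s)
  have le: "Re (f (complex_of_real t)) \<le> Re (f 0)" if t: "t > 0" for t
  proof -
    have "0 \<le> Re (F (complex_of_real t))" using FRe[of "complex_of_real t"] t by simp
    also have "\<dots> = (Re (f 0) - Re (f (complex_of_real t))) / t" by (simp add: F_def)
    finally show ?thesis using t by (simp add: zero_le_divide_iff)
  qed
  have "filterlim (\<lambda>t. complex_of_real t) at_infinity at_top"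
    by (rule filterlim_norm_at_top_imp_at_infinity) (auto intro: filterlim_abs_real)
  from tendsto_Re[OF filterlim_compose[OF flim this]]
  have "((\<lambda>t. Re (f (complex_of_real t))) \<longlongrightarrow> 0) at_top" by simp
  then have "0 \<le> Re (f 0)"
    by (rule tendsto_upperbound) (use eventually_mono[OF eventually_gt_at_top[of "0::real"] le] in auto)
  then show ?thesis by (simp add: f_def)
qed

text \<open>For the input u + s a of G the output G(s) u + s G(s) a converges to x as s tends to 0,
  because \<open>G1\<close> annihilates u. T and Gbar are continuous at 0, so the loop identity
  passes to the limit.\<close>

lemma stable_T0:
  assumes hw: "hurwitz Acl" and u: "u \<in> carrier_vec m" "cmat N.G1 *\<^sub>v u = 0\<^sub>v m" and a: "a \<in> carrier_vec m"
    and x: "x = cmat N.G0 *\<^sub>v u + cmat N.G1 *\<^sub>v a"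
  shows "T 0 *\<^sub>v (u - cmat S.dc *\<^sub>v x) = x"
proof -
  interpret cl: state_space "n + n'" m m Acl Bcl Ccl "0\<^sub>m m m" by (rule state_space_cl)
  let ?S = "{s. eigenvalue (cmat Acl) s}"
  have n0: "\<not> eigenvalue (cmat Acl) 0" using hw by (force simp: hurwitz_def)
  have G0u: "cmat N.G0 *\<^sub>v u \<in> carrier_vec m" and G1a: "cmat N.G1 *\<^sub>v a \<in> carrier_vec m"
    using mult_mat_vec_carrier[of "cmat N.G0" m m u] mult_mat_vec_carrier[of "cmat N.G1" m m a] u a by auto
  have xc: "x \<in> carrier_vec m" using G0u G1a by (simp add: x)
  have dcx: "cmat S.dc *\<^sub>v x \<in> carrier_vec m" using mult_mat_vec_carrier[of "cmat S.dc" m m x] xc by simp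
  define us where "us = (\<lambda>s. u + s \<cdot>\<^sub>v a)"
  define xs where "xs = (\<lambda>s. G s *\<^sub>v us s)"
  define vs where "vs = (\<lambda>s. us s - Gb s *\<^sub>v xs s)"
  have us: "us s \<in> carrier_vec m" and xs: "xs s \<in> carrier_vec m" for s using u a by (simp_all add: us_def xs_def)
  have vs: "vs s \<in> carrier_vec m" for s using us xs by (simp add: vs_def)
  have uslim: "((\<lambda>s. us s $ i) \<longlongrightarrow> u $ i) (at 0)" if "i < m" for i
  proof -
    have "((\<lambda>s. u $ i + s * a $ i) \<longlongrightarrow> u $ i + 0 * a $ i) (at 0)" by (intro tendsto_intros)
    then show ?thesis using that u a by (simp add: us_def)
  qed
  have xslim: "((\<lambda>s. xs s $ i) \<longlongrightarrow> x $ i) (at 0)" if i: "i < m" for i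
  proof -
    have "((\<lambda>s. (G s *\<^sub>v u) $ i + s * (G s *\<^sub>v a) $ i) \<longlongrightarrow> (cmat N.G0 *\<^sub>v u) $ i + (cmat N.G1 *\<^sub>v a) $ i) (at 0)"
      by (intro tendsto_add N.G0_vec_tendsto[OF u i] N.G1_vec_tendsto) (use a i in auto)
    moreover have "xs s $ i = (G s *\<^sub>v u) $ i + s * (G s *\<^sub>v a) $ i" for s
    proof -
      have "xs s = G s *\<^sub>v u + s \<cdot>\<^sub>v (G s *\<^sub>v a)" unfolding xs_def us_def
        using mult_add_distrib_mat_vec[OF N.G_carrier u(1), of "s \<cdot>\<^sub>v a"] mult_mat_vec[OF N.G_carrier a] a by simp
      then show ?thesis using i carrier_vecD[OF N.G_vec[OF a, of s]] by (simp del: index_mult_mat_vec dim_mult_mat_vec)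
    qed
    moreover have "(cmat N.G0 *\<^sub>v u) $ i + (cmat N.G1 *\<^sub>v a) $ i = x $ i"
      using i carrier_vecD[OF G1a] by (simp add: x del: index_mult_mat_vec dim_mult_mat_vec)
    ultimately show ?thesis by simp
  qed
  have Gbxlim: "((\<lambda>s. (Gb s *\<^sub>v xs s) $ i) \<longlongrightarrow> (cmat S.dc *\<^sub>v x) $ i) (at 0)" if "i < m" for i
    by (rule mat_vec_tendsto[OF S.G_carrier _ xs xc _ xslim that])
      (use S.G_isCont[OF S.no_pole, of 0] in \<open>auto simp: isCont_def S.G_dc\<close>)
  have vslim: "((\<lambda>s. vs s $ i) \<longlongrightarrow> (u - cmat S.dc *\<^sub>v x) $ i) (at 0)" if i: "i < m" for i
    using tendsto_diff[OF uslim[OF i] Gbxlim[OF i]] i us carrier_vecD[OF S.G_vec[OF xs]] carrier_vecD[OF dcx]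
    by (simp add: vs_def del: index_mult_mat_vec dim_mult_mat_vec)
  have v: "u - cmat S.dc *\<^sub>v x \<in> carrier_vec m" using u dcx by simp
  have ev: "eventually (\<lambda>s. s \<notin> N.spec \<union> S.spec \<union> ?S) (at 0)"
    by (rule eventually_not_in_finite_at) (use N.finite_spec S.finite_spec finite_spec_cl in simp)
  show ?thesis
  proof (rule eq_vecI)
    fix i assume "i < dim_vec x"
    then have i: "i < m" using xc by simp
    have "((\<lambda>s. (T s *\<^sub>v vs s) $ i) \<longlongrightarrow> (T 0 *\<^sub>v (u - cmat S.dc *\<^sub>v x)) $ i) (at 0)"
      by (rule mat_vec_tendsto[OF cl.tf_carrier_all cl.tf_carrier_all vs v _ vslim i])
        (use tf_isCont[OF state_space_cl n0] in \<open>auto simp: isCont_def\<close>)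
    moreover have "eventually (\<lambda>s. (T s *\<^sub>v vs s) $ i = xs s $ i) (at 0)"
      using ev by (rule eventually_mono) (use T_mult[OF _ _ _ us] in \<open>auto simp: vs_def xs_def\<close>)
    ultimately have "((\<lambda>s. xs s $ i) \<longlongrightarrow> (T 0 *\<^sub>v (u - cmat S.dc *\<^sub>v x)) $ i) (at 0)"
      by (rule Lim_transform_eventually)
    from tendsto_unique[OF at_neq_bot this xslim[OF i]]
    show "(T 0 *\<^sub>v (u - cmat S.dc *\<^sub>v x)) $ i = x $ i" .
  qed (use xc carrier_matD[OF cl.tf_carrier_all] in simp)
qed

text \<open>The source of the necessary conditions: u ranges over the kernel of \<open>G1\<close>, a
  is free, and each choice tests T(0) at one real vector.\<close>

lemma stable_imp:
  assumes hw: "hurwitz Acl" and u: "u \<in> carrier_vec m" "N.G1 *\<^sub>v u = 0\<^sub>v m" and a: "a \<in> carrier_vec m"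
    and x: "x = N.G0 *\<^sub>v u + N.G1 *\<^sub>v a"
  shows "0 \<le> x \<bullet> (u - S.dc *\<^sub>v x)" "u = S.dc *\<^sub>v x \<Longrightarrow> x = 0\<^sub>v m"
proof -
  interpret cl: state_space "n + n'" m m Acl Bcl Ccl "0\<^sub>m m m" by (rule state_space_cl)
  have G0u: "N.G0 *\<^sub>v u \<in> carrier_vec m" and G1a: "N.G1 *\<^sub>v a \<in> carrier_vec m"
    using mult_mat_vec_carrier[OF N.G0_carrier u(1)] mult_mat_vec_carrier[OF N.G1_carrier a] by auto
  have xc: "x \<in> carrier_vec m" using G0u G1a by (simp add: x)
  have dcx: "S.dc *\<^sub>v x \<in> carrier_vec m" using mult_mat_vec_carrier[OF S.dc_carrier xc] .
  have cx: "cvec x = cmat N.G0 *\<^sub>v cvec u + cmat N.G1 *\<^sub>v cvec a"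
    unfolding cmat_mult_cvec[OF N.G0_carrier u(1)] cmat_mult_cvec[OF N.G1_carrier a] x
    by (rule cvec_add[OF G0u G1a])
  have "cmat N.G1 *\<^sub>v cvec u = cvec (0\<^sub>v m)" unfolding cmat_mult_cvec[OF N.G1_carrier u(1)] u(2) ..
  then have cu: "cmat N.G1 *\<^sub>v cvec u = 0\<^sub>v m" by auto
  have v: "cvec u - cmat S.dc *\<^sub>v cvec x = cvec (u - S.dc *\<^sub>v x)"
    unfolding cmat_mult_cvec[OF S.dc_carrier xc] by (rule cvec_minus[OF u(1) dcx, symmetric])
  have T: "T 0 *\<^sub>v cvec (u - S.dc *\<^sub>v x) = cvec x"
    using stable_T0[OF hw _ cu _ cx] u a unfolding v by simp
  have vc: "u - S.dc *\<^sub>v x \<in> carrier_vec m" using u dcx by simp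
  have "0 \<le> Re (cvec x \<bullet>c cvec (u - S.dc *\<^sub>v x))" using stable_dc_nonneg[OF hw vc] unfolding T .
  also have "\<dots> = x \<bullet> (u - S.dc *\<^sub>v x)"
  proof -
    have "re_vec (cvec y) = y" "im_vec (cvec y) = 0\<^sub>v (dim_vec y)" for y by auto
    then show ?thesis using cscalar_prod_Re_Im(1)[of "cvec x" m "cvec (u - S.dc *\<^sub>v x)"] xc vc
        carrier_matD[OF S.dc_carrier] by simp
  qed
  finally show "0 \<le> x \<bullet> (u - S.dc *\<^sub>v x)" .
  assume "u = S.dc *\<^sub>v x"
  then have "u - S.dc *\<^sub>v x = 0\<^sub>v m" using dcx by simp
  then have "cvec (u - S.dc *\<^sub>v x) = 0\<^sub>v m" by auto
  with T have "cvec x = 0\<^sub>v m" using mult_mat_zero_vec[OF cl.tf_carrier_all] by simp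
  then show "x = 0\<^sub>v m" by (auto simp: vec_eq_iff)
qed

end

lemma minimal_imp_controllable:
  assumes "transfer_matrix m G" "minimal_realization m G n A B C D"
  shows "controllable A B"
proof -
  have "realization m G n A B C D" using assms(2) by (simp add: minimal_realization_def)
  from realizationD[OF this] show ?thesis
    using minimal_controllable[OF assms] by (auto simp: controllable_def)
qed

context transfer
begin

lemma steady_state_approx:
  assumes ctrl: "controllable A B" and x: "x \<in> carrier_vec n" and y: "y \<in> carrier_vec m"
    and eq: "pencil A z *\<^sub>v x = cmat B *\<^sub>v y"
  obtains Z where "\<And>s. Z s \<in> carrier_vec m" "\<And>i. i < m \<Longrightarrow> isCont (\<lambda>s. Z s $ i) z"
    "\<And>i. i < m \<Longrightarrow> ((\<lambda>s. (G s *\<^sub>v (y + (s - z) \<cdot>\<^sub>v Z s)) $ i) \<longlongrightarrow>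
       (cmat C *\<^sub>v x + cmat D *\<^sub>v y) $ i) (at z)"
proof (rule steady_state_limit[OF ctrl x y eq])
  fix Z assume Z: "\<And>s. Z s \<in> carrier_vec m" "\<And>i. i < m \<Longrightarrow> isCont (\<lambda>s. Z s $ i) z"
    and lim: "\<And>i. i < m \<Longrightarrow> ((\<lambda>s. (tf A B C D s *\<^sub>v (y + (s - z) \<cdot>\<^sub>v Z s)) $ i) \<longlongrightarrow>
       (cmat C *\<^sub>v x + cmat D *\<^sub>v y) $ i) (at z)"
  show thesis
  proof (rule that[OF Z])
    fix i assume i: "i < m"
    have "eventually (\<lambda>s. (tf A B C D s *\<^sub>v (y + (s - z) \<cdot>\<^sub>v Z s)) $ i = (G s *\<^sub>v (y + (s - z) \<cdot>\<^sub>v Z s)) $ i) (at z)"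
      using eventually_not_in_finite_at[OF finite_spec, of z] by eventually_elim (simp add: G_tf)
    then show "((\<lambda>s. (G s *\<^sub>v (y + (s - z) \<cdot>\<^sub>v Z s)) $ i) \<longlongrightarrow> (cmat C *\<^sub>v x + cmat D *\<^sub>v y) $ i) (at z)"
      by (rule Lim_transform_eventually[OF lim[OF i]])
  qed
qed

lemma approx_input_tendsto:
  fixes y :: "complex vec" and z :: complex
  assumes y: "y \<in> carrier_vec m" and Z: "\<And>s. Z s \<in> carrier_vec m" "isCont (\<lambda>s. Z s $ i) z" and i: "i < m"
  shows "((\<lambda>s. (y + (s - z) \<cdot>\<^sub>v Z s) $ i) \<longlongrightarrow> y $ i) (at z)"
proof -
  have "((\<lambda>s. y $ i + (s - z) * Z s $ i) \<longlongrightarrow> y $ i + (z - z) * Z z $ i) (at z)"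
    by (intro tendsto_intros Z(2)[unfolded isCont_def])
  moreover have "y $ i + (z - z) * Z z $ i = y $ i" by simp
  moreover have "(\<lambda>s. (y + (s - z) \<cdot>\<^sub>v Z s) $ i) = (\<lambda>s. y $ i + (s - z) * Z s $ i)"
    using i y carrier_vecD[OF Z(1)] by (intro ext) simp
  ultimately show ?thesis by (simp only:)
qed

text \<open>If z is no pole, the correction (s - z) Z(s) of the input dies out in the limit, so the
  state equation yields the output also at eigenvalues of A that cancel in G.\<close>

lemma steady_state_value:
  assumes ctrl: "controllable A B" and x: "x \<in> carrier_vec n" and y: "y \<in> carrier_vec m"
    and eq: "pencil A z *\<^sub>v x = cmat B *\<^sub>v y" and np: "\<not> mat_pole m G z"
  shows "G z *\<^sub>v y = cmat C *\<^sub>v x + cmat D *\<^sub>v y"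
proof (rule steady_state_approx[OF ctrl x y eq])
  fix Z assume Z: "\<And>s. Z s \<in> carrier_vec m" "\<And>i. i < m \<Longrightarrow> isCont (\<lambda>s. Z s $ i) z"
    and lim: "\<And>i. i < m \<Longrightarrow> ((\<lambda>s. (G s *\<^sub>v (y + (s - z) \<cdot>\<^sub>v Z s)) $ i) \<longlongrightarrow>
       (cmat C *\<^sub>v x + cmat D *\<^sub>v y) $ i) (at z)"
  have Dy: "cmat D *\<^sub>v y \<in> carrier_vec m" using D y by simp
  show ?thesis
  proof (rule eq_vecI)
    fix i assume "i < dim_vec (cmat C *\<^sub>v x + cmat D *\<^sub>v y)"
    then have i: "i < m" using carrier_vecD[OF Dy] by simp
    have "((\<lambda>s. (G s *\<^sub>v (y + (s - z) \<cdot>\<^sub>v Z s)) $ i) \<longlongrightarrow> (G z *\<^sub>v y) $ i) (at z)"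
      by (rule mat_vec_tendsto[of G m m "G z" "\<lambda>s. y + (s - z) \<cdot>\<^sub>v Z s" y])
        (use G_isCont[OF np] approx_input_tendsto[OF y Z(1) Z(2)] y Z(1) i in \<open>auto simp: isCont_def\<close>)
    from tendsto_unique[OF at_neq_bot this lim[OF i]]
    show "(G z *\<^sub>v y) $ i = (cmat C *\<^sub>v x + cmat D *\<^sub>v y) $ i" .
  qed (use carrier_matD[OF G_carrier[of z]] carrier_vecD[OF Dy] in simp)
qed

end

section \<open>Closed-loop eigenvalues in the closed right half plane\<close>

context feedback
begin

text \<open>Gbar has no pole at s, so y = C x determines w = Gbar(s) y. If y were 0, then w = 0 as
  well, and x and x' would be unobservable vectors in the kernels of the two pencils, hence 0 by
  minimality.\<close>

lemma unstable_mode: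
  assumes minN: "minimal_realization m G n A B C D" and minS: "minimal_realization m Gb n' A' B' C' D'"
    and eig: "eigenvalue (cmat Acl) s" and s: "0 \<le> Re s"
  obtains x y w where "x \<in> carrier_vec n" "y \<in> carrier_vec m" "w \<in> carrier_vec m" "y \<noteq> 0\<^sub>v m"
    "Gb s *\<^sub>v y = w" "pencil A s *\<^sub>v x = cmat B *\<^sub>v w" "cmat C *\<^sub>v x + cmat D *\<^sub>v w = y"
proof (rule eigenvector_Acl[OF eig])
  fix x x' assume x: "x \<in> carrier_vec n" and x': "x' \<in> carrier_vec n'" and nz: "x \<noteq> 0\<^sub>v n \<or> x' \<noteq> 0\<^sub>v n'"
    and e1: "pencil A s *\<^sub>v x = cmat B *\<^sub>v (cmat C' *\<^sub>v x' + cmat D' *\<^sub>v (cmat C *\<^sub>v x))"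
    and e2: "pencil A' s *\<^sub>v x' = cmat B' *\<^sub>v (cmat C *\<^sub>v x)"
  define y where "y = cmat C *\<^sub>v x"
  define w where "w = cmat C' *\<^sub>v x' + cmat D' *\<^sub>v y"
  have y: "y \<in> carrier_vec m" using N.C x by (simp add: y_def)
  have w: "w \<in> carrier_vec m" using S.C S.D x' y by (simp add: w_def)
  have Gby: "Gb s *\<^sub>v y = w" unfolding w_def
    by (rule S.steady_state_value[OF minimal_imp_controllable[OF S.G minS] x' y _ S.no_pole[OF s]])
      (use e2 in \<open>simp add: y_def\<close>)
  have y0: "y \<noteq> 0\<^sub>v m"
  proof
    assume y0: "y = 0\<^sub>v m"
    then have w0: "w = 0\<^sub>v m" using Gby mult_mat_zero_vec[OF S.G_carrier] by simp
    have "pencil A s *\<^sub>v x = 0\<^sub>v n"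
      using e1 mult_mat_zero_vec[of "cmat B" n m] N.B w0 unfolding y_def[symmetric] w_def[symmetric] by simp
    from minimal_observable[OF N.G minN x this] y0 have "x = 0\<^sub>v n" by (simp add: y_def)
    have "pencil A' s *\<^sub>v x' = 0\<^sub>v n'"
      using e2 mult_mat_zero_vec[of "cmat B'" n' m] S.B y0 unfolding y_def[symmetric] by simp
    moreover have "cmat C' *\<^sub>v x' = 0\<^sub>v m"
    proof -
      have "cmat D' *\<^sub>v y = 0\<^sub>v m" using y0 mult_mat_zero_vec[of "cmat D'" m m] S.D by simp
      moreover have "cmat C' *\<^sub>v x' \<in> carrier_vec m" using S.C x' by simp
      ultimately show ?thesis using w0 by (simp add: w_def)
    qed
    ultimately have "x' = 0\<^sub>v n'" by (rule minimal_observable[OF S.G minS x'])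
    with \<open>x = 0\<^sub>v n\<close> nz show False by simp
  qed
  have "cmat C *\<^sub>v x + cmat D *\<^sub>v w = y" using y w by (simp add: y_def N.D_zero)
  with that[OF x y w y0 Gby] e1 show thesis by (simp add: y_def w_def)
qed

text \<open>SNI of Gbar gives Im (y* w) < 0. NI of G gives Im (w* y) \<le> 0, obtained along inputs
  tending to w because i v may be a pole of G. The two numbers are conjugate, a
  contradiction.\<close>

lemma no_axis_mode:
  assumes minN: "minimal_realization m G n A B C D" and minS: "minimal_realization m Gb n' A' B' C' D'"
    and v: "v > 0"
  shows "\<not> eigenvalue (cmat Acl) (\<i> * complex_of_real v)"
proof
  let ?z = "\<i> * complex_of_real v"
  assume "eigenvalue (cmat Acl) ?z"
  note eig = this
  have Re: "0 \<le> Re ?z" by simp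
  obtain x y w where x: "x \<in> carrier_vec n" and y1: "y \<in> carrier_vec m"
    and w: "w \<in> carrier_vec m" and y0: "y \<noteq> 0\<^sub>v m" and Gby: "Gb ?z *\<^sub>v y = w"
    and e: "pencil A ?z *\<^sub>v x = cmat B *\<^sub>v w" and Cx: "cmat C *\<^sub>v x + cmat D *\<^sub>v w = y"
    by (rule unstable_mode[OF minN minS eig Re]) (rule that)
  note y = y1 y0
  have neg: "Im (w \<bullet>c y) < 0" using S.axis_neg[OF v y] by (simp add: Gby)
  show False
  proof (rule N.steady_state_approx[OF minimal_imp_controllable[OF N.G minN] x w e])
    fix Z assume Z: "\<And>s. Z s \<in> carrier_vec m" "\<And>i. i < m \<Longrightarrow> isCont (\<lambda>s. Z s $ i) ?z"
      and lim: "\<And>i. i < m \<Longrightarrow> ((\<lambda>s. (G s *\<^sub>v (w + (s - ?z) \<cdot>\<^sub>v Z s)) $ i) \<longlongrightarrow>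
         (cmat C *\<^sub>v x + cmat D *\<^sub>v w) $ i) (at ?z)"
    define ws where "ws = (\<lambda>s. w + (s - ?z) \<cdot>\<^sub>v Z s)"
    have ws: "ws s \<in> carrier_vec m" for s using w Z(1) by (simp add: ws_def)
    have "((\<lambda>s. (G s *\<^sub>v ws s) \<bullet>c ws s) \<longlongrightarrow> y \<bullet>c w) (at ?z)"
      by (rule cscalar_prod_tendsto[of _ m])
        (use ws w y N.approx_input_tendsto[OF w Z(1) Z(2)] lim in \<open>auto simp: Cx ws_def\<close>)
    from tendsto_Im[OF tendsto_at_imag_axis[OF this]]
    have "((\<lambda>t. Im ((G (\<i> * complex_of_real t) *\<^sub>v ws (\<i> * complex_of_real t)) \<bullet>c ws (\<i> * complex_of_real t)))
      \<longlongrightarrow> Im (y \<bullet>c w)) (at_right v)" .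
    moreover have "eventually (\<lambda>t. Im ((G (\<i> * complex_of_real t) *\<^sub>v ws (\<i> * complex_of_real t)) \<bullet>c ws (\<i> * complex_of_real t)) \<le> 0) (at_right v)"
      using eventually_at_right_less[of v] N.eventually_axis_spec[of v]
      by eventually_elim (use v N.axis_nonpos[OF _ _ ws] in auto)
    ultimately have "Im (y \<bullet>c w) \<le> 0" by (intro tendsto_upperbound) auto
    moreover have "y \<bullet>c w = cnj (w \<bullet>c y)" by (rule cscalar_prod_cnj[OF w y(1), symmetric])
    ultimately show False using neg by simp
  qed
qed

text \<open>For the approximating input w + s Z(s) the part s G(s) Z(s) tends to G1 Z(0), and a is
  Z(0). Hence G(s) w converges too, which forces G1 w = 0 and identifies the limit as G0 w.\<close>

lemma zero_mode:
  assumes minN: "minimal_realization m G n A B C D" and minS: "minimal_realization m Gb n' A' B' C' D'"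
    and eig: "eigenvalue (cmat Acl) 0"
  obtains y w a where "y \<in> carrier_vec m" "y \<noteq> 0\<^sub>v m" "w \<in> carrier_vec m" "a \<in> carrier_vec m"
    "w = cmat S.dc *\<^sub>v y" "cmat N.G1 *\<^sub>v w = 0\<^sub>v m" "y = cmat N.G0 *\<^sub>v w + cmat N.G1 *\<^sub>v a"
proof -
  have Re: "0 \<le> Re (0 :: complex)" by simp
  obtain x y w where x: "x \<in> carrier_vec n" and y1: "y \<in> carrier_vec m"
    and w: "w \<in> carrier_vec m" and y0: "y \<noteq> 0\<^sub>v m" and Gby: "Gb 0 *\<^sub>v y = w"
    and e: "pencil A 0 *\<^sub>v x = cmat B *\<^sub>v w" and Cx: "cmat C *\<^sub>v x + cmat D *\<^sub>v w = y"
    by (rule unstable_mode[OF minN minS eig Re]) (rule that)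
  note y = y1 y0
  show thesis
  proof (rule N.steady_state_approx[OF minimal_imp_controllable[OF N.G minN] x w e])
    fix Z assume Z: "\<And>s. Z s \<in> carrier_vec m" "\<And>i. i < m \<Longrightarrow> isCont (\<lambda>s. Z s $ i) 0"
      and lim: "\<And>i. i < m \<Longrightarrow> ((\<lambda>s. (G s *\<^sub>v (w + (s - 0) \<cdot>\<^sub>v Z s)) $ i) \<longlongrightarrow>
         (cmat C *\<^sub>v x + cmat D *\<^sub>v w) $ i) (at 0)"
    define a where "a = Z 0"
    have a: "a \<in> carrier_vec m" using Z(1) by (simp add: a_def)
    have G1a: "cmat N.G1 *\<^sub>v a \<in> carrier_vec m" using mult_mat_vec_carrier[of "cmat N.G1" m m a] a by simp
    have G1w: "cmat N.G1 *\<^sub>v w \<in> carrier_vec m" using mult_mat_vec_carrier[of "cmat N.G1" m m w] w by simp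
    have Zlim: "((\<lambda>s. s * (G s *\<^sub>v Z s) $ i) \<longlongrightarrow> (cmat N.G1 *\<^sub>v a) $ i) (at 0)" if i: "i < m" for i
      by (rule N.G1_vec_tendsto) (use Z a i in \<open>auto simp: isCont_def a_def\<close>)
    have wlim: "((\<lambda>s. (G s *\<^sub>v w) $ i) \<longlongrightarrow> y $ i - (cmat N.G1 *\<^sub>v a) $ i) (at 0)" if i: "i < m" for i
    proof -
      have "(G s *\<^sub>v (w + (s - 0) \<cdot>\<^sub>v Z s)) $ i - s * (G s *\<^sub>v Z s) $ i = (G s *\<^sub>v w) $ i" for s
      proof -
        have "G s *\<^sub>v (w + (s - 0) \<cdot>\<^sub>v Z s) = G s *\<^sub>v w + s \<cdot>\<^sub>v (G s *\<^sub>v Z s)"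
          using mult_add_distrib_mat_vec[OF N.G_carrier w, of "s \<cdot>\<^sub>v Z s"] mult_mat_vec[OF N.G_carrier Z(1)] Z(1) by simp
        then show ?thesis using i carrier_vecD[OF N.G_vec[OF Z(1), of s]]
          by (simp del: index_mult_mat_vec dim_mult_mat_vec)
      qed
      with tendsto_diff[OF lim[OF i] Zlim[OF i]] show ?thesis by (simp add: Cx)
    qed
    have "cmat N.G1 *\<^sub>v w = 0\<^sub>v m"
    proof (rule eq_vecI)
      fix i assume "i < dim_vec (0\<^sub>v m :: complex vec)"
      then have i: "i < m" by simp
      have "((\<lambda>s. s * (G s *\<^sub>v w) $ i) \<longlongrightarrow> (cmat N.G1 *\<^sub>v w) $ i) (at 0)"
        by (rule N.G1_vec_tendsto) (use w i in auto)
      moreover have "((\<lambda>s. s * (G s *\<^sub>v w) $ i) \<longlongrightarrow> 0 * (y $ i - (cmat N.G1 *\<^sub>v a) $ i)) (at 0)"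
        by (intro tendsto_intros wlim[OF i])
      ultimately have "(cmat N.G1 *\<^sub>v w) $ i = 0 * (y $ i - (cmat N.G1 *\<^sub>v a) $ i)"
        by (rule tendsto_unique[OF at_neq_bot])
      then show "(cmat N.G1 *\<^sub>v w) $ i = 0\<^sub>v m $ i" using i by simp
    qed (use carrier_vecD[OF G1w] in simp)
    note ker = this
    have G0w: "cmat N.G0 *\<^sub>v w \<in> carrier_vec m" using mult_mat_vec_carrier[of "cmat N.G0" m m w] w by simp
    have "y = cmat N.G0 *\<^sub>v w + cmat N.G1 *\<^sub>v a"
    proof (rule eq_vecI)
      fix i assume "i < dim_vec (cmat N.G0 *\<^sub>v w + cmat N.G1 *\<^sub>v a)"
      then have i: "i < m" using carrier_vecD[OF G1a] by simp
      from tendsto_unique[OF at_neq_bot wlim[OF i] N.G0_vec_tendsto[OF w ker i]]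
      have "y $ i = (cmat N.G0 *\<^sub>v w) $ i + (cmat N.G1 *\<^sub>v a) $ i" by (simp add: algebra_simps)
      then show "y $ i = (cmat N.G0 *\<^sub>v w + cmat N.G1 *\<^sub>v a) $ i"
        using i carrier_vecD[OF G1a] by (simp del: index_mult_mat_vec dim_mult_mat_vec)
    qed (use y carrier_vecD[OF G1a] in simp)
    with that[OF y w a _ ker] Gby show thesis by (simp add: S.G_dc)
  qed
qed

text \<open>As w = Gbar(s) y and G(s) w = y, both systems estimate the same number Re (s w* y): Gbar
  bounds it strictly above by Re s times y* H y with H = Gbar(0), and the Schwarz-Pick inequality
  bounds it below. The vector p has to be chosen once y is known, hence the function
  \<open>P\<close>.\<close>

lemma right_mode:
  assumes minN: "minimal_realization m G n A B C D" and minS: "minimal_realization m Gb n' A' B' C' D'"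
    and eig: "eigenvalue (cmat Acl) s" and s: "0 < Re s"
    and p: "\<And>y. y \<in> carrier_vec m \<Longrightarrow> P y \<in> carrier_vec m" "\<And>y. y \<in> carrier_vec m \<Longrightarrow> cmat N.G1 *\<^sub>v P y = 0\<^sub>v m"
  obtains y where "y \<in> carrier_vec m"
    "2 * Re (y \<bullet>c P y) - Re ((cmat N.G0 *\<^sub>v P y) \<bullet>c P y) < Re ((cmat S.dc *\<^sub>v y) \<bullet>c y)"
proof -
  have Re: "0 \<le> Re s" using s by simp
  obtain x y w where x: "x \<in> carrier_vec n" and y1: "y \<in> carrier_vec m"
    and w: "w \<in> carrier_vec m" and y0: "y \<noteq> 0\<^sub>v m" and Gby: "Gb s *\<^sub>v y = w"
    and e: "pencil A s *\<^sub>v x = cmat B *\<^sub>v w" and Cx: "cmat C *\<^sub>v x + cmat D *\<^sub>v w = y"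
    by (rule unstable_mode[OF minN minS eig Re]) (rule that)
  note y = y1 y0
  have Gw: "G s *\<^sub>v w = y"
    using N.steady_state_value[OF minimal_imp_controllable[OF N.G minN] x w e N.no_pole[OF s]] Cx by simp
  define h where "h = (cmat S.dc *\<^sub>v y) \<bullet>c y"
  have h: "Im h = 0" unfolding h_def by (rule S.dc_form_real[OF y(1)])
  have s0: "s \<noteq> 0" using s by auto
  have "0 < Re ((h - w \<bullet>c y) / s)" using S.dc_dominates[OF s y] by (simp add: h_def Gby)
  \<comment> \<open>Up to the positive factor 1 / |s|^2, division by s is multiplication by cnj s,
    which brings both bounds to Re (s w* y).\<close>
  also have "(h - w \<bullet>c y) / s = ((h - w \<bullet>c y) * cnj s) / complex_of_real ((cmod s)\<^sup>2)"
    using s0 unfolding complex_norm_square by simp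
  also have "Re \<dots> = Re ((h - w \<bullet>c y) * cnj s) / (cmod s)\<^sup>2" by (rule Re_divide_of_real)
  finally have "0 < Re ((h - w \<bullet>c y) * cnj s)" by (simp add: zero_less_divide_iff)
  moreover have "Re ((w \<bullet>c y) * cnj s) = Re (s * (y \<bullet>c w))"
    unfolding cscalar_prod_cnj[OF w y(1), symmetric] by (simp add: algebra_simps)
  moreover have "Re ((h - w \<bullet>c y) * cnj s) = Re s * Re h - Re ((w \<bullet>c y) * cnj s)"
    using h by (simp add: algebra_simps)
  ultimately have "Re (s * (y \<bullet>c w)) < Re s * Re h" by linarith
  moreover have "Re s * (2 * Re (y \<bullet>c P y) - Re ((cmat N.G0 *\<^sub>v P y) \<bullet>c P y)) \<le> Re (s * (y \<bullet>c w))"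
    using N.pick_inequality[OF s w p(1)[OF y(1)] p(2)[OF y(1)]] by (simp add: Gw)
  ultimately have "Re s * (2 * Re (y \<bullet>c P y) - Re ((cmat N.G0 *\<^sub>v P y) \<bullet>c P y)) < Re s * Re h" by linarith
  then have "2 * Re (y \<bullet>c P y) - Re ((cmat N.G0 *\<^sub>v P y) \<bullet>c P y) < Re h" using s by simp
  with that[OF y(1)] show thesis by (simp add: h_def)
qed

text \<open>Negative frequencies are covered by conjugation, the closed-loop matrix being
  real.\<close>

lemma hurwitz_if:
  assumes minN: "minimal_realization m G n A B C D" and minS: "minimal_realization m Gb n' A' B' C' D'"
    and zero: "\<not> eigenvalue (cmat Acl) 0" and right: "\<And>s. 0 < Re s \<Longrightarrow> \<not> eigenvalue (cmat Acl) s"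
  shows "hurwitz Acl"
  unfolding hurwitz_def
proof (intro allI impI)
  fix s assume e: "eigenvalue (cmat Acl) s"
  show "Re s < 0"
  proof (rule ccontr)
    assume "\<not> Re s < 0"
    with right[of s] e have Re: "Re s = 0" by (cases "0 < Re s") auto
    define v where "v = Im s"
    have sv: "s = \<i> * complex_of_real v" using imag_axis_form[OF Re] by (simp add: v_def)
    consider "v = 0" | "v > 0" | "- v > 0" by linarith
    then show False
    proof cases
      case 1
      with zero e sv show False by simp
    next
      case 2
      with no_axis_mode[OF minN minS this] e sv show False by simp
    next
      case 3
      have "cnj s = \<i> * complex_of_real (- v)" by (simp add: sv)
      with no_axis_mode[OF minN minS 3] e eigenvalue_cnj[OF Acl_carrier, of s] show False by metis
    qed
  qed
qed

end

section \<open>The static conditions\<close>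

lemma vec_minus_self_eq:
  fixes a b :: "'a :: ab_group_add vec"
  assumes "a \<in> carrier_vec n" "b \<in> carrier_vec n"
  shows "a - b = 0\<^sub>v n \<longleftrightarrow> a = b"
  using assms by (auto simp: vec_eq_iff)

lemma cmat_kernel_trivial:
  assumes M: "M \<in> carrier_mat m m" and d: "Determinant.det M \<noteq> 0"
    and x: "x \<in> carrier_vec m" "cmat M *\<^sub>v x = 0\<^sub>v m"
  shows "x = 0\<^sub>v m"
proof -
  have "M *\<^sub>v re_vec x = 0\<^sub>v m" "M *\<^sub>v im_vec x = 0\<^sub>v m" using x cmat_kernel_iff[OF M x(1)] by auto
  then have "re_vec x = 0\<^sub>v m" "im_vec x = 0\<^sub>v m"
    using d x(1) unfolding det_nonzero_iff_inj[OF M] by auto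
  then show ?thesis using x(1) complex_vec_eq_iff[of x m "0\<^sub>v m"] by (auto simp: vec_eq_iff)
qed

text \<open>The zero blocks remove \<open>P2\<close> and \<open>V2\<close> from the product, and
  orthonormality of \<open>V1\<close> is the leading block of that of [V1 V2].\<close>

lemma svd_factorD:
  assumes "svd_factor m M F"
  obtains r V where "F \<in> carrier_mat m r" "V \<in> carrier_mat m r" "M = F * V\<^sup>T" "V\<^sup>T * V = 1\<^sub>m r"
proof -
  from assms obtain r P1 P2 S V1 V2 where r: "r \<le> m"
    and P1: "P1 \<in> carrier_mat m r" and P2: "P2 \<in> carrier_mat m (m - r)"
    and V1: "V1 \<in> carrier_mat m r" and V2: "V2 \<in> carrier_mat m (m - r)" and S: "S \<in> carrier_mat r r"
    and VV: "(hcat V1 V2)\<^sup>T * hcat V1 V2 = 1\<^sub>m m"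
    and M: "M = hcat P1 P2 *
            four_block_mat S (0\<^sub>m r (m - r)) (0\<^sub>m (m - r) r) (0\<^sub>m (m - r) (m - r)) * (hcat V1 V2)\<^sup>T"
    and F: "F = P1 * S" unfolding svd_factor_def by blast
  let ?k = "m - r"
  have Fc: "F \<in> carrier_mat m r" using P1 S by (simp add: F)
  have hP: "hcat P1 P2 = four_block_mat P1 P2 (0\<^sub>m 0 r) (0\<^sub>m 0 ?k)"
    and hV: "hcat V1 V2 = four_block_mat V1 V2 (0\<^sub>m 0 r) (0\<^sub>m 0 ?k)"
    using P1 P2 V1 V2 by (simp_all add: hcat_def)
  have "hcat P1 P2 * four_block_mat S (0\<^sub>m r ?k) (0\<^sub>m ?k r) (0\<^sub>m ?k ?k) =
      four_block_mat (P1 * S + P2 * 0\<^sub>m ?k r) (P1 * 0\<^sub>m r ?k + P2 * 0\<^sub>m ?k ?k)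
        (0\<^sub>m 0 r * S + 0\<^sub>m 0 ?k * 0\<^sub>m ?k r) (0\<^sub>m 0 r * 0\<^sub>m r ?k + 0\<^sub>m 0 ?k * 0\<^sub>m ?k ?k)"
    unfolding hP by (rule mult_four_block_mat[OF P1 P2 _ _ S]) auto
  also have "\<dots> = four_block_mat F (0\<^sub>m m ?k) (0\<^sub>m 0 r) (0\<^sub>m 0 ?k)"
    using P1 P2 S Fc by (simp add: F)
  finally have 1: "hcat P1 P2 * four_block_mat S (0\<^sub>m r ?k) (0\<^sub>m ?k r) (0\<^sub>m ?k ?k) =
      four_block_mat F (0\<^sub>m m ?k) (0\<^sub>m 0 r) (0\<^sub>m 0 ?k)" .
  have 2: "(hcat V1 V2)\<^sup>T = four_block_mat (V1\<^sup>T) (0\<^sub>m r 0) (V2\<^sup>T) (0\<^sub>m ?k 0)"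
    unfolding hV using transpose_four_block_mat[OF V1 V2, of "0\<^sub>m 0 r" 0 "0\<^sub>m 0 ?k"] by simp
  have V1T: "V1\<^sup>T \<in> carrier_mat r m" and V2T: "V2\<^sup>T \<in> carrier_mat ?k m" using V1 V2 by auto
  have "M = four_block_mat (F * V1\<^sup>T + 0\<^sub>m m ?k * V2\<^sup>T) (F * 0\<^sub>m r 0 + 0\<^sub>m m ?k * 0\<^sub>m ?k 0)
      (0\<^sub>m 0 r * V1\<^sup>T + 0\<^sub>m 0 ?k * V2\<^sup>T) (0\<^sub>m 0 r * 0\<^sub>m r 0 + 0\<^sub>m 0 ?k * 0\<^sub>m ?k 0)"
    unfolding M 1 2 by (rule mult_four_block_mat[OF Fc _ _ _ V1T _ V2T]) auto
  also have "\<dots> = F * V1\<^sup>T" using Fc V1T V2T by (intro eq_matI) auto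
  finally have "M = F * V1\<^sup>T" .
  moreover have "V1\<^sup>T * V1 = 1\<^sub>m r"
  proof (rule eq_matI)
    fix i j assume "i < dim_row (1\<^sub>m r :: real mat)" "j < dim_col (1\<^sub>m r :: real mat)"
    then have ij: "i < r" "j < r" by auto
    have hc: "hcat V1 V2 \<in> carrier_mat m m" unfolding hV using four_block_carrier_mat[OF V1, of "0\<^sub>m 0 ?k" 0 ?k] r by simp
    have col: "col (hcat V1 V2) k = col V1 k" if "k < r" for k
      using that r hc V1 V2 by (intro eq_vecI) (auto simp: hcat_def)
    have "((hcat V1 V2)\<^sup>T * hcat V1 V2) $$ (i, j) = col (hcat V1 V2) i \<bullet> col (hcat V1 V2) j"
      using ij r hc by simp
    also have "\<dots> = (V1\<^sup>T * V1) $$ (i, j)" using ij V1 by (simp add: col)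
    finally show "(V1\<^sup>T * V1) $$ (i, j) = 1\<^sub>m r $$ (i, j)" unfolding VV using ij r by simp
  qed (use V1 in auto)
  ultimately show thesis by (rule that[OF Fc V1])
qed

section \<open>The matrix N1 relative to the range of F1\<close>

locale feedback_svd = feedback +
  fixes r :: nat and F V :: "real mat"
  assumes F: "F \<in> carrier_mat m r" and V: "V \<in> carrier_mat m r"
    and G1F: "N.G1 = F * V\<^sup>T" and VV: "V\<^sup>T * V = 1\<^sub>m r"
    and det_T: "Determinant.det (F\<^sup>T * S.dc * F) \<noteq> 0"
begin

abbreviation "H \<equiv> S.dc"

definition T1 :: "real mat" where "T1 = F\<^sup>T * H * F"
text \<open>N1 x = H (x - F T1^{-1} F^T H x): H applied after the H-orthogonal projection that
  removes the range of F. Consequently F^T N1 = 0, and N1 agrees with H on vectors H-orthogonal to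
  the range of F.\<close>

definition N1 :: "real mat" where "N1 = H - H * F * minv T1 * F\<^sup>T * H"

lemma carriers:
  "F\<^sup>T \<in> carrier_mat r m" "V\<^sup>T \<in> carrier_mat r m" "H \<in> carrier_mat m m" "T1 \<in> carrier_mat r r"
  "minv T1 \<in> carrier_mat r r" "N1 \<in> carrier_mat m m"
proof -
  show FT: "F\<^sup>T \<in> carrier_mat r m" "V\<^sup>T \<in> carrier_mat r m" "H \<in> carrier_mat m m" using F V by auto
  show T1: "T1 \<in> carrier_mat r r" unfolding T1_def using F by (auto intro: mult_carrier_mat)
  then show inv: "minv T1 \<in> carrier_mat r r" using minv_carrier det_T by (simp add: T1_def)
  have "H * F * minv T1 * F\<^sup>T * H \<in> carrier_mat m m"
    by (intro mult_carrier_mat[of _ m m] mult_carrier_mat[of _ m r]) (use FT F inv in auto)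
  then show "N1 \<in> carrier_mat m m" unfolding N1_def by (intro minus_carrier_mat)
qed

lemmas FT = carriers(1) and VT = carriers(2) and Hc = carriers(3) and T1c = carriers(4)
  and T1ic = carriers(5) and N1c = carriers(6)

lemma T1_mult: "c \<in> carrier_vec r \<Longrightarrow> T1 *\<^sub>v c = F\<^sup>T *\<^sub>v (H *\<^sub>v (F *\<^sub>v c))"
proof -
  assume c: "c \<in> carrier_vec r"
  have FH: "F\<^sup>T * H \<in> carrier_mat r m" and Fc: "F *\<^sub>v c \<in> carrier_vec m" using FT Hc F c by auto
  have "T1 *\<^sub>v c = (F\<^sup>T * H) *\<^sub>v (F *\<^sub>v c)" unfolding T1_def by (rule assoc_mult_mat_vec[OF FH F c])
  also have "\<dots> = F\<^sup>T *\<^sub>v (H *\<^sub>v (F *\<^sub>v c))" by (rule assoc_mult_mat_vec[OF FT Hc Fc])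
  finally show ?thesis .
qed

lemma N1_mult:
  assumes x: "x \<in> carrier_vec m"
  shows "N1 *\<^sub>v x = H *\<^sub>v x - H *\<^sub>v (F *\<^sub>v (minv T1 *\<^sub>v (F\<^sup>T *\<^sub>v (H *\<^sub>v x))))"
proof -
  have Hx: "H *\<^sub>v x \<in> carrier_vec m" using Hc x by (rule mult_mat_vec_carrier)
  have FHx: "F\<^sup>T *\<^sub>v (H *\<^sub>v x) \<in> carrier_vec r" using FT Hx by (rule mult_mat_vec_carrier)
  have TFHx: "minv T1 *\<^sub>v (F\<^sup>T *\<^sub>v (H *\<^sub>v x)) \<in> carrier_vec r" using T1ic FHx by (rule mult_mat_vec_carrier)
  have HF: "H * F \<in> carrier_mat m r" using Hc F by (rule mult_carrier_mat)
  have HFT: "H * F * minv T1 \<in> carrier_mat m r" using HF T1ic by (rule mult_carrier_mat)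
  have HFTF: "H * F * minv T1 * F\<^sup>T \<in> carrier_mat m m" using HFT FT by (rule mult_carrier_mat)
  have all: "H * F * minv T1 * F\<^sup>T * H \<in> carrier_mat m m" using HFTF Hc by (rule mult_carrier_mat)
  show ?thesis
    unfolding N1_def minus_mult_distrib_mat_vec[OF Hc all x] assoc_mult_mat_vec[OF HFTF Hc x]
      assoc_mult_mat_vec[OF HFT FT Hx] assoc_mult_mat_vec[OF HF T1ic FHx] assoc_mult_mat_vec[OF Hc F TFHx] ..
qed

lemma T1_inv: "c \<in> carrier_vec r \<Longrightarrow> T1 *\<^sub>v (minv T1 *\<^sub>v c) = c"
  using mult_minv_vec(1)[OF T1c _ ] det_T by (simp add: T1_def)

lemma H_sym: "x \<in> carrier_vec m \<Longrightarrow> y \<in> carrier_vec m \<Longrightarrow> (H *\<^sub>v x) \<bullet> y = x \<bullet> (H *\<^sub>v y)"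
  by (rule symmetric_scalar_prod[OF Hc S.dc_symmetric])

lemma F_adj: "x \<in> carrier_vec m \<Longrightarrow> c \<in> carrier_vec r \<Longrightarrow> (F\<^sup>T *\<^sub>v x) \<bullet> c = x \<bullet> (F *\<^sub>v c)"
  by (rule transpose_vec_mult_scalar[OF F])

lemma T1_symmetric: "T1\<^sup>T = T1"
proof -
  have "T1\<^sup>T = F\<^sup>T * (F\<^sup>T * H)\<^sup>T" unfolding T1_def by (rule transpose_mult[of _ r m _ r]) (use FT Hc F in auto)
  also have "(F\<^sup>T * H)\<^sup>T = H\<^sup>T * (F\<^sup>T)\<^sup>T" by (rule transpose_mult[OF FT Hc])
  finally show ?thesis using assoc_mult_mat[OF FT Hc F] by (simp add: T1_def S.dc_symmetric)
qed

lemma FT_N1: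
  assumes x: "x \<in> carrier_vec m"
  shows "F\<^sup>T *\<^sub>v (N1 *\<^sub>v x) = 0\<^sub>v r"
proof -
  have Hx: "H *\<^sub>v x \<in> carrier_vec m" using Hc x by (rule mult_mat_vec_carrier)
  define c where "c = minv T1 *\<^sub>v (F\<^sup>T *\<^sub>v (H *\<^sub>v x))"
  have FHx: "F\<^sup>T *\<^sub>v (H *\<^sub>v x) \<in> carrier_vec r" using FT Hx by (rule mult_mat_vec_carrier)
  have c: "c \<in> carrier_vec r" unfolding c_def using T1ic FHx by (rule mult_mat_vec_carrier)
  have HFc: "H *\<^sub>v (F *\<^sub>v c) \<in> carrier_vec m"
    using mult_mat_vec_carrier[OF Hc mult_mat_vec_carrier[OF F c]] .
  have "F\<^sup>T *\<^sub>v (N1 *\<^sub>v x) = F\<^sup>T *\<^sub>v (H *\<^sub>v x) - T1 *\<^sub>v c"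
    unfolding N1_mult[OF x] c_def[symmetric] mult_minus_distrib_mat_vec[OF FT Hx HFc] T1_mult[OF c] ..
  also have "T1 *\<^sub>v c = F\<^sup>T *\<^sub>v (H *\<^sub>v x)" unfolding c_def by (rule T1_inv[OF FHx])
  finally show ?thesis using FHx by simp
qed

lemma N1_eq_H:
  assumes x: "x \<in> carrier_vec m" and 0: "F\<^sup>T *\<^sub>v (H *\<^sub>v x) = 0\<^sub>v r"
  shows "N1 *\<^sub>v x = H *\<^sub>v x"
proof -
  have "H *\<^sub>v x \<in> carrier_vec m" using Hc x by (rule mult_mat_vec_carrier)
  then show ?thesis
    unfolding N1_mult[OF x] 0 mult_mat_zero_vec[OF T1ic] mult_mat_zero_vec[OF F] mult_mat_zero_vec[OF Hc] by simp
qed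

text \<open>F^T N1 = 0 holds by construction, and symmetry of N1 transposes it.\<close>

lemma N1_F:
  assumes c: "c \<in> carrier_vec r" and sym: "N1\<^sup>T = N1"
  shows "N1 *\<^sub>v (F *\<^sub>v c) = 0\<^sub>v m"
proof -
  have Fc: "F *\<^sub>v c \<in> carrier_vec m" using F c by (rule mult_mat_vec_carrier)
  define y where "y = N1 *\<^sub>v (F *\<^sub>v c)"
  have y: "y \<in> carrier_vec m" unfolding y_def using N1c Fc by (rule mult_mat_vec_carrier)
  have "y \<bullet> y = (F *\<^sub>v c) \<bullet> (N1 *\<^sub>v y)" unfolding y_def
    by (rule symmetric_scalar_prod[OF N1c sym Fc]) (use y in \<open>simp add: y_def\<close>)
  also have "\<dots> = (N1 *\<^sub>v y) \<bullet> (F *\<^sub>v c)" by (rule comm_scalar_prod[OF Fc mult_mat_vec_carrier[OF N1c y]])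
  also have "\<dots> = (F\<^sup>T *\<^sub>v (N1 *\<^sub>v y)) \<bullet> c" by (rule F_adj[OF mult_mat_vec_carrier[OF N1c y] c, symmetric])
  also have "\<dots> = 0" unfolding FT_N1[OF y] using c by simp
  finally show ?thesis using scalar_prod_self_real(2)[OF y] by (simp add: y_def)
qed

text \<open>The form of N1 - H at x equals - (T1 c) . c with c = T1^{-1} F^T H x, which is
  nonnegative because T1 is negative definite.\<close>

lemma N1_dominates:
  assumes neg: "neg_def T1" and sym: "N1\<^sup>T = N1"
  shows "pos_semidef (N1 - H)"
proof -
  have M: "N1 - H \<in> carrier_mat m m" using Hc by (rule minus_carrier_mat)
  have mT: "- T1 \<in> carrier_mat r r" using T1c by simp
  show ?thesis unfolding pos_semidef_real[OF M]
  proof (intro conjI ballI)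
    show "(N1 - H)\<^sup>T = N1 - H" using transpose_minus[OF N1c Hc] sym S.dc_symmetric by simp
    fix x :: "real vec" assume x: "x \<in> carrier_vec m"
    have Hx: "H *\<^sub>v x \<in> carrier_vec m" using Hc x by (rule mult_mat_vec_carrier)
    define w where "w = F\<^sup>T *\<^sub>v (H *\<^sub>v x)"
    define c where "c = minv T1 *\<^sub>v w"
    have w: "w \<in> carrier_vec r" unfolding w_def using FT Hx by (rule mult_mat_vec_carrier)
    have c: "c \<in> carrier_vec r" unfolding c_def using T1ic w by (rule mult_mat_vec_carrier)
    have Fc: "F *\<^sub>v c \<in> carrier_vec m" using F c by (rule mult_mat_vec_carrier)
    have HFc: "H *\<^sub>v (F *\<^sub>v c) \<in> carrier_vec m" using Hc Fc by (rule mult_mat_vec_carrier)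
    have N1x: "N1 *\<^sub>v x = H *\<^sub>v x - H *\<^sub>v (F *\<^sub>v c)" unfolding N1_mult[OF x] c_def w_def ..
    have N1xc: "N1 *\<^sub>v x \<in> carrier_vec m" using N1c x by (rule mult_mat_vec_carrier)
    have "x \<bullet> ((N1 - H) *\<^sub>v x) = x \<bullet> (N1 *\<^sub>v x) - x \<bullet> (H *\<^sub>v x)"
      unfolding minus_mult_distrib_mat_vec[OF N1c Hc x] by (rule scalar_prod_minus_distrib[OF x N1xc Hx])
    also have "x \<bullet> (N1 *\<^sub>v x) = x \<bullet> (H *\<^sub>v x) - x \<bullet> (H *\<^sub>v (F *\<^sub>v c))"
      unfolding N1x by (rule scalar_prod_minus_distrib[OF x Hx HFc])
    also have "x \<bullet> (H *\<^sub>v (F *\<^sub>v c)) = (H *\<^sub>v x) \<bullet> (F *\<^sub>v c)" by (rule H_sym[OF x Fc, symmetric])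
    also have "\<dots> = w \<bullet> c" unfolding w_def by (rule F_adj[OF Hx c, symmetric])
    also have "w = T1 *\<^sub>v c" unfolding c_def by (rule T1_inv[OF w, symmetric])
    finally have eq: "x \<bullet> ((N1 - H) *\<^sub>v x) = - ((T1 *\<^sub>v c) \<bullet> c)" by simp
    have "0 \<le> c \<bullet> ((- T1) *\<^sub>v c)" using pos_def_imp_semidef[OF mT neg] c unfolding pos_semidef_real[OF mT] by blast
    also have "(- T1) *\<^sub>v c = - (T1 *\<^sub>v c)" using T1c c by simp
    also have "c \<bullet> - (T1 *\<^sub>v c) = - ((T1 *\<^sub>v c) \<bullet> c)"
      using comm_scalar_prod[OF c mult_mat_vec_carrier[OF T1c c]] T1c c by simp
    finally show "0 \<le> x \<bullet> ((N1 - H) *\<^sub>v x)" unfolding eq .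
  qed
qed

lemma G1_V: "c \<in> carrier_vec r \<Longrightarrow> N.G1 *\<^sub>v (V *\<^sub>v c) = F *\<^sub>v c"
proof -
  assume c: "c \<in> carrier_vec r"
  have Vc: "V *\<^sub>v c \<in> carrier_vec m" using V c by (rule mult_mat_vec_carrier)
  have "N.G1 *\<^sub>v (V *\<^sub>v c) = F *\<^sub>v (V\<^sup>T *\<^sub>v (V *\<^sub>v c))" unfolding G1F by (rule assoc_mult_mat_vec[OF F VT Vc])
  also have "V\<^sup>T *\<^sub>v (V *\<^sub>v c) = (V\<^sup>T * V) *\<^sub>v c" by (rule assoc_mult_mat_vec[OF VT V c, symmetric])
  also have "\<dots> = c" unfolding VV using c by simp
  finally show ?thesis .
qed

lemma G1T_eq: "N.G1\<^sup>T = V * F\<^sup>T"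
  unfolding G1F using transpose_mult[OF F VT] by simp

text \<open>The choice u = 0, a = V c makes x = F c and yields semidefiniteness. Strictness comes
  from invertibility of T1, since a semidefinite form vanishes only on the kernel.\<close>

lemma stable_neg_def:
  assumes hw: "hurwitz Acl"
  shows "neg_def T1"
proof -
  have mT: "- T1 \<in> carrier_mat r r" using T1c by simp
  have mTc: "(- T1) *\<^sub>v c = - (T1 *\<^sub>v c)" if "c \<in> carrier_vec r" for c using T1c that by simp
  have nn: "0 \<le> c \<bullet> ((- T1) *\<^sub>v c)" if c: "c \<in> carrier_vec r" for c
  proof -
    have Fc: "F *\<^sub>v c \<in> carrier_vec m" using F c by (rule mult_mat_vec_carrier)
    have HFc: "H *\<^sub>v (F *\<^sub>v c) \<in> carrier_vec m" using Hc Fc by (rule mult_mat_vec_carrier)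
    have Vc: "V *\<^sub>v c \<in> carrier_vec m" using V c by (rule mult_mat_vec_carrier)
    have x: "F *\<^sub>v c = N.G0 *\<^sub>v 0\<^sub>v m + N.G1 *\<^sub>v (V *\<^sub>v c)"
      unfolding G1_V[OF c] mult_mat_zero_vec[OF N.G0_carrier] using Fc by simp
    have "0 \<le> (F *\<^sub>v c) \<bullet> (0\<^sub>v m - H *\<^sub>v (F *\<^sub>v c))"
      by (rule stable_imp(1)[OF hw _ _ Vc x]) (use mult_mat_zero_vec[OF N.G1_carrier] in auto)
    also have "\<dots> = - ((H *\<^sub>v (F *\<^sub>v c)) \<bullet> (F *\<^sub>v c))"
      using comm_scalar_prod[OF Fc HFc] scalar_prod_minus_distrib[OF Fc zero_carrier_vec HFc] Fc by simp
    also have "(H *\<^sub>v (F *\<^sub>v c)) \<bullet> (F *\<^sub>v c) = (T1 *\<^sub>v c) \<bullet> c" unfolding T1_mult[OF c] by (rule F_adj[OF HFc c, symmetric])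
    finally show ?thesis unfolding mTc[OF c]
      using comm_scalar_prod[OF c mult_mat_vec_carrier[OF T1c c]] T1c c by simp
  qed
  have sym: "(- T1)\<^sup>T = - T1" using T1_symmetric by (simp add: transpose_uminus)
  have psd: "pos_semidef (- T1)" unfolding pos_semidef_real[OF mT] using nn sym by blast
  show ?thesis unfolding pos_def_real[OF mT]
  proof (intro conjI sym ballI impI)
    fix c :: "real vec" assume c: "c \<in> carrier_vec r" "c \<noteq> 0\<^sub>v r"
    have "c \<bullet> ((- T1) *\<^sub>v c) \<noteq> 0"
    proof
      assume "c \<bullet> ((- T1) *\<^sub>v c) = 0"
      from pos_semidef_null[OF mT psd c(1) this] have "- (T1 *\<^sub>v c) = 0\<^sub>v r" unfolding mTc[OF c(1)] .
      then have "T1 *\<^sub>v c = 0\<^sub>v r" using uminus_zero_vec_eq[OF mult_mat_vec_carrier[OF T1c c(1)]] by simp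
      with c det_T show False unfolding T1_def[symmetric] det_nonzero_iff_inj[OF T1c] by blast
    qed
    with nn[OF c(1)] show "0 < c \<bullet> ((- T1) *\<^sub>v c)" by simp
  qed
qed

end

lemma eq_neg_if_add_zero:
  fixes a b :: "'a :: comm_ring_1 vec"
  assumes "a \<in> carrier_vec n" "b \<in> carrier_vec n" "a + b = 0\<^sub>v n"
  shows "a = (- 1) \<cdot>\<^sub>v b"
proof (rule eq_vecI)
  fix i assume i: "i < dim_vec ((- 1) \<cdot>\<^sub>v b)"
  have "(a + b) $ i = 0" using assms(2,3) i by simp
  then show "a $ i = ((- 1) \<cdot>\<^sub>v b) $ i" using assms(2) i by (simp add: eq_neg_iff_add_eq_0)
qed (use assms in auto)

lemma add_zero_if_eq_neg:
  fixes a b :: "'a :: comm_ring_1 vec"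
  assumes "a \<in> carrier_vec n" "b \<in> carrier_vec n" "a = (- 1) \<cdot>\<^sub>v b"
  shows "a + b = 0\<^sub>v n"
  using assms(2) unfolding assms(3) by (intro eq_vecI) auto

text \<open>The case N1 \<ge> 0 is e = 1 and the case N1 \<le> 0 is e = -1; R is the square root of e N1.\<close>

locale feedback_sqrt = feedback_svd +
  fixes R :: "real mat" and e :: real
  assumes R: "R \<in> carrier_mat m m" and R_sym: "R\<^sup>T = R" and e: "e * e = 1"
    and N1_sym: "N1\<^sup>T = N1" and N1_R: "N1 = e \<cdot>\<^sub>m (R * R)"
begin

lemma R_vec: "x \<in> carrier_vec m \<Longrightarrow> R *\<^sub>v x \<in> carrier_vec m"
  using R by (rule mult_mat_vec_carrier)

lemma N1_R_mult: "x \<in> carrier_vec m \<Longrightarrow> N1 *\<^sub>v x = e \<cdot>\<^sub>v (R *\<^sub>v (R *\<^sub>v x))"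
proof -
  assume x: "x \<in> carrier_vec m"
  have RR: "R * R \<in> carrier_mat m m" using R R by (rule mult_carrier_mat)
  have "N1 *\<^sub>v x = e \<cdot>\<^sub>v ((R * R) *\<^sub>v x)" unfolding N1_R using RR x by (intro eq_vecI) (auto simp del: assoc_mult_mat_vec)
  also have "(R * R) *\<^sub>v x = R *\<^sub>v (R *\<^sub>v x)" by (rule assoc_mult_mat_vec[OF R R x])
  finally show ?thesis .
qed

lemma R_sym_prod: "x \<in> carrier_vec m \<Longrightarrow> y \<in> carrier_vec m \<Longrightarrow> (R *\<^sub>v x) \<bullet> y = x \<bullet> (R *\<^sub>v y)"
  by (rule symmetric_scalar_prod[OF R R_sym])

text \<open>R^2 F = 0 follows from N1 F = 0, and |R F c|^2 = (F c) . R^2 F c.\<close>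

lemma R_F:
  assumes c: "c \<in> carrier_vec r"
  shows "R *\<^sub>v (F *\<^sub>v c) = 0\<^sub>v m"
proof -
  have Fc: "F *\<^sub>v c \<in> carrier_vec m" using F c by (rule mult_mat_vec_carrier)
  have "e \<cdot>\<^sub>v (R *\<^sub>v (R *\<^sub>v (F *\<^sub>v c))) = 0\<^sub>v m" using N1_R_mult[OF Fc] N1_F[OF c N1_sym] by simp
  then have "e \<cdot>\<^sub>v (e \<cdot>\<^sub>v (R *\<^sub>v (R *\<^sub>v (F *\<^sub>v c)))) = 0\<^sub>v m" by simp
  then have "R *\<^sub>v (R *\<^sub>v (F *\<^sub>v c)) = 0\<^sub>v m" using e by (simp add: smult_smult_assoc)
  then have "(R *\<^sub>v (F *\<^sub>v c)) \<bullet> (R *\<^sub>v (F *\<^sub>v c)) = 0"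
    using R_sym_prod[OF Fc R_vec[OF Fc]] Fc by simp
  then show ?thesis using scalar_prod_self_real(2)[OF R_vec[OF Fc]] by simp
qed

text \<open>F^T R = 0 is the transpose of R F = 0, so R x lies in the left kernel of
  \<open>G1\<close>, which is also its kernel. The range of R therefore supplies admissible vectors
  both for the stability test and for the Schwarz-Pick inequality.\<close>

lemma G1_R:
  assumes x: "x \<in> carrier_vec m"
  shows "N.G1 *\<^sub>v (R *\<^sub>v x) = 0\<^sub>v m"
proof -
  have Rx: "R *\<^sub>v x \<in> carrier_vec m" by (rule R_vec[OF x])
  define c where "c = F\<^sup>T *\<^sub>v (R *\<^sub>v x)"
  have c: "c \<in> carrier_vec r" unfolding c_def using FT Rx by (rule mult_mat_vec_carrier)
  have Fc: "F *\<^sub>v c \<in> carrier_vec m" using F c by (rule mult_mat_vec_carrier)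
  have "c \<bullet> c = (R *\<^sub>v x) \<bullet> (F *\<^sub>v c)" using F_adj[OF Rx c] by (simp add: c_def)
  also have "\<dots> = x \<bullet> (R *\<^sub>v (F *\<^sub>v c))" by (rule R_sym_prod[OF x Fc])
  also have "\<dots> = 0" unfolding R_F[OF c] using x by simp
  finally have "c = 0\<^sub>v r" using scalar_prod_self_real(2)[OF c] by simp
  then have "N.G1\<^sup>T *\<^sub>v (R *\<^sub>v x) = 0\<^sub>v m"
    unfolding G1T_eq assoc_mult_mat_vec[OF V FT Rx] c_def[symmetric] using mult_mat_zero_vec[OF V] by metis
  then show ?thesis using N.kernel_real[OF Rx] by simp
qed

lemma R_G1:
  assumes x: "x \<in> carrier_vec m"
  shows "R *\<^sub>v (N.G1 *\<^sub>v x) = 0\<^sub>v m"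
  unfolding G1F assoc_mult_mat_vec[OF F VT x] by (rule R_F[OF mult_mat_vec_carrier[OF VT x]])

lemma G1_R_mat: "N.G1 * R = 0\<^sub>m m m"
proof (rule mat_eqI_vec)
  fix x :: "real vec" assume x: "x \<in> carrier_vec m"
  show "(N.G1 * R) *\<^sub>v x = 0\<^sub>m m m *\<^sub>v x"
    unfolding assoc_mult_mat_vec[OF N.G1_carrier R x] G1_R[OF x] zero_mat_mult_vec[OF x] ..
qed (rule mult_carrier_mat[OF N.G1_carrier R], rule zero_carrier_mat)

lemma R_G1_mat: "R * N.G1 = 0\<^sub>m m m"
proof (rule mat_eqI_vec)
  fix x :: "real vec" assume x: "x \<in> carrier_vec m"
  show "(R * N.G1) *\<^sub>v x = 0\<^sub>m m m *\<^sub>v x"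
    unfolding assoc_mult_mat_vec[OF R N.G1_carrier x] R_G1[OF x] zero_mat_mult_vec[OF x] ..
qed (rule mult_carrier_mat[OF R N.G1_carrier], rule zero_carrier_mat)

definition K :: "real mat" where "K = R * N.G0 * R"

lemma K: "K \<in> carrier_mat m m" and RG0: "R * N.G0 \<in> carrier_mat m m"
proof -
  show RG0: "R * N.G0 \<in> carrier_mat m m" using R N.G0_carrier by (rule mult_carrier_mat)
  show "K \<in> carrier_mat m m" unfolding K_def using RG0 R by (rule mult_carrier_mat)
qed

lemma K_mult: "x \<in> carrier_vec m \<Longrightarrow> K *\<^sub>v x = R *\<^sub>v (N.G0 *\<^sub>v (R *\<^sub>v x))"
  unfolding K_def by (simp only: assoc_mult_mat_vec[OF RG0 R] assoc_mult_mat_vec[OF R N.G0_carrier R_vec])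

lemma cmat_vec: "x \<in> carrier_vec m \<Longrightarrow> cmat R *\<^sub>v x \<in> carrier_vec m"
    "x \<in> carrier_vec m \<Longrightarrow> cmat N.G0 *\<^sub>v x \<in> carrier_vec m"
    "x \<in> carrier_vec m \<Longrightarrow> cmat N.G1 *\<^sub>v x \<in> carrier_vec m"
    "x \<in> carrier_vec m \<Longrightarrow> cmat K *\<^sub>v x \<in> carrier_vec m"
  using mult_mat_vec_carrier[of "cmat R" m m x] mult_mat_vec_carrier[of "cmat N.G0" m m x]
    mult_mat_vec_carrier[of "cmat N.G1" m m x] mult_mat_vec_carrier[of "cmat K" m m x] R K by auto

lemma K_cmult: "x \<in> carrier_vec m \<Longrightarrow> cmat K *\<^sub>v x = cmat R *\<^sub>v (cmat N.G0 *\<^sub>v (cmat R *\<^sub>v x))"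
  unfolding K_def by (simp only: cmat_mult_vec[OF RG0 R] cmat_mult_vec[OF R N.G0_carrier] cmat_vec)

lemma G1_cR: "x \<in> carrier_vec m \<Longrightarrow> cmat N.G1 *\<^sub>v (cmat R *\<^sub>v x) = 0\<^sub>v m"
  using cmat_mult_vec[OF N.G1_carrier R, of x] by (simp add: G1_R_mat)

lemma cR_G1: "x \<in> carrier_vec m \<Longrightarrow> cmat R *\<^sub>v (cmat N.G1 *\<^sub>v x) = 0\<^sub>v m"
  using cmat_mult_vec[OF R N.G1_carrier, of x] by (simp add: R_G1_mat)

lemma cR_adj: "x \<in> carrier_vec m \<Longrightarrow> y \<in> carrier_vec m \<Longrightarrow> (cmat R *\<^sub>v x) \<bullet>c y = x \<bullet>c (cmat R *\<^sub>v y)"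
  using cscalar_prod_adjoint[of "cmat R" m m x y] R by (simp add: mat_adjoint_cmat R_sym)

lemma N1_cmult:
  assumes x: "x \<in> carrier_vec m"
  shows "cmat N1 *\<^sub>v x = complex_of_real e \<cdot>\<^sub>v (cmat R *\<^sub>v (cmat R *\<^sub>v x))"
proof -
  have RR: "R * R \<in> carrier_mat m m" using R R by (rule mult_carrier_mat)
  have "cmat N1 = complex_of_real e \<cdot>\<^sub>m cmat (R * R)" unfolding N1_R using RR by auto
  moreover have "(complex_of_real e \<cdot>\<^sub>m M) *\<^sub>v x = complex_of_real e \<cdot>\<^sub>v (M *\<^sub>v x)"
    if "M \<in> carrier_mat m m" for M using that x by (intro eq_vecI) auto
  ultimately have "cmat N1 *\<^sub>v x = complex_of_real e \<cdot>\<^sub>v (cmat (R * R) *\<^sub>v x)" using RR by simp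
  then show ?thesis by (simp only: cmat_mult_vec[OF R R x])
qed

text \<open>The form of \<open>G0\<close> is real on the kernel of \<open>G1\<close>, and R maps
  into that kernel.\<close>

lemma K_sym: "K\<^sup>T = K"
proof (rule symmetric_if_form_real[OF K])
  fix x :: "complex vec" assume x: "x \<in> carrier_vec m"
  have "(cmat K *\<^sub>v x) \<bullet>c x = (cmat N.G0 *\<^sub>v (cmat R *\<^sub>v x)) \<bullet>c (cmat R *\<^sub>v x)"
    unfolding K_cmult[OF x] by (rule cR_adj[OF cmat_vec(2)[OF cmat_vec(1)[OF x]] x])
  then show "Im ((cmat K *\<^sub>v x) \<bullet>c x) = 0"
    using N.G0_form_real[OF cmat_vec(1)[OF x] G1_cR[OF x]] by simp
qed

text \<open>The term \<open>G1\<close> a can be any vector in the range of F and is chosen so that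
  F^T H x = 0. Then H x = N1 x, and since N1 and R kill the range of F, only G0 (e R q) contributes
  to H x and R x.\<close>

lemma test_vector:
  assumes q: "q \<in> carrier_vec m"
  obtains x a where "x \<in> carrier_vec m" "a \<in> carrier_vec m"
    "x = N.G0 *\<^sub>v (e \<cdot>\<^sub>v (R *\<^sub>v q)) + N.G1 *\<^sub>v a"
    "H *\<^sub>v x = R *\<^sub>v (K *\<^sub>v q)" "R *\<^sub>v x = e \<cdot>\<^sub>v (K *\<^sub>v q)"
proof -
  have Rq: "R *\<^sub>v q \<in> carrier_vec m" by (rule R_vec[OF q])
  have GRq: "N.G0 *\<^sub>v (R *\<^sub>v q) \<in> carrier_vec m" using N.G0_carrier Rq by (rule mult_mat_vec_carrier)
  define g where "g = N.G0 *\<^sub>v (e \<cdot>\<^sub>v (R *\<^sub>v q))"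
  have g: "g \<in> carrier_vec m" unfolding g_def using N.G0_carrier by (rule mult_mat_vec_carrier) (use Rq in simp)
  have ge: "g = e \<cdot>\<^sub>v (N.G0 *\<^sub>v (R *\<^sub>v q))" unfolding g_def by (rule mult_mat_vec[OF N.G0_carrier Rq])
  have Hg: "H *\<^sub>v g \<in> carrier_vec m" using Hc g by (rule mult_mat_vec_carrier)
  have FHg: "F\<^sup>T *\<^sub>v (H *\<^sub>v g) \<in> carrier_vec r" using FT Hg by (rule mult_mat_vec_carrier)
  define d where "d = minv T1 *\<^sub>v (F\<^sup>T *\<^sub>v (H *\<^sub>v g))"
  have d: "d \<in> carrier_vec r" unfolding d_def using T1ic FHg by (rule mult_mat_vec_carrier)
  define c where "c = (- 1) \<cdot>\<^sub>v d"
  have c: "c \<in> carrier_vec r" using d by (simp add: c_def)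
  have Fc: "F *\<^sub>v c \<in> carrier_vec m" using F c by (rule mult_mat_vec_carrier)
  have HFc: "H *\<^sub>v (F *\<^sub>v c) \<in> carrier_vec m" using Hc Fc by (rule mult_mat_vec_carrier)
  define x where "x = g + F *\<^sub>v c"
  have x: "x \<in> carrier_vec m" using g Fc by (simp add: x_def)
  have Kq: "K *\<^sub>v q \<in> carrier_vec m" using K q by (rule mult_mat_vec_carrier)
  have Rg: "R *\<^sub>v g = e \<cdot>\<^sub>v (K *\<^sub>v q)" unfolding ge K_mult[OF q] by (rule mult_mat_vec[OF R GRq])
  have "F\<^sup>T *\<^sub>v (H *\<^sub>v x) = F\<^sup>T *\<^sub>v (H *\<^sub>v g) + T1 *\<^sub>v c"
    unfolding x_def mult_add_distrib_mat_vec[OF Hc g Fc] mult_add_distrib_mat_vec[OF FT Hg HFc] T1_mult[OF c] ..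
  also have "T1 *\<^sub>v c = (- 1) \<cdot>\<^sub>v (F\<^sup>T *\<^sub>v (H *\<^sub>v g))"
    using mult_mat_vec[OF T1c d, of "- 1"] T1_inv[OF FHg] by (simp only: c_def d_def)
  also have "F\<^sup>T *\<^sub>v (H *\<^sub>v g) + (- 1) \<cdot>\<^sub>v (F\<^sup>T *\<^sub>v (H *\<^sub>v g)) = 0\<^sub>v r"
    using FHg by (intro eq_vecI) (simp_all del: index_mult_mat_vec dim_mult_mat_vec)
  finally have "F\<^sup>T *\<^sub>v (H *\<^sub>v x) = 0\<^sub>v r" .
  then have "H *\<^sub>v x = N1 *\<^sub>v x" by (rule N1_eq_H[OF x, symmetric])
  also have "\<dots> = N1 *\<^sub>v g" unfolding x_def mult_add_distrib_mat_vec[OF N1c g Fc] N1_F[OF c N1_sym]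
    using mult_mat_vec_carrier[OF N1c g] by simp
  also have "\<dots> = e \<cdot>\<^sub>v (R *\<^sub>v (e \<cdot>\<^sub>v (K *\<^sub>v q)))" unfolding N1_R_mult[OF g] Rg ..
  also have "\<dots> = R *\<^sub>v (K *\<^sub>v q)" unfolding mult_mat_vec[OF R Kq] using e by (simp add: smult_smult_assoc)
  finally have Hx: "H *\<^sub>v x = R *\<^sub>v (K *\<^sub>v q)" .
  have Rx: "R *\<^sub>v x = e \<cdot>\<^sub>v (K *\<^sub>v q)"
    unfolding x_def mult_add_distrib_mat_vec[OF R g Fc] R_F[OF c] Rg using Kq by simp
  have Vc: "V *\<^sub>v c \<in> carrier_vec m" using V c by (rule mult_mat_vec_carrier)
  have "x = N.G0 *\<^sub>v (e \<cdot>\<^sub>v (R *\<^sub>v q)) + N.G1 *\<^sub>v (V *\<^sub>v c)" unfolding x_def g_def G1_V[OF c] ..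
  from that[OF x Vc this Hx Rx] show thesis .
qed

text \<open>The fixed-point equation makes u = e R q equal to R K q = H x, so x = 0 by stability,
  and then q = e K q = R x = 0.\<close>

lemma stable_injective:
  assumes hw: "hurwitz Acl" and q: "q \<in> carrier_vec m" and eq: "q = e \<cdot>\<^sub>v (K *\<^sub>v q)"
  shows "q = 0\<^sub>v m"
proof (rule test_vector[OF q])
  fix x a assume x: "x \<in> carrier_vec m" and a: "a \<in> carrier_vec m"
    and xe: "x = N.G0 *\<^sub>v (e \<cdot>\<^sub>v (R *\<^sub>v q)) + N.G1 *\<^sub>v a"
    and Hx: "H *\<^sub>v x = R *\<^sub>v (K *\<^sub>v q)" and Rx: "R *\<^sub>v x = e \<cdot>\<^sub>v (K *\<^sub>v q)"
  have Rq: "R *\<^sub>v q \<in> carrier_vec m" by (rule R_vec[OF q])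
  have u: "e \<cdot>\<^sub>v (R *\<^sub>v q) \<in> carrier_vec m" using Rq by simp
  have Kq: "K *\<^sub>v q \<in> carrier_vec m" using K q by (rule mult_mat_vec_carrier)
  have G1u: "N.G1 *\<^sub>v (e \<cdot>\<^sub>v (R *\<^sub>v q)) = 0\<^sub>v m"
    unfolding mult_mat_vec[OF N.G1_carrier Rq] G1_R[OF q] by simp
  have "e \<cdot>\<^sub>v (R *\<^sub>v q) = e \<cdot>\<^sub>v (R *\<^sub>v (e \<cdot>\<^sub>v (K *\<^sub>v q)))" using eq by simp
  also have "\<dots> = H *\<^sub>v x" unfolding Hx mult_mat_vec[OF R Kq] using e by (simp add: smult_smult_assoc)
  finally have "x = 0\<^sub>v m" by (rule stable_imp(2)[OF hw u G1u a xe])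
  then have "R *\<^sub>v x = 0\<^sub>v m" using mult_mat_zero_vec[OF R] by metis
  with Rx eq show "q = 0\<^sub>v m" by simp
qed

text \<open>Stability gives x . (u - H x) = (K q) . d \<ge> 0 with d = q - K q, while the form of I
  - K at q is q . d = |d|^2 + (K q) . d. Injectivity makes d nonzero, hence the strict sign.\<close>

lemma stable_pos_def:
  assumes hw: "hurwitz Acl" and e1: "e = 1"
  shows "pos_def (1\<^sub>m m - K)"
proof -
  have M: "1\<^sub>m m - K \<in> carrier_mat m m" using K by (rule minus_carrier_mat)
  show ?thesis unfolding pos_def_real[OF M]
  proof (intro conjI ballI impI)
    show "(1\<^sub>m m - K)\<^sup>T = 1\<^sub>m m - K" using transpose_minus[OF one_carrier_mat K] K_sym by simp
    fix q :: "real vec" assume q: "q \<in> carrier_vec m" "q \<noteq> 0\<^sub>v m"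
    have Kq: "K *\<^sub>v q \<in> carrier_vec m" using K q(1) by (rule mult_mat_vec_carrier)
    show "0 < q \<bullet> ((1\<^sub>m m - K) *\<^sub>v q)"
    proof (rule test_vector[OF q(1)])
      fix x a assume x: "x \<in> carrier_vec m" and a: "a \<in> carrier_vec m"
        and xe: "x = N.G0 *\<^sub>v (e \<cdot>\<^sub>v (R *\<^sub>v q)) + N.G1 *\<^sub>v a"
        and Hx: "H *\<^sub>v x = R *\<^sub>v (K *\<^sub>v q)" and Rx: "R *\<^sub>v x = e \<cdot>\<^sub>v (K *\<^sub>v q)"
      define d where "d = q - K *\<^sub>v q"
      have d: "d \<in> carrier_vec m" using q Kq by (simp add: d_def)
      have Rq: "R *\<^sub>v q \<in> carrier_vec m" by (rule R_vec[OF q(1)])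
      have u: "e \<cdot>\<^sub>v (R *\<^sub>v q) \<in> carrier_vec m" using Rq by simp
      have G1u: "N.G1 *\<^sub>v (e \<cdot>\<^sub>v (R *\<^sub>v q)) = 0\<^sub>v m"
        unfolding mult_mat_vec[OF N.G1_carrier Rq] G1_R[OF q(1)] by simp
      have "0 \<le> x \<bullet> (e \<cdot>\<^sub>v (R *\<^sub>v q) - H *\<^sub>v x)" by (rule stable_imp(1)[OF hw u G1u a xe])
      also have "e \<cdot>\<^sub>v (R *\<^sub>v q) - H *\<^sub>v x = R *\<^sub>v d"
        unfolding Hx d_def mult_minus_distrib_mat_vec[OF R q(1) Kq] by (simp add: e1)
      also have "x \<bullet> (R *\<^sub>v d) = (K *\<^sub>v q) \<bullet> d" using R_sym_prod[OF x d] Rx by (simp add: e1)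
      finally have 1: "0 \<le> (K *\<^sub>v q) \<bullet> d" .
      have "d \<noteq> 0\<^sub>v m"
      proof
        assume "d = 0\<^sub>v m"
        then have "q = e \<cdot>\<^sub>v (K *\<^sub>v q)" using vec_minus_self_eq[OF q(1) Kq] by (simp add: d_def e1)
        from stable_injective[OF hw q(1) this] q(2) show False by simp
      qed
      then have 2: "0 < d \<bullet> d" using scalar_prod_self_real[of d] d by (metis less_eq_real_def)
      have "q \<bullet> ((1\<^sub>m m - K) *\<^sub>v q) = q \<bullet> d"
        unfolding minus_mult_distrib_mat_vec[OF one_carrier_mat K q(1)] using q(1) by (simp add: d_def)
      moreover have "q = d + K *\<^sub>v q"
        unfolding d_def using q(1) Kq by (intro eq_vecI) (simp_all del: index_mult_mat_vec dim_mult_mat_vec)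
      then have "q \<bullet> d = d \<bullet> d + (K *\<^sub>v q) \<bullet> d" using add_scalar_prod_distrib[OF d Kq d] by simp
      ultimately have "q \<bullet> ((1\<^sub>m m - K) *\<^sub>v q) = d \<bullet> d + (K *\<^sub>v q) \<bullet> d" by simp
      with 1 2 show ?thesis by simp
    qed
  qed
qed

text \<open>G1 w = 0 means F^T w = 0, so w = H y = N1 y, and q = R y satisfies q = e K q.
  Injectivity gives q = 0, hence w = 0, and y = F c for some c. Then T1 c = F^T w = 0, so c = 0 and
  y = 0.\<close>

lemma no_zero_mode:
  assumes minN: "minimal_realization m G n A B C D" and minS: "minimal_realization m Gb n' A' B' C' D'"
    and inj: "\<And>q. q \<in> carrier_vec m \<Longrightarrow> q = complex_of_real e \<cdot>\<^sub>v (cmat K *\<^sub>v q) \<Longrightarrow> q = 0\<^sub>v m"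
  shows "\<not> eigenvalue (cmat Acl) 0"
proof
  let ?e = "complex_of_real e"
  assume eig: "eigenvalue (cmat Acl) 0"
  show False
  proof (rule zero_mode[OF minN minS eig])
    fix y w a assume y: "y \<in> carrier_vec m" "y \<noteq> 0\<^sub>v m" and w: "w \<in> carrier_vec m" and a: "a \<in> carrier_vec m"
      and wH: "w = cmat H *\<^sub>v y" and G1w: "cmat N.G1 *\<^sub>v w = 0\<^sub>v m" and ye: "y = cmat N.G0 *\<^sub>v w + cmat N.G1 *\<^sub>v a"
    have cF: "cmat F \<in> carrier_mat m r" and cV: "cmat V \<in> carrier_mat m r" using F V by auto
    have FTw: "cmat (F\<^sup>T) *\<^sub>v w \<in> carrier_vec r" using mult_mat_vec_carrier[of "cmat (F\<^sup>T)" r m w] FT w by simp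
    have "cmat V *\<^sub>v (cmat (F\<^sup>T) *\<^sub>v w) = cmat (N.G1\<^sup>T) *\<^sub>v w" unfolding G1T_eq by (rule cmat_mult_vec[OF V FT w, symmetric])
    also have "\<dots> = 0\<^sub>v m" using N.kernel_complex[OF w] G1w by simp
    finally have "cmat (V\<^sup>T) *\<^sub>v (cmat V *\<^sub>v (cmat (F\<^sup>T) *\<^sub>v w)) = 0\<^sub>v r"
      using mult_mat_zero_vec[of "cmat (V\<^sup>T)" r m] VT by simp
    then have FTw0: "cmat (F\<^sup>T) *\<^sub>v w = 0\<^sub>v r"
      using cmat_mult_vec[OF VT V FTw] FTw by (simp add: VV)
    have HFi: "H * F * minv T1 \<in> carrier_mat m r"
      using mult_carrier_mat[OF mult_carrier_mat[OF Hc F] T1ic] .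
    have HFiF: "H * F * minv T1 * F\<^sup>T \<in> carrier_mat m m" using mult_carrier_mat[OF HFi FT] .
    have P: "H * F * minv T1 * F\<^sup>T * H \<in> carrier_mat m m" using mult_carrier_mat[OF HFiF Hc] .
    have "cmat (H * F * minv T1 * F\<^sup>T * H) *\<^sub>v y = cmat (H * F * minv T1) *\<^sub>v (cmat (F\<^sup>T) *\<^sub>v w)"
      unfolding cmat_mult_vec[OF HFiF Hc y(1)] wH[symmetric] by (rule cmat_mult_vec[OF HFi FT w])
    also have "\<dots> = 0\<^sub>v m" unfolding FTw0 using mult_mat_zero_vec[of "cmat (H * F * minv T1)" m r] HFi by simp
    finally have z: "cmat (H * F * minv T1 * F\<^sup>T * H) *\<^sub>v y = 0\<^sub>v m" .
    have "cmat N1 *\<^sub>v y = w"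
    proof -
      have "cmat N1 *\<^sub>v y = cmat H *\<^sub>v y - cmat (H * F * minv T1 * F\<^sup>T * H) *\<^sub>v y"
        unfolding N1_def cmat_minus[OF Hc P] by (rule minus_mult_distrib_mat_vec[of _ m m]) (use Hc P y in simp_all)
      then show ?thesis unfolding z wH[symmetric] using w by simp
    qed
    then have wR: "w = ?e \<cdot>\<^sub>v (cmat R *\<^sub>v (cmat R *\<^sub>v y))" using N1_cmult[OF y(1)] by simp
    define q where "q = cmat R *\<^sub>v y"
    have q: "q \<in> carrier_vec m" unfolding q_def by (rule cmat_vec(1)[OF y(1)])
    have cR: "cmat R \<in> carrier_mat m m" and cG0: "cmat N.G0 \<in> carrier_mat m m" using R by auto
    have "q = cmat R *\<^sub>v (cmat N.G0 *\<^sub>v w) + cmat R *\<^sub>v (cmat N.G1 *\<^sub>v a)"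
      unfolding q_def by (subst ye) (rule mult_add_distrib_mat_vec[OF cR cmat_vec(2)[OF w] cmat_vec(3)[OF a]])
    also have "\<dots> = cmat R *\<^sub>v (cmat N.G0 *\<^sub>v w)"
      unfolding cR_G1[OF a] using cmat_vec(1)[OF cmat_vec(2)[OF w]] by simp
    also have "\<dots> = cmat R *\<^sub>v (?e \<cdot>\<^sub>v (cmat N.G0 *\<^sub>v (cmat R *\<^sub>v q)))"
      using mult_mat_vec[OF cG0 cmat_vec(1)[OF q], of ?e] by (simp add: wR q_def)
    also have "\<dots> = ?e \<cdot>\<^sub>v (cmat K *\<^sub>v q)"
      unfolding K_cmult[OF q] by (rule mult_mat_vec[OF cR cmat_vec(2)[OF cmat_vec(1)[OF q]]])
    finally have "q = 0\<^sub>v m" by (rule inj[OF q])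
    then have w0: "w = 0\<^sub>v m" unfolding wR q_def[symmetric] using mult_mat_zero_vec[OF cR] by simp
    have "y = cmat N.G1 *\<^sub>v a" using ye w0 mult_mat_zero_vec[OF cG0] cmat_vec(3)[OF a] by simp
    define c where "c = cmat (V\<^sup>T) *\<^sub>v a"
    have c: "c \<in> carrier_vec r" unfolding c_def using mult_mat_vec_carrier[of "cmat (V\<^sup>T)" r m a] VT a by simp
    have yF: "y = cmat F *\<^sub>v c" unfolding \<open>y = cmat N.G1 *\<^sub>v a\<close> G1F c_def by (rule cmat_mult_vec[OF F VT a])
    have FH: "F\<^sup>T * H \<in> carrier_mat r m" using FT Hc by (rule mult_carrier_mat)
    have "cmat T1 *\<^sub>v c = cmat (F\<^sup>T * H) *\<^sub>v y" unfolding T1_def yF by (rule cmat_mult_vec[OF FH F c])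
    also have "\<dots> = cmat (F\<^sup>T) *\<^sub>v w" unfolding wH by (rule cmat_mult_vec[OF FT Hc y(1)])
    finally have "cmat T1 *\<^sub>v c = 0\<^sub>v r" unfolding FTw0 .
    then have "c = 0\<^sub>v r" by (rule cmat_kernel_trivial[OF T1c det_T[folded T1_def] c])
    then have "y = 0\<^sub>v m" using yF mult_mat_zero_vec[OF cF] by simp
    with y(2) show False by simp
  qed
qed

lemma cN1_form:
  assumes y: "y \<in> carrier_vec m"
  shows "(cmat N1 *\<^sub>v y) \<bullet>c y = complex_of_real e * ((cmat R *\<^sub>v y) \<bullet>c (cmat R *\<^sub>v y))"
proof -
  have RRy: "cmat R *\<^sub>v (cmat R *\<^sub>v y) \<in> carrier_vec m" by (rule cmat_vec(1)[OF cmat_vec(1)[OF y]])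
  show ?thesis unfolding N1_cmult[OF y]
    using smult_scalar_prod_distrib[OF RRy, of "conjugate y"] cR_adj[OF cmat_vec(1)[OF y] y] y by simp
qed

lemma dc_le_N1:
  assumes neg: "neg_def T1" and y: "y \<in> carrier_vec m"
  shows "Re ((cmat H *\<^sub>v y) \<bullet>c y) \<le> e * Re ((cmat R *\<^sub>v y) \<bullet>c (cmat R *\<^sub>v y))"
proof -
  have M: "N1 - H \<in> carrier_mat m m" using Hc by (rule minus_carrier_mat)
  have cN: "cmat N1 \<in> carrier_mat m m" and cH: "cmat H \<in> carrier_mat m m" using N1c Hc by auto
  have Ny: "cmat N1 *\<^sub>v y \<in> carrier_vec m" and Hy: "cmat H *\<^sub>v y \<in> carrier_vec m"
    using mult_mat_vec_carrier[OF cN y] mult_mat_vec_carrier[OF cH y] by auto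
  have cy: "conjugate y \<in> carrier_vec m" using y by simp
  have "0 \<le> Re ((cmat (N1 - H) *\<^sub>v y) \<bullet>c y)"
    by (rule pos_semidef_complex_form[OF M N1_dominates[OF neg N1_sym] y])
  also have "(cmat (N1 - H) *\<^sub>v y) \<bullet>c y = (cmat N1 *\<^sub>v y) \<bullet>c y - (cmat H *\<^sub>v y) \<bullet>c y"
    unfolding cmat_minus[OF N1c Hc] minus_mult_distrib_mat_vec[OF cN cH y] by (rule minus_scalar_prod_distrib[OF Ny Hy cy])
  finally show ?thesis unfolding cN1_form[OF y] by simp
qed

lemma no_right_mode_pos:
  assumes minN: "minimal_realization m G n A B C D" and minS: "minimal_realization m Gb n' A' B' C' D'"
    and e1: "e = 1" and neg: "neg_def T1" and pd: "pos_def (1\<^sub>m m - K)" and s: "0 < Re s"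
  shows "\<not> eigenvalue (cmat Acl) s"
proof
  assume eig: "eigenvalue (cmat Acl) s"
  let ?P = "\<lambda>y. cmat R *\<^sub>v (cmat R *\<^sub>v y)"
  show False
  proof (rule right_mode[OF minN minS eig s, where P = ?P])
    show "?P y \<in> carrier_vec m" if "y \<in> carrier_vec m" for y by (rule cmat_vec(1)[OF cmat_vec(1)[OF that]])
    show "cmat N.G1 *\<^sub>v ?P y = 0\<^sub>v m" if "y \<in> carrier_vec m" for y by (rule G1_cR[OF cmat_vec(1)[OF that]])
    fix y assume y: "y \<in> carrier_vec m"
      and lt: "2 * Re (y \<bullet>c ?P y) - Re ((cmat N.G0 *\<^sub>v ?P y) \<bullet>c ?P y) < Re ((cmat H *\<^sub>v y) \<bullet>c y)"
    define q where "q = cmat R *\<^sub>v y"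
    have q: "q \<in> carrier_vec m" unfolding q_def by (rule cmat_vec(1)[OF y])
    have 1: "y \<bullet>c ?P y = q \<bullet>c q" using cR_adj[OF y q] by (simp add: q_def)
    have 2: "(cmat N.G0 *\<^sub>v ?P y) \<bullet>c ?P y = (cmat K *\<^sub>v q) \<bullet>c q"
      unfolding K_cmult[OF q] using cR_adj[OF cmat_vec(2)[OF cmat_vec(1)[OF q]] q] by (simp add: q_def)
    have 3: "Re ((cmat H *\<^sub>v y) \<bullet>c y) \<le> Re (q \<bullet>c q)" using dc_le_N1[OF neg y] by (simp add: q_def e1)
    have M: "1\<^sub>m m - K \<in> carrier_mat m m" using K by (rule minus_carrier_mat)
    have cK: "cmat K \<in> carrier_mat m m" using K by simp
    have cq: "conjugate q \<in> carrier_vec m" using q by simp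
    \<comment> \<open>The strict inequality of the contradiction is supplied by the mode, ultimately
      by SNI, so here the form of I - K enters with \<le>; q may be 0.\<close>
    have "0 \<le> Re ((cmat (1\<^sub>m m - K) *\<^sub>v q) \<bullet>c q)"
      by (rule pos_semidef_complex_form[OF M pos_def_imp_semidef[OF M pd] q])
    also have "(cmat (1\<^sub>m m - K) *\<^sub>v q) \<bullet>c q = q \<bullet>c q - (cmat K *\<^sub>v q) \<bullet>c q"
      unfolding cmat_minus[OF one_carrier_mat K] cmat_one minus_mult_distrib_mat_vec[OF one_carrier_mat cK q]
      using minus_scalar_prod_distrib[OF q cmat_vec(4)[OF q] cq] q by simp
    finally show False using lt 3 unfolding 1 2 by simp
  qed
qed

lemma no_right_mode_neg:
  assumes minN: "minimal_realization m G n A B C D" and minS: "minimal_realization m Gb n' A' B' C' D'"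
    and e1: "e = - 1" and neg: "neg_def T1" and s: "0 < Re s"
  shows "\<not> eigenvalue (cmat Acl) s"
proof
  assume eig: "eigenvalue (cmat Acl) s"
  show False
  proof (rule right_mode[OF minN minS eig s, where P = "\<lambda>_. 0\<^sub>v m"])
    show "cmat N.G1 *\<^sub>v 0\<^sub>v m = 0\<^sub>v m" using mult_mat_zero_vec[of "cmat N.G1" m m] by simp
    fix y :: "complex vec" assume y: "y \<in> carrier_vec m"
      and lt: "2 * Re (y \<bullet>c 0\<^sub>v m) - Re ((cmat N.G0 *\<^sub>v 0\<^sub>v m) \<bullet>c 0\<^sub>v m) < Re ((cmat H *\<^sub>v y) \<bullet>c y)"
    have "0 < Re ((cmat H *\<^sub>v y) \<bullet>c y)" using lt y mult_mat_zero_vec[of "cmat N.G0" m m] by simp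
    with dc_le_N1[OF neg y] cscalar_prod_self_Re(1)[of "cmat R *\<^sub>v y"] show False by (simp add: e1)
  qed simp
qed

lemma stable_iff_pos:
  assumes minN: "minimal_realization m G n A B C D" and minS: "minimal_realization m Gb n' A' B' C' D'"
    and e1: "e = 1"
  shows "hurwitz Acl \<longleftrightarrow> neg_def T1 \<and> pos_def (1\<^sub>m m - K)"
proof
  assume "neg_def T1 \<and> pos_def (1\<^sub>m m - K)"
  then have neg: "neg_def T1" and pd: "pos_def (1\<^sub>m m - K)" by auto
  have M: "1\<^sub>m m - K \<in> carrier_mat m m" using K by (rule minus_carrier_mat)
  have cK: "cmat K \<in> carrier_mat m m" using K by simp
  have "q = 0\<^sub>v m" if q: "q \<in> carrier_vec m" and eq: "q = complex_of_real e \<cdot>\<^sub>v (cmat K *\<^sub>v q)" for q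
  proof (rule cmat_kernel_trivial[OF M pos_def_det[OF M pd] q])
    have "cmat (1\<^sub>m m - K) *\<^sub>v q = q - cmat K *\<^sub>v q"
      unfolding cmat_minus[OF one_carrier_mat K] cmat_one minus_mult_distrib_mat_vec[OF one_carrier_mat cK q]
      using q by simp
    then show "cmat (1\<^sub>m m - K) *\<^sub>v q = 0\<^sub>v m"
      using vec_minus_self_eq[OF q cmat_vec(4)[OF q]] eq by (simp add: e1)
  qed
  then show "hurwitz Acl"
    using hurwitz_if[OF minN minS no_zero_mode[OF minN minS] no_right_mode_pos[OF minN minS e1 neg pd]] by blast
qed (auto intro: stable_neg_def stable_pos_def e1)

lemma stable_iff_neg:
  assumes minN: "minimal_realization m G n A B C D" and minS: "minimal_realization m Gb n' A' B' C' D'"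
    and e1: "e = - 1"
  shows "hurwitz Acl \<longleftrightarrow> neg_def T1 \<and> Determinant.det (1\<^sub>m m + K) \<noteq> 0"
proof
  have M: "1\<^sub>m m + K \<in> carrier_mat m m" using K by simp
  show "neg_def T1 \<and> Determinant.det (1\<^sub>m m + K) \<noteq> 0" if hw: "hurwitz Acl"
  proof
    show "Determinant.det (1\<^sub>m m + K) \<noteq> 0" unfolding det_nonzero_iff_inj[OF M]
    proof (intro ballI impI)
      fix q :: "real vec" assume q: "q \<in> carrier_vec m" and 0: "(1\<^sub>m m + K) *\<^sub>v q = 0\<^sub>v m"
      have Kq: "K *\<^sub>v q \<in> carrier_vec m" using K q by (rule mult_mat_vec_carrier)
      have "q + K *\<^sub>v q = 0\<^sub>v m"
        using 0 add_mult_distrib_mat_vec[OF one_carrier_mat K q] q by simp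
      then have "q = e \<cdot>\<^sub>v (K *\<^sub>v q)" unfolding e1 by (rule eq_neg_if_add_zero[OF q Kq])
      then show "q = 0\<^sub>v m" by (rule stable_injective[OF hw q])
    qed
  qed (rule stable_neg_def[OF hw])
  assume "neg_def T1 \<and> Determinant.det (1\<^sub>m m + K) \<noteq> 0"
  then have neg: "neg_def T1" and d: "Determinant.det (1\<^sub>m m + K) \<noteq> 0" by auto
  have cK: "cmat K \<in> carrier_mat m m" using K by simp
  have "q = 0\<^sub>v m" if q: "q \<in> carrier_vec m" and eq: "q = complex_of_real e \<cdot>\<^sub>v (cmat K *\<^sub>v q)" for q
  proof (rule cmat_kernel_trivial[OF M d q])
    have "cmat (1\<^sub>m m + K) *\<^sub>v q = q + cmat K *\<^sub>v q"
      unfolding cmat_add[OF one_carrier_mat K] cmat_one add_mult_distrib_mat_vec[OF one_carrier_mat cK q]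
      using q by simp
    also have "\<dots> = 0\<^sub>v m" by (rule add_zero_if_eq_neg[OF q cmat_vec(4)[OF q]]) (use eq in \<open>simp add: e1\<close>)
    finally show "cmat (1\<^sub>m m + K) *\<^sub>v q = 0\<^sub>v m" .
  qed
  then show "hurwitz Acl"
    using hurwitz_if[OF minN minS no_zero_mode[OF minN minS] no_right_mode_neg[OF minN minS e1 neg]] by blast
qed

end

section \<open>From the static conditions to arbitrary minimal realizations\<close>

lemma hurwitz_closed_loop_iff:
  assumes G: "transfer_matrix m G" "strictly_proper m G" "negative_imaginary m G" "laurent2 m G = 0\<^sub>m m m"
    and Gb: "transfer_matrix m Gb" "strictly_negative_imaginary m Gb"
    and svd: "svd_factor m (re_mat (laurent1 m G)) F"
    and inv: "invertible_mat (F\<^sup>T * H * F)"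
    and defs: "G0 = re_mat (laurent0 m G)" "H = re_mat (Gb 0)" "N1 = H - H * F * minv (F\<^sup>T * H * F) * F\<^sup>T * H"
    and minN: "minimal_realization m G n A B C D" and minS: "minimal_realization m Gb n' A' B' C' D'"
  shows "invertible_mat (1\<^sub>m m - D * D')"
    and "pos_semidef N1 \<Longrightarrow> hurwitz (closed_loop_matrix m A B C D A' B' C' D') \<longleftrightarrow>
      neg_def (F\<^sup>T * H * F) \<and> pos_def (1\<^sub>m m - psd_sqrt N1 * G0 * psd_sqrt N1)"
    and "neg_semidef N1 \<Longrightarrow> hurwitz (closed_loop_matrix m A B C D A' B' C' D') \<longleftrightarrow>
      neg_def (F\<^sup>T * H * F) \<and> Determinant.det (1\<^sub>m m + psd_sqrt (- N1) * G0 * psd_sqrt (- N1)) \<noteq> 0"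
proof -
  interpret N: ni_system m n G A B C D
    by unfold_locales (use G minN in \<open>auto simp: minimal_realization_def\<close>)
  interpret S: sni_system m n' Gb A' B' C' D'
    by unfold_locales (use Gb minS in \<open>auto simp: minimal_realization_def\<close>)
  interpret feedback m n n' G Gb A B C D A' B' C' D' ..
  show "invertible_mat (1\<^sub>m m - D * D')" by (rule well_posed)
  obtain r V where F: "F \<in> carrier_mat m r" and V: "V \<in> carrier_mat m r"
    and G1: "re_mat (laurent1 m G) = F * V\<^sup>T" and VV: "V\<^sup>T * V = 1\<^sub>m r"
    by (rule svd_factorD[OF svd])
  have H: "S.dc = H" by (simp add: S.dc_def defs)
  have G0: "N.G0 = G0" by (simp add: N.G0_def defs)
  have Hc: "H \<in> carrier_mat m m" using S.dc_carrier by (simp add: H)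
  have FHF: "F\<^sup>T * H * F \<in> carrier_mat r r" using F Hc by (intro mult_carrier_mat[of _ r m]) auto
  interpret feedback_svd m n n' G Gb A B C D A' B' C' D' r F V
    by unfold_locales (use F V G1 VV inv invertible_mat_iff_det[OF FHF] in \<open>simp_all add: N.G1_def H\<close>)
  have T: "T1 = F\<^sup>T * H * F" by (simp add: T1_def H)
  have N1_eq: "local.N1 = N1" by (simp add: local.N1_def T H defs(3))
  have N1c': "N1 \<in> carrier_mat m m" using N1c by (simp add: N1_eq)
  {
    assume psd: "pos_semidef N1"
    note R = psd_sqrt[OF N1c' psd]
    interpret feedback_sqrt m n n' G Gb A B C D A' B' C' D' r F V "psd_sqrt N1" 1
    proof unfold_locales
      show "(psd_sqrt N1)\<^sup>T = psd_sqrt N1" using R(2) pos_semidef_real[OF R(1)] by simp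
      show "local.N1\<^sup>T = local.N1" using psd pos_semidef_real[OF N1c'] by (simp add: N1_eq)
      show "local.N1 = 1 \<cdot>\<^sub>m (psd_sqrt N1 * psd_sqrt N1)" unfolding R(3) N1_eq by auto
    qed (use R in auto)
    show "hurwitz (closed_loop_matrix m A B C D A' B' C' D') \<longleftrightarrow>
      neg_def (F\<^sup>T * H * F) \<and> pos_def (1\<^sub>m m - psd_sqrt N1 * G0 * psd_sqrt N1)"
      using stable_iff_pos[OF minN minS] by (simp add: closed_loop T K_def G0)
  }
  {
    assume psd: "neg_semidef N1"
    have M: "- N1 \<in> carrier_mat m m" using N1c' by simp
    note R = psd_sqrt[OF M psd]
    have "(- N1)\<^sup>T = - N1" using psd pos_semidef_real[OF M] by simp
    then have sym: "N1\<^sup>T = N1" using N1c' by (simp add: transpose_uminus)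
    have neg: "(- 1) \<cdot>\<^sub>m (- N1) = N1" by auto
    interpret feedback_sqrt m n n' G Gb A B C D A' B' C' D' r F V "psd_sqrt (- N1)" "- 1"
    proof unfold_locales
      show "(psd_sqrt (- N1))\<^sup>T = psd_sqrt (- N1)" using R(2) pos_semidef_real[OF R(1)] by simp
      show "local.N1\<^sup>T = local.N1" using sym by (simp add: N1_eq)
      show "local.N1 = (- 1) \<cdot>\<^sub>m (psd_sqrt (- N1) * psd_sqrt (- N1))" unfolding R(3) N1_eq neg ..
    qed (use R in auto)
    show "hurwitz (closed_loop_matrix m A B C D A' B' C' D') \<longleftrightarrow>
      neg_def (F\<^sup>T * H * F) \<and> Determinant.det (1\<^sub>m m + psd_sqrt (- N1) * G0 * psd_sqrt (- N1)) \<noteq> 0"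
      using stable_iff_neg[OF minN minS] by (simp add: closed_loop T K_def G0)
  }
qed

text \<open>\<open>internally_stable\<close> asserts a stable loop for some pair of minimal
  realizations, whereas the criterion is available for every pair. One direction is then immediate,
  and the other holds because minimal realizations exist.\<close>

lemma internally_stable_iff:
  assumes "transfer_matrix m G" "transfer_matrix m G'"
    and "\<And>n A B C D n' A' B' C' D'. minimal_realization m G n A B C D \<Longrightarrow> minimal_realization m G' n' A' B' C' D' \<Longrightarrow>
      invertible_mat (1\<^sub>m m - D * D') \<and> (hurwitz (closed_loop_matrix m A B C D A' B' C' D') \<longleftrightarrow> P)"
  shows "internally_stable m G G' \<longleftrightarrow> P"
proof
  assume "internally_stable m G G'"
  then show P unfolding internally_stable_def using assms(3) by blast
next
  assume P
  obtain n A B C D where 1: "minimal_realization m G n A B C D"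
    using minimal_realization_exists[OF assms(1)] by blast
  obtain n' A' B' C' D' where 2: "minimal_realization m G' n' A' B' C' D'"
    using minimal_realization_exists[OF assms(2)] by blast
  show "internally_stable m G G'" unfolding internally_stable_def using 1 2 assms(3)[OF 1 2] \<open>P\<close> by blast
qed

theorem theorem3:
  fixes m :: nat
    and G Gbar :: "complex \<Rightarrow> complex mat"
    and G0 G1 H0 F1 N1 :: "real mat"
  assumes "transfer_matrix m G" and "transfer_matrix m Gbar"
    and "strictly_negative_imaginary m Gbar"
    and "strictly_proper m G" and "negative_imaginary m G"
    and "laurent2 m G = 0\<^sub>m m m" and "laurent1 m G \<noteq> 0\<^sub>m m m"
    and "G1 = re_mat (laurent1 m G)" and "G0 = re_mat (laurent0 m G)"
    and "H0 = re_mat (Gbar 0)"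
    and "svd_factor m G1 F1"
    and "invertible_mat (F1\<^sup>T * H0 * F1)"
    and "N1 = H0 - H0 * F1 * minv (F1\<^sup>T * H0 * F1) * F1\<^sup>T * H0"
  shows "(pos_semidef N1 \<longrightarrow>
            (internally_stable m G Gbar \<longleftrightarrow>
               neg_def (F1\<^sup>T * H0 * F1) \<and>
               pos_def (1\<^sub>m m - psd_sqrt N1 * G0 * psd_sqrt N1))) \<and>
         (neg_semidef N1 \<longrightarrow>
            (internally_stable m G Gbar \<longleftrightarrow>
               neg_def (F1\<^sup>T * H0 * F1) \<and>
               Determinant.det (1\<^sub>m m + psd_sqrt (- N1) * G0 * psd_sqrt (- N1)) \<noteq> 0))"
proof (intro conjI impI)
  note G1 = \<open>G1 = re_mat (laurent1 m G)\<close>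
  note loop = hurwitz_closed_loop_iff[OF assms(1,4,5,6,2,3) assms(11)[unfolded G1] assms(12,9,10,13)]
  show "internally_stable m G Gbar \<longleftrightarrow> neg_def (F1\<^sup>T * H0 * F1) \<and>
      pos_def (1\<^sub>m m - psd_sqrt N1 * G0 * psd_sqrt N1)" if "pos_semidef N1"
    by (rule internally_stable_iff[OF assms(1,2)], intro conjI) (erule (1) loop(1), erule (1) loop(2)[OF _ _ that])
  show "internally_stable m G Gbar \<longleftrightarrow> neg_def (F1\<^sup>T * H0 * F1) \<and>
      Determinant.det (1\<^sub>m m + psd_sqrt (- N1) * G0 * psd_sqrt (- N1)) \<noteq> 0" if "neg_semidef N1"
    by (rule internally_stable_iff[OF assms(1,2)], intro conjI) (erule (1) loop(1), erule (1) loop(3)[OF _ _ that])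
qed

end
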